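(* Let $0<\frac1n\ll \varepsilon^*\le \varepsilon\ll \nu'\ll\nu\ll\tau\ll\gamma\ll \alpha,\eta^*\ll 1$, and let $\ell\le \frac12(\alpha-\eta^* )n$ be a positive integer. Suppose $G$ is an $(\alpha,\varepsilon^* )$-almost regular robust $(\nu,\tau)$-expander on $n$ vertices. Suppose that, for each $i\in[1,\ell]$, $F_i$ is a multiset of edges on $V(G)$, and assume that $(L_1,F_1),\dots,(L_\ell,F_\ell)$ are layouts with $V(L_i)\subseteq V(G)$ for each $i\in[1,\ell]$ such that, writing $L=\bigcup_{i\in[1,\ell]}L_i$: (a) for each $i\in[1,\ell]$, $|V(L_i)|\le \varepsilon^2 n$ and $|E(L_i)|\le \varepsilon^4 n$; (b) for each $v\in V(G)$, $d_L(v)\le \varepsilon^3 n$, and there are at most $\varepsilon^2 n$ indices $i\in[1,\ell]$ with $v\in V(L_i)$. Then there exist edge-disjoint submultigraphs $\mathcal{H}_1,\dots,\mathcal{H}_\ell\subseteq G+\bigcup_{i\in[1,\ell]}F_i$ such that each $\mathcal{H}_i$ is a spanning configuration of shape $(L_i,F_i)$, and $G-\bigcup_{i=1}^{\ell}E(\mathcal{H}_i)$ is a robust $(\nu'/2,4\tau)$-expander.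
   Context: Hierarchy convention: a statement asserted for $0<a\ll b\le 1$ means there is a non-decreasing function $f:(0,1]\to(0,1]$ such that it holds whenever $a\le f(b)$; for longer chains, each parameter is chosen sufficiently small relative to those to its right. $[p,q]=\{i\in\mathbb{Z}: p\le i\le q\}$. Given $0<\nu\le\tau<1$, a graph $G$ on $n$ vertices is a robust $(\nu,\tau)$-expander if for every $S\subseteq V(G)$ with $\tau n\le|S|\le(1-\tau)n$, the number of vertices of $G$ with at least $\nu n$ neighbors in $S$ is at least $|S|+\nu n$. A graph $G$ on $n$ vertices is $(\delta,\varepsilon)$-almost regular if $d_G(v)=(\delta\pm\varepsilon)n$ for every $v\in V(G)$. Layouts: let $V$ be a vertex set. Let $L$ be a multiset consisting of paths on $V$ and isolated vertices; $V(L)$ is the set of vertices that are isolated in $L$ or lie on the non-trivial paths of $L$, $E(L)$ is the multiset of edges of the paths in $L$, and for $v\in V(L)$, $d_L(v)$ is the number of edges of $E(L)$ having $v$ as an endvertex. For a multiset $F$ of edges, $(L,F)$ is a layout if $F\subseteq E(L)$ and $E(L)\setminus F\neq\emptyset$. A path from $u$ to $v$ is said to have shape $uv$. A multigraph $\mathcal{H}$ on $V$ is a spanning configuration of shape $(L,F)$ if $\mathcal{H}$ can be decomposed into internally vertex-disjoint paths $\{P_e: e\in E(L)\}$ such that each $P_e$ has shape $e$, $P_f=f$ for all $f\in F$, and $\bigcup_{e\in E(L)}V^0(P_e)=V\setminus V(L)$, where $V^0(P)$ is the set of internal vertices of a path $P$ (so isolated vertices of $L$ remain isolated in $\mathcal{H}$).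 $G+F$ denotes the multigraph obtained by adding the edges of $F$ to $G$; edges of the $F_i$ are regarded as distinct from edges of $G$ even if they have the same endpoints. *)

theory Defs
  imports Complex_Main "HOL-Library.FuncSet" "HOL-Library.Multiset"
begin

text \<open>A chain of constraints \<open>a \<lless> b\<close> is read as \<open>a \<le> f b\<close> for one admissible \<open>f\<close>.
  Finitely many admissible functions have an admissible pointwise minimum, so a single \<open>f\<close>
  serves a whole chain.\<close>

definition hierarchy_function :: "(real \<Rightarrow> real) \<Rightarrow> bool" where
  "hierarchy_function f \<longleftrightarrow> f \<in> {0<..1} \<rightarrow> {0<..1} \<and> mono_on {0<..1} f"

definition simple_graph :: "'a set \<Rightarrow> 'a set set \<Rightarrow> bool" where
  "simple_graph V E \<longleftrightarrow> finite V \<and> (\<forall>e\<in>E. e \<subseteq> V \<and> card e = 2)"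

definition neighbours :: "'a set set \<Rightarrow> 'a \<Rightarrow> 'a set" where
  "neighbours E v = {w. {v, w} \<in> E}"

definition robust_expander :: "real \<Rightarrow> real \<Rightarrow> 'a set \<Rightarrow> 'a set set \<Rightarrow> bool" where
  "robust_expander \<nu> \<tau> V E \<longleftrightarrow>
     0 < \<nu> \<and> \<nu> \<le> \<tau> \<and> \<tau> < 1 \<and>
     (\<forall>S\<subseteq>V. \<tau> * real (card V) \<le> real (card S) \<and> real (card S) \<le> (1 - \<tau>) * real (card V) \<longrightarrow>
        real (card {v\<in>V. \<nu> * real (card V) \<le> real (card (neighbours E v \<inter> S))})
          \<ge> real (card S) + \<nu> * real (card V))"

definition almost_regular :: "real \<Rightarrow> real \<Rightarrow> 'a set \<Rightarrow> 'a set set \<Rightarrow> bool" where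
  "almost_regular \<delta> \<epsilon> V E \<longleftrightarrow>
     (\<forall>v\<in>V. (\<delta> - \<epsilon>) * real (card V) \<le> real (card (neighbours E v)) \<and>
             real (card (neighbours E v)) \<le> (\<delta> + \<epsilon>) * real (card V))"

text \<open>The collection \<open>L\<close> of a layout is a multiset of non-empty lists of distinct vertices: a list
  of length at least two is a non-trivial path (its orientation plays no role), and a one-element
  list is an isolated vertex. Edges are two-element sets.\<close>

fun path_edges :: "'a list \<Rightarrow> 'a set multiset" where
  "path_edges (u # v # p) = add_mset {u, v} (path_edges (v # p))"
| "path_edges _ = {#}"

definition layout_verts :: "'a list multiset \<Rightarrow> 'a set" where
  "layout_verts L = (\<Union>p\<in>set_mset L. set p)"

definition layout_edges :: "'a list multiset \<Rightarrow> 'a set multiset" where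
  "layout_edges L = (\<Sum>p\<in>#L. path_edges p)"

definition layout_degree :: "'a list multiset \<Rightarrow> 'a \<Rightarrow> nat" where
  "layout_degree L v = size {#e \<in># layout_edges L. v \<in> e#}"

definition layout :: "'a list multiset \<Rightarrow> 'a set multiset \<Rightarrow> bool" where
  "layout L F \<longleftrightarrow>
     (\<forall>p\<in>#L. p \<noteq> [] \<and> distinct p) \<and> F \<subseteq># layout_edges L \<and> layout_edges L - F \<noteq> {#}"

text \<open>Edges of \<open>G\<close> and edges of the \<open>F\<^sub>i\<close> are kept apart by tags even if they have the same
  endpoints. A multigraph on a given vertex set is represented by its multiset of tagged edges.\<close>

datatype 'a medge = GEdge (ends: "'a set") | FEdge (ends: "'a set")

definition add_edges :: "'a set set \<Rightarrow> 'a set multiset \<Rightarrow> 'a medge multiset" where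
  "add_edges E F = image_mset GEdge (mset_set E) + image_mset FEdge F"

text \<open>A path of a multigraph consists of its vertex sequence and its edge sequence.\<close>

type_synonym 'a mpath = "'a list \<times> 'a medge list"

definition is_mpath :: "'a mpath \<Rightarrow> bool" where
  "is_mpath P \<longleftrightarrow>
     distinct (fst P) \<and> length (fst P) = Suc (length (snd P)) \<and>
     (\<forall>j<length (snd P). ends (snd P ! j) = {fst P ! j, fst P ! Suc j})"

definition path_ends :: "'a mpath \<Rightarrow> 'a set" where
  "path_ends P = {hd (fst P), last (fst P)}"

definition internal_verts :: "'a mpath \<Rightarrow> 'a set" where
  "internal_verts P = set (fst P) - path_ends P"

text \<open>The elements of a multiset counted with multiplicity, as pairs of an element and the number
  of a copy. If \<open>F \<subseteq># M\<close> then \<open>copies F \<subseteq> copies M\<close>.\<close>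

definition copies :: "'b multiset \<Rightarrow> ('b \<times> nat) set" where
  "copies M = {(e, k). k < count M e}"

definition spanning_configuration ::
  "'a set \<Rightarrow> 'a list multiset \<Rightarrow> 'a set multiset \<Rightarrow> 'a medge multiset \<Rightarrow> bool" where
  "spanning_configuration V L F H \<longleftrightarrow>
     (\<exists>P :: 'a set \<times> nat \<Rightarrow> 'a mpath.
        (\<forall>x\<in>copies (layout_edges L). is_mpath (P x) \<and> path_ends (P x) = fst x) \<and>
        (\<forall>x\<in>copies F. snd (P x) = [FEdge (fst x)]) \<and>
        (\<forall>x\<in>copies (layout_edges L). \<forall>y\<in>copies (layout_edges L).
           x \<noteq> y \<longrightarrow> set (fst (P x)) \<inter> internal_verts (P y) = {}) \<and>
        (\<Union>x\<in>copies (layout_edges L). internal_verts (P x)) = V - layout_verts L \<and>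
        H = (\<Sum>x\<in>copies (layout_edges L). mset (snd (P x))))"

end

theory Submission
  imports Defs "HOL-Computational_Algebra.Primes"
begin

text \<open>Split off a sparse random-like subgraph \<open>\<Gamma>\<close> of \<open>G\<close> that is still a robust expander, and
  partition \<open>V\<close> into a large prime number \<open>K\<close> of parts that inherit the expansion of \<open>\<Gamma>\<close> and the
  degrees of \<open>G - \<Gamma>\<close>. For each difference \<open>d < K / 2\<close> the arcs of \<open>G - \<Gamma>\<close> going from part \<open>a\<close> to part
  \<open>a + d\<close> (mod \<open>K\<close>) form an almost regular digraph, whose edge colouring gives almost perfect matchings; since
  \<open>K\<close> is prime, deleting the arcs into one part \<open>p\<close> turns such a matching into a linear forest whose paths
  start in \<open>p\<close> and end in \<open>q = p - d\<close>, up to few exceptions. There are more than \<open>l\<close> of these forests, and an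
  exponential-potential argument assigns one to each layout so that no vertex meets the layouts too
  often. The paths of one forest are joined into the required configuration with edges of \<open>\<Gamma>\<close>: few
  edges repair the exceptional ends, and a spanning linkage in the digraph \<open>{last P, hd Q}\<close> between the
  parts \<open>q\<close> and \<open>p\<close>, found by absorption, does the rest. Each configuration uses
  each \<open>\<Gamma>\<close>-pair of parts sparingly, so the unused part of \<open>\<Gamma>\<close> stays expanding throughout.\<close>

text \<open>The hierarchy compares \<epsilon> and 1/n only with \<nu>', so every threshold,
  \<open>K\<close> included, is computed from a lower bound for \<nu>' alone. The tight point is the
  number of forests: there are (K-1)/2 differences with nearly \<alpha>(1-1/k)n/K good colours each,
  where 1/k, at most \<gamma>, is the share of \<Gamma> in G. So \<Gamma> is sparse and must be
  rationed. The deleted part \<open>p\<close> is the residue of the colour mod \<open>K\<close>,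
  which spreads the forests over the pairs (q, p), about n/K^2 at most per pair. A vertex keeps a
  fraction of n/K, not depending on \<open>K\<close>, of \<Gamma>-edges into every part, so a large
  \<open>K\<close> suffices. Repair edges are less even and could pile up at one vertex: a vertex
  that has received many of them is declared congested and receives no further ones. The bound on
  all requests keeps the congested vertices few.\<close>

lemma conj_drop2: "A \<and> B \<and> C ==> C"
 by simp

text \<open>Together with the neighbouring projections this lets \<open>THEN\<close> pick any
  component of a long conjunction by steps of 8, 4 and 2.\<close>

lemma conj_drop4: "A \<and> B \<and> C \<and> D \<and> E ==> E"
 by simp

lemma conj_drop8: "A \<and> B \<and> C \<and> D \<and> E \<and> F \<and> G \<and> H \<and> I ==> I"
 by simp

section \<open>Equidistribution by exponential potentials\<close>

lemma exists_le_average: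
 fixes g :: "nat => real"
 assumes "0 < K" "(\<Sum>k<K. g k) \<le> real K * B"
 shows "\<exists>k<K. g k \<le> B"
proof (rule ccontr)
 assume "\<not> ?thesis"
 then have "(\<Sum>k<K. B) < (\<Sum>k<K. g k)"
  using assms(1) by (intro sum_strict_mono) auto
 then show False using assms(2) by simp
qed

text \<open>The method of conditional expectations. The elements of \<open>\<Omega>\<close> are
  coloured one at a time; averaged over the \<open>K\<close> colours, the factor that a new element
  contributes to each test \<open>t\<close> is at most 1, so some colour does not increase the
  weighted sum.\<close>

lemma colouring_by_potential:
 fixes \<mu> :: "'t => 'a => nat => real" and w :: "'t => real"
 assumes "finite \<Omega>" "0 < K"
  and "\<And>t x k. t \<in> T ==> 0 \<le> \<mu> t x k"
  and "\<And>t x. t \<in> T ==> (\<Sum>k<K. \<mu> t x k) \<le> real K"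
  and "\<And>t. t \<in> T ==> 0 \<le> w t"
 shows "\<exists>c. (\<forall>x. c x < K) & (\<Sum>t\<in>T. w t * (\<Prod>x\<in>\<Omega>. \<mu> t x (c x))) \<le> (\<Sum>t\<in>T. w t)"
 using assms(1)
proof (induction \<Omega>)
 case empty
 show ?case using assms(2) by (intro exI[of _ "\<lambda>_. 0"]) simp
next
 case (insert x \<Omega>)
 then obtain c where c: "\<forall>x. c x < K"
  and le: "(\<Sum>t\<in>T. w t * (\<Prod>x\<in>\<Omega>. \<mu> t x (c x))) \<le> (\<Sum>t\<in>T. w t)"
  by blast
 define P where "P t = w t * (\<Prod>x\<in>\<Omega>. \<mu> t x (c x))" for t
 have P0: "0 \<le> P t" if "t \<in> T" for t
  unfolding P_def using assms(3,5) that by (intro mult_nonneg_nonneg prod_nonneg) auto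
 have "(\<Sum>k<K. \<Sum>t\<in>T. P t * \<mu> t x k) = (\<Sum>t\<in>T. P t * (\<Sum>k<K. \<mu> t x k))"
  by (subst sum.swap) (simp add: sum_distrib_left)
 also have "\<dots> \<le> (\<Sum>t\<in>T. P t * real K)"
  using P0 assms(4) by (intro sum_mono mult_left_mono) auto
 also have "\<dots> = real K * (\<Sum>t\<in>T. P t)"
  by (simp add: sum_distrib_left mult.commute)
 finally obtain k where k: "k < K" "(\<Sum>t\<in>T. P t * \<mu> t x k) \<le> (\<Sum>t\<in>T. P t)"
  using exists_le_average[OF assms(2)] by blast
 have "(\<Prod>y\<in>insert x \<Omega>. \<mu> t y ((c(x := k)) y)) = \<mu> t x k * (\<Prod>y\<in>\<Omega>. \<mu> t y (c y))" for t
 proof -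
  have "(\<Prod>y\<in>\<Omega>. \<mu> t y ((c(x := k)) y)) = (\<Prod>y\<in>\<Omega>. \<mu> t y (c y))"
   using insert.hyps by (intro prod.cong) auto
  then show ?thesis using insert.hyps by simp
 qed
 then have "(\<Sum>t\<in>T. w t * (\<Prod>y\<in>insert x \<Omega>. \<mu> t y ((c(x := k)) y))) = (\<Sum>t\<in>T. P t * \<mu> t x k)"
  by (simp add: P_def mult_ac)
 then show ?case using c k le unfolding P_def
  by (intro exI[of _ "c(x := k)"]) auto
qed

lemma exp_le_quadratic:
 fixes y :: real
 assumes "\<bar>y\<bar> \<le> 1"
 shows "exp y \<le> 1 + y + y\<^sup>2"
proof (cases "0 \<le> y")
 case True
 then show ?thesis using exp_bound[of y] assms by simp
next
 case False
 \<comment> \<open>The quadratic 1 - z + z^2 dominates 1/(1+z), because its product with 1 + z is 1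
   + z^3, and 1/(1+z) dominates exp(-z).\<close>
 define z where "z = - y"
 have z: "0 < z" "z \<le> 1" using False assms by (auto simp: z_def)
 have "1 + z \<le> exp z" by simp
 moreover have "1 \<le> (1 - z + z\<^sup>2) * (1 + z)"
 proof -
  have "(1 - z + z\<^sup>2) * (1 + z) = 1 + z ^ 3" by (simp add: algebra_simps power3_eq_cube power2_eq_square)
  then show ?thesis using z by simp
 qed
 moreover have "0 \<le> 1 - z + z\<^sup>2" using z by (smt (verit) zero_le_power2)
 ultimately have "1 \<le> (1 - z + z\<^sup>2) * exp z"
  by (smt (verit) mult_left_mono)
 then have "exp (- z) \<le> 1 - z + z\<^sup>2"
  by (simp add: exp_minus field_simps)
 then show ?thesis by (simp add: z_def)
qed

text \<open>The moment generating function of the centred indicator of colour \<open>j\<close> under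
  a uniform colour. The linear terms cancel, and the summand \<open>- lam^2\<close> in the exponent
  pays for the quadratic ones.\<close>

lemma sum_centred_exp_le:
 fixes lam s :: real
 assumes "j < K" "0 \<le> lam" "lam \<le> 1" "\<bar>s\<bar> = 1"
 shows "(\<Sum>k<K. exp (s * lam * (of_bool (k = j) - 1 / real K) - lam\<^sup>2)) \<le> real K"
proof -
 have K: "0 < K" using assms by simp
 define y where "y k = s * lam * (of_bool (k = j) - 1 / real K)" for k
 have ab: "\<bar>of_bool (k = j) - 1 / real K\<bar> \<le> 1" for k
  using K by (auto simp: field_simps abs_if)
 have yl: "\<bar>y k\<bar> \<le> lam" for k
  using mult_mono[OF order_refl ab, of lam k] assms by (simp add: y_def abs_mult)
 have y2: "(y k)\<^sup>2 \<le> lam\<^sup>2" for k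
  using yl[of k] assms(2) by (metis abs_le_square_iff abs_of_nonneg)
 have "(\<Sum>k<K. y k) = s * lam * (\<Sum>k<K. of_bool (k = j) - 1 / real K)"
  by (simp add: y_def sum_distrib_left)
 also have "(\<Sum>k<K. of_bool (k = j) - 1 / real K) = 0"
 proof -
  have "(\<Sum>k<K. of_bool (k = j)) = (1::real)" using assms(1) by (simp add: of_bool_def)
  then show ?thesis using K by (simp add: sum_subtractf)
 qed
 finally have y0: "(\<Sum>k<K. y k) = 0" by simp
 have "(\<Sum>k<K. exp (y k)) \<le> (\<Sum>k<K. 1 + y k + lam\<^sup>2)"
  by (intro sum_mono) (use exp_le_quadratic yl y2 assms(3) in \<open>smt (verit)\<close>)
 also have "\<dots> = real K * (1 + lam\<^sup>2)" using y0 by (simp add: sum.distrib algebra_simps)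
 also have "\<dots> \<le> real K * exp (lam\<^sup>2)" by (intro mult_left_mono) auto
 finally have "(\<Sum>k<K. exp (y k)) * exp (- lam\<^sup>2) \<le> real K * exp (lam\<^sup>2) * exp (- lam\<^sup>2)"
  by (intro mult_right_mono) auto
 also have "real K * exp (lam\<^sup>2) * exp (- lam\<^sup>2) = real K"
  by (simp add: exp_minus)
 finally show ?thesis
  by (simp add: y_def sum_distrib_right flip: exp_add)
qed

text \<open>A Chernoff bound with a union bound, made deterministic: \<open>small\<close> says that
  the expected number of failures, as estimated by the potential, is below 1.\<close>

lemma equidistributed_colouring:
 fixes A :: "'i => 'a set" and D M :: "'i => real"
 assumes "finite \<Omega>" "finite I" "0 < K"
  and A: "\<And>i. i \<in> I ==> A i \<subseteq> \<Omega>"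
  and D: "\<And>i. i \<in> I ==> 0 < D i" "\<And>i. i \<in> I ==> D i \<le> M i"
  and M: "\<And>i. i \<in> I ==> real (card (A i)) \<le> M i"
  and small: "(\<Sum>i\<in>I. 2 * real K * exp (- ((D i)\<^sup>2 / (4 * M i)))) < 1"
 shows "\<exists>c. (\<forall>x. c x < K) &
  (\<forall>i\<in>I. \<forall>j<K. \<bar>real (card {x \<in> A i. c x = j}) - real (card (A i)) / real K\<bar> \<le> D i)"
proof -
 \<comment> \<open>This choice maximises lam * D - M * lam^2; the maximum is D^2 / (4M), the
   exponent in \<open>small\<close>.\<close>
 define lam where "lam i = D i / (2 * M i)" for i
 \<comment> \<open>A test is a set, a colour and a sign, the sign separating the upper from the
   lower tail; hence the factor 2K in \<open>small\<close>.\<close>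
 define T where "T = I \<times> {..<K} \<times> {1, -1::real}"
 define \<mu> where "\<mu> = (\<lambda>(i, j::nat, s) x k. if x \<in> A i
  then exp (s * lam i * (of_bool (k = j) - 1 / real K) - (lam i)\<^sup>2) else (1::real))"
 define w where "w = (\<lambda>(i, j::nat, s::real). exp (- ((D i)\<^sup>2 / (4 * M i))))"
 have mu0: "0 \<le> \<mu> t x k" and w0: "0 \<le> w t" for t x k
  by (cases t; simp add: \<mu>_def w_def)+
 have Mpos: "0 < M i" if "i \<in> I" for i using D that by (meson less_le_trans)
 have lam: "0 < lam i" "lam i \<le> 1" if "i \<in> I" for i
  using D Mpos that by (auto simp: lam_def field_simps) (smt (verit))
 have "\<exists>c. (\<forall>x. c x < K) & (\<Sum>t\<in>T. w t * (\<Prod>x\<in>\<Omega>. \<mu> t x (c x))) \<le> (\<Sum>t\<in>T. w t)"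
 proof (rule colouring_by_potential[OF assms(1,3)])
  fix t x assume "t \<in> T"
  then obtain i j s where t: "t = (i, j, s)" "i \<in> I" "j < K" "\<bar>s\<bar> = 1" by (auto simp: T_def)
  show "(\<Sum>k<K. \<mu> t x k) \<le> real K"
   using sum_centred_exp_le[OF t(3), of "lam i" s] lam[OF t(2)] t
   by (cases "x \<in> A i") (auto simp: \<mu>_def)
 qed (auto simp: mu0 w0)
 then obtain c where c: "\<forall>x. c x < K"
  and le: "(\<Sum>t\<in>T. w t * (\<Prod>x\<in>\<Omega>. \<mu> t x (c x))) \<le> (\<Sum>t\<in>T. w t)" by blast
 have "(\<Sum>t\<in>T. w t) = (\<Sum>i\<in>I. 2 * real K * exp (- ((D i)\<^sup>2 / (4 * M i))))"
  unfolding T_def w_def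
  by (simp add: sum.cartesian_product[symmetric] sum_distrib_left mult_ac)
 then have lt1: "(\<Sum>t\<in>T. w t * (\<Prod>x\<in>\<Omega>. \<mu> t x (c x))) < 1" using le small by linarith
 have finT: "finite T" using assms(2) by (simp add: T_def)
 \<comment> \<open>The final potential is a sum of nonnegative terms and below 1, so every single
   term is below 1. Its logarithm bounds the deviation in the direction \<open>s\<close>.\<close>
 have main: "s * (real (card {x \<in> A i. c x = j}) - real (card (A i)) / real K) < D i"
  if "i \<in> I" "j < K" "s \<in> {1, -1::real}" for i j s
 proof -
  let ?X = "real (card {x \<in> A i. c x = j}) - real (card (A i)) / real K"
  have fA: "finite (A i)" using A[OF that(1)] assms(1) finite_subset by blast
  have tT: "(i, j, s) \<in> T" using that by (simp add: T_def)
  have "w (i,j,s) * (\<Prod>x\<in>\<Omega>. \<mu> (i,j,s) x (c x)) \<le> (\<Sum>t\<in>T. w t * (\<Prod>x\<in>\<Omega>. \<mu> t x (c x)))"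
   using w0 mu0 by (intro member_le_sum[OF tT _ finT] mult_nonneg_nonneg prod_nonneg) auto
  then have l1: "w (i,j,s) * (\<Prod>x\<in>\<Omega>. \<mu> (i,j,s) x (c x)) < 1" using lt1 by linarith
  have "(\<Prod>x\<in>\<Omega>. \<mu> (i,j,s) x (c x)) =
    (\<Prod>x\<in>A i. exp (s * lam i * (of_bool (c x = j) - 1 / real K) - (lam i)\<^sup>2))"
   using A[OF that(1)] assms(1) by (intro prod.mono_neutral_cong_right) (auto simp: \<mu>_def)
  also have "\<dots> = exp (\<Sum>x\<in>A i. s * lam i * (of_bool (c x = j) - 1 / real K) - (lam i)\<^sup>2)"
   using fA by (simp add: exp_sum)
  also have "(\<Sum>x\<in>A i. s * lam i * (of_bool (c x = j) - 1 / real K) - (lam i)\<^sup>2)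
    = s * lam i * (\<Sum>x\<in>A i. of_bool (c x = j) - 1 / real K) - real (card (A i)) * (lam i)\<^sup>2"
   unfolding sum_distrib_left by (simp only: sum_subtractf sum_constant)
  also have "(\<Sum>x\<in>A i. of_bool (c x = j) - 1 / real K) = ?X"
  proof -
   have "(\<Sum>x\<in>A i. of_bool (c x = j)) = real (card {x \<in> A i. c x = j})"
    using fA by (simp add: of_bool_def sum.If_cases Int_def)
   then show ?thesis by (simp add: sum_subtractf)
  qed
  finally have "exp (- ((D i)\<^sup>2 / (4 * M i)) + (s * lam i * ?X - real (card (A i)) * (lam i)\<^sup>2)) < 1"
   using l1 by (simp add: w_def flip: exp_add)
  then have neg: "- ((D i)\<^sup>2 / (4 * M i)) + (s * lam i * ?X - real (card (A i)) * (lam i)\<^sup>2) < 0"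
   by simp
  have "(D i)\<^sup>2 / (4 * M i) = lam i * D i - M i * (lam i)\<^sup>2"
   using Mpos[OF that(1)] by (simp add: lam_def field_simps power2_eq_square)
  moreover have "real (card (A i)) * (lam i)\<^sup>2 \<le> M i * (lam i)\<^sup>2"
   using M[OF that(1)] by (intro mult_right_mono) auto
  ultimately have "lam i * (s * ?X) < lam i * D i" using neg by (simp add: algebra_simps)
  then show ?thesis using lam[OF that(1)] by simp
 qed
 have "\<bar>real (card {x \<in> A i. c x = j}) - real (card (A i)) / real K\<bar> \<le> D i"
  if "i \<in> I" "j < K" for i j
  using main[OF that, of 1] main[OF that, of "-1"] by (simp add: abs_le_iff)
 then show ?thesis using c by blast
qed

section \<open>Dense expanders and their inheritance by the parts of a partition\<close>

text \<open>Robust expansion in a symmetric counting form: if few vertices had many neighbours in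
  \<open>X\<close>, the remaining vertices \<open>Y\<close> would satisfy |X| + |Y| near
  \<open>N\<close> with few arcs from \<open>X\<close> to \<open>Y\<close>. The scale
  \<open>N\<close> is nominal and not tied to the sizes of \<open>A\<close> and \<open>B\<close>, so
  the notion passes to subsets without change, and to the converse relation.\<close>

definition dense_expander ::
 "real => real => real => ('a \<times> 'b) set => 'a set => 'b set => bool" where
 "dense_expander \<zeta> \<tau> N r A B \<longleftrightarrow>
   (\<forall>X\<subseteq>A. \<forall>Y\<subseteq>B. \<tau> * N \<le> real (card X) & \<tau> * N \<le> real (card Y) &
    (1 - \<zeta>) * N \<le> real (card X) + real (card Y) -->
    \<zeta> * N\<^sup>2 \<le> real (card (r \<inter> X \<times> Y)))"

lemma dense_expanderD:
 "[|dense_expander \<zeta> \<tau> N r A B; X \<subseteq> A; Y \<subseteq> B; \<tau> * N \<le> real (card X); \<tau> * N \<le> real (card Y);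
  (1 - \<zeta>) * N \<le> real (card X) + real (card Y)|] ==> \<zeta> * N\<^sup>2 \<le> real (card (r \<inter> X \<times> Y))"
 unfolding dense_expander_def by blast

lemma dense_expander_subset:
 "[|dense_expander \<zeta> \<tau> N r A B; A' \<subseteq> A; B' \<subseteq> B|] ==> dense_expander \<zeta> \<tau> N r A' B'"
 unfolding dense_expander_def by (meson order_trans)

lemma card_converse_Times: "card (r\<inverse> \<inter> X \<times> Y) = card (r \<inter> Y \<times> X)"
proof -
 have "r\<inverse> \<inter> X \<times> Y = (r \<inter> Y \<times> X)\<inverse>" by auto
 then show ?thesis by simp
qed

lemma dense_expander_converse:
 assumes "dense_expander \<zeta> \<tau> N r A B"
 shows "dense_expander \<zeta> \<tau> N (r\<inverse>) B A"
 using assms unfolding dense_expander_def card_converse_Times by (simp add: add.commute)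

text \<open>Halving \<open>\<zeta>\<close> and doubling \<open>\<tau>\<close> leaves enough slack to
  change the nominal size by a factor 1 - \<zeta>/8 to 1 + \<zeta>/8.\<close>

lemma dense_expander_rescale:
 assumes "dense_expander \<zeta> \<tau> N r A B" "0 < \<zeta>" "\<zeta> \<le> 1" "0 \<le> \<tau>" "0 \<le> N"
  and "\<bar>N' - N\<bar> \<le> \<zeta> / 8 * N"
 shows "dense_expander (\<zeta> / 2) (2 * \<tau>) N' r A B"
 unfolding dense_expander_def
proof (intro allI impI, elim conjE)
 fix X Y assume XY: "X \<subseteq> A" "Y \<subseteq> B"
  and X: "2 * \<tau> * N' \<le> real (card X)" and Y: "2 * \<tau> * N' \<le> real (card Y)"
  and S: "(1 - \<zeta> / 2) * N' \<le> real (card X) + real (card Y)"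
 have zN: "\<zeta> * N \<le> 1 * N" using assms by (intro mult_right_mono) auto
 have N1: "(1 - \<zeta> / 8) * N \<le> N'" and N2: "N' \<le> (1 + \<zeta> / 8) * N"
  using assms(6) unfolding abs_le_iff left_diff_distrib distrib_right by linarith+
 have "N \<le> 2 * N'" using N1 zN assms(5) by (simp add: algebra_simps)
 then have t: "\<tau> * N \<le> 2 * \<tau> * N'" using assms(4) mult_left_mono[of N "2 * N'" \<tau>] by simp
 have "(1 - \<zeta>) \<le> (1 - \<zeta> / 2) * (1 - \<zeta> / 8)"
 proof -
  have "(1 - \<zeta> / 2) * (1 - \<zeta> / 8) = 1 - 5 / 8 * \<zeta> + \<zeta> * \<zeta> / 16" by (simp add: field_simps)
  moreover have "0 \<le> \<zeta> * \<zeta>" by simp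
  ultimately show ?thesis using assms(2) by linarith
 qed
 then have "(1 - \<zeta>) * N \<le> (1 - \<zeta> / 2) * ((1 - \<zeta> / 8) * N)"
  using assms(5) mult_right_mono by (fastforce simp: mult.assoc)
 also have "\<dots> \<le> (1 - \<zeta> / 2) * N'" using N1 assms by (intro mult_left_mono) auto
 finally have "(1 - \<zeta>) * N \<le> (1 - \<zeta> / 2) * N'" .
 then have ge: "\<zeta> * N\<^sup>2 \<le> real (card (r \<inter> X \<times> Y))"
  using dense_expanderD[OF assms(1) XY] t X Y S by linarith
 have "N' \<le> (9 / 8) * N" using N2 zN by (simp add: algebra_simps)
 moreover have "0 \<le> N'" using \<open>N \<le> 2 * N'\<close> assms(5) by simp
 ultimately have "N'\<^sup>2 \<le> ((9 / 8) * N)\<^sup>2" by (intro power_mono) auto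
 also have "\<dots> \<le> 2 * N\<^sup>2" by (simp add: power_mult_distrib power2_eq_square)
 finally have "\<zeta> / 2 * N'\<^sup>2 \<le> \<zeta> / 2 * (2 * N\<^sup>2)" using assms(2) by (intro mult_left_mono) auto
 then show "\<zeta> / 2 * N'\<^sup>2 \<le> real (card (r \<inter> X \<times> Y))" using ge by simp
qed

lemma card_rel_Times_eq_sum_left:
 assumes "finite X" "finite Y"
 shows "card (r \<inter> X \<times> Y) = (\<Sum>x\<in>X. card {y\<in>Y. (x, y) \<in> r})"
proof -
 have "r \<inter> X \<times> Y = (SIGMA x:X. {y\<in>Y. (x, y) \<in> r})" by auto
 then show ?thesis using assms by simp
qed

lemma card_rel_Times_eq_sum_right:
 assumes "finite X" "finite Y"
 shows "card (r \<inter> X \<times> Y) = (\<Sum>y\<in>Y. card {x\<in>X. (x, y) \<in> r})"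
proof -
 have "card (r \<inter> X \<times> Y) = card (r\<inverse> \<inter> Y \<times> X)" by (simp add: card_converse_Times)
 then show ?thesis using card_rel_Times_eq_sum_left[OF assms(2,1), of "r\<inverse>"] by simp
qed

text \<open>Markov's inequality.\<close>

lemma card_gt_threshold_le:
 fixes g :: "'a => real"
 assumes "finite X" "\<And>x. x \<in> X ==> 0 \<le> g x"
 shows "s * real (card {x\<in>X. s < g x}) \<le> (\<Sum>x\<in>X. g x)"
proof -
 have "s * real (card {x\<in>X. s < g x}) = (\<Sum>x\<in>{x\<in>X. s < g x}. s)" by simp
 also have "\<dots> \<le> (\<Sum>x\<in>{x\<in>X. s < g x}. g x)" by (intro sum_mono) auto
 also have "\<dots> \<le> (\<Sum>x\<in>X. g x)" using assms by (intro sum_mono2) auto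
 finally show ?thesis .
qed

text \<open>A sample of bounded length determines the neighbourhood frequencies of all but few vertices;
 each next sample point is one that does not exceed the average of the squared error.\<close>

lemma sample_neighbourhood_frequencies:
 fixes V :: "'b set" and X :: "'a set"
 assumes "finite V" "finite X" "X \<noteq> {}"
 shows "\<exists>xs. length xs = t & set xs \<subseteq> X &
  (\<Sum>v\<in>V. (real (length (filter (\<lambda>x. (x, v) \<in> r) xs)) -
    real t * (real (card {x\<in>X. (x, v) \<in> r}) / real (card X)))\<^sup>2) \<le> real t * real (card V)"
proof (induction t)
 case 0
 show ?case by (intro exI[of _ "[]"]) simp
next
 case (Suc t)
 define p where "p v = real (card {x\<in>X. (x, v) \<in> r}) / real (card X)" for v
 have cX: "0 < real (card X)" using assms by (simp add: card_gt_0_iff)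
 obtain xs where xs: "length xs = t" "set xs \<subseteq> X"
  and le: "(\<Sum>v\<in>V. (real (length (filter (\<lambda>x. (x, v) \<in> r) xs)) - real t * p v)\<^sup>2)
    \<le> real t * real (card V)"
  using Suc.IH unfolding p_def by blast
 define y where "y v = real (length (filter (\<lambda>x. (x, v) \<in> r) xs)) - real t * p v" for v
 define b where "b x v = of_bool ((x, v) \<in> r) - p v" for x v
 have sb: "(\<Sum>x\<in>X. of_bool ((x, v) \<in> r)) = p v * real (card X)" for v
  using assms cX by (simp add: p_def of_bool_def sum.If_cases Int_def)
 \<comment> \<open>Since \<open>b\<close> is centred, the cross terms vanish on average over the
   next sample point, so the squared error grows on average by at most \<open>card V\<close> per
   point.\<close>
 have b0: "(\<Sum>x\<in>X. b x v) = 0" for v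
  using sb by (simp add: b_def sum_subtractf)
 have p01: "0 \<le> p v" "p v \<le> 1" for v
  unfolding p_def using cX assms by (auto simp: field_simps intro!: card_mono)
 have b1: "(b x v)\<^sup>2 \<le> 1" for x v
  using p01[of v] unfolding b_def by (simp add: abs_square_le_1 abs_le_iff of_bool_def)
 have "(\<Sum>x\<in>X. \<Sum>v\<in>V. (y v + b x v)\<^sup>2) = (\<Sum>v\<in>V. \<Sum>x\<in>X. (y v + b x v)\<^sup>2)"
  by (rule sum.swap)
 also have "\<dots> = (\<Sum>v\<in>V. real (card X) * (y v)\<^sup>2 + (\<Sum>x\<in>X. (b x v)\<^sup>2))"
 proof (rule sum.cong[OF refl])
  fix v
  have "(\<Sum>x\<in>X. (y v + b x v)\<^sup>2) = (\<Sum>x\<in>X. (y v)\<^sup>2 + 2 * y v * b x v + (b x v)\<^sup>2)"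
   by (simp add: power2_sum algebra_simps)
  also have "\<dots> = real (card X) * (y v)\<^sup>2 + 2 * y v * (\<Sum>x\<in>X. b x v) + (\<Sum>x\<in>X. (b x v)\<^sup>2)"
   by (simp add: sum.distrib sum_distrib_left)
  finally show "(\<Sum>x\<in>X. (y v + b x v)\<^sup>2) = real (card X) * (y v)\<^sup>2 + (\<Sum>x\<in>X. (b x v)\<^sup>2)"
   by (simp add: b0)
 qed
 also have "\<dots> \<le> (\<Sum>v\<in>V. real (card X) * (y v)\<^sup>2 + (\<Sum>x\<in>X. 1))"
  using b1 by (intro sum_mono add_left_mono) auto
 also have "\<dots> = real (card X) * (\<Sum>v\<in>V. (y v)\<^sup>2) + real (card X) * real (card V)"
  by (simp add: sum.distrib sum_distrib_left mult.commute)
 also have "\<dots> \<le> real (card X) * (real (Suc t) * real (card V))"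
  using mult_left_mono[OF le, of "real (card X)"] by (simp add: y_def algebra_simps)
 finally have avg: "(\<Sum>x\<in>X. \<Sum>v\<in>V. (y v + b x v)\<^sup>2) \<le> real (card X) * (real (Suc t) * real (card V))" .
 have "\<exists>x\<in>X. (\<Sum>v\<in>V. (y v + b x v)\<^sup>2) \<le> real (Suc t) * real (card V)"
 proof (rule ccontr)
  assume "\<not> ?thesis"
  then have "(\<Sum>x\<in>X. real (Suc t) * real (card V)) < (\<Sum>x\<in>X. \<Sum>v\<in>V. (y v + b x v)\<^sup>2)"
   using assms by (intro sum_strict_mono) auto
  then show False using avg by simp
 qed
 then obtain x where x: "x \<in> X" "(\<Sum>v\<in>V. (y v + b x v)\<^sup>2) \<le> real (Suc t) * real (card V)" by blast
 have "real (length (filter (\<lambda>x. (x, v) \<in> r) (x # xs))) - real (Suc t) * p v = y v + b x v" for v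
  by (simp add: y_def b_def algebra_simps)
 then show ?case using x xs unfolding p_def[symmetric] by (intro exI[of _ "x # xs"]) auto
qed

lemma eventually_power_mult_exp_less:
 fixes a C :: real
 assumes "0 < a"
 shows "\<forall>\<^sub>F n in sequentially. C * real n ^ k * exp (- a * real n) < 1"
proof -
 have "filterlim (\<lambda>n. a * real n) at_top sequentially"
  using assms by (intro filterlim_tendsto_pos_mult_at_top[OF tendsto_const _ filterlim_real_sequentially])
 then have "((\<lambda>n. (a * real n) ^ k / exp (a * real n)) \<longlongrightarrow> 0) sequentially"
  using filterlim_compose[OF tendsto_power_div_exp_0] by blast
 then have "((\<lambda>n. C / a ^ k * ((a * real n) ^ k / exp (a * real n))) \<longlongrightarrow> C / a ^ k * 0) sequentially"
  by (intro tendsto_mult tendsto_const)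
 moreover have "C / a ^ k * ((a * real n) ^ k / exp (a * real n)) = C * real n ^ k * exp (- a * real n)" for n
  using assms by (simp add: power_mult_distrib exp_minus field_simps)
 ultimately have "((\<lambda>n. C * real n ^ k * exp (- a * real n)) \<longlongrightarrow> 0) sequentially" by simp
 then show ?thesis by (rule order_tendstoD) simp
qed

text \<open>A certificate for sparse pairs. The sets \<open>T\<close> and \<open>S\<close> are
  determined by a list of bounded length, so only about n^t pairs of them exist, and yet every
  \<open>X\<close> lies almost inside some \<open>S\<close> whose \<open>T\<close> contains almost
  all of any \<open>Y\<close> that receives few arcs from \<open>X\<close>. This replaces
  exponentially many pairs \<open>X\<close>, \<open>Y\<close> by polynomially many.\<close>

lemma sampled_sparse_pair:
 fixes V :: "'a set"
 assumes fin: "finite V" and X: "X \<subseteq> V" "X \<noteq> {}" and t: "0 < t" "1 \<le> real t * (\<zeta>\<^sup>2 / 64)\<^sup>2 * \<kappa>"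
  and z: "0 < \<zeta>" "\<zeta> \<le> 1" and k: "0 < \<kappa>" "\<kappa> \<le> \<zeta>\<^sup>2 / 64"
 shows "\<exists>xs. length xs = t & set xs \<subseteq> V & (\<exists>T S.
   T = {v\<in>V. real (length (filter (\<lambda>x. (x, v) \<in> r) xs)) \<le> \<zeta>\<^sup>2 / 16 * real t} &
   S = {u\<in>V. real (card {v\<in>T. (u, v) \<in> r}) \<le> \<zeta> / 2 * real (card V)} &
   real (card (X - S)) \<le> 3 / 16 * \<zeta> * real (card X) &
   (\<forall>Y\<subseteq>V. \<zeta>\<^sup>2 / 32 * real (card X) * (real (card (Y - T)) - \<kappa> * real (card V))
    \<le> real (card (r \<inter> X \<times> Y))))"
proof -
 define n where "n = real (card V)"
 define cX where "cX = real (card X)"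
 have finX: "finite X" using X fin finite_subset by blast
 have cX: "0 < cX" using X finX by (simp add: cX_def card_gt_0_iff)
 have n: "0 < n" using X fin by (auto simp: n_def card_gt_0_iff)
 define p where "p v = real (card {x\<in>X. (x, v) \<in> r}) / cX" for v
 obtain xs where xs: "length xs = t" "set xs \<subseteq> X"
  and var: "(\<Sum>v\<in>V. (real (length (filter (\<lambda>x. (x, v) \<in> r) xs)) - real t * p v)\<^sup>2) \<le> real t * n"
  using sample_neighbourhood_frequencies[OF fin finX X(2), of t r] unfolding p_def cX_def n_def by blast
 define cnt where "cnt v = real (length (filter (\<lambda>x. (x, v) \<in> r) xs))" for v
 \<comment> \<open>The vertices whose frequency in the sample is wrong by more than \<zeta>^2/64.
   Chebyshev's inequality and the lower bound on \<open>t\<close> leave at most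
   \<open>\<kappa> * n\<close> of them.\<close>
 define Exc where "Exc = {v\<in>V. (\<zeta>\<^sup>2 / 64 * real t)\<^sup>2 < (cnt v - real t * p v)\<^sup>2}"
 have finE: "finite Exc" using fin by (simp add: Exc_def)
 have "(\<zeta>\<^sup>2 / 64 * real t)\<^sup>2 * real (card Exc) \<le> real t * n"
  unfolding Exc_def
  by (rule order_trans[OF card_gt_threshold_le[OF fin]]) (use var in \<open>simp_all add: cnt_def\<close>)
 then have "real t * (real t * (\<zeta>\<^sup>2 / 64)\<^sup>2 * real (card Exc)) \<le> real t * n"
  by (simp add: power2_eq_square mult_ac)
 then have e1: "real t * (\<zeta>\<^sup>2 / 64)\<^sup>2 * real (card Exc) \<le> n" using t(1) by simp
 have "real (card Exc) \<le> \<kappa> * n"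
 proof -
  have "1 * real (card Exc) \<le> (real t * (\<zeta>\<^sup>2 / 64)\<^sup>2 * \<kappa>) * real (card Exc)"
   using t(2) by (intro mult_right_mono) auto
  also have "\<dots> = \<kappa> * (real t * (\<zeta>\<^sup>2 / 64)\<^sup>2 * real (card Exc))" by (simp add: mult_ac)
  also have "\<dots> \<le> \<kappa> * n" using e1 k by (intro mult_left_mono) auto
  finally show ?thesis by simp
 qed
 note Exc = this
 have near: "\<bar>cnt v - real t * p v\<bar> \<le> \<zeta>\<^sup>2 / 64 * real t" if "v \<in> V - Exc" for v
 proof -
  have "(cnt v - real t * p v)\<^sup>2 \<le> (\<zeta>\<^sup>2 / 64 * real t)\<^sup>2" using that by (auto simp: Exc_def)
  then have "\<bar>cnt v - real t * p v\<bar> \<le> \<bar>\<zeta>\<^sup>2 / 64 * real t\<bar>" by (simp only: abs_le_square_iff)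
  also have "\<dots> = \<zeta>\<^sup>2 / 64 * real t" by simp
  finally show ?thesis .
 qed
 \<comment> \<open>The threshold \<zeta>^2/16 leaves room for the sampling error on both sides: a
   vertex of \<open>T\<close> outside \<open>Exc\<close> has density at most 5/64 \<zeta>^2 into
   \<open>X\<close>, and a vertex outside both has density above 3/64 \<zeta>^2, hence above
   \<zeta>^2/32.\<close>
 define T where "T = {v\<in>V. cnt v \<le> \<zeta>\<^sup>2 / 16 * real t}"
 define S where "S = {u\<in>V. real (card {v\<in>T. (u, v) \<in> r}) \<le> \<zeta> / 2 * n}"
 have finT: "finite T" using fin by (simp add: T_def)
 have pX: "real (card {x\<in>X. (x, v) \<in> r}) = p v * cX" for v using cX by (simp add: p_def)
 have p1: "p v \<le> 1" for v
  unfolding p_def cX_def using cX finX by (auto simp: cX_def field_simps intro!: card_mono)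
 have "real (card (r \<inter> X \<times> T)) = (\<Sum>v\<in>T. p v * cX)"
  using card_rel_Times_eq_sum_right[OF finX finT, of r] pX by simp
 also have "\<dots> \<le> (\<Sum>v\<in>T. 5 / 64 * \<zeta>\<^sup>2 * cX + of_bool (v \<in> Exc) * cX)"
 proof (rule sum_mono)
  fix v assume v: "v \<in> T"
  show "p v * cX \<le> 5 / 64 * \<zeta>\<^sup>2 * cX + of_bool (v \<in> Exc) * cX"
  proof (cases "v \<in> Exc")
   case True
   have "p v * cX \<le> 1 * cX" using p1 cX by (intro mult_right_mono) auto
   moreover have "0 \<le> 5 / 64 * \<zeta>\<^sup>2 * cX" using cX by simp
   ultimately have "p v * cX \<le> 5 / 64 * \<zeta>\<^sup>2 * cX + 1 * cX" by linarith
   then show ?thesis using True by simp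
  next
   case False
   then have "real t * p v \<le> cnt v + \<zeta>\<^sup>2 / 64 * real t" using near[of v] v unfolding T_def
    by (smt (verit) DiffI mem_Collect_eq)
   also have "\<dots> \<le> real t * (5 / 64 * \<zeta>\<^sup>2)" using v by (simp add: T_def algebra_simps)
   finally have "p v \<le> 5 / 64 * \<zeta>\<^sup>2" using t(1) by simp
   then show ?thesis using False cX by (simp add: mult_right_mono)
  qed
 qed
 also have "\<dots> = real (card T) * (5 / 64 * \<zeta>\<^sup>2 * cX) + real (card (T \<inter> Exc)) * cX"
  using finT by (simp add: sum.distrib of_bool_def sum.If_cases Int_def flip: sum_distrib_right)
 also have "\<dots> \<le> n * (5 / 64 * \<zeta>\<^sup>2 * cX) + (\<kappa> * n) * cX"
 proof -
  have "real (card T) \<le> n" unfolding n_def T_def using fin by (auto intro!: card_mono)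
  moreover have "real (card (T \<inter> Exc)) \<le> \<kappa> * n"
   using Exc card_mono[OF finE, of "T \<inter> Exc"] by simp
  ultimately show ?thesis using cX by (intro add_mono mult_right_mono) auto
 qed
 also have "\<dots> \<le> n * (5 / 64 * \<zeta>\<^sup>2 * cX) + (\<zeta>\<^sup>2 / 64 * n) * cX"
  using k n cX by (intro add_left_mono mult_right_mono) auto
 finally have eXT: "real (card (r \<inter> X \<times> T)) \<le> 6 / 64 * \<zeta>\<^sup>2 * n * cX" by (simp add: algebra_simps)
 have "X - S = {x\<in>X. \<zeta> / 2 * n < real (card {v\<in>T. (x, v) \<in> r})}" using X by (auto simp: S_def)
 then have "\<zeta> / 2 * n * real (card (X - S)) \<le> (\<Sum>x\<in>X. real (card {v\<in>T. (x, v) \<in> r}))"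
  using card_gt_threshold_le[OF finX, of "\<lambda>x. real (card {v\<in>T. (x, v) \<in> r})" "\<zeta> / 2 * n"] by simp
 also have "\<dots> = real (card (r \<inter> X \<times> T))" using card_rel_Times_eq_sum_left[OF finX finT, of r] by simp
 also have "\<dots> \<le> \<zeta> / 2 * n * (3 / 16 * \<zeta> * cX)" using eXT by (simp add: power2_eq_square algebra_simps)
 finally have XS: "real (card (X - S)) \<le> 3 / 16 * \<zeta> * cX" using z n by simp
 have YT: "\<zeta>\<^sup>2 / 32 * cX * (real (card (Y - T)) - \<kappa> * n) \<le> real (card (r \<inter> X \<times> Y))" if "Y \<subseteq> V" for Y
 proof -
  have finY: "finite Y" using that fin finite_subset by blast
  have "Y - T \<subseteq> Exc \<union> {y\<in>Y. \<zeta>\<^sup>2 / 32 * cX < real (card {x\<in>X. (x, y) \<in> r})}"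
  proof
   fix y assume y: "y \<in> Y - T"
   show "y \<in> Exc \<union> {y\<in>Y. \<zeta>\<^sup>2 / 32 * cX < real (card {x\<in>X. (x, y) \<in> r})}"
   proof (cases "y \<in> Exc")
    case False
    then have "real t * p y \<ge> cnt y - \<zeta>\<^sup>2 / 64 * real t" using near[of y] y that
     by (smt (verit) DiffD1 DiffI subsetD)
    moreover have "cnt y > \<zeta>\<^sup>2 / 16 * real t" using y that by (auto simp: T_def)
    ultimately have "real t * p y > real t * (3 / 64 * \<zeta>\<^sup>2)" by (simp add: algebra_simps)
    then have "p y > 3 / 64 * \<zeta>\<^sup>2" using t(1) by simp
    moreover have "3 / 64 * \<zeta>\<^sup>2 > \<zeta>\<^sup>2 / 32" using z by simp
    ultimately have "\<zeta>\<^sup>2 / 32 < p y" by linarith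
    then have "\<zeta>\<^sup>2 / 32 * cX < p y * cX" using cX by (intro mult_strict_right_mono)
    then show ?thesis using y pX by simp
   qed simp
  qed
  then have "card (Y - T) \<le> card (Exc \<union> {y\<in>Y. \<zeta>\<^sup>2 / 32 * cX < real (card {x\<in>X. (x, y) \<in> r})})"
   using finE finY by (intro card_mono) auto
  also have "\<dots> \<le> card Exc + card {y\<in>Y. \<zeta>\<^sup>2 / 32 * cX < real (card {x\<in>X. (x, y) \<in> r})}"
   by (rule card_Un_le)
  finally have "real (card (Y - T)) - \<kappa> * n \<le>
    real (card {y\<in>Y. \<zeta>\<^sup>2 / 32 * cX < real (card {x\<in>X. (x, y) \<in> r})})" using Exc by linarith
  then have "\<zeta>\<^sup>2 / 32 * cX * (real (card (Y - T)) - \<kappa> * n) \<le> \<zeta>\<^sup>2 / 32 * cX *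
    real (card {y\<in>Y. \<zeta>\<^sup>2 / 32 * cX < real (card {x\<in>X. (x, y) \<in> r})})"
   using cX by (intro mult_left_mono) auto
  also have "\<dots> \<le> (\<Sum>y\<in>Y. real (card {x\<in>X. (x, y) \<in> r}))"
   by (rule card_gt_threshold_le[OF finY]) simp
  also have "\<dots> = real (card (r \<inter> X \<times> Y))" using card_rel_Times_eq_sum_right[OF finX finY, of r] by simp
  finally show ?thesis .
 qed
 show ?thesis
 proof (intro exI conjI)
  show "length xs = t" "set xs \<subseteq> V" using xs X by auto
  show "T = {v\<in>V. real (length (filter (\<lambda>x. (x, v) \<in> r) xs)) \<le> \<zeta>\<^sup>2 / 16 * real t}"
   by (simp add: T_def cnt_def)
  show "S = {u\<in>V. real (card {v\<in>T. (u, v) \<in> r}) \<le> \<zeta> / 2 * real (card V)}"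
   by (simp add: S_def n_def)
 qed (use XS YT in \<open>auto simp: cX_def n_def\<close>)
qed

text \<open>The subsets of the parts are too many for a union bound at this accuracy. Only the
  certificate sets of \<open>sampled_sparse_pair\<close> and the family \<open>\<F>\<close> are
  equidistributed. A sparse pair inside two parts would then have a certificate whose sets are about
  \<open>K\<close> times larger and sparse in the whole digraph, contrary to its expansion. The
  bound on \<open>\<F>\<close> leaves room for all in-neighbourhoods, all out-neighbourhoods and
  \<open>V\<close> itself.\<close>

lemma partition_expander:
 fixes \<zeta> \<xi> :: real and K :: nat
 assumes z: "0 < \<zeta>" "\<zeta> \<le> 1" and "0 < \<xi>" "0 < K"
 shows "\<exists>n0::nat. \<forall>(V :: 'a set) r \<tau> \<F>. finite V & n0 \<le> card V & \<zeta> \<le> \<tau> &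
  dense_expander \<zeta> \<tau> (real (card V)) r V V & \<F> \<subseteq> Pow V & card \<F> \<le> 3 * card V -->
  (\<exists>c. (\<forall>x. c x < K) &
    (\<forall>S\<in>\<F>. \<forall>j<K. \<bar>real (card {x\<in>S. c x = j}) - real (card S) / real K\<bar> \<le> \<xi> * real (card V)) &
    (\<forall>a<K. \<forall>b<K. dense_expander (\<zeta> ^ 4 / 512) (2 * \<tau>) (real (card V) / real K) r
     {x\<in>V. c x = a} {x\<in>V. c x = b}))"
proof -
 \<comment> \<open>Sizes measured inside one part are later multiplied by \<open>K\<close>. With
   these choices the multiplied errors \<open>K * \<xi>'\<close> and \<open>K * \<kappa>\<close> are
   at most \<zeta>/32 and \<zeta>/16.\<close>
 define \<xi>' where "\<xi>' = min (min \<xi> 1) (\<zeta> / (32 * real K))"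
 define \<kappa> where "\<kappa> = min (\<zeta>\<^sup>2 / 64) (\<zeta> / (16 * real K))"
 have x': "0 < \<xi>'" "\<xi>' \<le> \<xi>" "\<xi>' \<le> 1" "\<xi>' \<le> \<zeta> / (32 * real K)" using assms by (auto simp: \<xi>'_def)
 then have Kx': "real K * \<xi>' \<le> \<zeta> / 32" using assms(4) by (simp add: field_simps)
 have k: "0 < \<kappa>" "\<kappa> \<le> \<zeta>\<^sup>2 / 64" "\<kappa> \<le> \<zeta> / (16 * real K)" using assms by (auto simp: \<kappa>_def)
 then have Kk: "real K * \<kappa> \<le> \<zeta> / 16" using assms(4) by (simp add: field_simps)
 obtain t where t: "1 / ((\<zeta>\<^sup>2 / 64)\<^sup>2 * \<kappa>) < real t" using reals_Archimedean2 by blast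
 have kz: "0 < (\<zeta>\<^sup>2 / 64)\<^sup>2 * \<kappa>" using k z by simp
 have t1: "1 \<le> real t * (\<zeta>\<^sup>2 / 64)\<^sup>2 * \<kappa>" using t kz by (simp add: field_simps)
 have t0: "0 < t" using t kz by (metis divide_pos_pos less_trans of_nat_0_less_iff zero_less_one)
 have "\<forall>\<^sub>F n in sequentially. (12 * real K) * real n ^ Suc t * exp (- (\<xi>'\<^sup>2 / 4) * real n) < 1"
  using x' by (intro eventually_power_mult_exp_less) simp
 then obtain n0 where n0: "\<And>n. n \<ge> n0 ==> (12 * real K) * real n ^ Suc t * exp (- (\<xi>'\<^sup>2 / 4) * real n) < 1"
  unfolding eventually_sequentially by blast
 show ?thesis
 proof (intro exI[of _ "max n0 1"] allI impI, elim conjE)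
  fix V :: "'a set" and r \<tau> \<F>
  assume fin: "finite V" and nV: "max n0 1 \<le> card V" and \<tau>: "\<zeta> \<le> \<tau>"
   and ex: "dense_expander \<zeta> \<tau> (real (card V)) r V V" and \<F>: "\<F> \<subseteq> Pow V" "card \<F> \<le> 3 * card V"
  define n where "n = real (card V)"
  have n1: "1 \<le> n" using nV by (simp add: n_def)
  define T where "T xs = {v\<in>V. real (length (filter (\<lambda>x. (x, v) \<in> r) xs)) \<le> \<zeta>\<^sup>2 / 16 * real t}" for xs
  define S where "S xs = {u\<in>V. real (card {v\<in>T xs. (u, v) \<in> r}) \<le> \<zeta> / 2 * n}" for xs
  define Ls where "Ls = {xs. set xs \<subseteq> V & length xs = t}"
  \<comment> \<open>All sets that have to split evenly; only polynomially many in n, since the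
    samples have the fixed length \<open>t\<close>.\<close>
  define I where "I = \<F> \<union> {V} \<union> T ` Ls \<union> S ` Ls"
  have finL: "finite Ls" "card Ls = card V ^ t"
   unfolding Ls_def using fin by (auto simp: finite_lists_length_eq card_lists_length_eq)
  have IV: "S' \<subseteq> V" if "S' \<in> I" for S' using that \<F> by (auto simp: I_def T_def S_def)
  have finI: "finite I" using fin IV by (meson PowI finite_Pow_iff finite_subset subsetI)
  have "card I \<le> card \<F> + 1 + card (T ` Ls) + card (S ` Ls)"
   unfolding I_def by (intro order_trans[OF card_Un_le] add_mono) auto
  also have "\<dots> \<le> 3 * card V + 1 + card V ^ t + card V ^ t"
   using \<F> finL card_image_le[OF finL(1), of T] card_image_le[OF finL(1), of S] by simp
  also have "\<dots> \<le> 6 * card V ^ Suc t"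
  proof -
   have "1 \<le> card V" using nV by simp
   then have "card V ^ 1 \<le> card V ^ Suc t" "card V ^ t \<le> card V ^ Suc t" "1 \<le> card V ^ Suc t"
    by (simp_all only: power_increasing one_le_power)
   then show ?thesis unfolding power_one_right by linarith
  qed
  finally have "real (card I) \<le> 6 * n ^ Suc t" unfolding n_def by (metis of_nat_le_iff of_nat_mult of_nat_numeral of_nat_power)
  have "(\<Sum>i\<in>I. 2 * real K * exp (- ((\<xi>' * n)\<^sup>2 / (4 * n)))) = real (card I) * (2 * real K * exp (- (\<xi>'\<^sup>2 / 4) * n))"
   using n1 by (simp add: power2_eq_square)
  also have "\<dots> \<le> 6 * n ^ Suc t * (2 * real K * exp (- (\<xi>'\<^sup>2 / 4) * n))"
   using \<open>real (card I) \<le> 6 * n ^ Suc t\<close> by (intro mult_right_mono) auto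
  also have "\<dots> < 1" using n0[of "card V"] nV by (simp add: n_def mult_ac)
  finally have small: "(\<Sum>i\<in>I. 2 * real K * exp (- ((\<xi>' * n)\<^sup>2 / (4 * n)))) < 1" .
  have "\<exists>c. (\<forall>x. c x < K) & (\<forall>i\<in>I. \<forall>j<K. \<bar>real (card {x \<in> i. c x = j}) - real (card i) / real K\<bar> \<le> \<xi>' * n)"
  proof (rule equidistributed_colouring[OF fin finI assms(4), where D = "\<lambda>_. \<xi>' * n" and M = "\<lambda>_. n"])
   show "\<And>i. i \<in> I ==> real (card i) \<le> n" unfolding n_def using IV fin by (simp add: card_mono)
  qed (use IV x' n1 small in \<open>auto\<close>)
  then obtain c where c: "\<forall>x. c x < K"
   and eq: "\<And>i j. i \<in> I ==> j < K ==> \<bar>real (card {x \<in> i. c x = j}) - real (card i) / real K\<bar> \<le> \<xi>' * n" by blast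
  have xi': "\<xi>' * n \<le> \<xi> * n" using x' n1 by (intro mult_right_mono) auto
  have lower: "real (card i) \<ge> real K * real (card {x\<in>i. c x = j}) - \<zeta> / 32 * n" if "i \<in> I" "j < K" for i j
  proof -
   have "real (card {x \<in> i. c x = j}) \<le> real (card i) / real K + \<xi>' * n" using eq[OF that] by linarith
   then have "real K * real (card {x \<in> i. c x = j}) \<le> real K * (real (card i) / real K + \<xi>' * n)"
    by (intro mult_left_mono) auto
   also have "\<dots> = real (card i) + (real K * \<xi>') * n" using assms(4) by (simp add: algebra_simps)
   also have "\<dots> \<le> real (card i) + \<zeta> / 32 * n" using Kx' n1 by (intro add_left_mono mult_right_mono) auto
   finally show ?thesis by linarith
  qed
  have pair: "dense_expander (\<zeta> ^ 4 / 512) (2 * \<tau>) (n / real K) r {x\<in>V. c x = a} {x\<in>V. c x = b}"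
   if ab: "a < K" "b < K" for a b
   unfolding dense_expander_def
  proof (intro allI impI, elim conjE, rule ccontr)
   fix X Y assume X: "X \<subseteq> {x\<in>V. c x = a}" and Y: "Y \<subseteq> {x\<in>V. c x = b}"
    and cX: "2 * \<tau> * (n / real K) \<le> real (card X)" and cY: "2 * \<tau> * (n / real K) \<le> real (card Y)"
    and sum: "(1 - \<zeta> ^ 4 / 512) * (n / real K) \<le> real (card X) + real (card Y)"
    and "\<not> \<zeta> ^ 4 / 512 * (n / real K)\<^sup>2 \<le> real (card (r \<inter> X \<times> Y))"
   then have few: "real (card (r \<inter> X \<times> Y)) < \<zeta> ^ 4 / 512 * (n / real K)\<^sup>2" by simp
   define m where "m = n / real K"
   have m: "0 < m" and Km: "real K * m = n" using n1 assms(4) by (auto simp: m_def)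
   have zm: "2 * \<zeta> * m \<le> real (card X)" using cX \<tau> m mult_right_mono[of \<zeta> \<tau> m] unfolding m_def by simp
   have "0 < 2 * \<zeta> * m" using z m by simp
   then have "0 < real (card X)" using zm by linarith
   then have Xne: "X \<noteq> {}" by auto
   have XV: "X \<subseteq> V" and YV: "Y \<subseteq> V" using X Y by auto
   obtain xs where xs: "length xs = t" "set xs \<subseteq> V"
    and XS: "real (card (X - S xs)) \<le> 3 / 16 * \<zeta> * real (card X)"
    and YT: "\<zeta>\<^sup>2 / 32 * real (card X) * (real (card (Y - T xs)) - \<kappa> * n) \<le> real (card (r \<inter> X \<times> Y))"
    using sampled_sparse_pair[OF fin XV Xne t0 t1 z k(1,2), of r] YV
    unfolding T_def S_def n_def by auto
   have sI: "S xs \<in> I" "T xs \<in> I" "V \<in> I" using xs by (auto simp: I_def Ls_def)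
   have YT': "real (card (Y - T xs)) \<le> \<zeta> * m / 32 + \<kappa> * n"
   proof (rule ccontr)
    assume "\<not> ?thesis"
    then have gt: "\<zeta> * m / 32 < real (card (Y - T xs)) - \<kappa> * n" by simp
    \<comment> \<open>The origin of \<zeta>^4/512: the density \<zeta>^2/32 of a vertex outside
      \<open>T\<close>, the lower bound 2\<zeta>m for |X|, and the surplus \<zeta>m/32 of vertices
      of \<open>Y\<close> outside \<open>T\<close>.\<close>
    have "\<zeta> ^ 4 / 512 * m\<^sup>2 = \<zeta>\<^sup>2 / 32 * (2 * \<zeta> * m) * (\<zeta> * m / 32)"
     by (simp add: power2_eq_square power4_eq_xxxx)
    also have "\<dots> \<le> \<zeta>\<^sup>2 / 32 * real (card X) * (real (card (Y - T xs)) - \<kappa> * n)"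
     using zm gt z m by (intro mult_mono) auto
    finally show False using YT few by (simp add: m_def)
   qed
   have finXY: "finite X" "finite Y" using XV YV fin finite_subset by blast+
   have ge1: "real (card {x\<in>S xs. c x = a}) \<ge> real (card X) - 3 / 16 * \<zeta> * real (card X)"
   proof -
    have "card X \<le> card ({x\<in>S xs. c x = a} \<union> (X - S xs))"
     using X fin finXY by (intro card_mono) (auto simp: S_def)
    also have "\<dots> \<le> card {x\<in>S xs. c x = a} + card (X - S xs)" by (rule card_Un_le)
    finally show ?thesis using XS by linarith
   qed
   have ge2: "real (card {x\<in>T xs. c x = b}) \<ge> real (card Y) - \<zeta> * m / 32 - \<kappa> * n"
   proof -
    have "card Y \<le> card ({x\<in>T xs. c x = b} \<union> (Y - T xs))"
     using Y fin finXY by (intro card_mono) (auto simp: T_def)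
    also have "\<dots> \<le> card {x\<in>T xs. c x = b} + card (Y - T xs)" by (rule card_Un_le)
    finally show ?thesis using YT' by linarith
   qed
   have S1: "real (card (S xs)) \<ge> real K * real (card X) - 3 / 16 * \<zeta> * (real K * real (card X)) - \<zeta> / 32 * n"
    using lower[OF sI(1) ab(1)] mult_left_mono[OF ge1, of "real K"] by (simp add: algebra_simps)
   have T1: "real (card (T xs)) \<ge> real K * real (card Y) - \<zeta> / 32 * n - \<zeta> / 16 * n - \<zeta> / 32 * n"
   proof -
    have "real K * (real (card Y) - \<zeta> * m / 32 - \<kappa> * n) = real K * real (card Y) - \<zeta> / 32 * (real K * m) - real K * \<kappa> * n"
     by (simp add: algebra_simps)
    moreover have "real K * \<kappa> * n \<le> \<zeta> / 16 * n" using Kk n1 by (intro mult_right_mono) auto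
    ultimately show ?thesis using lower[OF sI(2) ab(2)] mult_left_mono[OF ge2, of "real K"] Km by simp
   qed
   have KX: "real K * real (card X) \<le> n + \<zeta> / 32 * n"
   proof -
    have "card X \<le> card {x\<in>V. c x = a}" using X fin by (intro card_mono) auto
    then have "real K * real (card X) \<le> real K * real (card {x\<in>V. c x = a})" by (simp add: mult_left_mono)
    then show ?thesis using lower[OF sI(3) ab(1)] by (simp add: n_def)
   qed
   have KXl: "2 * \<tau> * n \<le> real K * real (card X)" "2 * \<tau> * n \<le> real K * real (card Y)"
    using mult_left_mono[OF cX, of "real K"] mult_left_mono[OF cY, of "real K"] assms(4) by simp_all
   have Ksum: "(1 - \<zeta> ^ 4 / 512) * n \<le> real K * real (card X) + real K * real (card Y)"
    using mult_left_mono[OF sum, of "real K"] assms(4) by (simp add: algebra_simps)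
   have zn: "\<zeta> * n \<le> \<tau> * n" using \<tau> n1 by simp
   have z4: "\<zeta> ^ 4 * n \<le> \<zeta> * n" using z n1 by (intro mult_right_mono) (auto intro: power_le_one order_trans[OF power_decreasing[of 1 4 \<zeta>]])
   have zpos: "0 < \<zeta> * n" using z n1 by simp
   have zle: "\<zeta> * n \<le> n" using z n1 mult_right_mono[of \<zeta> 1 n] by simp
   have zKX: "\<zeta> * (real K * real (card X)) \<le> 33 / 32 * (\<zeta> * n)"
   proof -
    have "\<zeta> * (real K * real (card X)) \<le> \<zeta> * (n + \<zeta> / 32 * n)" using KX z by (intro mult_left_mono) auto
    also have "\<dots> \<le> \<zeta> * (33 / 32 * n)" using zle z by (intro mult_left_mono) auto
    finally show ?thesis by simp
   qed
   have a1: "\<tau> * n \<le> real (card (S xs))" using S1 KXl zKX zn zpos by (simp add: algebra_simps)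
   have a2: "\<tau> * n \<le> real (card (T xs))" using T1 KXl zn zpos by (simp add: algebra_simps)
   have a3: "(1 - \<zeta>) * n \<le> real (card (S xs)) + real (card (T xs))"
    using S1 T1 Ksum zKX z4 zpos by (simp add: algebra_simps)
   have finST: "finite (S xs)" "finite (T xs)" using fin by (auto simp: S_def T_def)
   \<comment> \<open>The certificate sets are large enough for the expansion of the whole digraph,
     but by the definition of \<open>S\<close> each of its vertices sends at most \<zeta>n/2 arcs to
     \<open>T\<close>.\<close>
   have "\<zeta> * n\<^sup>2 \<le> real (card (r \<inter> S xs \<times> T xs))"
    using dense_expanderD[OF ex, of "S xs" "T xs"] a1 a2 a3 unfolding n_def by (auto simp: S_def T_def)
   also have "\<dots> = (\<Sum>x\<in>S xs. real (card {y\<in>T xs. (x, y) \<in> r}))"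
    using card_rel_Times_eq_sum_left[OF finST] by simp
   also have "\<dots> \<le> (\<Sum>x\<in>S xs. \<zeta> / 2 * n)" by (intro sum_mono) (auto simp: S_def)
   also have "\<dots> = real (card (S xs)) * (\<zeta> / 2 * n)" by simp
   also have "\<dots> \<le> n * (\<zeta> / 2 * n)"
    using fin z n1 by (intro mult_right_mono) (auto simp: n_def S_def intro!: card_mono)
   also have "\<dots> = \<zeta> * n\<^sup>2 / 2" by (simp add: power2_eq_square)
   finally show False using z n1 by simp
  qed
  show "\<exists>c. (\<forall>x. c x < K) &
    (\<forall>S\<in>\<F>. \<forall>j<K. \<bar>real (card {x\<in>S. c x = j}) - real (card S) / real K\<bar> \<le> \<xi> * real (card V)) &
    (\<forall>a<K. \<forall>b<K. dense_expander (\<zeta> ^ 4 / 512) (2 * \<tau>) (real (card V) / real K) r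
     {x\<in>V. c x = a} {x\<in>V. c x = b})"
  proof (intro exI[of _ c] conjI ballI allI impI)
   fix S j assume "S \<in> \<F>" "j < K"
   then have "\<bar>real (card {x\<in>S. c x = j}) - real (card S) / real K\<bar> \<le> \<xi>' * n"
    by (intro eq) (auto simp: I_def)
   then show "\<bar>real (card {x\<in>S. c x = j}) - real (card S) / real K\<bar> \<le> \<xi> * real (card V)"
    using xi' by (simp add: n_def)
  qed (use c pair in \<open>auto simp: n_def\<close>)
 qed
qed

section \<open>Hall's theorem and edge colourings of digraphs\<close>

text \<open>The induction of Halmos and Vaughan. If no nonempty proper subfamily is tight, any one
  choice can be fixed and its element deleted everywhere. Otherwise a tight subfamily is matched by
  itself, and the rest still satisfies Hall's condition outside the elements of the tight
  subfamily.\<close>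

theorem hall:
 assumes "finite I" "\<And>i. i \<in> I ==> finite (N i)"
  and "\<And>J. J \<subseteq> I ==> card J \<le> card (\<Union>(N ` J))"
 shows "\<exists>f. inj_on f I & (\<forall>i\<in>I. f i \<in> N i)"
 using assms
proof (induction "card I" arbitrary: I N rule: less_induct)
 case less
 note finN = less.prems(2) and hc = less.prems(3)
 show ?case
 proof (cases "I = {}")
  case False
  then obtain i where i: "i \<in> I" by blast
  show ?thesis
  proof (cases "\<exists>J. J \<subset> I & J \<noteq> {} & card (\<Union>(N ` J)) = card J")
   case nex: False
   have "card {i} \<le> card (\<Union>(N ` {i}))" using i by (intro hc) auto
   then have "N i \<noteq> {}" by auto
   then obtain x where x: "x \<in> N i" by blast
   have "\<exists>f. inj_on f (I - {i}) & (\<forall>j\<in>I - {i}. f j \<in> N j - {x})"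
   proof (rule less.hyps)
    show "card (I - {i}) < card I" using i by (intro psubset_card_mono[OF less.prems(1)]) auto
    fix J assume J: "J \<subseteq> I - {i}"
    show "card J \<le> card (\<Union>j\<in>J. N j - {x})"
    proof (cases "J = {}")
     case False
     have "J \<subset> I" using J i by auto
     then have "card J < card (\<Union>(N ` J))"
      using hc[of J] nex False by (metis le_neq_implies_less psubset_imp_subset)
     moreover have "(\<Union>j\<in>J. N j - {x}) = \<Union>(N ` J) - {x}" by auto
     moreover have "card (\<Union>(N ` J)) - 1 \<le> card (\<Union>(N ` J) - {x})"
      by (simp add: card_Diff_singleton_if)
     ultimately show ?thesis by simp
    qed simp
   next
    show "finite (I - {i})" using less.prems(1) by simp
    show "finite (N j - {x})" if "j \<in> I - {i}" for j using finN[of j] that by simp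
   qed
   then obtain f where f: "inj_on f (I - {i})" "\<forall>j\<in>I - {i}. f j \<in> N j - {x}" by blast
   then have "inj_on (f(i := x)) (insert i (I - {i}))"
    unfolding inj_on_def by (simp, metis DiffI singletonD)
   then have "inj_on (f(i := x)) I & (\<forall>j\<in>I. (f(i := x)) j \<in> N j)"
    using x i f(2) by (simp add: insert_absorb)
   then show ?thesis by blast
  next
   case True
   then obtain J where J: "J \<subset> I" "J \<noteq> {}" "card (\<Union>(N ` J)) = card J" by blast
   have finJ: "finite J" using J less.prems(1) finite_subset by blast
   have "\<exists>f. inj_on f J & (\<forall>j\<in>J. f j \<in> N j)"
   proof (rule less.hyps)
    show "card J < card I" by (rule psubset_card_mono[OF less.prems(1) J(1)])
    show "finite (N j)" if "j \<in> J" for j using J(1) that by (intro finN) auto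
    show "card S \<le> card (\<Union>(N ` S))" if "S \<subseteq> J" for S using J(1) that by (intro hc) auto
   qed (rule finJ)
   then obtain f where f: "inj_on f J" "\<forall>j\<in>J. f j \<in> N j" by blast
      have "\<exists>g. inj_on g (I - J) & (\<forall>j\<in>I - J. g j \<in> N j - \<Union>(N ` J))"
   proof (rule less.hyps)
    show "card (I - J) < card I" using J less.prems(1)
     by (intro psubset_card_mono) auto
    fix S assume S: "S \<subseteq> I - J"
    have finS: "finite S" using S less.prems(1) finite_subset by blast
    have "card S + card J = card (S \<union> J)" using S finS finJ by (subst card_Un_disjoint) auto
    also have "\<dots> \<le> card (\<Union>(N ` (S \<union> J)))" using S J by (intro hc) auto
    also have "\<Union>(N ` (S \<union> J)) = (\<Union>j\<in>S. N j - \<Union>(N ` J)) \<union> \<Union>(N ` J)" by auto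
    also have "card \<dots> \<le> card (\<Union>j\<in>S. N j - \<Union>(N ` J)) + card (\<Union>(N ` J))" by (rule card_Un_le)
    finally show "card S \<le> card (\<Union>j\<in>S. N j - \<Union>(N ` J))" using J(3) by simp
   next
    show "finite (I - J)" using less.prems(1) by simp
    show "finite (N j - \<Union>(N ` J))" if "j \<in> I - J" for j using finN[of j] that by simp
   qed
   then obtain g where g: "inj_on g (I - J)" "\<forall>j\<in>I - J. g j \<in> N j - \<Union>(N ` J)" by blast
   let ?h = "\<lambda>j. if j \<in> J then f j else g j"
   have "inj_on ?h I"
   proof (rule inj_onI)
    fix a b assume ab: "a \<in> I" "b \<in> I" "?h a = ?h b"
    have fJ: "f j \<in> \<Union>(N ` J)" if "j \<in> J" for j using f(2) that by blast
    have gJ: "g j \<notin> \<Union>(N ` J)" if "j \<in> I - J" for j using g(2) that by blast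
    show "a = b"
    proof (cases "a \<in> J")
     case True
     then have "b \<in> J" using ab fJ[of a] gJ[of b] by (metis DiffI)
     then show ?thesis using True ab(3) f(1) by (simp add: inj_on_eq_iff)
    next
     case False
     then have "b \<notin> J" using ab fJ[of b] gJ[of a] by (metis DiffI)
     then show ?thesis using False ab g(1) by (simp add: inj_on_eq_iff)
    qed
   qed
   moreover have "\<forall>j\<in>I. ?h j \<in> N j" using f g by auto
   ultimately show ?thesis by blast
  qed
 qed simp
qed

text \<open>With \<open>d\<close> dummy elements available to every index the exact condition holds;
  the indices matched to dummies are the ones given up.\<close>

lemma hall_deficiency:
 assumes "finite I" "\<And>i. i \<in> I ==> finite (N i)"
  and "\<And>J. J \<subseteq> I ==> card J \<le> card (\<Union>(N ` J)) + d"
 shows "\<exists>I' f. I' \<subseteq> I & card (I - I') \<le> d & inj_on f I' & (\<forall>i\<in>I'. f i \<in> N i)"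
proof -
 define N' where "N' i = Inl ` N i \<union> Inr ` {..<d}" for i
 have "\<exists>f. inj_on f I & (\<forall>i\<in>I. f i \<in> N' i)"
 proof (rule hall[OF assms(1)])
  show "finite (N' i)" if "i \<in> I" for i using that assms(2) by (simp add: N'_def)
  fix J assume J: "J \<subseteq> I"
  show "card J \<le> card (\<Union>(N' ` J))"
  proof (cases "J = {}")
   case False
   have "\<Union>(N' ` J) = Inl ` \<Union>(N ` J) \<union> Inr ` {..<d}" using False by (auto simp: N'_def)
   moreover have "finite (\<Union>(N ` J))" using assms(1,2) J by (meson finite_UN finite_subset subsetD)
   moreover have "(Inl :: 'b => 'b + nat) ` A \<inter> Inr ` B = {}" for A B by auto
   ultimately have "card (\<Union>(N' ` J)) = card (\<Union>(N ` J)) + d"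
    by (simp add: card_Un_disjoint card_image)
   then show ?thesis using assms(3)[OF J] by simp
  qed simp
 qed
 then obtain f where f: "inj_on f I" "\<forall>i\<in>I. f i \<in> N' i" by blast
 define I' where "I' = {i\<in>I. f i \<in> range Inl}"
 have "f ` (I - I') \<subseteq> Inr ` {..<d}" using f(2) by (auto simp: I'_def N'_def)
 then have "card (f ` (I - I')) \<le> card (Inr ` {..<d} :: ('b + nat) set)" by (intro card_mono) auto
 moreover have "card (f ` (I - I')) = card (I - I')"
  by (intro card_image inj_on_subset[OF f(1)]) auto
 ultimately have "card (I - I') \<le> d" by (simp add: card_image)
 moreover have "inj_on (projl \<circ> f) I'"
  by (rule inj_onI) (use f(1) in \<open>auto simp: I'_def inj_on_def\<close>)
 moreover have "\<forall>i\<in>I'. (projl \<circ> f) i \<in> N i" using f(2) by (auto simp: I'_def N'_def)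
 ultimately show ?thesis by (intro exI[of _ I'] exI[of _ "projl \<circ> f"]) (auto simp: I'_def)
qed

text \<open>The integer form of Birkhoff's theorem. Counting the weight in the rows of
  \<open>J\<close> gives Hall's condition for the support, so a permutation inside the support
  exists; subtracting it lowers all row and column sums by one.\<close>

lemma regular_matrix_sum_of_permutations:
 fixes w :: "'i => 'i => nat"
 assumes "finite I" "\<And>i. i \<in> I ==> (\<Sum>j\<in>I. w i j) = \<Delta>" "\<And>j. j \<in> I ==> (\<Sum>i\<in>I. w i j) = \<Delta>"
 shows "\<exists>\<pi>. (\<forall>k<\<Delta>. inj_on (\<pi> k) I & \<pi> k ` I \<subseteq> I) & (\<forall>i\<in>I. \<forall>j\<in>I. w i j = card {k. k < \<Delta> & \<pi> k i = j})"
 using assms(2,3)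
proof (induction \<Delta> arbitrary: w)
 case 0
 then show ?case using assms(1) by auto
next
 case (Suc \<Delta>)
 define N where "N i = {j\<in>I. 0 < w i j}" for i
 have "\<exists>f. inj_on f I & (\<forall>i\<in>I. f i \<in> N i)"
 proof (rule hall[OF assms(1)])
  show "finite (N i)" for i using assms(1) by (simp add: N_def)
  fix J assume J: "J \<subseteq> I"
  have sub: "\<Union>(N ` J) \<subseteq> I" by (auto simp: N_def)
  have "(\<Sum>i\<in>J. \<Sum>j\<in>I. w i j) = (\<Sum>i\<in>J. Suc \<Delta>)" using J by (intro sum.cong refl Suc.prems(1)) blast
  then have "card J * Suc \<Delta> = (\<Sum>i\<in>J. \<Sum>j\<in>I. w i j)" by (simp only: sum_constant of_nat_id)
  also have "\<dots> = (\<Sum>i\<in>J. \<Sum>j\<in>\<Union>(N ` J). w i j)"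
   using assms(1) sub by (intro sum.cong refl sum.mono_neutral_right) (auto simp: N_def)
  also have "\<dots> = (\<Sum>j\<in>\<Union>(N ` J). \<Sum>i\<in>J. w i j)" by (rule sum.swap)
  also have "\<dots> \<le> (\<Sum>j\<in>\<Union>(N ` J). \<Sum>i\<in>I. w i j)"
   using J assms(1) by (intro sum_mono sum_mono2) auto
  also have "\<dots> = (\<Sum>j\<in>\<Union>(N ` J). Suc \<Delta>)" using sub by (intro sum.cong refl Suc.prems(2)) blast
  also have "\<dots> = card (\<Union>(N ` J)) * Suc \<Delta>" by (simp only: sum_constant of_nat_id)
  finally show "card J \<le> card (\<Union>(N ` J))" by (simp only: mult_le_cancel2)
 qed
 then obtain f where f: "inj_on f I" "\<forall>i\<in>I. f i \<in> N i" by blast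
 have fI: "f ` I \<subseteq> I" using f(2) by (auto simp: N_def)
 then have surj: "f ` I = I" using f(1) assms(1) by (simp add: endo_inj_surj)
 define w' where "w' i j = w i j - of_bool (j = f i)" for i j
 have w: "w i j = w' i j + of_bool (j = f i)" if "i \<in> I" for i j
  using f(2) that by (auto simp: w'_def N_def of_bool_def)
 have row: "(\<Sum>j\<in>I. of_bool (j = f i)) = (1::nat)" if "i \<in> I" for i
  using fI that assms(1) by (auto simp: of_bool_def)
 have col: "(\<Sum>i\<in>I. of_bool (j = f i)) = (1::nat)" if j: "j \<in> I" for j
 proof -
  obtain i0 where i0: "i0 \<in> I" "j = f i0" using surj j by blast
  have "(\<Sum>i\<in>I. of_bool (j = f i)) = (\<Sum>i\<in>I. of_bool (i = i0))"
   using i0 f(1) by (intro sum.cong refl) (auto simp: inj_on_def)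
  also have "\<dots> = 1" using i0(1) assms(1) by (simp add: of_bool_def)
  finally show ?thesis .
 qed
 have "\<exists>\<pi>. (\<forall>k<\<Delta>. inj_on (\<pi> k) I & \<pi> k ` I \<subseteq> I) & (\<forall>i\<in>I. \<forall>j\<in>I. w' i j = card {k. k < \<Delta> & \<pi> k i = j})"
 proof (rule Suc.IH)
  fix i assume i: "i \<in> I"
  have "(\<Sum>j\<in>I. w i j) = (\<Sum>j\<in>I. w' i j) + (\<Sum>j\<in>I. of_bool (j = f i))"
   by (simp only: w[OF i] sum.distrib)
  then show "(\<Sum>j\<in>I. w' i j) = \<Delta>" using Suc.prems(1)[OF i] row[OF i] by linarith
 next
  fix j assume j: "j \<in> I"
  have "(\<Sum>i\<in>I. w i j) = (\<Sum>i\<in>I. w' i j) + (\<Sum>i\<in>I. of_bool (j = f i))"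
   unfolding sum.distrib[symmetric] by (intro sum.cong refl w)
  then show "(\<Sum>i\<in>I. w' i j) = \<Delta>" using Suc.prems(2)[OF j] col[OF j] by linarith
 qed
 then obtain \<pi> where \<pi>: "\<forall>k<\<Delta>. inj_on (\<pi> k) I & \<pi> k ` I \<subseteq> I"
  "\<forall>i\<in>I. \<forall>j\<in>I. w' i j = card {k. k < \<Delta> & \<pi> k i = j}" by blast
 have "w i j = card {k. k < Suc \<Delta> & (\<pi>(\<Delta> := f)) k i = j}" if "i \<in> I" "j \<in> I" for i j
 proof -
  have "{k. k < Suc \<Delta> & (\<pi>(\<Delta> := f)) k i = j} =
    (if j = f i then insert \<Delta> else id) {k. k < \<Delta> & \<pi> k i = j}"
   by (auto simp: less_Suc_eq)
  moreover have "w' i j = card {k. k < \<Delta> & \<pi> k i = j}" using \<pi>(2) that by blast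
  ultimately show ?thesis using w[OF that(1), of j] by (cases "j = f i") simp_all
 qed
 moreover have "inj_on ((\<pi>(\<Delta> := f)) k) I & (\<pi>(\<Delta> := f)) k ` I \<subseteq> I" if "k < Suc \<Delta>" for k
  using \<pi>(1) f(1) fI that by (cases "k = \<Delta>") simp_all
 ultimately show ?case by blast
qed

text \<open>The adjacency matrix \<open>A\<close> is completed to the matrix \<open>[[A, D\<^sub>1], [D\<^sub>2, A\<^sup>T]]\<close> with constant row and
 column sums, where \<open>D\<^sub>1\<close> and \<open>D\<^sub>2\<close> are diagonal.\<close>

lemma digraph_edge_colouring:
 fixes V :: "'a set"
 assumes fin: "finite V" and B: "B \<subseteq> V \<times> V"
  and out: "\<And>u. u \<in> V ==> card {v\<in>V. (u, v) \<in> B} \<le> \<Delta>"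
  and inn: "\<And>v. v \<in> V ==> card {u\<in>V. (u, v) \<in> B} \<le> \<Delta>"
 shows "\<exists>col. (\<forall>e\<in>B. col e < \<Delta>) &
  (\<forall>u v v'. (u, v) \<in> B & (u, v') \<in> B & col (u, v) = col (u, v') --> v = v') &
  (\<forall>u u' v. (u, v) \<in> B & (u', v) \<in> B & col (u, v) = col (u', v) --> u = u')"
proof -
 define I where "I = (Inl ` V \<union> Inr ` V :: ('a + 'a) set)"
 define w :: "'a + 'a => 'a + 'a => nat" where
  "w x y = (case x of
    Inl u => (case y of Inl v => of_bool ((u, v) \<in> B)
         | Inr u' => of_bool (u = u') * (\<Delta> - card {v\<in>V. (u, v) \<in> B}))
   | Inr v => (case y of Inl v' => of_bool (v = v') * (\<Delta> - card {u\<in>V. (u, v) \<in> B})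
         | Inr u => of_bool ((u, v) \<in> B)))" for x y
 have sumI: "(\<Sum>x\<in>I. g x) = (\<Sum>u\<in>V. g (Inl u)) + (\<Sum>u\<in>V. g (Inr u))" for g :: "'a + 'a => nat"
  unfolding I_def using fin by (subst sum.union_disjoint) (auto simp: sum.reindex)
 have cnt: "(\<Sum>v\<in>V. of_bool (P v)) = card {v\<in>V. P v}" for P
  using fin by (simp add: of_bool_def sum.If_cases Int_def)
 have sing: "(\<Sum>v\<in>V. of_bool (v = u) * c v) = c u" if "u \<in> V" for u and c :: "'a => nat"
  using fin that by (simp add: of_bool_def if_distrib[of "\<lambda>x. x * _"] cong: if_cong)
 have sing1: "(\<Sum>v\<in>V. of_bool (u = v) * c) = c" if "u \<in> V" for u and c :: nat
  using fin that by (simp add: of_bool_def if_distrib[of "\<lambda>x. x * _"] cong: if_cong)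
 have "\<exists>\<pi>. (\<forall>k<\<Delta>. inj_on (\<pi> k) I & \<pi> k ` I \<subseteq> I) & (\<forall>i\<in>I. \<forall>j\<in>I. w i j = card {k. k < \<Delta> & \<pi> k i = j})"
 proof (rule regular_matrix_sum_of_permutations)
  show "finite I" using fin by (simp add: I_def)
  fix i assume "i \<in> I"
  then consider u where "u \<in> V" "i = Inl u" | u where "u \<in> V" "i = Inr u" by (auto simp: I_def)
  then show "(\<Sum>j\<in>I. w i j) = \<Delta>"
   by cases (simp_all add: sumI w_def cnt sing1 out inn)
 next
  fix j assume "j \<in> I"
  then consider u where "u \<in> V" "j = Inl u" | u where "u \<in> V" "j = Inr u" by (auto simp: I_def)
  then show "(\<Sum>i\<in>I. w i j) = \<Delta>"
   by cases (simp_all add: sumI w_def cnt sing out inn)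
 qed
 then obtain \<pi> where \<pi>: "\<forall>k<\<Delta>. inj_on (\<pi> k) I"
  "\<forall>i\<in>I. \<forall>j\<in>I. w i j = card {k. k < \<Delta> & \<pi> k i = j}" by blast
 \<comment> \<open>An arc is an entry 1 of the upper left block and thus covered by one of the
   permutations. Arcs of one colour belong to one permutation, whose being a function and injective
   makes them a matching.\<close>
 define col where "col = (\<lambda>(u, v). SOME k. k < \<Delta> & \<pi> k (Inl u) = Inl v)"
 have col: "col (u, v) < \<Delta> & \<pi> (col (u, v)) (Inl u) = Inl v" if "(u, v) \<in> B" for u v
 proof -
  have "Inl u \<in> I" "Inl v \<in> I" using B that by (auto simp: I_def)
  then have "card {k. k < \<Delta> & \<pi> k (Inl u) = Inl v} = w (Inl u) (Inl v)" using \<pi>(2) by metis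
  then have "card {k. k < \<Delta> & \<pi> k (Inl u) = Inl v} = 1" using that by (simp add: w_def)
  then have "\<exists>k. k < \<Delta> & \<pi> k (Inl u) = Inl v" by (metis (mono_tags, lifting) card_1_singletonE insertI1 mem_Collect_eq)
  then show ?thesis unfolding col_def by (auto intro: someI2_ex)
 qed
 show ?thesis
 proof (intro exI[of _ col] conjI allI impI ballI)
  fix e assume "e \<in> B" then show "col e < \<Delta>" using col by (cases e) auto
 next
  fix u v v' assume "(u, v) \<in> B & (u, v') \<in> B & col (u, v) = col (u, v')"
  then show "v = v'" using col by (metis sum.inject(1))
 next
  fix u u' v assume a: "(u, v) \<in> B & (u', v) \<in> B & col (u, v) = col (u', v)"
  then have "\<pi> (col (u, v)) (Inl u) = \<pi> (col (u, v)) (Inl u')" using col by metis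
  moreover have "Inl u \<in> I" "Inl u' \<in> I" using a B by (auto simp: I_def)
  ultimately show "u = u'" using \<pi>(1) col a by (metis inj_onD sum.inject(1))
 qed
qed

section \<open>Covers by disjoint directed paths\<close>

definition path_cover :: "('a \<times> 'a) set => 'a set => 'a list set => bool" where
 "path_cover r W \<Q> \<longleftrightarrow>
   (\<forall>q\<in>\<Q>. q \<noteq> [] & distinct q & successively (\<lambda>x y. (x, y) \<in> r) q) &
   (\<forall>q\<in>\<Q>. \<forall>q'\<in>\<Q>. q \<noteq> q' --> set q \<inter> set q' = {}) & (\<Union>q\<in>\<Q>. set q) = W"

lemma path_coverD:
 assumes "path_cover r W \<Q>"
 shows "q \<in> \<Q> ==> q \<noteq> []" "q \<in> \<Q> ==> distinct q" "q \<in> \<Q> ==> successively (\<lambda>x y. (x, y) \<in> r) q"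
  "q \<in> \<Q> ==> q' \<in> \<Q> ==> q \<noteq> q' ==> set q \<inter> set q' = {}" "(\<Union>q\<in>\<Q>. set q) = W"
 using assms unfolding path_cover_def by auto

lemma path_cover_inj:
 assumes "path_cover r W \<Q>"
 shows "inj_on hd \<Q>" "inj_on last \<Q>"
 using assms unfolding path_cover_def inj_on_def
 by (metis disjoint_iff hd_in_set) (metis assms path_coverD(1,4) disjoint_iff last_in_set)

lemma path_cover_finite:
 assumes "path_cover r W \<Q>" "finite W"
 shows "finite \<Q>"
proof -
 have "hd ` \<Q> \<subseteq> W" using assms(1) unfolding path_cover_def by (metis UN_I hd_in_set image_subsetI)
 then show ?thesis using assms path_cover_inj(1) by (metis finite_imageD finite_subset)
qed

text \<open>A merge removes exactly one head and one last vertex. From here on covers are tracked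
  through the two sets \<open>hd\<close> \<Q>\<open>and\<close>last \<open>\<Q>\<close>
  only.\<close>

lemma path_cover_merge:
 assumes pc: "path_cover r W \<Q>" and q: "q1 \<in> \<Q>" "q2 \<in> \<Q>" "q1 \<noteq> q2"
  and r: "(last q1, hd q2) \<in> r'" "r \<subseteq> r'"
 shows "path_cover r' W (insert (q1 @ q2) (\<Q> - {q1, q2}))"
  "hd ` insert (q1 @ q2) (\<Q> - {q1, q2}) = hd ` \<Q> - {hd q2}"
  "last ` insert (q1 @ q2) (\<Q> - {q1, q2}) = last ` \<Q> - {last q1}"
proof -
 note D = path_coverD[OF pc]
 have suc: "successively (\<lambda>x y. (x, y) \<in> r') q" if "q \<in> \<Q>" for q
  using D(3)[OF that] r(2) by (auto elim: successively_mono)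
 show "path_cover r' W (insert (q1 @ q2) (\<Q> - {q1, q2}))"
  unfolding path_cover_def
 proof (intro conjI ballI impI)
  fix q assume "q \<in> insert (q1 @ q2) (\<Q> - {q1, q2})"
  then show "q \<noteq> []" "distinct q" "successively (\<lambda>x y. (x, y) \<in> r') q"
   using D(1,2) D(4)[OF q] suc q r(1) by (auto simp: successively_append_iff)
 next
  fix q q' assume "q \<in> insert (q1 @ q2) (\<Q> - {q1, q2})" "q' \<in> insert (q1 @ q2) (\<Q> - {q1, q2})" "q \<noteq> q'"
  moreover have "set p \<inter> set (q1 @ q2) = {}" if "p \<in> \<Q> - {q1, q2}" for p
   using D(4)[of p q1] D(4)[of p q2] q that by auto
  ultimately show "set q \<inter> set q' = {}" using D(4)[of q q'] by blast
 next
  show "(\<Union>q\<in>insert (q1 @ q2) (\<Q> - {q1, q2}). set q) = W" using D(5) q by auto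
 qed
 have ne: "q1 \<noteq> []" "q2 \<noteq> []" using D(1) q by auto
 show "hd ` insert (q1 @ q2) (\<Q> - {q1, q2}) = hd ` \<Q> - {hd q2}"
  using path_cover_inj(1)[OF pc] q ne by (auto simp: inj_on_def image_iff)
 show "last ` insert (q1 @ q2) (\<Q> - {q1, q2}) = last ` \<Q> - {last q1}"
  using path_cover_inj(2)[OF pc] q ne by (auto simp: inj_on_def image_iff)
qed

lemma path_cover_mono: "path_cover r W \<Q> ==> r \<subseteq> r' ==> path_cover r' W \<Q>"
 unfolding path_cover_def by (metis (no_types, lifting) subsetD successively_mono)

lemma successively_less_hd_last:
 fixes pos :: "'a => nat"
 assumes "q \<noteq> []" "successively (\<lambda>x y. (x, y) \<in> r) q" "\<And>x y. (x, y) \<in> r ==> pos x < pos y"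
 shows "pos (hd q) \<le> pos (last q)"
 using assms(1,2)
proof (induction q rule: list_nonempty_induct)
 case (cons x xs)
 then obtain y ys where xs: "xs = y # ys" by (cases xs) auto
 then have "(x, y) \<in> r" and "pos y \<le> pos (last xs)" using cons by auto
 then show ?case using assms(3)[of x y] xs by simp
qed simp

text \<open>Arcs are inserted one at a time, each merging two paths. In-degrees and out-degrees at
  most 1 make the tail of the new arc a last vertex and its tip a head; the potential
  \<open>pos\<close> excludes cycles.\<close>

lemma path_cover_of_arcs:
 fixes pos :: "'a => nat"
 assumes "finite W" "r \<subseteq> W \<times> W" "\<And>x y. (x, y) \<in> r ==> pos x < pos y"
  "single_valued r" "single_valued (r\<inverse>)"
 shows "\<exists>\<Q>. path_cover r W \<Q> & hd ` \<Q> = W - Range r & last ` \<Q> = W - Domain r"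
proof -
 have "finite r" using assms(1,2) finite_subset by blast
 then show ?thesis using assms(2-5)
 proof (induction r rule: finite_induct)
  case empty
  have "path_cover {} W ((\<lambda>x. [x]) ` W)" by (auto simp: path_cover_def)
  then show ?case by (intro exI[of _ "(\<lambda>x. [x]) ` W"]) (auto simp: image_image)
 next
  case (insert e r)
  obtain u v where e: "e = (u, v)" by (cases e)
  have uD: "u \<notin> Domain r" and vR: "v \<notin> Range r"
   using insert.hyps(2) insert.prems(3,4) unfolding e single_valued_def by blast+
  have "\<exists>\<Q>. path_cover r W \<Q> & hd ` \<Q> = W - Range r & last ` \<Q> = W - Domain r"
  proof (rule insert.IH)
   show "single_valued r" "single_valued (r\<inverse>)"
    using insert.prems(3,4) by (auto intro: single_valued_subset[rotated])
  qed (use insert.prems(1,2) in blast)+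
  then obtain \<Q> where Q: "path_cover r W \<Q>" "hd ` \<Q> = W - Range r" "last ` \<Q> = W - Domain r" by blast
  have "u \<in> last ` \<Q>" "v \<in> hd ` \<Q>" using Q uD vR insert.prems(1) by (auto simp: e)
  then obtain q1 q2 where q: "q1 \<in> \<Q>" "last q1 = u" "q2 \<in> \<Q>" "hd q2 = v" by auto
  \<comment> \<open>If both ends of the new arc lay on one path, that path would run from
    \<open>v\<close> to \<open>u\<close>, so \<open>pos v\<close> would be at most
    \<open>pos u\<close>, against the arc from \<open>u\<close> to \<open>v\<close>.\<close>
  have "q1 \<noteq> q2"
  proof
   assume "q1 = q2"
   then have "pos v \<le> pos u"
    using successively_less_hd_last[of q1 r pos] path_coverD(1,3)[OF Q(1) q(1)] q insert.prems(2) by auto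
   then show False using insert.prems(2)[of u v] by (simp add: e)
  qed
  note m = path_cover_merge[OF Q(1) q(1,3) this, of "insert e r"]
  have "path_cover (insert e r) W (insert (q1 @ q2) (\<Q> - {q1, q2}))"
   by (rule m(1)) (use q in \<open>auto simp: e\<close>)
  moreover have "hd ` insert (q1 @ q2) (\<Q> - {q1, q2}) = W - Range (insert e r)"
   using m(2) q Q(2) unfolding e by (simp, blast)
  moreover have "last ` insert (q1 @ q2) (\<Q> - {q1, q2}) = W - Domain (insert e r)"
   using m(3) q Q(3) unfolding e by (simp, blast)
  ultimately show ?case by blast
 qed
qed

lemma dense_expander_no_arcs:
 assumes "dense_expander \<zeta> \<tau> N r A B" "0 < \<zeta>" "0 < N" "X \<subseteq> A" "Y \<subseteq> B" "r \<inter> X \<times> Y = {}"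
  "\<tau> * N \<le> real (card X)" "\<tau> * N \<le> real (card Y)"
 shows "real (card X) + real (card Y) < (1 - \<zeta>) * N"
proof (rule ccontr)
 assume "\<not> ?thesis"
 then have "\<zeta> * N\<^sup>2 \<le> real (card (r \<inter> X \<times> Y))" using dense_expanderD[OF assms(1,4,5,7,8)] by simp
 moreover have "0 < \<zeta> * N\<^sup>2" using assms(2,3) by simp
 ultimately show False using assms(6) by simp
qed

text \<open>\<open>Z\<close> is split into \<open>K\<close> parts of about |Z|/K vertices, and
  consecutive parts are matched almost perfectly. The resulting paths run through the parts in
  order, so a path ends in the last part or at one of the few unmatched vertices. The part index
  serves as the potential that excludes cycles.\<close>

lemma few_paths_cover:
 fixes \<zeta> :: real and K :: nat
 assumes z: "0 < \<zeta>" "\<zeta> \<le> 1" and K: "0 < K"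
 shows "\<exists>n0::nat. \<forall>(Z :: 'a set) r \<tau>. finite Z & n0 \<le> card Z & \<zeta> \<le> \<tau> &
  dense_expander \<zeta> \<tau> (real (card Z)) r Z Z &
  (\<forall>x\<in>Z. 8 * \<tau> * real (card Z) \<le> real (card {y\<in>Z. (x, y) \<in> r}) &
      8 * \<tau> * real (card Z) \<le> real (card {y\<in>Z. (y, x) \<in> r})) -->
  (\<exists>\<Q>. path_cover r Z \<Q> & real (card \<Q>) \<le> 4 * real (card Z) / real K)"
proof -
 define \<zeta>' where "\<zeta>' = \<zeta> ^ 4 / 512"
 have z4: "\<zeta> ^ 4 \<le> \<zeta>" using z power_decreasing[of 1 4 \<zeta>] by simp
 have z': "0 < \<zeta>'" "\<zeta>' \<le> \<zeta>" "\<zeta>' \<le> 1" using z z4 unfolding \<zeta>'_def by (simp, linarith, linarith)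
 \<comment> \<open>With the square of \<open>K\<close> the deficiencies 2\<xi>n of all matchings add
   up to at most 2\<zeta>'|Z|/K, the order of a single part.\<close>
 define \<xi> where "\<xi> = \<zeta>' / (real K)\<^sup>2"
 have xi: "0 < \<xi>" using z' K by (simp add: \<xi>_def)
 from partition_expander[OF z xi K, where 'a = 'a] obtain n0
  where n0: "\<forall>(V :: 'a set) r \<tau> \<F>. finite V & n0 \<le> card V & \<zeta> \<le> \<tau> &
  dense_expander \<zeta> \<tau> (real (card V)) r V V & \<F> \<subseteq> Pow V & card \<F> \<le> 3 * card V -->
  (\<exists>c. (\<forall>x. c x < K) &
    (\<forall>S\<in>\<F>. \<forall>j<K. \<bar>real (card {x\<in>S. c x = j}) - real (card S) / real K\<bar> \<le> \<xi> * real (card V)) &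
    (\<forall>a<K. \<forall>b<K. dense_expander (\<zeta> ^ 4 / 512) (2 * \<tau>) (real (card V) / real K) r
     {x\<in>V. c x = a} {x\<in>V. c x = b}))" ..
 show ?thesis
 proof (intro exI[of _ "max n0 1"] allI impI, elim conjE)
  fix Z :: "'a set" and r \<tau>
  assume fin: "finite Z" and nZ: "max n0 1 \<le> card Z" and \<tau>: "\<zeta> \<le> \<tau>"
   and ex: "dense_expander \<zeta> \<tau> (real (card Z)) r Z Z"
   and deg: "\<forall>x\<in>Z. 8 * \<tau> * real (card Z) \<le> real (card {y\<in>Z. (x, y) \<in> r}) &
      8 * \<tau> * real (card Z) \<le> real (card {y\<in>Z. (y, x) \<in> r})"
  define n where "n = real (card Z)"
  define m where "m = n / real K"
  have n1: "1 \<le> n" using nZ by (simp add: n_def)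
  have K1: "1 \<le> real K" using K by simp
  have m: "0 < m" using n1 K by (simp add: m_def)
  have xim: "\<xi> * n = \<zeta>' * m / real K" using K by (simp add: \<xi>_def m_def power2_eq_square)
  have xz: "\<xi> * n \<le> \<zeta>' * m" unfolding xim using K1 z' m by (simp add: field_simps mult_left_le)
  have zm: "\<zeta>' * m \<le> 1 * m" "\<zeta>' * m \<le> \<tau> * m" using z' \<tau> m by (intro mult_right_mono; simp)+
  define \<F> where "\<F> = (\<lambda>x. {y\<in>Z. (x, y) \<in> r}) ` Z \<union> (\<lambda>x. {y\<in>Z. (y, x) \<in> r}) ` Z \<union> {Z}"
  have "card \<F> \<le> card Z + card Z + 1" unfolding \<F>_def
   by (intro order_trans[OF card_Un_le] add_mono card_image_le fin) simp
  then have cF: "card \<F> \<le> 3 * card Z" using nZ by simp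
  have FZ: "\<F> \<subseteq> Pow Z" by (auto simp: \<F>_def)
  obtain c where c: "\<forall>x. c x < K"
   and eq: "\<And>S j. S \<in> \<F> ==> j < K ==> \<bar>real (card {x\<in>S. c x = j}) - real (card S) / real K\<bar> \<le> \<xi> * n"
   and pe: "\<And>a b. a < K ==> b < K ==> dense_expander \<zeta>' (2 * \<tau>) m r {x\<in>Z. c x = a} {x\<in>Z. c x = b}"
  proof -
   have "finite Z & n0 \<le> card Z & \<zeta> \<le> \<tau> & dense_expander \<zeta> \<tau> (real (card Z)) r Z Z &
     \<F> \<subseteq> Pow Z & card \<F> \<le> 3 * card Z"
    using fin nZ \<tau> ex FZ cF by simp
   from n0[rule_format, OF this] show ?thesis using that unfolding n_def m_def \<zeta>'_def by blast
  qed
  define W where "W j = {x\<in>Z. c x = j}" for j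
  have finW: "finite (W j)" for j using fin by (simp add: W_def)
  have cW: "m - \<xi> * n \<le> real (card (W j))" "real (card (W j)) \<le> m + \<xi> * n" if "j < K" for j
   using eq[of Z j] that by (auto simp: \<F>_def W_def m_def n_def abs_le_iff)
  have dout: "7 * \<tau> * m \<le> real (card {y\<in>W j. (x, y) \<in> r})" if "x \<in> Z" "j < K" for x j
  proof -
   have "{y \<in> {y\<in>Z. (x, y) \<in> r}. c y = j} = {y\<in>W j. (x, y) \<in> r}" by (auto simp: W_def)
   then have "real (card {y\<in>Z. (x, y) \<in> r}) / real K - \<xi> * n \<le> real (card {y\<in>W j. (x, y) \<in> r})"
    using eq[of "{y\<in>Z. (x, y) \<in> r}" j] that by (auto simp: \<F>_def abs_le_iff)
   moreover have "8 * \<tau> * m \<le> real (card {y\<in>Z. (x, y) \<in> r}) / real K"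
    using deg that K by (simp add: m_def n_def divide_right_mono)
   ultimately show ?thesis using xz zm by linarith
  qed
  have din: "7 * \<tau> * m \<le> real (card {y\<in>W j. (y, x) \<in> r})" if "x \<in> Z" "j < K" for x j
  proof -
   have "{y \<in> {y\<in>Z. (y, x) \<in> r}. c y = j} = {y\<in>W j. (y, x) \<in> r}" by (auto simp: W_def)
   then have "real (card {y\<in>Z. (y, x) \<in> r}) / real K - \<xi> * n \<le> real (card {y\<in>W j. (y, x) \<in> r})"
    using eq[of "{y\<in>Z. (y, x) \<in> r}" j] that by (auto simp: \<F>_def abs_le_iff)
   moreover have "8 * \<tau> * m \<le> real (card {y\<in>Z. (y, x) \<in> r}) / real K"
    using deg that K by (simp add: m_def n_def divide_right_mono)
   ultimately show ?thesis using xz zm by linarith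
  qed
  define d where "d = nat \<lfloor>2 * \<xi> * n\<rfloor>"
  have d0: "0 \<le> 2 * \<xi> * n" using xi n1 by simp
  have dle: "real d \<le> 2 * \<xi> * n" using d0 by (simp add: d_def)
  have dgt: "2 * \<xi> * n < real d + 1" using d0 unfolding d_def by linarith
  have tm: "0 < \<tau> * m" using z \<tau> m by simp
  have "\<exists>I' f. I' \<subseteq> W j & card (W j - I') \<le> d & inj_on f I' & (\<forall>x\<in>I'. f x \<in> {y\<in>W (Suc j). (x, y) \<in> r})"
   if j: "Suc j < K" for j
  proof (rule hall_deficiency[OF finW])
   show "finite {y\<in>W (Suc j). (x, y) \<in> r}" for x using finW by simp
   fix J assume J: "J \<subseteq> W j"
   define NJ where "NJ = (\<Union>x\<in>J. {y\<in>W (Suc j). (x, y) \<in> r})"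
   \<comment> \<open>If Hall's condition failed for \<open>J\<close>, there would be no arcs from
     \<open>J\<close> to \<open>Y\<close> while |J| + |Y| is at least \<open>m\<close>. Both sets
     are large: \<open>J\<close> because even one vertex has many out-neighbours, all in
     \<open>NJ\<close>, and \<open>Y\<close> because the in-neighbours of one of its vertices avoid
     \<open>J\<close>. This contradicts expansion.\<close>
   define Y where "Y = W (Suc j) - NJ"
   have NJW: "NJ \<subseteq> W (Suc j)" by (auto simp: NJ_def)
   have finJ: "finite J" "finite NJ"
    using finite_subset[OF J finW] finite_subset[OF NJW finW] by blast+
   show "card J \<le> card (\<Union>x\<in>J. {y\<in>W (Suc j). (x, y) \<in> r}) + d"
   proof (rule ccontr)
    assume "\<not> ?thesis"
    then have "card NJ + d + 1 \<le> card J" by (simp add: NJ_def)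
    then have "real (card NJ) + real d + 1 \<le> real (card J)" by linarith
    then have big: "real (card NJ) + 2 * \<xi> * n < real (card J)" using dgt by linarith
    then have "J \<noteq> {}" using d0 by auto
    then obtain x where x: "x \<in> J" by blast
    have "card {y\<in>W (Suc j). (x, y) \<in> r} \<le> card NJ" using x finJ by (intro card_mono) (auto simp: NJ_def)
    moreover have "x \<in> Z" using x J by (auto simp: W_def)
    ultimately have NJ7: "7 * \<tau> * m \<le> real (card NJ)" using dout[of x "Suc j"] j by linarith
    have cY: "real (card Y) = real (card (W (Suc j))) - real (card NJ)"
     unfolding Y_def using card_Diff_subset[OF finJ(2) NJW] card_mono[OF finW NJW] by linarith
    have cJW: "card J \<le> card (W j)" using J finW by (intro card_mono)
    have "0 < real (card Y)" using cY big cJW cW[of j] cW[of "Suc j"] j by linarith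
    then have "Y \<noteq> {}" by auto
    then obtain y where y: "y \<in> Y" by blast
    have "J \<inter> {x\<in>W j. (x, y) \<in> r} = {}" using y by (auto simp: Y_def NJ_def)
    then have "card J + card {x\<in>W j. (x, y) \<in> r} = card (J \<union> {x\<in>W j. (x, y) \<in> r})"
     using finJ finW by (subst card_Un_disjoint) auto
    also have "\<dots> \<le> card (W j)" using J finW by (intro card_mono) auto
    finally have "real (card J) + real (card {x\<in>W j. (x, y) \<in> r}) \<le> real (card (W j))" by linarith
    moreover have "y \<in> Z" using y by (simp add: Y_def W_def)
    ultimately have "real (card J) + 7 * \<tau> * m \<le> real (card (W j))" using din[of y j] j by linarith
    then have Y7: "7 * \<tau> * m \<le> real (card Y)" using cY big cW[of j] cW[of "Suc j"] j by linarith
    have "real (card J) + real (card Y) < (1 - \<zeta>') * m"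
    proof (rule dense_expander_no_arcs[OF pe])
     show "j < K" "Suc j < K" using j by auto
     show "J \<subseteq> {x\<in>Z. c x = j}" "Y \<subseteq> {x\<in>Z. c x = Suc j}" using J by (auto simp: W_def Y_def)
     show "r \<inter> J \<times> Y = {}" by (auto simp: Y_def NJ_def)
     show "2 * \<tau> * m \<le> real (card J)" using NJ7 big d0 tm by linarith
     show "2 * \<tau> * m \<le> real (card Y)" using Y7 tm by linarith
    qed (use z' m in auto)
    moreover have "m \<le> real (card J) + real (card Y)" using cY big cW(1)[of "Suc j"] j d0 by linarith
    moreover have "0 < \<zeta>' * m" using z' m by simp
    ultimately show False by (simp add: left_diff_distrib)
   qed
  qed
  then obtain I' f where I': "\<And>j. Suc j < K ==> I' j \<subseteq> W j" "\<And>j. Suc j < K ==> card (W j - I' j) \<le> d"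
   and f: "\<And>j. Suc j < K ==> inj_on (f j) (I' j)"
    "\<And>j x. Suc j < K ==> x \<in> I' j ==> f j x \<in> W (Suc j) & (x, f j x) \<in> r"
   by (simp only: mem_Collect_eq) metis
  define arcs where "arcs = {(x, f (c x) x) | x. Suc (c x) < K & x \<in> I' (c x)}"
  have carc: "c x \<in> {j. Suc j < K} & x \<in> I' (c x) & y = f (c x) x & x \<in> Z & y \<in> Z & c y = Suc (c x) & (x, y) \<in> r"
   if "(x, y) \<in> arcs" for x y
  proof -
   from that have 1: "y = f (c x) x" "Suc (c x) < K" "x \<in> I' (c x)" by (auto simp: arcs_def)
   then show ?thesis using f(2)[OF 1(2,3)] I'(1)[OF 1(2)] by (auto simp: W_def)
  qed
  have "\<exists>\<Q>. path_cover arcs Z \<Q> & hd ` \<Q> = Z - Range arcs & last ` \<Q> = Z - Domain arcs"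
  proof (rule path_cover_of_arcs[OF fin, where pos = c])
   show "arcs \<subseteq> Z \<times> Z" by (rule subrelI) (use carc in simp)
   show "c x < c y" if "(x, y) \<in> arcs" for x y using carc[OF that] by (metis lessI)
   show "single_valued arcs" using carc unfolding single_valued_def by metis
   show "single_valued (arcs\<inverse>)"
    unfolding single_valued_def
   proof (intro allI impI, unfold converse_iff)
    fix y x x' assume a: "(x, y) \<in> arcs" "(x', y) \<in> arcs"
    note x = carc[OF a(1)] and x' = carc[OF a(2)]
    have c: "c x = c x'" using x x' by (metis Suc_inject)
    have "inj_on (f (c x)) (I' (c x))" using x by (intro f(1)) simp
    moreover have "f (c x) x = f (c x) x'" using x x' c by metis
    ultimately show "x = x'" using x x' c by (metis inj_onD)
   qed
  qed
  then obtain \<Q> where Q: "path_cover arcs Z \<Q>" "last ` \<Q> = Z - Domain arcs" by blast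
  have "path_cover r Z \<Q>"
   by (rule path_cover_mono[OF Q(1)], rule subrelI) (use carc in simp)
  moreover have "real (card \<Q>) \<le> 4 * n / real K"
  proof -
   \<comment> \<open>Last vertices are the vertices without outgoing arc; they lie in the last part
     or were left unmatched.\<close>
   have sub: "Z - Domain arcs \<subseteq> W (K - 1) \<union> (\<Union>j<K - 1. W j - I' j)"
   proof
    fix x assume x: "x \<in> Z - Domain arcs"
    show "x \<in> W (K - 1) \<union> (\<Union>j<K - 1. W j - I' j)"
    proof (cases "Suc (c x) < K")
     case True
     then have "x \<notin> I' (c x)" using x unfolding arcs_def by blast
     then have "x \<in> W (c x) - I' (c x)" "c x \<in> {..<K - 1}" using True x by (auto simp: W_def)
     then show ?thesis by blast
    next
     case False
     then have "c x = K - 1" using c by (metis Suc_lessI diff_Suc_1)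
     then show ?thesis using x by (simp add: W_def)
    qed
   qed
   have "card \<Q> = card (last ` \<Q>)" using path_cover_inj(2)[OF Q(1)] by (simp add: card_image)
   also have "\<dots> \<le> card (W (K - 1) \<union> (\<Union>j<K - 1. W j - I' j))"
    unfolding Q(2) using sub finW by (intro card_mono) auto
   also have "\<dots> \<le> card (W (K - 1)) + (\<Sum>j<K - 1. card (W j - I' j))"
    by (intro order_trans[OF card_Un_le] add_left_mono card_UN_le) simp
   also have "\<dots> \<le> card (W (K - 1)) + (\<Sum>j<K - 1. d)"
    using I'(2) by (intro add_left_mono sum_mono) simp
   finally have "card \<Q> \<le> card (W (K - 1)) + (K - 1) * d" by simp
   then have "real (card \<Q>) \<le> real (card (W (K - 1))) + real ((K - 1) * d)" by linarith
   also have "\<dots> \<le> (m + \<xi> * n) + real K * (2 * \<xi> * n)"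
    using cW(2)[of "K - 1"] K dle by (intro add_mono) (auto intro!: mult_mono)
   also have "real K * (2 * \<xi> * n) = 2 * (\<zeta>' * m)" using xim K by simp
   also have "(m + \<xi> * n) + 2 * (\<zeta>' * m) \<le> 4 * m" using xz zm by linarith
   finally show ?thesis by (simp add: m_def)
  qed
  ultimately show "\<exists>\<Q>. path_cover r Z \<Q> & real (card \<Q>) \<le> 4 * real (card Z) / real K"
   unfolding n_def by blast
 qed
qed

section \<open>Short walks and links in dense expanders\<close>

text \<open>The set \<open>Y\<close> of vertices with few in-neighbours in \<open>X\<close> receives
  fewer than \<zeta>N^2 arcs in total. If the robust neighbourhood \<open>M\<close> were small in
  both senses, \<open>Y\<close> would be large enough to contradict expansion.\<close>

lemma expander_growth:
 assumes ex: "dense_expander \<zeta> \<tau> N r U U" and fin: "finite U" and pos: "0 < \<zeta>" "0 < N"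
  and U: "(1 - \<zeta> / 2) * N \<le> real (card U)" "real (card U) \<le> 2 * N"
  and X: "X \<subseteq> U" "\<tau> * N \<le> real (card X)"
 defines "M \<equiv> {y\<in>U. \<zeta> / 2 * N \<le> real (card {x\<in>X. (x, y) \<in> r})}"
 shows "real (card U) - \<tau> * N \<le> real (card M) \<or> real (card X) + \<zeta> / 2 * N \<le> real (card M)"
proof (rule ccontr)
 assume n: "\<not> ?thesis"
 define Y where "Y = U - M"
 have MU: "M \<subseteq> U" by (auto simp: M_def)
 have cY: "real (card Y) = real (card U) - real (card M)"
  unfolding Y_def using card_Diff_subset[OF finite_subset[OF MU fin] MU] card_mono[OF fin MU] by linarith
 have finXY: "finite X" "finite Y" using X fin finite_subset by (auto simp: Y_def)
 have ge: "\<zeta> * N\<^sup>2 \<le> real (card (r \<inter> X \<times> Y))"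
 proof (rule dense_expanderD[OF ex X(1)])
  show "Y \<subseteq> U" by (auto simp: Y_def)
  show "\<tau> * N \<le> real (card Y)" using n cY by linarith
  show "(1 - \<zeta>) * N \<le> real (card X) + real (card Y)" using n cY U(1) by (simp add: left_diff_distrib)
 qed (rule X(2))
 have "real (card (r \<inter> X \<times> Y)) = (\<Sum>y\<in>Y. real (card {x\<in>X. (x, y) \<in> r}))"
  using card_rel_Times_eq_sum_right[OF finXY] by simp
 also have "\<dots> < \<zeta> * N\<^sup>2"
 proof (cases "Y = {}")
  case False
  have "(\<Sum>y\<in>Y. real (card {x\<in>X. (x, y) \<in> r})) < (\<Sum>y\<in>Y. \<zeta> / 2 * N)"
   using False finXY by (intro sum_strict_mono) (auto simp: Y_def M_def)
  also have "\<dots> = real (card Y) * (\<zeta> / 2 * N)" by simp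
  also have "\<dots> \<le> 2 * N * (\<zeta> / 2 * N)" using cY U pos by (intro mult_right_mono) auto
  finally show ?thesis by (simp add: power2_eq_square mult_ac)
 qed (use pos in simp)
 finally show False using ge by simp
qed

text \<open>A vertex enters the next layer only if it has at least \<open>s\<close> predecessors, so
  that a walk can be traced back while avoiding forbidden vertices. The relation may change from
  step to step because the absorbers need walks that alternate between \<open>r\<close> and its
  converse.\<close>

primrec walk_layers ::
 "real => 'a set => 'a set => (nat => ('a \<times> 'a) set) => nat => 'a set" where
 "walk_layers s U X rr 0 = X"
| "walk_layers s U X rr (Suc j) =
   {y\<in>U. s \<le> real (card {x \<in> walk_layers s U X rr j. (x, y) \<in> rr j})}"

lemma card_walk_layers:
 assumes ex: "\<And>j. dense_expander \<zeta> \<tau> N (rr j) U U" and fin: "finite U" and pos: "0 < \<zeta>" "\<zeta> \<le> 1" "0 < N" "0 \<le> \<tau>" "\<tau> \<le> 1 / 4"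
  and U: "(1 - \<zeta> / 2) * N \<le> real (card U)" "real (card U) \<le> 2 * N"
  and X: "X \<subseteq> U" "\<tau> * N \<le> real (card X)"
 shows "walk_layers (\<zeta> / 2 * N) U X rr j \<subseteq> U & \<tau> * N \<le> real (card (walk_layers (\<zeta> / 2 * N) U X rr j)) &
  min (real j * (\<zeta> / 2 * N)) (real (card U) - \<tau> * N) \<le> real (card (walk_layers (\<zeta> / 2 * N) U X rr j))"
proof (induction j)
 case 0
 then show ?case using X by simp
next
 case (Suc j)
 have "\<tau> * N \<le> 1 / 4 * N" "\<zeta> * N \<le> 1 * N" using pos by (intro mult_right_mono; simp)+
 moreover have "N - \<zeta> * N / 2 \<le> real (card U)" using U(1) by (simp add: left_diff_distrib)
 ultimately have "\<tau> * N \<le> real (card U) - \<tau> * N" using pos by linarith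
 moreover have "0 < \<zeta> / 2 * N" using pos by simp
 moreover define L where "L = walk_layers (\<zeta> / 2 * N) U X rr j"
 moreover define M where "M = walk_layers (\<zeta> / 2 * N) U X rr (Suc j)"
 moreover have "real (card U) - \<tau> * N \<le> real (card M) \<or> real (card L) + \<zeta> / 2 * N \<le> real (card M)"
  using expander_growth[OF ex[of j] fin pos(1,3) U, of L] Suc.IH unfolding L_def M_def by simp
 moreover have "real (Suc j) * (\<zeta> / 2 * N) = real j * (\<zeta> / 2 * N) + \<zeta> / 2 * N"
  by (simp add: algebra_simps)
 moreover have "M \<subseteq> U" by (auto simp: M_def)
 ultimately show ?case using Suc.IH unfolding M_def[symmetric] L_def[symmetric] by linarith
qed

text \<open>The walk is built backwards from \<open>y\<close>. Each vertex has at least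
  \<open>s\<close> predecessors in the previous layer, more than the forbidden and already visited
  vertices together, so a fresh predecessor always remains.\<close>

lemma walk_to_layer:
 assumes "y \<in> walk_layers s U X rr j" "X \<subseteq> U" "finite U" "finite F" "y \<notin> F" "real (card F) + real j < s"
 shows "\<exists>vs. length vs = Suc j & distinct vs & set vs \<subseteq> U - F & vs ! 0 \<in> X & vs ! j = y &
  (\<forall>i<j. (vs ! i, vs ! Suc i) \<in> rr i)"
 using assms(1,4-6)
proof (induction j arbitrary: y F)
 case 0
 then show ?case using assms(2) by (intro exI[of _ "[y]"]) auto
next
 case (Suc j)
 let ?P = "{x \<in> walk_layers s U X rr j. (x, y) \<in> rr j}"
 have "walk_layers s U X rr j \<subseteq> U" using assms(2) by (cases j) auto
 then have finP: "finite ?P" using assms(3) by (auto intro: finite_subset)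
 have sP: "s \<le> real (card ?P)" and yU: "y \<in> U" using Suc.prems(1) by auto
 have "\<not> ?P \<subseteq> insert y F"
 proof
  assume "?P \<subseteq> insert y F"
  then have "card ?P \<le> card (insert y F)" using Suc.prems(2) by (intro card_mono) auto
  also have "\<dots> = Suc (card F)" using Suc.prems(2,3) by simp
  finally have "real (card ?P) \<le> real (Suc (card F))" by (simp only: of_nat_le_iff)
  then show False using sP Suc.prems(4) by simp
 qed
 then obtain x where x: "x \<in> walk_layers s U X rr j" "(x, y) \<in> rr j" "x \<notin> insert y F" by blast
 have "real (card (insert y F)) + real j < s" using Suc.prems(2-4) by simp
 then obtain vs where vs: "length vs = Suc j" "distinct vs" "set vs \<subseteq> U - insert y F" "vs ! 0 \<in> X" "vs ! j = x"
  "\<forall>i<j. (vs ! i, vs ! Suc i) \<in> rr i"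
  using Suc.IH[OF x(1), of "insert y F"] x(3) Suc.prems(2) by auto
 show ?case
 proof (intro exI[of _ "vs @ [y]"] conjI allI impI)
  fix i assume "i < Suc j"
  then show "((vs @ [y]) ! i, (vs @ [y]) ! Suc i) \<in> rr i"
   using vs x by (cases "i = j") (auto simp: nth_append)
 qed (use vs yU Suc.prems in \<open>auto simp: nth_append\<close>)
qed

lemma expander_walk:
 assumes ex: "\<And>j. dense_expander \<zeta> \<tau> N (rr j) U U" and fin: "finite U" and pos: "0 < \<zeta>" "\<zeta> \<le> 1" "0 < N" "0 \<le> \<tau>" "\<tau> \<le> 1 / 4"
  and U: "(1 - \<zeta> / 2) * N \<le> real (card U)" "real (card U) \<le> 2 * N"
  and X: "X \<subseteq> U" "\<tau> * N \<le> real (card X)" and T: "T \<subseteq> U" "\<tau> * N < real (card T)"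
  and t: "4 / \<zeta> \<le> real t" "real t < \<zeta> / 2 * N"
 shows "\<exists>vs. length vs = Suc t & distinct vs & set vs \<subseteq> U & vs ! 0 \<in> X & vs ! t \<in> T &
  (\<forall>i<t. (vs ! i, vs ! Suc i) \<in> rr i)"
proof -
 let ?L = "walk_layers (\<zeta> / 2 * N) U X rr t"
 have L: "?L \<subseteq> U" "\<tau> * N \<le> real (card ?L)" "min (real t * (\<zeta> / 2 * N)) (real (card U) - \<tau> * N) \<le> real (card ?L)"
  using card_walk_layers[where rr = rr and j = t, OF ex fin pos U X] by blast+
 \<comment> \<open>Layers gain \<zeta>N/2 per step until they contain all but \<tau>N vertices;
   4/\<zeta> steps gain 2N, which is at least |U|. The last layer then meets \<open>T\<close>, which
   has more than \<tau>N vertices.\<close>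
 have "4 \<le> real t * \<zeta>" using t(1) pos by (simp add: field_simps)
 then have "2 * N \<le> real t * \<zeta> / 2 * N" using pos by (intro mult_right_mono) auto
 then have "real (card U) \<le> real t * (\<zeta> / 2 * N)" using U(2) by simp
 moreover have tN: "0 \<le> \<tau> * N" using pos by simp
 ultimately have cL: "real (card U) - \<tau> * N \<le> real (card ?L)" using L(3) by linarith
 have "T \<inter> ?L \<noteq> {}"
 proof
  assume "T \<inter> ?L = {}"
  then have "card T + card ?L = card (T \<union> ?L)"
   using finite_subset[OF T(1) fin] finite_subset[OF L(1) fin] by (simp add: card_Un_disjoint)
  also have "\<dots> \<le> card U" using fin T L(1) by (intro card_mono) auto
  finally show False using cL T(2) by linarith
 qed
 then obtain y where y: "y \<in> T" "y \<in> ?L" by blast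
 show ?thesis using walk_to_layer[OF y(2) X(1) fin, of "{}"] t(2) y(1) by auto
qed

abbreviation arc_path :: "('a \<times> 'a) set => 'a list => bool" where
 "arc_path r \<equiv> successively (\<lambda>x y. (x, y) \<in> r)"

lemma link_exists:
 assumes ex: "dense_expander \<zeta> \<tau> N r U U" and fin: "finite U" and pos: "0 < \<zeta>" "\<zeta> \<le> 1" "0 < N" "0 \<le> \<tau>" "\<tau> \<le> 1 / 4"
  and U: "(1 - \<zeta> / 2) * N \<le> real (card U)" "real (card U) \<le> 2 * N"
  and out: "\<tau> * N \<le> real (card {y\<in>U. (u, y) \<in> r})" and inn: "\<tau> * N < real (card {y\<in>U. (y, v) \<in> r})"
  and t: "4 / \<zeta> \<le> real t" "real t < \<zeta> / 2 * N"
 shows "\<exists>vs. length vs = Suc t & distinct vs & set vs \<subseteq> U & arc_path r (u # vs @ [v])"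
proof -
 obtain vs where vs: "length vs = Suc t" "distinct vs" "set vs \<subseteq> U" "vs ! 0 \<in> {y\<in>U. (u, y) \<in> r}"
  "vs ! t \<in> {y\<in>U. (y, v) \<in> r}" "\<forall>i<t. (vs ! i, vs ! Suc i) \<in> r"
  using expander_walk[where rr = "\<lambda>_. r", OF ex fin pos U _ out _ inn t] by auto
 have ne: "vs \<noteq> []" using vs(1) by auto
 have "arc_path r vs" using vs(1,6) by (simp add: successively_conv_nth)
 moreover have "hd vs = vs ! 0" "last vs = vs ! t" using vs(1) ne by (simp_all add: hd_conv_nth last_conv_nth)
 ultimately have "arc_path r (u # vs @ [v])"
  using vs(4,5) ne by (simp add: successively_Cons successively_append_iff)
 then show ?thesis using vs by blast
qed

lemma card_Diff_ge:
 assumes "finite D"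
 shows "real (card A) - real (card D) \<le> real (card (A - D))"
 using diff_card_le_card_Diff[OF assms, of A] by linarith

text \<open>Greedy choice: all links together occupy at most \<zeta>N/4 vertices, and what remains
  of \<open>U\<close> still satisfies the size and degree conditions of
  \<open>link_exists\<close>.\<close>

lemma links_exist:
 assumes ex: "dense_expander \<zeta> \<tau> N r U U" and fin: "finite U" and pos: "0 < \<zeta>" "\<zeta> \<le> 1" "0 < N" "\<zeta> \<le> \<tau>" "\<tau> \<le> 1 / 4"
  and U: "(1 - \<zeta> / 4) * N \<le> real (card U)" "real (card U) \<le> 2 * N"
  and t: "4 / \<zeta> \<le> real t" "real t < \<zeta> / 2 * N"
  and I: "finite I" "real (card I) * (real t + 1) \<le> \<zeta> / 4 * N"
  and deg: "\<And>i. i \<in> I ==> 2 * \<tau> * N \<le> real (card {y\<in>U. (u i, y) \<in> r})"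
   "\<And>i. i \<in> I ==> 2 * \<tau> * N \<le> real (card {y\<in>U. (y, v i) \<in> r})"
 shows "\<exists>lk. (\<forall>i\<in>I. length (lk i) = Suc t & distinct (lk i) & set (lk i) \<subseteq> U & arc_path r (u i # lk i @ [v i])) &
  (\<forall>i\<in>I. \<forall>j\<in>I. i \<noteq> j --> set (lk i) \<inter> set (lk j) = {})"
 using I deg
proof (induction I rule: finite_induct)
 case empty
 then show ?case by simp
next
 case (insert x I)
 have cI: "real (card (insert x I)) * (real t + 1) = real (card I) * (real t + 1) + (real t + 1)"
  using insert.hyps by (simp add: algebra_simps)
 have le: "real (card I) * (real t + 1) \<le> \<zeta> / 4 * N" using insert.prems(1) cI by linarith
 obtain lk where lk: "\<forall>i\<in>I. length (lk i) = Suc t & distinct (lk i) & set (lk i) \<subseteq> U & arc_path r (u i # lk i @ [v i])"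
  "\<forall>i\<in>I. \<forall>j\<in>I. i \<noteq> j --> set (lk i) \<inter> set (lk j) = {}"
  using insert.IH[OF le] insert.prems(2,3) by auto
 define D where "D = (\<Union>i\<in>I. set (lk i))"
 have finD: "finite D" using insert.hyps by (simp add: D_def)
 have "card D \<le> (\<Sum>i\<in>I. card (set (lk i)))" unfolding D_def by (rule card_UN_le[OF insert.hyps(1)])
 also have "\<dots> \<le> (\<Sum>i\<in>I. Suc t)" by (rule sum_mono) (use lk(1) card_length in metis)
 finally have "card D \<le> card I * Suc t" by (simp only: sum_constant of_nat_id)
 then have "real (card D) \<le> real (card I * Suc t)" by (simp only: of_nat_le_iff)
 then have cD: "real (card D) \<le> \<zeta> / 4 * N" using le by (simp add: algebra_simps)
 have zN: "\<zeta> * N \<le> \<tau> * N" "0 < \<zeta> * N" using pos by simp_all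
 have sub: "{y\<in>U - D. P y} = {y\<in>U. P y} - D" for P by auto
 have "\<exists>vs. length vs = Suc t & distinct vs & set vs \<subseteq> U - D & arc_path r (u x # vs @ [v x])"
 proof (rule link_exists[OF dense_expander_subset[OF ex]])
  show "(1 - \<zeta> / 2) * N \<le> real (card (U - D))"
   using card_Diff_ge[OF finD, of U] cD U(1) by (simp add: left_diff_distrib)
  show "real (card (U - D)) \<le> 2 * N" using card_mono[OF fin, of "U - D"] U(2) by simp
  show "\<tau> * N \<le> real (card {y\<in>U - D. (u x, y) \<in> r})"
   unfolding sub using card_Diff_ge[OF finD, of "{y\<in>U. (u x, y) \<in> r}"] cD insert.prems(2)[of x] zN by simp
  have "2 * \<tau> * N \<le> real (card {y\<in>U. (y, v x) \<in> r})" using insert.prems(3)[of x] by simp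
  then show "\<tau> * N < real (card {y\<in>U - D. (y, v x) \<in> r})"
   unfolding sub using card_Diff_ge[OF finD, of "{y\<in>U. (y, v x) \<in> r}"] cD zN by linarith
 qed (use fin pos t in auto)
 then obtain vs where vs: "length vs = Suc t" "distinct vs" "set vs \<subseteq> U - D" "arc_path r (u x # vs @ [v x])" by blast
 have dis: "set (lk i) \<inter> set vs = {}" if "i \<in> I" for i using vs(3) that by (auto simp: D_def)
 show ?case
 proof (intro exI[of _ "lk(x := vs)"] conjI ballI impI)
  fix i assume "i \<in> insert x I"
  then show "length ((lk(x := vs)) i) = Suc t" "distinct ((lk(x := vs)) i)" "set ((lk(x := vs)) i) \<subseteq> U"
   "arc_path r (u i # (lk(x := vs)) i @ [v i])"
   using lk(1) vs by auto
 next
  fix i j assume "i \<in> insert x I" "j \<in> insert x I" "i \<noteq> j"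
  then show "set ((lk(x := vs)) i) \<inter> set ((lk(x := vs)) j) = {}"
   using lk(2) dis insert.hyps(2) by (cases "i = x"; cases "j = x") (simp_all add: Int_commute)
 qed
qed

section \<open>Absorbers\<close>

definition path_on :: "('a \<times> 'a) set => 'a => 'a => 'a set => bool" where
 "path_on r a b W \<longleftrightarrow> (\<exists>p. p \<noteq> [] & hd p = a & last p = b & distinct p & set p = W & arc_path r p)"

definition flexible :: "('a \<times> 'a) set => 'a => 'a => 'a set => 'a set => bool" where
 "flexible r a b W S \<longleftrightarrow> (\<forall>R\<subseteq>S. path_on r a b (W \<union> R))"

lemma path_on_append:
 assumes "path_on r a b W" "path_on r a' b' W'" "(b, a') \<in> r" "W \<inter> W' = {}"
 shows "path_on r a b' (W \<union> W')"
proof -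
 obtain p p' where p: "p \<noteq> []" "hd p = a" "last p = b" "distinct p" "set p = W" "arc_path r p"
  and p': "p' \<noteq> []" "hd p' = a'" "last p' = b'" "distinct p'" "set p' = W'" "arc_path r p'"
  using assms(1,2) unfolding path_on_def by blast
 show ?thesis unfolding path_on_def
  by (rule exI[of _ "p @ p'"]) (use p p' assms(3,4) in \<open>simp add: successively_append_iff\<close>)
qed

lemma path_on_singleton: "path_on r a a {a}"
 unfolding path_on_def by (rule exI[of _ "[a]"]) simp

lemma path_on_link:
 assumes "path_on r a b W" "path_on r a' b' W'" "arc_path r (b # l @ [a'])" "l \<noteq> []" "distinct l"
  "W \<inter> W' = {}" "set l \<inter> W = {}" "set l \<inter> W' = {}"
 shows "path_on r a b' (W \<union> set l \<union> W')"
proof -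
 have l: "(b, hd l) \<in> r" "(last l, a') \<in> r" "arc_path r l"
  using assms(3,4) by (simp_all add: successively_Cons successively_append_iff)
 have pl: "path_on r (hd l) (last l) (set l)" unfolding path_on_def using l assms(4,5) by blast
 have "path_on r a (last l) (W \<union> set l)"
  using assms(7) by (intro path_on_append[OF assms(1) pl l(1)]) blast
 from path_on_append[OF this assms(2) l(2)] show ?thesis using assms(6,8) by blast
qed

lemma path_on_chain:
 fixes h l :: "nat => 'a" and n :: nat
 assumes "\<And>i. i \<le> n ==> path_on r (h i) (l i) (W i)"
  and "\<And>i. i < n ==> arc_path r (l i # lk i @ [h (Suc i)]) & lk i \<noteq> [] & distinct (lk i)"
  and "\<And>i j. i \<le> n ==> j < i ==> W i \<inter> W j = {}"
  and "\<And>i j. i < n ==> j < i ==> set (lk i) \<inter> set (lk j) = {}"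
  and "\<And>i j. i \<le> n ==> j < n ==> W i \<inter> set (lk j) = {}"
 shows "path_on r (h 0) (l n) ((\<Union>i\<le>n. W i) \<union> (\<Union>i<n. set (lk i)))"
 using assms
proof (induction n)
 case 0
 then show ?case by simp
next
 case (Suc n)
 let ?V = "(\<Union>i\<le>n. W i) \<union> (\<Union>i<n. set (lk i))"
 have IH: "path_on r (h 0) (l n) ?V" using Suc.prems by (intro Suc.IH) simp_all
 have "path_on r (h 0) (l (Suc n)) (?V \<union> set (lk n) \<union> W (Suc n))"
 proof (rule path_on_link[OF IH])
  show "path_on r (h (Suc n)) (l (Suc n)) (W (Suc n))" using Suc.prems(1) by simp
  show "arc_path r (l n # lk n @ [h (Suc n)])" "lk n \<noteq> []" "distinct (lk n)" using Suc.prems(2)[of n] by simp_all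
  have "W i \<inter> W (Suc n) = {}" if "i \<le> n" for i using Suc.prems(3)[of "Suc n" i] that by auto
  moreover have "set (lk i) \<inter> W (Suc n) = {}" if "i < n" for i using Suc.prems(5)[of "Suc n" i] that by auto
  ultimately show "?V \<inter> W (Suc n) = {}" by blast
  have "W i \<inter> set (lk n) = {}" if "i \<le> n" for i using Suc.prems(5)[of i n] that by auto
  moreover have "set (lk i) \<inter> set (lk n) = {}" if "i < n" for i using Suc.prems(4)[of n i] that by auto
  ultimately show "set (lk n) \<inter> ?V = {}" by blast
  show "set (lk n) \<inter> W (Suc n) = {}" using Suc.prems(5)[of "Suc n" n] by auto
 qed
 moreover have "?V \<union> set (lk n) \<union> W (Suc n) = (\<Union>i\<le>Suc n. W i) \<union> (\<Union>i<Suc n. set (lk i))"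
  unfolding atMost_Suc lessThan_Suc by blast
 ultimately show ?case by simp
qed

lemma flexible_append:
 assumes "flexible r a b W S" "flexible r a' b' W' S'" "(b, a') \<in> r" "(W \<union> S) \<inter> (W' \<union> S') = {}"
 shows "flexible r a b' (W \<union> W') (S \<union> S')"
 unfolding flexible_def
proof (intro allI impI)
 fix R assume R: "R \<subseteq> S \<union> S'"
 have "path_on r a b' ((W \<union> (R \<inter> S)) \<union> (W' \<union> (R \<inter> S')))"
 proof (rule path_on_append[OF _ _ assms(3)])
  show "path_on r a b (W \<union> R \<inter> S)" "path_on r a' b' (W' \<union> R \<inter> S')"
   using assms(1,2) unfolding flexible_def by simp_all
  show "(W \<union> R \<inter> S) \<inter> (W' \<union> R \<inter> S') = {}" using assms(4) by blast
 qed
 moreover have "(W \<union> (R \<inter> S)) \<union> (W' \<union> (R \<inter> S')) = W \<union> W' \<union> R" using R by blast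
 ultimately show "path_on r a b' (W \<union> W' \<union> R)" by simp
qed

text \<open>With segments \<open>S\<^sub>0, S\<^sub>1, \<dots>, S\<^sub>k\<close> the default path is \<open>S\<^sub>0 S\<^sub>1 \<dots> S\<^sub>k\<close>; for odd \<open>k\<close> the vertex \<open>x\<close> is
 absorbed by \<open>S\<^sub>0 S\<^sub>2 \<dots> S\<^sub>k\<^sub>-\<^sub>1 x S\<^sub>1 S\<^sub>3 \<dots> S\<^sub>k\<close>. The two strands are built simultaneously.\<close>

lemma interleaved_strands:
 fixes y z :: "nat => 'a" and lk :: "nat => 'a list"
 defines "seg \<equiv> \<lambda>i. y i # lk i @ [z (Suc i)]"
 assumes zy: "\<And>i. i < k ==> (z i, y i) \<in> r" and zy': "\<And>i. Suc i < k ==> (z i, y (Suc i)) \<in> r"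
  and seg: "\<And>i. Suc i < k ==> arc_path r (seg i)"
  and j: "1 \<le> j" "j < k"
 shows "arc_path r (z 0 # concat (map seg [0..<j])) & last (z 0 # concat (map seg [0..<j])) = z j &
  (\<exists>A B. mset (A @ B) = mset (z 0 # concat (map seg [0..<j])) & A \<noteq> [] & B \<noteq> [] &
   arc_path r A & arc_path r B & last A = z j & last B = z (j - 1) &
   hd A = (if odd j then y 0 else z 0) & hd B = (if odd j then z 0 else y 0))"
 using j
proof (induction j rule: nat_induct_at_least)
 case base
 have "arc_path r (z 0 # seg 0)" using zy[of 0] seg[of 0] base by (simp add: seg_def)
 then show ?case using base seg[of 0]
  by (intro conjI exI[of _ "seg 0"] exI[of _ "[z 0]"]) (simp_all add: seg_def)
next
 case (Suc j)
 define d where "d = z 0 # concat (map seg [0..<j])"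
 obtain A B where d: "arc_path r d" "last d = z j" and AB: "mset (A @ B) = mset d" "A \<noteq> []" "B \<noteq> []"
   "arc_path r A" "arc_path r B" "last A = z j" "last B = z (j - 1)"
   "hd A = (if odd j then y 0 else z 0)" "hd B = (if odd j then z 0 else y 0)"
  using Suc.IH Suc.prems unfolding d_def by auto
 have eq: "z 0 # concat (map seg [0..<Suc j]) = d @ seg j" by (simp add: d_def)
 have sj: "arc_path r (seg j)" "seg j \<noteq> []" "hd (seg j) = y j" "last (seg j) = z (Suc j)"
  using seg[of j] Suc.prems by (simp_all add: seg_def)
 have dne: "d \<noteq> []" by (simp add: d_def)
 have "(z (j - 1), y j) \<in> r" using zy'[of "j - 1"] Suc by simp
 then have "arc_path r (B @ seg j)" using AB sj by (simp add: successively_append_iff)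
 moreover have "arc_path r (d @ seg j)" using d sj zy[of j] Suc.prems dne by (simp add: successively_append_iff)
 moreover have "mset ((B @ seg j) @ A) = mset (d @ seg j)" using AB(1) by (simp add: ac_simps)
 ultimately show ?case unfolding eq using AB sj
  by (intro conjI exI[of _ "B @ seg j"] exI[of _ A]) simp_all
qed

lemma distinct_segments:
 fixes y z :: "nat => 'a" and lk :: "nat => 'a list"
 defines "seg \<equiv> \<lambda>i. y i # lk i @ [z (Suc i)]"
 assumes inj: "inj_on y {..<k}" "inj_on z {..<k}" "\<And>i j. i < k ==> j < k ==> y i \<noteq> z j"
  and lk: "\<And>i. Suc i < k ==> distinct (lk i)" "\<And>i j. Suc i < k ==> j < k ==> y j \<notin> set (lk i) & z j \<notin> set (lk i)"
   "\<And>i j. Suc i < k ==> j < i ==> set (lk i) \<inter> set (lk j) = {}"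
  and j: "j < k"
 shows "distinct (z 0 # concat (map seg [0..<j])) &
  set (z 0 # concat (map seg [0..<j])) = z ` {..j} \<union> y ` {..<j} \<union> (\<Union>i<j. set (lk i))"
 using j
proof (induction j)
 case 0
 then show ?case by simp
next
 case (Suc j)
 define d where "d = z 0 # concat (map seg [0..<j])"
 have d: "distinct d" "set d = z ` {..j} \<union> y ` {..<j} \<union> (\<Union>i<j. set (lk i))"
  using Suc unfolding d_def by simp_all
 have eq: "z 0 # concat (map seg [0..<Suc j]) = d @ seg j" by (simp add: d_def)
 have j: "j < k" "Suc j < k" using Suc.prems by simp_all
 have yj: "y j \<notin> set d"
 proof -
  have "y j \<noteq> y i" if "i < j" for i using inj(1) that j by (auto dest!: inj_onD)
  moreover have "y j \<noteq> z i" if "i \<le> j" for i using inj(3)[of j i] that j by simp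
  moreover have "y j \<notin> set (lk i)" if "i < j" for i using lk(2)[of i j] that j by simp
  ultimately show ?thesis unfolding d(2) by blast
 qed
 have zj: "z (Suc j) \<notin> set d"
 proof -
  have "z (Suc j) \<noteq> z i" if "i \<le> j" for i using inj(2) that j by (auto dest!: inj_onD)
  moreover have "z (Suc j) \<noteq> y i" if "i < j" for i using inj(3)[of i "Suc j"] that j by (metis less_trans)
  moreover have "z (Suc j) \<notin> set (lk i)" if "i < j" for i using lk(2)[of i "Suc j"] that j by simp
  ultimately show ?thesis unfolding d(2) by blast
 qed
 have lj: "set (lk j) \<inter> set d = {}"
 proof -
  have "z i \<notin> set (lk j)" if "i \<le> j" for i using lk(2)[of j i] that j by simp
  moreover have "y i \<notin> set (lk j)" if "i < j" for i using lk(2)[of j i] that j by simp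
  moreover have "set (lk j) \<inter> set (lk i) = {}" if "i < j" for i using lk(3)[of j i] that j by simp
  ultimately show ?thesis unfolding d(2) by blast
 qed
 have "distinct (seg j)" using lk(1)[of j] lk(2)[of j j] lk(2)[of j "Suc j"] inj(3)[of j "Suc j"] j
  by (simp add: seg_def)
 moreover have "set d \<inter> set (seg j) = {}" using yj zj lj by (auto simp: seg_def)
 ultimately have "distinct (d @ seg j)" using d(1) by simp
 moreover have "set (d @ seg j) = z ` {..Suc j} \<union> y ` {..<Suc j} \<union> (\<Union>i<Suc j. set (lk i))"
  unfolding set_append d(2) atMost_Suc lessThan_Suc by (auto simp: seg_def)
 ultimately show ?case unfolding eq by blast
qed

text \<open>A closed alternating walk through \<open>x\<close> provides both the arcs from
  \<open>z i\<close> to \<open>y i\<close> and the arcs from \<open>z i\<close> to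
  \<open>y (Suc i)\<close>. The default path uses the first kind; switching to the second kind
  yields two strands that \<open>x\<close> joins. Ordinary links inside \<open>U\<close> turn the
  pairs from \<open>y i\<close> to \<open>z (Suc i)\<close> into segments. The cost is 2k vertices
  of the walk plus at most k links with t+1 vertices each.\<close>

lemma absorber_exists:
 assumes ex: "dense_expander \<zeta> \<tau> N r U U" and fin: "finite U" and pos: "0 < \<zeta>" "\<zeta> \<le> 1" "0 < N" "\<zeta> \<le> \<tau>" "\<tau> \<le> 1 / 4"
  and U: "(1 - \<zeta> / 8) * N \<le> real (card U)" "real (card U) \<le> 2 * N" and x: "x \<notin> U"
  and deg: "\<And>u. u \<in> insert x U ==> 3 * \<tau> * N \<le> real (card {y\<in>U. (u, y) \<in> r})"
   "\<And>u. u \<in> insert x U ==> 3 * \<tau> * N \<le> real (card {y\<in>U. (y, u) \<in> r})"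
  and t: "4 / \<zeta> \<le> real t" and k: "k = 2 * t + 1" and big: "real (k * (t + 3)) < \<zeta> / 8 * N"
 shows "\<exists>a b W. W \<subseteq> U & card W \<le> k * (t + 3) & a \<in> W & b \<in> W & flexible r a b W {x}"
proof -
 \<comment> \<open>The alternation of the walk: an even step goes against an arc, an odd step along
   one.\<close>
 define rr where "rr j = (if even j then r\<inverse> else r)" for j :: nat
 have rrx: "dense_expander \<zeta> \<tau> N (rr j) U U" for j
  using ex dense_expander_converse[OF ex] by (simp add: rr_def)
 have tN: "0 < \<tau> * N" "0 < \<zeta> * N" "\<zeta> * N \<le> \<tau> * N" using pos by simp_all
 have t1: "1 \<le> t" using t pos by (metis divide_pos_pos leI le_zero_eq less_le_trans not_less_eq_eq of_nat_0_less_iff zero_less_numeral One_nat_def Suc_leI)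
 have kt: "2 * k \<le> k * (t + 3)" "(k - 1) * (t + 1) \<le> k * (t + 3)" by (simp_all add: algebra_simps mult_le_mono)
 have kN: "2 * real k < \<zeta> / 8 * N"
 proof -
  have "real (2 * k) \<le> real (k * (t + 3))" using kt(1) by (simp only: of_nat_le_iff)
  then show ?thesis using big by simp
 qed
 have "\<exists>vs. length vs = Suc (2 * k - 1) & distinct vs & set vs \<subseteq> U & vs ! 0 \<in> {y\<in>U. (x, y) \<in> r} &
   vs ! (2 * k - 1) \<in> {y\<in>U. (y, x) \<in> r} & (\<forall>i<2 * k - 1. (vs ! i, vs ! Suc i) \<in> rr i)"
 proof (rule expander_walk[OF rrx fin])
  show "(1 - \<zeta> / 2) * N \<le> real (card U)" using U(1) tN by (simp add: left_diff_distrib)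
  show "\<tau> * N \<le> real (card {y\<in>U. (x, y) \<in> r})" using deg(1)[of x] tN by simp
  have "3 * \<tau> * N \<le> real (card {y\<in>U. (y, x) \<in> r})" using deg(2)[of x] by simp
  then show "\<tau> * N < real (card {y\<in>U. (y, x) \<in> r})" using tN by linarith
  show "4 / \<zeta> \<le> real (2 * k - 1)" using t k by simp
  have "real (2 * k - 1) \<le> 2 * real k" by simp
  then show "real (2 * k - 1) < \<zeta> / 2 * N" using kN tN by linarith
 qed (use pos U in auto)
 then obtain vs where vs: "length vs = 2 * k" "distinct vs" "set vs \<subseteq> U" "(x, vs ! 0) \<in> r" "(vs ! (2 * k - 1), x) \<in> r"
  "\<And>i. i < 2 * k - 1 ==> (vs ! i, vs ! Suc i) \<in> rr i" using k by auto
 \<comment> \<open>The even vertices of the walk are the \<open>y i\<close> and the odd ones the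
   \<open>z i\<close>; every arc of the walk leaves some \<open>z i\<close> and enters
   \<open>y i\<close> or \<open>y (Suc i)\<close>.\<close>
 define y where "y i = vs ! (2 * i)" for i
 define z where "z i = vs ! (2 * i + 1)" for i
 have zy: "(z i, y i) \<in> r" if "i < k" for i
  using vs(6)[of "2 * i"] that by (simp add: rr_def y_def z_def)
 have zy': "(z i, y (Suc i)) \<in> r" if "Suc i < k" for i
  using vs(6)[of "2 * i + 1"] that by (simp add: rr_def y_def z_def)
 have yU: "y i \<in> U" "z i \<in> U" if "i < k" for i
  using vs(1,3) that by (auto simp: y_def z_def subset_iff)
 define U2 where "U2 = U - set vs"
 have cvs: "real (card (set vs)) \<le> \<zeta> / 8 * N" using kN vs(1,2) by (simp add: distinct_card)
 have sub: "{y\<in>U2. P y} = {y\<in>U. P y} - set vs" for P by (auto simp: U2_def)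
 have lkdeg: "2 * \<tau> * N \<le> real (card {w\<in>U2. (u, w) \<in> r})" "2 * \<tau> * N \<le> real (card {w\<in>U2. (w, u) \<in> r})" if "u \<in> U" for u
 proof -
  have "3 * \<tau> * N \<le> real (card {w\<in>U. (u, w) \<in> r})" "3 * \<tau> * N \<le> real (card {w\<in>U. (w, u) \<in> r})"
   using deg[of u] that by simp_all
  then show "2 * \<tau> * N \<le> real (card {w\<in>U2. (u, w) \<in> r})" "2 * \<tau> * N \<le> real (card {w\<in>U2. (w, u) \<in> r})"
   unfolding sub using card_Diff_ge[OF finite_set, of "{w\<in>U. (u, w) \<in> r}" vs]
    card_Diff_ge[OF finite_set, of "{w\<in>U. (w, u) \<in> r}" vs] cvs tN by linarith+
 qed
 have "\<exists>lk. (\<forall>i\<in>{..<k - 1}. length (lk i) = Suc t & distinct (lk i) & set (lk i) \<subseteq> U2 & arc_path r (y i # lk i @ [z (Suc i)])) &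
  (\<forall>i\<in>{..<k - 1}. \<forall>j\<in>{..<k - 1}. i \<noteq> j --> set (lk i) \<inter> set (lk j) = {})"
 proof (rule links_exist[where \<zeta> = \<zeta> and \<tau> = \<tau> and N = N])
  show "dense_expander \<zeta> \<tau> N r U2 U2" by (rule dense_expander_subset[OF ex]) (auto simp: U2_def)
  show "(1 - \<zeta> / 4) * N \<le> real (card U2)"
   using card_Diff_ge[of "set vs" U] cvs U(1) unfolding U2_def by (simp add: left_diff_distrib)
  show "real (card U2) \<le> 2 * N" using card_mono[OF fin, of U2] U(2) by (simp add: U2_def)
  have "real t \<le> 2 * real k" using k by simp
  then show "real t < \<zeta> / 2 * N" using kN tN by linarith
  have "real ((k - 1) * (t + 1)) \<le> real (k * (t + 3))" using kt(2) by (simp only: of_nat_le_iff)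
  also have "\<dots> \<le> \<zeta> / 4 * N" using big tN by linarith
  finally have "real ((k - 1) * (t + 1)) \<le> \<zeta> / 4 * N" .
  moreover have "real ((k - 1) * (t + 1)) = real (card {..<k - 1}) * (real t + 1)"
   by (simp only: of_nat_mult of_nat_add of_nat_1 card_lessThan)
  ultimately show "real (card {..<k - 1}) * (real t + 1) \<le> \<zeta> / 4 * N" by linarith
 qed (use fin pos t lkdeg yU in \<open>auto simp: U2_def\<close>)
 then obtain lk where lk1: "\<forall>i\<in>{..<k - 1}. length (lk i) = Suc t & distinct (lk i) & set (lk i) \<subseteq> U2 &
   arc_path r (y i # lk i @ [z (Suc i)])"
  and lk2: "\<forall>i\<in>{..<k - 1}. \<forall>j\<in>{..<k - 1}. i \<noteq> j --> set (lk i) \<inter> set (lk j) = {}" by blast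
 have mem: "i \<in> {..<k - 1}" if "Suc i < k" for i using that by simp
 have lk: "length (lk i) = Suc t" "distinct (lk i)" "set (lk i) \<subseteq> U2" "arc_path r (y i # lk i @ [z (Suc i)])"
  if "Suc i < k" for i using lk1[rule_format, OF mem[OF that]] by blast+
 have lk5: "set (lk i) \<inter> set (lk j) = {}" if "Suc i < k" "Suc j < k" "i \<noteq> j" for i j
  using lk2[rule_format, OF mem[OF that(1)] mem[OF that(2)] that(3)] .
 define seg where "seg i = y i # lk i @ [z (Suc i)]" for i
 define d where "d = z 0 # concat (map seg [0..<k - 1])"
 have k3: "k - 1 < k" "1 \<le> k - 1" "even (k - 1)" "Suc (k - 1) = k" using k t1 by auto
 have yz_vs: "y i \<in> set vs" "z i \<in> set vs" if "i < k" for i using that vs(1) by (auto simp: y_def z_def)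
 have inj: "inj_on y {..<k}" "inj_on z {..<k}" "\<And>i j. i < k ==> j < k ==> y i \<noteq> z j"
 proof -
  show "inj_on y {..<k}" using vs(1,2) by (auto simp: inj_on_def y_def nth_eq_iff_index_eq)
  show "inj_on z {..<k}" using vs(1,2) by (auto simp: inj_on_def z_def nth_eq_iff_index_eq)
  fix i j assume "i < k" "j < k"
  then show "y i \<noteq> z j" using vs(1,2) unfolding y_def z_def
   by (subst nth_eq_iff_index_eq) (auto, presburger)
 qed
 have dd: "distinct d & set d = z ` {..k - 1} \<union> y ` {..<k - 1} \<union> (\<Union>i<k - 1. set (lk i))"
  unfolding d_def seg_def
 proof (rule distinct_segments[where y = y and z = z and lk = lk and k = k, OF inj lk(2)])
  fix i j assume "Suc i < k" "j < k"
  then show "y j \<notin> set (lk i) & z j \<notin> set (lk i)" using lk(3)[of i] yz_vs[of j] by (auto simp: U2_def)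
 next
  fix i j assume "Suc i < k" "j < i"
  then show "set (lk i) \<inter> set (lk j) = {}" using lk5[of i j] by simp
 qed (use k3 in auto)
 have str: "arc_path r d & last d = z (k - 1) &
  (\<exists>A B. mset (A @ B) = mset d & A \<noteq> [] & B \<noteq> [] & arc_path r A & arc_path r B &
   last A = z (k - 1) & last B = z (k - 1 - 1) &
   hd A = (if odd (k - 1) then y 0 else z 0) & hd B = (if odd (k - 1) then z 0 else y 0))"
  unfolding d_def seg_def
  by (rule interleaved_strands[where y = y and z = z and lk = lk and k = k and r = r, OF zy zy' lk(4)])
   (use k3 in auto)
 then obtain A B where AB: "mset (A @ B) = mset d" "A \<noteq> []" "B \<noteq> []" "arc_path r A" "arc_path r B"
   "last A = z (k - 1)" "last B = z (k - 1 - 1)" "hd A = z 0" "hd B = y 0" using k3 by auto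
 have dne: "d \<noteq> []" "hd d = z 0" by (simp_all add: d_def)
 have setAB: "set A \<union> set B = set d" using mset_eq_setD[OF AB(1)] by simp
 have dAB: "distinct (A @ B)" using mset_eq_imp_distinct_iff[OF AB(1)] dd by simp
 let ?b = "y (k - 1)"
 have bd: "?b \<notin> set d"
 proof -
  have "?b \<noteq> z i" if "i \<le> k - 1" for i using inj(3)[of "k - 1" i] that k3 by simp
  moreover have "?b \<noteq> y i" if "i < k - 1" for i using inj(1) that k3 by (auto dest!: inj_onD)
  moreover have "?b \<notin> set (lk i)" if "i < k - 1" for i
   using lk(3)[of i] yz_vs(1)[of "k - 1"] that k3 by (auto simp: U2_def)
  ultimately show ?thesis using dd by blast
 qed
 have dU: "set d \<subseteq> U"
 proof -
  have z: "z i \<in> U" if "i \<in> {..k - 1}" for i using yU(2)[of i] that k3 by simp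
  have y: "y i \<in> U" if "i \<in> {..<k - 1}" for i using yU(1)[of i] that by simp
  have l: "set (lk i) \<subseteq> U" if "i \<in> {..<k - 1}" for i
  proof -
   have "Suc i < k" using that by simp
   from lk(3)[OF this] show ?thesis unfolding U2_def by blast
  qed
  show ?thesis unfolding conjunct2[OF dd]
   by (intro Un_least UN_least image_subsetI z y l)
 qed
 have bU: "?b \<in> U" using yU(1)[of "k - 1"] k3 by simp
 have p0: "path_on r (z 0) ?b (insert ?b (set d))"
  unfolding path_on_def
  by (rule exI[of _ "d @ [?b]"]) (use dd str bd dne zy[of "k - 1"] k3 in \<open>auto simp: successively_append_iff\<close>)
 \<comment> \<open>Since \<open>k - 1\<close> is even, the strand starting at \<open>z 0\<close>
   ends at \<open>z (k - 1)\<close>, which has an arc to \<open>x\<close>; the other strand starts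
   at \<open>y 0\<close>, which \<open>x\<close> reaches, and its end leads to the common last
   vertex \<open>y (k - 1)\<close>.\<close>
 have p1: "path_on r (z 0) ?b (insert x (insert ?b (set d)))"
  unfolding path_on_def
 proof (rule exI[of _ "A @ [x] @ B @ [?b]"], intro conjI)
  have "(z (k - 1), x) \<in> r" using vs(5) k by (simp add: z_def)
  moreover have "(x, y 0) \<in> r" using vs(4) by (simp add: y_def)
  moreover have "(z (k - 1 - 1), ?b) \<in> r" using zy'[of "k - 1 - 1"] k3 by (simp add: Suc_diff_Suc)
  ultimately show "arc_path r (A @ [x] @ B @ [?b])"
   using AB by (simp add: successively_append_iff successively_Cons)
  have "x \<notin> set d" "x \<noteq> ?b" using x dU bU by auto
  then show "distinct (A @ [x] @ B @ [?b])" using dAB bd setAB by auto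
  show "set (A @ [x] @ B @ [?b]) = insert x (insert ?b (set d))" using setAB by auto
 qed (use AB in auto)
 have "flexible r (z 0) ?b (insert ?b (set d)) {x}"
  unfolding flexible_def
 proof (intro allI impI)
  fix R assume "R \<subseteq> {x}"
  then consider "R = {}" | "R = {x}" by blast
  then show "path_on r (z 0) ?b (insert ?b (set d) \<union> R)" using p0 p1 by cases simp_all
 qed
 moreover have "card (insert ?b (set d)) \<le> k * (t + 3)"
 proof -
  have "card (set d) \<le> card (z ` {..k - 1}) + card (y ` {..<k - 1}) + card (\<Union>i<k - 1. set (lk i))"
   unfolding conjunct2[OF dd] by (intro order_trans[OF card_Un_le] add_right_mono card_Un_le)
  also have "\<dots> \<le> k + (k - 1) + (\<Sum>i<k - 1. Suc t)"
  proof (intro add_mono)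
   show "card (z ` {..k - 1}) \<le> k" using card_image_le[of "{..k - 1}" z] k3 by simp
   show "card (y ` {..<k - 1}) \<le> k - 1" using card_image_le[of "{..<k - 1}" y] by simp
   have "card (\<Union>i<k - 1. set (lk i)) \<le> (\<Sum>i<k - 1. card (set (lk i)))" by (rule card_UN_le) simp
   also have "\<dots> \<le> (\<Sum>i<k - 1. Suc t)"
   proof (rule sum_mono)
    fix i assume "i \<in> {..<k - 1}"
    then have "Suc i < k" by simp
    from lk(1)[OF this] show "card (set (lk i)) \<le> Suc t" using card_length[of "lk i"] by linarith
   qed
   finally show "card (\<Union>i<k - 1. set (lk i)) \<le> (\<Sum>i<k - 1. Suc t)" .
  qed
  finally have "card (set d) \<le> k + (k - 1) + (k - 1) * Suc t" by simp
  moreover have "card (insert ?b (set d)) = Suc (card (set d))" using bd by simp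
  moreover have "Suc (k + (k - 1) + (k - 1) * Suc t) \<le> k * (t + 3)"
   using k by (simp add: algebra_simps)
  ultimately show ?thesis by linarith
 qed
 moreover have "insert ?b (set d) \<subseteq> U" using bU dU by simp
 moreover have "z 0 \<in> insert ?b (set d)" by (simp add: d_def)
 ultimately show ?thesis by blast
qed

lemma flexible_path:
 assumes "l \<noteq> []" "distinct l" "arc_path r l"
 shows "flexible r (hd l) (last l) (set l) {}"
 using assms unfolding flexible_def path_on_def by auto

text \<open>One absorber for each vertex of \<open>R\<close>, strung together by links.
  \<open>C\<close> is the cost of an absorber and a link, and the bound on \<open>card R * C\<close>
  keeps the rest of \<open>U\<close> usable throughout the induction.\<close>

lemma absorbing_path:
 assumes ex: "dense_expander \<zeta> \<tau> N r U U" and fin: "finite U" and pos: "0 < \<zeta>" "\<zeta> \<le> 1" "0 < N" "\<zeta> \<le> \<tau>" "\<tau> \<le> 1 / 4"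
  and U: "(1 - \<zeta> / 16) * N \<le> real (card U)" "real (card U) \<le> 2 * N"
  and R: "finite R" "R \<noteq> {}" "R \<inter> U = {}"
  and deg: "\<And>u. u \<in> R \<union> U ==> 4 * \<tau> * N \<le> real (card {y\<in>U. (u, y) \<in> r})"
   "\<And>u. u \<in> R \<union> U ==> 4 * \<tau> * N \<le> real (card {y\<in>U. (y, u) \<in> r})"
  and t: "4 / \<zeta> \<le> real t" and k: "k = 2 * t + 1"
  and C: "C = k * (t + 3) + Suc t" "real (card R * C) \<le> \<zeta> / 16 * N"
 shows "\<exists>a b W. W \<subseteq> U & card W \<le> card R * C & a \<in> W & b \<in> W & flexible r a b W R"
 using R deg C(2)
proof (induction R rule: finite_ne_induct)
 case (singleton x)
 have tN: "0 < \<tau> * N" "0 < \<zeta> * N" using pos by simp_all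
 have big: "real (k * (t + 3)) < \<zeta> / 8 * N"
 proof -
  have "real (k * (t + 3)) \<le> real C" using C(1) by simp
  then show ?thesis using singleton.prems(4) tN by simp
 qed
 have "\<exists>a b W. W \<subseteq> U & card W \<le> k * (t + 3) & a \<in> W & b \<in> W & flexible r a b W {x}"
 proof (rule absorber_exists[OF ex fin pos _ U(2) _ _ _ t k big])
  show "(1 - \<zeta> / 8) * N \<le> real (card U)" using U(1) tN by (simp add: left_diff_distrib)
  show "3 * \<tau> * N \<le> real (card {y\<in>U. (u, y) \<in> r})" "3 * \<tau> * N \<le> real (card {y\<in>U. (y, u) \<in> r})"
   if "u \<in> insert x U" for u using singleton.prems(2,3)[of u] that tN by simp_all
 qed (use singleton.prems(1) in auto)
 then obtain a b W where "W \<subseteq> U" "card W \<le> k * (t + 3)" "a \<in> W" "b \<in> W" "flexible r a b W {x}" by blast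
 then show ?case using C(1) by (intro exI[of _ a] exI[of _ b] exI[of _ W]) simp
next
 case (insert x R)
 have tN: "0 < \<tau> * N" "0 < \<zeta> * N" "\<zeta> * N \<le> \<tau> * N" using pos by simp_all
 have cC: "real (card (insert x R) * C) = real (card R * C) + real C" using insert.hyps by simp
 have "\<exists>a b W. W \<subseteq> U & card W \<le> card R * C & a \<in> W & b \<in> W & flexible r a b W R"
 proof (rule insert.IH)
  show "R \<inter> U = {}" using insert.prems(1) by auto
  show "real (card R * C) \<le> \<zeta> / 16 * N" using insert.prems(4) cC by linarith
 qed (use insert.prems(2,3) in auto)
 then obtain a b W where W: "W \<subseteq> U" "card W \<le> card R * C" "a \<in> W" "b \<in> W" "flexible r a b W R" by blast
 define U1 where "U1 = U - W"
 have finW: "finite W" using W(1) fin finite_subset by blast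
 have "real (card W) \<le> real (card R * C)" using W(2) by (simp only: of_nat_le_iff)
 then have cW: "real (card W) + real C \<le> \<zeta> / 16 * N" using insert.prems(4) cC by linarith
 have sub1: "{y\<in>U1. P y} = {y\<in>U. P y} - W" for P by (auto simp: U1_def)
 have big: "real (k * (t + 3)) < \<zeta> / 8 * N"
 proof -
  have "real (k * (t + 3)) \<le> real C" using C(1) by simp
  then show ?thesis using cW tN by linarith
 qed
 have xU: "x \<notin> U" "x \<notin> R" using insert.prems(1) insert.hyps by auto
 have d4: "4 * \<tau> * N \<le> real (card {y\<in>U. (u, y) \<in> r})" "4 * \<tau> * N \<le> real (card {y\<in>U. (y, u) \<in> r})"
  if "u \<in> insert x U" for u using insert.prems(2,3)[of u] that by auto
 have d3: "3 * \<tau> * N \<le> real (card {y\<in>U1. (u, y) \<in> r})" "3 * \<tau> * N \<le> real (card {y\<in>U1. (y, u) \<in> r})"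
  if "u \<in> insert x U" for u
  unfolding sub1 using d4[OF that] card_Diff_ge[OF finW, of "{y\<in>U. (u, y) \<in> r}"]
   card_Diff_ge[OF finW, of "{y\<in>U. (y, u) \<in> r}"] cW tN by linarith+
 have cU1: "(1 - \<zeta> / 8) * N \<le> real (card U1)"
  using card_Diff_ge[OF finW, of U] cW U(1) tN unfolding U1_def left_diff_distrib by linarith
 have exU1: "dense_expander \<zeta> \<tau> N r U1 U1" by (rule dense_expander_subset[OF ex]) (auto simp: U1_def)
 have U1U: "U1 \<subseteq> U" "finite U1" using fin by (auto simp: U1_def)
 have U1le: "real (card U1) \<le> 2 * N" using card_mono[OF fin U1U(1)] U(2) by linarith
 have "\<exists>a b W. W \<subseteq> U1 & card W \<le> k * (t + 3) & a \<in> W & b \<in> W & flexible r a b W {x}"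
  by (rule absorber_exists[OF exU1 U1U(2) pos cU1 U1le _ d3 t k big]) (use xU U1U in auto)
 then obtain a' b' W' where W': "W' \<subseteq> U1" "card W' \<le> k * (t + 3)" "a' \<in> W'" "b' \<in> W'" "flexible r a' b' W' {x}" by blast
 define U2 where "U2 = U1 - W'"
 have finW': "finite W'" using W'(1) U1U finite_subset by blast
 have "real (card W') \<le> real (k * (t + 3))" using W'(2) by (simp only: of_nat_le_iff)
 then have cW': "real (card W') \<le> \<zeta> / 16 * N" "real t < \<zeta> / 2 * N" using cW C(1) tN by simp_all
 have sub2: "{y\<in>U2. P y} = {y\<in>U1. P y} - W'" for P by (auto simp: U2_def)
 have bU: "b \<in> U" "a' \<in> U" using W W' U1U by auto
 have "\<exists>vs. length vs = Suc t & distinct vs & set vs \<subseteq> U2 & arc_path r (b # vs @ [a'])"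
 proof (rule link_exists)
  show "dense_expander \<zeta> \<tau> N r U2 U2" by (rule dense_expander_subset[OF exU1]) (auto simp: U2_def)
  show "(1 - \<zeta> / 2) * N \<le> real (card U2)"
   using card_Diff_ge[OF finW', of U1] cW'(1) cU1 tN unfolding U2_def left_diff_distrib by linarith
  show "real (card U2) \<le> 2 * N" using card_mono[OF U1U(2), of U2] U1le by (simp add: U2_def)
  show "\<tau> * N \<le> real (card {y\<in>U2. (b, y) \<in> r})"
   unfolding sub2 using d3(1)[of b] bU card_Diff_ge[OF finW', of "{y\<in>U1. (b, y) \<in> r}"] cW' tN by simp
  have "3 * \<tau> * N \<le> real (card {y\<in>U1. (y, a') \<in> r})" using d3(2)[of a'] bU by simp
  then show "\<tau> * N < real (card {y\<in>U2. (y, a') \<in> r})"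
   unfolding sub2 using card_Diff_ge[OF finW', of "{y\<in>U1. (y, a') \<in> r}"] cW' tN by linarith
 qed (use U1U pos t cW' in \<open>auto simp: U2_def\<close>)
 then obtain l where l: "length l = Suc t" "distinct l" "set l \<subseteq> U2" "arc_path r (b # l @ [a'])" by blast
 have lne: "l \<noteq> []" using l(1) by auto
 have l2: "(b, hd l) \<in> r" "(last l, a') \<in> r" "arc_path r l"
  using l(4) lne by (simp_all add: successively_Cons successively_append_iff)
 have RU: "R \<inter> U = {}" using insert.prems(1) by auto
 have "flexible r a (last l) (W \<union> set l) (R \<union> {})"
  by (rule flexible_append[OF W(5) flexible_path[OF lne l(2) l2(3)] l2(1)])
    (use l(3) RU W(1) in \<open>auto simp: U2_def U1_def\<close>)
 then have "flexible r a b' (W \<union> set l \<union> W') (R \<union> {} \<union> {x})"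
  by (rule flexible_append[OF _ W'(5) l2(2)])
    (use l(3) RU W(1) W'(1) xU in \<open>auto simp: U2_def U1_def\<close>)
 moreover have "card (W \<union> set l \<union> W') \<le> card (insert x R) * C"
 proof -
  have "card (W \<union> set l \<union> W') \<le> card W + card (set l) + card W'"
   by (intro order_trans[OF card_Un_le] add_right_mono card_Un_le)
  also have "\<dots> \<le> card R * C + Suc t + k * (t + 3)"
   using W(2) W'(2) l(1) card_length[of l] by linarith
  also have "\<dots> = card (insert x R) * C" using insert.hyps C(1) by simp
  finally show ?thesis .
 qed
 moreover have "W \<union> set l \<union> W' \<subseteq> U" using W(1) W'(1) l(3) by (auto simp: U2_def U1_def)
 ultimately show ?case using W(3) W'(4)
  by (intro exI[of _ a] exI[of _ b'] exI[of _ "W \<union> set l \<union> W'"]) simp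
qed

section \<open>Spanning linkages\<close>

text \<open>All pairs but one are joined by single links through the reservoir \<open>R\<close>. The
  remaining pair \<open>x0\<close> takes everything else: its path runs from \<open>a x0\<close>
  through all paths of \<open>\<Q>\<close> and through the absorbing path to \<open>b x0\<close>,
  again with links from \<open>R\<close>. The absorbing path finally swallows the part of
  \<open>R\<close> that no link has used.\<close>

lemma linkage_through_reservoir:
 fixes C :: "'c set" and a b :: "'c => 'q"
 assumes C: "finite C" "C \<noteq> {}" "inj_on a C" "inj_on b C" "a ` C \<inter> b ` C = {}"
  and Q: "Q = R \<union> (a ` C \<union> b ` C) \<union> WA \<union> Z"
  and dis: "R \<inter> (a ` C \<union> b ` C) = {}" "R \<inter> WA = {}" "R \<inter> Z = {}" "(a ` C \<union> b ` C) \<inter> WA = {}"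
   "(a ` C \<union> b ` C) \<inter> Z = {}" "WA \<inter> Z = {}"
  and fl: "flexible r aA bA WA R" "aA \<in> WA" "bA \<in> WA"
  and pc: "path_cover r Z \<Q>" "finite \<Q>"
  and links: "\<And>(u :: nat + 'c => 'q) v I. finite I ==> card I \<le> card \<Q> + 2 + card C ==>
    (\<forall>i\<in>I. u i \<in> Q & v i \<in> Q) ==>
    \<exists>lk. (\<forall>i\<in>I. lk i \<noteq> [] & distinct (lk i) & set (lk i) \<subseteq> R & arc_path r (u i # lk i @ [v i])) &
     (\<forall>i\<in>I. \<forall>j\<in>I. i \<noteq> j --> set (lk i) \<inter> set (lk j) = {})"
 shows "\<exists>W. (\<forall>x\<in>C. path_on r (a x) (b x) (W x)) & (\<forall>x\<in>C. \<forall>y\<in>C. x \<noteq> y --> W x \<inter> W y = {}) & (\<Union>x\<in>C. W x) = Q"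
proof -
 obtain x0 where x0: "x0 \<in> C" using C(2) by blast
 obtain qs where qs: "set qs = \<Q>" "distinct qs" using finite_distinct_list[OF pc(2)] by blast
 define s where "s = length qs"
 have cs: "card \<Q> = s" using qs distinct_card[of qs] by (simp add: s_def)
 have qsQ: "qs ! i \<in> \<Q>" if "i < s" for i using that qs(1) by (auto simp: s_def)
 \<comment> \<open>The long path is a chain of s + 3 blocks: \<open>a x0\<close>, the s cover paths,
   the absorbing path, \<open>b x0\<close>. \<open>h i\<close> and \<open>l i\<close> are the first
   and last vertex of block i, so s + 2 links are needed, indexed by \<open>Inl\<close>; the links
   of the other pairs are indexed by \<open>Inr\<close>.\<close>
 define h where "h i = (if i = 0 then a x0 else if i \<le> s then hd (qs ! (i - 1)) else if i = s + 1 then aA else b x0)" for i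
 define l where "l i = (if i = 0 then a x0 else if i \<le> s then last (qs ! (i - 1)) else if i = s + 1 then bA else b x0)" for i
 define I where "I = (Inl ` {..<s + 2} \<union> Inr ` (C - {x0}) :: (nat + 'c) set)"
 define u where "u = case_sum l a"
 define v where "v = case_sum (\<lambda>i. h (Suc i)) b"
 have qZ: "set (qs ! i) \<subseteq> Z" "qs ! i \<noteq> []" if "i < s" for i
  using path_coverD(5)[OF pc(1)] path_coverD(1)[OF pc(1) qsQ[OF that]] qsQ[OF that] by auto
 have hQ: "h i \<in> Q" "l i \<in> Q" for i
 proof -
  have "hd (qs ! (i - 1)) \<in> Q" "last (qs ! (i - 1)) \<in> Q" if "i \<noteq> 0" "i \<le> s"
  proof -
   have "i - 1 < s" using that by simp
   from qZ[OF this] have "hd (qs ! (i - 1)) \<in> Z" "last (qs ! (i - 1)) \<in> Z"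
    by (meson hd_in_set last_in_set subsetD)+
   then show "hd (qs ! (i - 1)) \<in> Q" "last (qs ! (i - 1)) \<in> Q" unfolding Q by simp_all
  qed
  then show "h i \<in> Q" "l i \<in> Q" using x0 fl(2,3) unfolding h_def l_def Q by simp_all
 qed
 have "\<exists>lk. (\<forall>i\<in>I. lk i \<noteq> [] & distinct (lk i) & set (lk i) \<subseteq> R & arc_path r (u i # lk i @ [v i])) &
     (\<forall>i\<in>I. \<forall>j\<in>I. i \<noteq> j --> set (lk i) \<inter> set (lk j) = {})"
 proof (rule links)
  show "finite I" using C(1) by (simp add: I_def)
  have "card I \<le> card (Inl ` {..<s + 2} :: (nat + 'c) set) + card (Inr ` (C - {x0}) :: (nat + 'c) set)"
   unfolding I_def by (rule card_Un_le)
  also have "\<dots> \<le> (s + 2) + card C"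
   by (intro add_mono) (simp_all add: card_image card_Diff1_le)
  finally show "card I \<le> card \<Q> + 2 + card C" by (simp add: cs)
  show "\<forall>i\<in>I. u i \<in> Q & v i \<in> Q"
  proof
   fix i assume "i \<in> I"
   then consider j where "i = Inl j" | x where "i = Inr x" "x \<in> C" by (auto simp: I_def)
   then show "u i \<in> Q & v i \<in> Q" using hQ by cases (auto simp: u_def v_def Q)
  qed
 qed
 then obtain lk where lk1: "\<forall>i\<in>I. lk i \<noteq> [] & distinct (lk i) & set (lk i) \<subseteq> R & arc_path r (u i # lk i @ [v i])"
  and lk2: "\<forall>i\<in>I. \<forall>j\<in>I. i \<noteq> j --> set (lk i) \<inter> set (lk j) = {}" by blast
 have lkR: "set (lk i) \<subseteq> R" if "i \<in> I" for i using lk1[rule_format, OF that] by blast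
 have inl: "Inl i \<in> I" if "i < s + 2" for i using that by (simp add: I_def)
 have inr: "Inr x \<in> I" if "x \<in> C" "x \<noteq> x0" for x using that by (simp add: I_def)
 define Used where "Used = (\<Union>i\<in>I. set (lk i))"
 \<comment> \<open>The leftover of the reservoir is known only after all links have been fixed;
   flexibility of the absorbing path allows any leftover.\<close>
 define R' where "R' = R - Used"
 have UR: "Used \<subseteq> R" unfolding Used_def by (intro UN_least lkR)
 have R'R: "R' \<subseteq> R" by (simp add: R'_def Diff_subset)
 have pA: "path_on r aA bA (WA \<union> R')" using fl(1)[unfolded flexible_def, rule_format, OF R'R] .
 define Wc where "Wc i = (if i = 0 then {a x0} else if i \<le> s then set (qs ! (i - 1)) else if i = s + 1 then WA \<union> R' else {b x0})" for i
 have Wc: "Wc 0 = {a x0}" "Wc (s + 1) = WA \<union> R'" "Wc (s + 2) = {b x0}"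
  "\<And>i. i < s ==> Wc (Suc i) = set (qs ! i)" by (simp_all add: Wc_def)
 have atM: "{..s + 2} = insert 0 (insert (s + 1) (insert (s + 2) (Suc ` {..<s})))"
 proof (intro set_eqI iffI)
  fix i assume i: "i \<in> {..s + 2}"
  show "i \<in> insert 0 (insert (s + 1) (insert (s + 2) (Suc ` {..<s})))"
  proof (cases i)
   case (Suc j)
   then show ?thesis using i by (cases "j < s") auto
  qed simp
 qed auto
 have UWc: "(\<Union>i\<le>s + 2. Wc i) = {a x0, b x0} \<union> Z \<union> WA \<union> R'"
 proof -
  have "(\<Union>i<s. set (qs ! i)) = Z"
   using path_coverD(5)[OF pc(1)] qs(1) by (auto simp: s_def set_conv_nth)
  then have "(\<Union>i\<in>Suc ` {..<s}. Wc i) = Z" using Wc(4) by simp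
  then show ?thesis unfolding atM UN_insert Wc by blast
 qed
 have ab: "a x0 \<noteq> b x0" "a x0 \<notin> Z \<union> WA \<union> R" "b x0 \<notin> Z \<union> WA \<union> R" using C(5) x0 dis by auto
 have WcD: "Wc i \<inter> Wc j = {}" if "i \<le> s + 2" "j < i" for i j
 proof -
  have qq: "set (qs ! i) \<inter> set (qs ! j) = {}" if "i < s" "j < s" "i \<noteq> j" for i j
   using path_coverD(4)[OF pc(1) qsQ[OF that(1)] qsQ[OF that(2)]] that qs(2) by (simp add: nth_eq_iff_index_eq s_def)
  have WcZ: "Wc j \<subseteq> insert (a x0) Z" if "j \<in> insert 0 (Suc ` {..<s})" for j
   using that
  proof (elim insertE imageE)
   fix j' assume "j = Suc j'" "j' \<in> {..<s}"
   then show ?thesis using Wc(4)[of j'] qZ(1)[of j'] by auto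
  qed (simp add: Wc(1))
  have "i \<in> insert 0 (insert (s + 1) (insert (s + 2) (Suc ` {..<s})))" unfolding atM[symmetric] using that by simp
  moreover have "i \<noteq> 0" using that by simp
  ultimately consider "i = s + 1" | "i = s + 2" | i' where "i = Suc i'" "i' < s" by auto
  then show ?thesis
  proof cases
   case 1
   have "j \<in> insert 0 (Suc ` {..<s})" using 1 that by (cases j) auto
   then show ?thesis unfolding 1 Wc(2) using WcZ[of j] ab(2) dis(3,6) unfolding R'_def by blast
  next
   case 2
   have "j \<in> insert 0 (insert (s + 1) (Suc ` {..<s}))" using 2 that by (cases j) auto
   then have "Wc j \<subseteq> insert (a x0) Z \<union> (WA \<union> R')" using WcZ[of j] Wc(2) by blast
   moreover have "b x0 \<notin> insert (a x0) Z \<union> (WA \<union> R')" using ab R'R by auto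
   ultimately have "b x0 \<notin> Wc j" by (meson subsetD)
   then show ?thesis unfolding 2 Wc(3) by simp
  next
   case 3
   have "j \<in> insert 0 (Suc ` {..<s})" using 3 that by (cases j) auto
   then show ?thesis unfolding 3(1) Wc(4)[OF 3(2)]
   proof (elim insertE imageE)
    assume "j = 0" then show "set (qs ! i') \<inter> Wc j = {}" using Wc(1) ab(2) qZ(1)[OF 3(2)] by auto
   next
    fix j' assume j': "j = Suc j'" "j' \<in> {..<s}"
    then show "set (qs ! i') \<inter> Wc j = {}" using Wc(4)[of j'] qq[of i' j'] 3 that by simp
   qed
  qed
 qed
 have WcLk: "Wc i \<inter> set (lk (Inl j)) = {}" if "i \<le> s + 2" "j < s + 2" for i j
 proof -
  have "set (lk (Inl j)) \<subseteq> Used" using inl[OF that(2)] by (auto simp: Used_def)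
  moreover have "Wc i \<subseteq> {a x0, b x0} \<union> Z \<union> WA \<union> R'" using UWc that by blast
  moreover have "({a x0, b x0} \<union> Z \<union> WA \<union> R') \<inter> Used = {}" using ab dis(2,3) UR by (auto simp: R'_def)
  ultimately show ?thesis by (meson disjoint_iff subsetD)
 qed
 have "path_on r (h 0) (l (s + 2)) ((\<Union>i\<le>s + 2. Wc i) \<union> (\<Union>i<s + 2. set (lk (Inl i))))"
 proof (rule path_on_chain)
  fix i assume "i \<le> s + 2"
  then have "i \<in> insert 0 (insert (s + 1) (insert (s + 2) (Suc ` {..<s})))" unfolding atM[symmetric] by simp
  then consider "i = 0" | "i = s + 1" | "i = s + 2" | i' where "i = Suc i'" "i' < s" by auto
  then show "path_on r (h i) (l i) (Wc i)"
  proof cases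
   case 4
   have "path_on r (hd (qs ! i')) (last (qs ! i')) (set (qs ! i'))"
    unfolding path_on_def using path_coverD(1-3)[OF pc(1) qsQ[OF 4(2)]] by blast
   then show ?thesis using 4 by (simp add: Wc_def h_def l_def)
  qed (use pA path_on_singleton in \<open>auto simp: Wc_def h_def l_def\<close>)
 next
  fix i assume "i < s + 2"
  from lk1[rule_format, OF inl[OF this]]
  show "arc_path r (l i # lk (Inl i) @ [h (Suc i)]) & lk (Inl i) \<noteq> [] & distinct (lk (Inl i))"
   by (simp add: u_def v_def)
 next
  fix i j assume "i < s + 2" "j < i"
  then show "set (lk (Inl i)) \<inter> set (lk (Inl j)) = {}" using lk2 inl[of i] inl[of j] by simp
 qed (use WcD WcLk in auto)
 then have P0: "path_on r (a x0) (b x0) ({a x0, b x0} \<union> Z \<union> WA \<union> R' \<union> (\<Union>i<s + 2. set (lk (Inl i))))"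
  unfolding UWc by (simp add: h_def l_def)
 define W where "W x = (if x = x0 then {a x0, b x0} \<union> Z \<union> WA \<union> R' \<union> (\<Union>i<s + 2. set (lk (Inl i)))
   else {a x} \<union> set (lk (Inr x)) \<union> {b x})" for x
 have paths: "path_on r (a x) (b x) (W x)" if x: "x \<in> C" for x
 proof (cases "x = x0")
  case False
  have L: "lk (Inr x) \<noteq> []" "distinct (lk (Inr x))" "set (lk (Inr x)) \<subseteq> R" "arc_path r (a x # lk (Inr x) @ [b x])"
   using lk1[rule_format, OF inr[OF x False]] by (auto simp: u_def v_def)
  have "path_on r (a x) (b x) ({a x} \<union> set (lk (Inr x)) \<union> {b x})"
   by (rule path_on_link[OF path_on_singleton path_on_singleton L(4,1,2)])
     (use L(3) dis(1) C(5) x in auto)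
  then show ?thesis using False by (simp add: W_def)
 qed (use P0 in \<open>simp add: W_def\<close>)
 have d1: "W x0 \<inter> W y = {}" if y: "y \<in> C" "y \<noteq> x0" for y
 proof -
  define L0 where "L0 = (\<Union>i<s + 2. set (lk (Inl i)))"
  define Ly where "Ly = set (lk (Inr y))"
  have W0: "W x0 = {a x0, b x0} \<union> Z \<union> WA \<union> R' \<union> L0" and Wy: "W y = {a y} \<union> Ly \<union> {b y}"
   using y(2) by (simp_all add: W_def L0_def Ly_def)
  have "set (lk (Inl i)) \<inter> Ly = {}" if "i < s + 2" for i
   using lk2[rule_format, OF inl[OF that] inr[OF y]] by (simp add: Ly_def)
  then have e3: "L0 \<inter> Ly = {}" by (auto simp: L0_def disjoint_iff)
  have LyU: "Ly \<subseteq> Used" unfolding Used_def Ly_def by (rule UN_upper[OF inr[OF y]])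
  have LyR: "Ly \<subseteq> R" using LyU UR by (rule order_trans)
  have e2: "R' \<inter> Ly = {}" using LyU by (auto simp: R'_def)
  have e1: "({a x0, b x0} \<union> Z \<union> WA) \<inter> Ly = {}" using LyR ab dis(2,3) by auto
  have L0R: "L0 \<subseteq> R" unfolding L0_def by (intro UN_least lkR inl) simp
  have ne: "a y \<noteq> a x0" "b y \<noteq> b x0" "a y \<noteq> b x0" "b y \<noteq> a x0"
   using inj_on_contraD[OF C(3) y(2) y(1) x0] inj_on_contraD[OF C(4) y(2) y(1) x0] C(5) x0 y(1) by auto
  have nin: "a y \<notin> Z \<union> WA \<union> R" "b y \<notin> Z \<union> WA \<union> R" using dis y(1) by auto
  have "a y \<notin> W x0" "b y \<notin> W x0" unfolding W0 using ne nin L0R R'R by auto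
  moreover have "W x0 \<inter> Ly = {}" unfolding W0 using e1 e2 e3 by (simp add: Int_Un_distrib2)
  ultimately show ?thesis unfolding Wy by (simp add: Int_Un_distrib)
 qed
 have d2: "W x \<inter> W y = {}" if xy: "x \<in> C" "y \<in> C" "x \<noteq> x0" "y \<noteq> x0" "x \<noteq> y" for x y
 proof -
  have "set (lk (Inr x)) \<inter> set (lk (Inr y)) = {}" using lk2 inr[of x] inr[of y] xy by simp
  moreover have "set (lk (Inr x)) \<subseteq> R" "set (lk (Inr y)) \<subseteq> R" using lkR inr[of x] inr[of y] xy by simp_all
  moreover have "a x \<noteq> a y" "b x \<noteq> b y" "a x \<noteq> b y" "b x \<noteq> a y" using C(3,4,5) xy by (auto dest: inj_onD)
  moreover have "a x \<notin> R" "a y \<notin> R" "b x \<notin> R" "b y \<notin> R" using dis(1) xy by auto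
  ultimately show ?thesis using xy(3,4) unfolding W_def by auto
 qed
 have un: "(\<Union>x\<in>C. W x) = Q"
 proof -
  define L0 where "L0 = (\<Union>i<s + 2. set (lk (Inl i)))"
  define LC where "LC = (\<Union>x\<in>C - {x0}. set (lk (Inr x)))"
  have "Used = L0 \<union> LC" unfolding Used_def I_def L0_def LC_def by auto
  then have R: "R = R' \<union> L0 \<union> LC" using UR unfolding R'_def by auto
  have ins: "C = insert x0 (C - {x0})" using x0 by auto
  have "(\<Union>x\<in>C. W x) = W x0 \<union> (\<Union>x\<in>C - {x0}. W x)" using x0 by auto
  also have "(\<Union>x\<in>C - {x0}. W x) = a ` (C - {x0}) \<union> b ` (C - {x0}) \<union> LC"
   unfolding W_def LC_def by auto
  also have "W x0 = {a x0, b x0} \<union> Z \<union> WA \<union> R' \<union> L0" by (simp add: W_def L0_def)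
  finally have lhs: "(\<Union>x\<in>C. W x) = {a x0, b x0} \<union> Z \<union> WA \<union> R' \<union> L0 \<union> (a ` (C - {x0}) \<union> b ` (C - {x0}) \<union> LC)" .
  have "a ` C \<union> b ` C = {a x0, b x0} \<union> a ` (C - {x0}) \<union> b ` (C - {x0})" by (subst (1 2) ins) auto
  then show ?thesis unfolding Q lhs by (subst R) auto
 qed
 show ?thesis
 proof (intro exI[of _ W] conjI ballI impI)
  fix x y assume "x \<in> C" "y \<in> C" "x \<noteq> y"
  then show "W x \<inter> W y = {}" using d1[of x] d1[of y] d2[of x y] by (cases "x = x0"; cases "y = x0") (auto simp: Int_commute)
 qed (use paths un in auto)
qed

text \<open>One class of an equidistributed colouring serves as the reservoir, an absorbing path for
  it is built outside, and the rest is covered by few paths. The constants are nested: the reservoir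
  must be small enough to be absorbed, yet large enough for all the links.\<close>

theorem spanning_linkage:
 fixes \<zeta> :: real
 assumes z: "0 < \<zeta>" "\<zeta> \<le> 1"
 shows "\<exists>\<sigma>>0. \<exists>N0::nat. \<forall>(Q :: 'q set) r \<tau> (C :: 'c set) a b.
  finite Q & N0 \<le> card Q & \<zeta> \<le> \<tau> & dense_expander \<zeta> \<tau> (real (card Q)) r Q Q &
  (\<forall>x\<in>Q. 32 * \<tau> * real (card Q) \<le> real (card {y\<in>Q. (x, y) \<in> r}) &
      32 * \<tau> * real (card Q) \<le> real (card {y\<in>Q. (y, x) \<in> r})) &
  finite C & C \<noteq> {} & real (card C) \<le> \<sigma> * real (card Q) &
  inj_on a C & inj_on b C & a ` C \<subseteq> Q & b ` C \<subseteq> Q & a ` C \<inter> b ` C = {} -->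
  (\<exists>W. (\<forall>x\<in>C. path_on r (a x) (b x) (W x)) & (\<forall>x\<in>C. \<forall>y\<in>C. x \<noteq> y --> W x \<inter> W y = {}) &
    (\<Union>x\<in>C. W x) = Q)"
proof -
 obtain t :: nat where t: "4 / \<zeta> \<le> real t" using real_arch_simple by blast
 define k where "k = 2 * t + 1"
 define CC where "CC = k * (t + 3) + Suc t"
 \<comment> \<open>The reservoir has about |Q|/K1 vertices, each costing \<open>CC\<close> for its
   absorber; this \<open>K1\<close> keeps the whole absorbing path below \<zeta>|Q|/16.\<close>
 obtain K1 :: nat where K1': "64 * real CC / \<zeta> \<le> real K1" using real_arch_simple by blast
 have CC1: "1 \<le> real CC" by (simp add: CC_def)
 have K1: "64 * real CC \<le> \<zeta> * real K1" using K1' z by (simp add: field_simps)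
 then have "0 < \<zeta> * real K1" using CC1 by linarith
 then have K1p: "0 < K1" using z by (simp add: zero_less_mult_iff)
 define \<zeta>1 where "\<zeta>1 = \<zeta> ^ 4 / 512"
 have z4: "\<zeta> ^ 4 \<le> \<zeta>" using z power_decreasing[of 1 4 \<zeta>] by simp
 have z1: "0 < \<zeta>1" "\<zeta>1 \<le> \<zeta>" "\<zeta>1 \<le> 1" "\<zeta>1 \<le> \<zeta> / 512" using z z4 unfolding \<zeta>1_def by (simp, linarith, linarith, linarith)
 define \<xi> where "\<xi> = \<zeta>1 / (8 * real K1)"
 have xi: "0 < \<xi>" using z1 K1p by (simp add: \<xi>_def)
 obtain t1 :: nat where t1: "4 / \<zeta>1 \<le> real t1" using real_arch_simple by blast
 \<comment> \<open>With this \<sigma>, links of t1 + 1 vertices for all prescribed pairs take at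
   most \<zeta>1 M/16 vertices of the reservoir.\<close>
 define \<sigma> where "\<sigma> = \<zeta>1 / (16 * real K1 * (real t1 + 1))"
 have s0: "0 < \<sigma>" using z1 K1p by (simp add: \<sigma>_def)
 \<comment> \<open>The cover has at most 4|Q|/K2 paths. This \<open>K2\<close> bounds the reservoir
   vertices needed for linking them by \<zeta>1 M/16 as well.\<close>
 obtain K2 :: nat where K2': "64 * real K1 * (real t1 + 1) / \<zeta>1 < real K2" using reals_Archimedean2 by blast
 have K2: "64 * real K1 * (real t1 + 1) < \<zeta>1 * real K2" using K2' z1 by (simp add: field_simps)
 have "0 < 64 * real K1 * (real t1 + 1)" using K1p by simp
 then have "0 < \<zeta>1 * real K2" using K2 by linarith
 then have K2p: "0 < K2" using z1 by (simp add: zero_less_mult_iff)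
 have z2: "0 < \<zeta> / 2" "\<zeta> / 2 \<le> 1" using z by auto
 from partition_expander[OF z xi K1p, where 'a = 'q] obtain n1
  where n1: "\<forall>(V :: 'q set) r \<tau> \<F>. finite V & n1 \<le> card V & \<zeta> \<le> \<tau> &
  dense_expander \<zeta> \<tau> (real (card V)) r V V & \<F> \<subseteq> Pow V & card \<F> \<le> 3 * card V -->
  (\<exists>c. (\<forall>x. c x < K1) &
    (\<forall>S\<in>\<F>. \<forall>j<K1. \<bar>real (card {x\<in>S. c x = j}) - real (card S) / real K1\<bar> \<le> \<xi> * real (card V)) &
    (\<forall>a<K1. \<forall>b<K1. dense_expander (\<zeta> ^ 4 / 512) (2 * \<tau>) (real (card V) / real K1) r
     {x\<in>V. c x = a} {x\<in>V. c x = b}))" ..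
 from few_paths_cover[OF z2 K2p, where 'a = 'q] obtain n2
  where n2: "\<forall>(Z :: 'q set) r \<tau>. finite Z & n2 \<le> card Z & \<zeta> / 2 \<le> \<tau> &
  dense_expander (\<zeta> / 2) \<tau> (real (card Z)) r Z Z &
  (\<forall>x\<in>Z. 8 * \<tau> * real (card Z) \<le> real (card {y\<in>Z. (x, y) \<in> r}) &
      8 * \<tau> * real (card Z) \<le> real (card {y\<in>Z. (y, x) \<in> r})) -->
  (\<exists>\<Q>. path_cover r Z \<Q> & real (card \<Q>) \<le> 4 * real (card Z) / real K2)" ..
 obtain n3 :: nat where n3: "32 * real K1 * (real t1 + 1) / \<zeta>1 < real n3" using reals_Archimedean2 by blast
 show ?thesis
 proof (intro exI[of _ \<sigma>] conjI s0 exI[of _ "max (max n1 (2 * n2)) (max n3 1)"] allI impI, elim conjE)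
  fix Q :: "'q set" and r \<tau> and C :: "'c set" and a b
  assume finQ: "finite Q" and nQ: "max (max n1 (2 * n2)) (max n3 1) \<le> card Q" and \<tau>: "\<zeta> \<le> \<tau>"
   and ex: "dense_expander \<zeta> \<tau> (real (card Q)) r Q Q"
   and deg: "\<forall>x\<in>Q. 32 * \<tau> * real (card Q) \<le> real (card {y\<in>Q. (x, y) \<in> r}) &
      32 * \<tau> * real (card Q) \<le> real (card {y\<in>Q. (y, x) \<in> r})"
   and C: "finite C" "C \<noteq> {}" "real (card C) \<le> \<sigma> * real (card Q)" "inj_on a C" "inj_on b C"
    "a ` C \<subseteq> Q" "b ` C \<subseteq> Q" "a ` C \<inter> b ` C = {}"
  define N where "N = real (card Q)"
  define M where "M = N / real K1"
  have N1: "1 \<le> N" using nQ by (simp add: N_def)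
  have M: "0 < M" "real K1 * M = N" using N1 K1p by (auto simp: M_def)
  have tN: "0 < \<tau> * N" "\<zeta> * N \<le> \<tau> * N" "0 < \<zeta> * N" "\<zeta> * N \<le> N"
   using z \<tau> N1 mult_right_mono[of \<zeta> 1 N] by auto
  have tM: "\<zeta>1 * M \<le> \<tau> * M" "0 < \<zeta>1 * M" "\<zeta>1 * M \<le> M" using z1 \<tau> M mult_right_mono[of \<zeta>1 1 M] by auto
  have zM: "64 * real CC * M \<le> \<zeta> * N"
  proof -
   have "64 * real CC * M \<le> \<zeta> * real K1 * M" using K1 M by (intro mult_right_mono) auto
   then show ?thesis using M(2) by (simp add: mult.assoc)
  qed
  have zM64: "64 * M \<le> \<zeta> * N" using zM CC1 M(1) mult_right_mono[of 1 "real CC" M] by linarith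
  have xiN: "\<xi> * N = \<zeta>1 * M / 8" using K1p by (simp add: \<xi>_def M_def)
  have bigN: "32 * (real t1 + 1) < \<zeta>1 * M"
  proof -
   have "32 * real K1 * (real t1 + 1) / \<zeta>1 < N" using n3 nQ unfolding N_def by (smt (verit) max.bounded_iff of_nat_le_iff)
   then have "32 * real K1 * (real t1 + 1) < \<zeta>1 * N" using z1 by (simp add: field_simps)
   also have "\<zeta>1 * N = real K1 * (\<zeta>1 * M)" using M(2) by (simp add: mult_ac flip: M(2))
   finally have "real K1 * (32 * (real t1 + 1)) < real K1 * (\<zeta>1 * M)" by (simp only: mult_ac)
   then show ?thesis using K1p by simp
  qed
  have sN: "\<sigma> * N * (real t1 + 1) = \<zeta>1 * M / 16"
  proof -
   define q where "q = real t1 + 1"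
   have "q \<noteq> 0" by (simp add: q_def)
   then show ?thesis unfolding \<sigma>_def M_def q_def[symmetric] using K1p by simp
  qed
  have sN2: "\<sigma> * N \<le> \<zeta>1 * M / 16"
  proof -
   have "\<sigma> * N * 1 \<le> \<sigma> * N * (real t1 + 1)" using s0 N1 by (intro mult_left_mono) auto
   then show ?thesis using sN by simp
  qed
  define out where "out x = {y\<in>Q. (x, y) \<in> r}" for x
  define inn where "inn x = {y\<in>Q. (y, x) \<in> r}" for x
  have deg': "32 * \<tau> * N \<le> real (card (out x))" "32 * \<tau> * N \<le> real (card (inn x))" if "x \<in> Q" for x
   using deg that by (simp_all add: N_def out_def inn_def)
  \<comment> \<open>The degree hypothesis itself bounds \<tau>, since no degree exceeds
    \<open>card Q\<close>.\<close>
  have t32: "32 * \<tau> \<le> 1"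
  proof -
   obtain x where x: "x \<in> Q" using N1 unfolding N_def by fastforce
   have "card (out x) \<le> card Q" using finQ by (intro card_mono) (auto simp: out_def)
   then have "32 * \<tau> * N \<le> 1 * N" using deg'(1)[OF x] by (simp add: N_def)
   then show ?thesis using N1 by (simp only: mult_le_cancel_right)
  qed
  define \<F> where "\<F> = out ` Q \<union> inn ` Q \<union> {Q}"
  have "card \<F> \<le> card Q + card Q + 1" unfolding \<F>_def
   by (intro order_trans[OF card_Un_le] add_mono card_image_le finQ) simp
  then have cF: "card \<F> \<le> 3 * card Q" using nQ by simp
  have FQ: "\<F> \<subseteq> Pow Q" by (auto simp: \<F>_def out_def inn_def)
  have "finite Q & n1 \<le> card Q & \<zeta> \<le> \<tau> & dense_expander \<zeta> \<tau> (real (card Q)) r Q Q & \<F> \<subseteq> Pow Q & card \<F> \<le> 3 * card Q"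
   using finQ nQ \<tau> ex FQ cF by simp
  from n1[rule_format, OF this] obtain c where
   eq: "\<forall>S\<in>\<F>. \<forall>j<K1. \<bar>real (card {x\<in>S. c x = j}) - real (card S) / real K1\<bar> \<le> \<xi> * N"
   and pe: "\<forall>a<K1. \<forall>b<K1. dense_expander \<zeta>1 (2 * \<tau>) M r {x\<in>Q. c x = a} {x\<in>Q. c x = b}"
   unfolding N_def M_def \<zeta>1_def by blast
  define AB where "AB = a ` C \<union> b ` C"
  have finAB: "finite AB" using C(1) by (simp add: AB_def)
  have ABQ: "AB \<subseteq> Q" using C by (auto simp: AB_def)
  have "card AB \<le> card C + card C" unfolding AB_def by (intro order_trans[OF card_Un_le] add_mono card_image_le C(1))
  then have cAB: "real (card AB) \<le> \<zeta>1 * M / 8" using C(3) sN2 by (simp add: N_def)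
  define R0 where "R0 = {x\<in>Q. c x = 0}"
  define R where "R = R0 - AB"
  have finR0: "finite R0" using finQ by (simp add: R0_def)
  have cR0: "M - \<zeta>1 * M / 8 \<le> real (card R0)" "real (card R0) \<le> M + \<zeta>1 * M / 8"
  proof -
   have "Q \<in> \<F>" by (simp add: \<F>_def)
   with eq K1p have "\<bar>real (card R0) - M\<bar> \<le> \<xi> * N" unfolding R0_def M_def N_def by blast
   then show "M - \<zeta>1 * M / 8 \<le> real (card R0)" "real (card R0) \<le> M + \<zeta>1 * M / 8" unfolding xiN by linarith+
  qed
  have dR0: "31 * \<tau> * M \<le> real (card {y\<in>R0. (x, y) \<in> r})" "31 * \<tau> * M \<le> real (card {y\<in>R0. (y, x) \<in> r})" if x: "x \<in> Q" for x
  proof -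
   have "out x \<in> \<F>" "inn x \<in> \<F>" using x by (auto simp: \<F>_def)
   then have "\<bar>real (card {y\<in>out x. c y = 0}) - real (card (out x)) / real K1\<bar> \<le> \<xi> * N"
    "\<bar>real (card {y\<in>inn x. c y = 0}) - real (card (inn x)) / real K1\<bar> \<le> \<xi> * N" using eq K1p by blast+
   moreover have "card {y\<in>out x. c y = 0} = card {y\<in>R0. (x, y) \<in> r}"
    "card {y\<in>inn x. c y = 0} = card {y\<in>R0. (y, x) \<in> r}"
    by (rule arg_cong[where f = card], auto simp: out_def inn_def R0_def)+
   moreover have "32 * \<tau> * M \<le> real (card (out x)) / real K1" "32 * \<tau> * M \<le> real (card (inn x)) / real K1"
    using deg'[OF x] K1p by (simp_all add: M_def divide_right_mono)
   ultimately show "31 * \<tau> * M \<le> real (card {y\<in>R0. (x, y) \<in> r})" "31 * \<tau> * M \<le> real (card {y\<in>R0. (y, x) \<in> r})"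
    unfolding xiN using tM by linarith+
  qed
  have subR: "{y\<in>R. P y} = {y\<in>R0. P y} - AB" for P by (auto simp: R_def)
  have dR: "2 * (2 * \<tau>) * M \<le> real (card {y\<in>R. (x, y) \<in> r})" "2 * (2 * \<tau>) * M \<le> real (card {y\<in>R. (y, x) \<in> r})" if x: "x \<in> Q" for x
   unfolding subR using dR0[OF x] card_Diff_ge[OF finAB, of "{y\<in>R0. (x, y) \<in> r}"]
    card_Diff_ge[OF finAB, of "{y\<in>R0. (y, x) \<in> r}"] cAB tM by linarith+
  have cR: "(1 - \<zeta>1 / 4) * M \<le> real (card R)" "real (card R) \<le> 2 * M"
   using cR0 card_Diff_ge[OF finAB, of R0] cAB card_mono[OF finR0, of R] tM
   unfolding R_def left_diff_distrib by (linarith, simp)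
  have finR: "finite R" using finR0 by (simp add: R_def)
  have exR: "dense_expander \<zeta>1 (2 * \<tau>) M r R R"
  proof (rule dense_expander_subset)
   show "dense_expander \<zeta>1 (2 * \<tau>) M r R0 R0" unfolding R0_def using pe[rule_format, OF K1p K1p] .
  qed (auto simp: R_def)
  define U where "U = Q - (R0 \<union> AB)"
  have finU: "finite U" using finQ by (simp add: U_def)
  have fRA: "finite (R0 \<union> AB)" using finR0 finAB by simp
  have cRA: "real (card (R0 \<union> AB)) \<le> \<zeta> / 16 * N"
  proof -
   have "real (card (R0 \<union> AB)) \<le> real (card R0) + real (card AB)" using card_Un_le[of R0 AB] by linarith
   then show ?thesis using cR0 cAB tM zM64 by linarith
  qed
  have subU: "{y\<in>U. P y} = {y\<in>Q. P y} - (R0 \<union> AB)" for P by (auto simp: U_def)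
  have dU: "4 * \<tau> * N \<le> real (card {y\<in>U. (x, y) \<in> r})" "4 * \<tau> * N \<le> real (card {y\<in>U. (y, x) \<in> r})" if x: "x \<in> Q" for x
   unfolding subU using deg'[OF x] card_Diff_ge[OF fRA, of "out x"] card_Diff_ge[OF fRA, of "inn x"] cRA tN
   unfolding out_def inn_def by linarith+
  have "real (card U) \<le> N" using card_mono[OF finQ, of U] by (simp add: U_def N_def)
  then have cU2: "real (card U) \<le> 2 * N" using N1 by linarith
  have cU1: "(1 - \<zeta> / 16) * N \<le> real (card U)"
   using card_Diff_ge[OF fRA, of Q] cRA unfolding U_def left_diff_distrib N_def[symmetric] by linarith
  note cU = cU1 cU2
  have exU: "dense_expander \<zeta> \<tau> N r U U" unfolding N_def by (rule dense_expander_subset[OF ex]) (auto simp: U_def)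
  have "0 < (1 - \<zeta>1 / 4) * M" using z1 M by simp
  then have "0 < real (card R)" using cR(1) by linarith
  then have Rne: "R \<noteq> {}" by auto
  have RC: "real (card R * CC) \<le> \<zeta> / 16 * N"
  proof -
   have "real (card R * CC) = real (card R) * real CC" by simp
   also have "\<dots> \<le> 2 * M * real CC" using cR(2) by (intro mult_right_mono) auto
   also have "\<dots> \<le> \<zeta> / 16 * N" using zM tN by (simp add: mult_ac)
   finally show ?thesis .
  qed
  have RU: "R \<inter> U = {}" "R \<subseteq> Q" "U \<subseteq> Q" by (auto simp: R_def U_def R0_def)
  have "\<exists>aA bA W. W \<subseteq> U & card W \<le> card R * CC & aA \<in> W & bA \<in> W & flexible r aA bA W R"
  proof (rule absorbing_path[OF exU finU z _ \<tau> _ cU finR Rne RU(1) _ _ t k_def CC_def RC])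
   show "0 < N" using N1 by simp
   show "\<tau> \<le> 1 / 4" using t32 by simp
  qed (use dU RU in auto)
  then obtain aA bA WA where WA: "WA \<subseteq> U" "card WA \<le> card R * CC" "aA \<in> WA" "bA \<in> WA" "flexible r aA bA WA R" by blast
  define Z where "Z = U - WA"
  have finZ: "finite Z" using finU by (simp add: Z_def)
  have finWA: "finite WA" using WA(1) finU finite_subset by blast
  have cWA: "real (card WA) \<le> \<zeta> / 16 * N"
  proof -
   have "real (card WA) \<le> real (card R * CC)" using WA(2) by (simp only: of_nat_le_iff)
   then show ?thesis using RC by linarith
  qed
  have ZQ: "Z \<subseteq> Q" by (auto simp: Z_def U_def)
  have cZ: "N - \<zeta> / 8 * N \<le> real (card Z)" "real (card Z) \<le> N"
   using card_Diff_ge[OF finWA, of U] cU(1) cWA card_mono[OF finQ ZQ]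
   unfolding Z_def left_diff_distrib N_def by (linarith, simp)
  have exZ: "dense_expander (\<zeta> / 2) (2 * \<tau>) (real (card Z)) r Z Z"
  proof (rule dense_expander_rescale)
   show "dense_expander \<zeta> \<tau> N r Z Z" by (rule dense_expander_subset[OF exU]) (auto simp: Z_def)
   show "\<bar>real (card Z) - N\<bar> \<le> \<zeta> / 8 * N" using cZ tN by (simp add: abs_le_iff)
  qed (use z \<tau> N1 in auto)
  have subZ: "{y\<in>Z. P y} = {y\<in>U. P y} - WA" for P by (auto simp: Z_def)
  have "\<exists>\<Q>. path_cover r Z \<Q> & real (card \<Q>) \<le> 4 * real (card Z) / real K2"
  proof (rule n2[rule_format], intro conjI ballI)
   have "real (2 * n2) \<le> N" using nQ unfolding N_def by (simp only: of_nat_le_iff max.bounded_iff)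
   moreover have "N \<le> 2 * real (card Z)" using cZ(1) tN by linarith
   ultimately show "n2 \<le> card Z" by simp
   show "\<zeta> / 2 \<le> 2 * \<tau>" using z \<tau> by linarith
   fix x assume "x \<in> Z"
   then have x: "x \<in> Q" using ZQ by auto
   have "16 * \<tau> * real (card Z) \<le> 16 * \<tau> * N" using cZ(2) z \<tau> by (intro mult_left_mono) auto
   moreover have "32 * \<tau> * N - \<zeta> / 16 * N - \<zeta> / 16 * N \<le> real (card {y\<in>Z. (x, y) \<in> r})"
    unfolding subZ subU using deg'[OF x] card_Diff_ge[OF fRA, of "out x"] cRA cWA
     card_Diff_ge[OF finWA, of "{y\<in>Q. (x, y) \<in> r} - (R0 \<union> AB)"] unfolding out_def by linarith
   moreover have "32 * \<tau> * N - \<zeta> / 16 * N - \<zeta> / 16 * N \<le> real (card {y\<in>Z. (y, x) \<in> r})"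
    unfolding subZ subU using deg'[OF x] card_Diff_ge[OF fRA, of "inn x"] cRA cWA
     card_Diff_ge[OF finWA, of "{y\<in>Q. (y, x) \<in> r} - (R0 \<union> AB)"] unfolding inn_def by linarith
   ultimately show "8 * (2 * \<tau>) * real (card Z) \<le> real (card {y\<in>Z. (x, y) \<in> r})"
    "8 * (2 * \<tau>) * real (card Z) \<le> real (card {y\<in>Z. (y, x) \<in> r})" using tN by linarith+
  qed (use finZ exZ in auto)
  then obtain \<Q> where pc: "path_cover r Z \<Q>" and cQ: "real (card \<Q>) \<le> 4 * real (card Z) / real K2" by blast
  have finQQ: "finite \<Q>" by (rule path_cover_finite[OF pc finZ])
  show "\<exists>W. (\<forall>x\<in>C. path_on r (a x) (b x) (W x)) & (\<forall>x\<in>C. \<forall>y\<in>C. x \<noteq> y --> W x \<inter> W y = {}) & (\<Union>x\<in>C. W x) = Q"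
  proof (rule linkage_through_reservoir[OF C(1,2,4,5,8), where R = R and WA = WA and Z = Z and aA = aA and bA = bA and \<Q> = \<Q>])
   show "Q = R \<union> (a ` C \<union> b ` C) \<union> WA \<union> Z"
    using ABQ WA(1) unfolding Z_def U_def R_def AB_def[symmetric] by (auto simp: R0_def)
   show "R \<inter> (a ` C \<union> b ` C) = {}" unfolding R_def AB_def[symmetric] by blast
   show "(a ` C \<union> b ` C) \<inter> WA = {}" "(a ` C \<union> b ` C) \<inter> Z = {}"
    using WA(1) unfolding AB_def[symmetric] Z_def U_def by blast+
   show "R \<inter> WA = {}" "R \<inter> Z = {}" "WA \<inter> Z = {}" using RU(1) WA(1) by (auto simp: Z_def)
  next
   fix u v :: "nat + 'c => 'q" and I
   assume I: "finite I" "card I \<le> card \<Q> + 2 + card C" "\<forall>i\<in>I. u i \<in> Q & v i \<in> Q"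
   have "\<exists>lk. (\<forall>i\<in>I. length (lk i) = Suc t1 & distinct (lk i) & set (lk i) \<subseteq> R & arc_path r (u i # lk i @ [v i])) &
     (\<forall>i\<in>I. \<forall>j\<in>I. i \<noteq> j --> set (lk i) \<inter> set (lk j) = {})"
   proof (rule links_exist[OF exR finR z1(1,3) M(1) _ _ cR t1 _ I(1)])
    show "\<zeta>1 \<le> 2 * \<tau>" "2 * \<tau> \<le> 1 / 4" using z1 \<tau> t32 z by linarith+
    show "real t1 < \<zeta>1 / 2 * M" using bigN by simp
    have "real (card I) \<le> real (card \<Q> + 2 + card C)" using I(2) by (simp only: of_nat_le_iff)
    also have "\<dots> \<le> 4 * N / real K2 + 2 + \<sigma> * N"
    proof -
     have "4 * real (card Z) / real K2 \<le> 4 * N / real K2" using cZ(2) by (intro divide_right_mono) auto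
     then show ?thesis using cQ C(3) by (simp add: N_def)
    qed
    finally have "real (card I) * (real t1 + 1) \<le> (4 * N / real K2 + 2 + \<sigma> * N) * (real t1 + 1)"
     by (intro mult_right_mono) auto
    also have "\<dots> = 4 * N * (real t1 + 1) / real K2 + 2 * (real t1 + 1) + \<zeta>1 * M / 16"
     using sN by (simp add: algebra_simps add_divide_distrib)
    finally have le: "real (card I) * (real t1 + 1) \<le> 4 * N * (real t1 + 1) / real K2 + 2 * (real t1 + 1) + \<zeta>1 * M / 16" .
    have "4 * N * (real t1 + 1) / real K2 \<le> \<zeta>1 * M / 16"
    proof -
     have "64 * real K1 * (real t1 + 1) * M \<le> \<zeta>1 * real K2 * M" using K2 M by (intro mult_right_mono) auto
     moreover have "64 * real K1 * (real t1 + 1) * M = 64 * (real K1 * M) * (real t1 + 1)" by (simp only: mult_ac)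
     moreover have "\<zeta>1 * real K2 * M = 16 * (\<zeta>1 * M / 16 * real K2)" by simp
     ultimately have "4 * N * (real t1 + 1) \<le> \<zeta>1 * M / 16 * real K2" unfolding M(2) by linarith
     then show ?thesis using K2p by (simp only: pos_divide_le_eq of_nat_0_less_iff)
    qed
    then show "real (card I) * (real t1 + 1) \<le> \<zeta>1 / 4 * M" using bigN le tM(2) by linarith
   qed (use dR I(3) in auto)
   then obtain lk where "(\<forall>i\<in>I. length (lk i) = Suc t1 & distinct (lk i) & set (lk i) \<subseteq> R & arc_path r (u i # lk i @ [v i])) &
     (\<forall>i\<in>I. \<forall>j\<in>I. i \<noteq> j --> set (lk i) \<inter> set (lk j) = {})" by blast
   then show "\<exists>lk. (\<forall>i\<in>I. lk i \<noteq> [] & distinct (lk i) & set (lk i) \<subseteq> R & arc_path r (u i # lk i @ [v i])) &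
     (\<forall>i\<in>I. \<forall>j\<in>I. i \<noteq> j --> set (lk i) \<inter> set (lk j) = {})"
    by (intro exI[of _ lk]) auto
  qed (use WA pc finQQ in auto)
 qed
qed

section \<open>A sparse subgraph with robust expansion\<close>

lemma simple_graph_finite: "simple_graph V E ==> finite E"
 unfolding simple_graph_def by (meson Pow_iff finite_Pow_iff finite_subset subsetI)

lemma neighbours_subset: "simple_graph V E ==> neighbours E v \<subseteq> V"
 unfolding simple_graph_def neighbours_def by auto

lemma card_neighbours:
 assumes "simple_graph V E"
 shows "card (neighbours E v) = card {e\<in>E. v \<in> e}"
proof (rule bij_betw_same_card)
 show "bij_betw (\<lambda>w. {v, w}) (neighbours E v) {e\<in>E. v \<in> e}"
  unfolding bij_betw_def
 proof
  show "inj_on (\<lambda>w. {v, w}) (neighbours E v)" by (auto simp: inj_on_def doubleton_eq_iff)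
  show "(\<lambda>w. {v, w}) ` neighbours E v = {e\<in>E. v \<in> e}"
  proof (intro equalityI subsetI)
   fix e assume e: "e \<in> {e\<in>E. v \<in> e}"
   then have "card e = 2" using assms by (auto simp: simple_graph_def)
   then obtain a b where "e = {a, b}" by (auto simp: card_2_iff)
   then obtain w where "e = {v, w}" using e by auto
   then show "e \<in> (\<lambda>w. {v, w}) ` neighbours E v" using e by (auto simp: neighbours_def)
  qed (auto simp: neighbours_def)
 qed
qed

text \<open>The robust neighbourhood of \<open>X\<close> exceeds \<open>X\<close> by \<kappa>n, so
  it overlaps a set \<open>Y\<close> with |X| + |Y| near n in at least \<kappa>n/2 vertices, each of
  which receives at least \<beta>n arcs.\<close>

lemma dense_expander_of_robust:
 assumes fin: "finite V" and r: "\<And>S. S \<subseteq> V ==> \<tau> * real (card V) \<le> real (card S) ==>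
   real (card S) \<le> (1 - \<tau>) * real (card V) ==>
   real (card S) + \<kappa> * real (card V) \<le> real (card {v\<in>V. \<beta> * real (card V) \<le> real (card {u\<in>S. (u, v) \<in> r})})"
  and pos: "0 < \<tau>" "\<tau> \<le> 1 / 4" "1 \<le> \<tau> * real (card V)" "0 < \<kappa>" "0 < \<beta>"
  and z: "0 \<le> \<zeta>" "\<zeta> \<le> \<kappa> / 2" "\<zeta> \<le> \<beta> * \<kappa> / 2"
 shows "dense_expander \<zeta> (2 * \<tau>) (real (card V)) r V V"
 unfolding dense_expander_def
proof (intro allI impI, elim conjE)
 fix X Y assume X: "X \<subseteq> V" "2 * \<tau> * real (card V) \<le> real (card X)"
  and Y: "Y \<subseteq> V" "2 * \<tau> * real (card V) \<le> real (card Y)"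
  and sum: "(1 - \<zeta>) * real (card V) \<le> real (card X) + real (card Y)"
 define n where "n = real (card V)"
 have n: "0 < n" using pos unfolding n_def by (smt (verit) mult_nonneg_nonpos of_nat_0_le_iff)
 have tn: "\<tau> * n \<le> n / 4" using pos n mult_right_mono[of \<tau> "1/4" n] by simp
 have zn: "0 \<le> \<zeta> * n" using z n by simp
 have "\<exists>S\<subseteq>X. \<tau> * n \<le> real (card S) & real (card S) \<le> (1 - \<tau>) * n & (1 - \<zeta>) * n \<le> real (card S) + real (card Y)"
 proof (cases "real (card X) \<le> (1 - \<tau>) * n")
  case True
  then show ?thesis using X sum pos n unfolding n_def by (intro exI[of _ X]) auto
 next
  case False
  \<comment> \<open>Robust expansion speaks only of sets with at most (1-\<tau>)n vertices, so a
    larger \<open>X\<close> is trimmed. Rounding loses less than one vertex, and |Y| at least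
    2\<tau>n with \<tau>n at least 1 makes up for it.\<close>
  define s where "s = nat \<lfloor>(1 - \<tau>) * n\<rfloor>"
  have "0 \<le> (1 - \<tau>) * n" using pos n by simp
  then have s: "real s \<le> (1 - \<tau>) * n" "(1 - \<tau>) * n < real s + 1" unfolding s_def by linarith+
  then have "s \<le> card X" using False by linarith
  then obtain S where S: "S \<subseteq> X" "card S = s" by (meson obtain_subset_with_card_n)
  have "\<tau> * n \<le> real s" using s(2) tn pos(3) unfolding left_diff_distrib n_def[symmetric] by linarith
  moreover have "(1 - \<zeta>) * n \<le> real s + real (card Y)"
   using s(2) Y(2) zn pos(3) unfolding left_diff_distrib n_def[symmetric] by linarith
  ultimately show ?thesis using S s(1) by (intro exI[of _ S]) simp
 qed
 then obtain S where S: "S \<subseteq> X" "\<tau> * n \<le> real (card S)" "real (card S) \<le> (1 - \<tau>) * n"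
  "(1 - \<zeta>) * n \<le> real (card S) + real (card Y)" by blast
 define G where "G = {v\<in>V. \<beta> * n \<le> real (card {u\<in>S. (u, v) \<in> r})}"
 have finS: "finite X" "finite Y" "finite G" "finite S"
  using finite_subset[OF X(1) fin] finite_subset[OF Y(1) fin] finite_subset[OF S(1)] fin
  by (simp_all add: G_def)
 have cG: "real (card S) + \<kappa> * n \<le> real (card G)" unfolding G_def n_def
  using S X by (intro r) (auto simp: n_def)
 have "card G + card Y = card (G \<union> Y) + card (G \<inter> Y)" using finS by (intro card_Un_Int)
 moreover have "card (G \<union> Y) \<le> card V" using fin Y by (intro card_mono) (auto simp: G_def)
 ultimately have "real (card G) + real (card Y) \<le> n + real (card (G \<inter> Y))" unfolding n_def by linarith
 moreover have "\<zeta> * n \<le> \<kappa> / 2 * n" using z n by (intro mult_right_mono) auto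
 ultimately have GY: "\<kappa> / 2 * n \<le> real (card (G \<inter> Y))" using cG S(4) unfolding left_diff_distrib by linarith
 have "\<zeta> * n\<^sup>2 \<le> \<beta> * \<kappa> / 2 * n\<^sup>2" using z by (intro mult_right_mono) auto
 also have "\<dots> = (\<kappa> / 2 * n) * (\<beta> * n)" by (simp add: power2_eq_square)
 also have "\<dots> \<le> real (card (G \<inter> Y)) * (\<beta> * n)" using GY pos n by (intro mult_right_mono) auto
 also have "\<dots> = (\<Sum>y\<in>G \<inter> Y. \<beta> * n)" by simp
 also have "\<dots> \<le> (\<Sum>y\<in>G \<inter> Y. real (card {u\<in>S. (u, y) \<in> r}))" by (intro sum_mono) (auto simp: G_def)
 also have "\<dots> \<le> (\<Sum>y\<in>Y. real (card {u\<in>X. (u, y) \<in> r}))"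
 proof -
  have "(\<Sum>y\<in>G \<inter> Y. real (card {u\<in>S. (u, y) \<in> r})) \<le> (\<Sum>y\<in>G \<inter> Y. real (card {u\<in>X. (u, y) \<in> r}))"
   using S(1) finS by (intro sum_mono) (auto intro!: card_mono)
  also have "\<dots> \<le> (\<Sum>y\<in>Y. real (card {u\<in>X. (u, y) \<in> r}))" using finS by (intro sum_mono2) auto
  finally show ?thesis .
 qed
 also have "\<dots> = real (card (r \<inter> X \<times> Y))" using card_rel_Times_eq_sum_right[OF finS(1,2), of r] by simp
 finally show "\<zeta> * (real (card V))\<^sup>2 \<le> real (card (r \<inter> X \<times> Y))" by (simp add: n_def)
qed

definition edges_between :: "'a set set => 'a set => 'a set => 'a set set" where
 "edges_between E S T = {e\<in>E. \<exists>s\<in>S. \<exists>t\<in>T. e = {t, s}}"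

text \<open>Double counting; the factor 2 is due to edges with both ends in
  \<open>S \<inter> T\<close>, which are counted from either end.\<close>

lemma card_edges_between:
 assumes g: "simple_graph V E" and T: "T \<subseteq> V"
 shows "(\<Sum>t\<in>T. card (neighbours E t \<inter> S)) \<le> 2 * card (edges_between E S T)"
  and "card (edges_between E S T) \<le> (\<Sum>t\<in>T. card (neighbours E t \<inter> S))"
proof -
 have fin: "finite E" "finite V" "finite T"
  using simple_graph_finite[OF g] g finite_subset[OF T] by (simp_all add: simple_graph_def)
 have finN: "finite (neighbours E t \<inter> S)" for t
  using finite_subset[OF neighbours_subset[OF g] fin(2)] by simp
 define P where "P = (SIGMA t:T. neighbours E t \<inter> S)"
 have finP: "finite P" and cP: "card P = (\<Sum>t\<in>T. card (neighbours E t \<inter> S))"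
  using fin finN by (auto simp: P_def)
 have im: "(\<lambda>(t, s). {t, s}) ` P = edges_between E S T"
 proof (intro equalityI subsetI)
  fix e assume "e \<in> (\<lambda>(t, s). {t, s}) ` P"
  then obtain t s where "e = {t, s}" "t \<in> T" "s \<in> S" "{t, s} \<in> E" by (auto simp: P_def neighbours_def)
  then show "e \<in> edges_between E S T" unfolding edges_between_def by blast
 next
  fix e assume "e \<in> edges_between E S T"
  then obtain t s where e: "e = {t, s}" "t \<in> T" "s \<in> S" "e \<in> E" by (auto simp: edges_between_def)
  then have "(t, s) \<in> P" by (simp add: P_def neighbours_def)
  then show "e \<in> (\<lambda>(t, s). {t, s}) ` P" using e(1) by (intro image_eqI[of _ _ "(t, s)"]) simp_all
 qed
 show "card (edges_between E S T) \<le> (\<Sum>t\<in>T. card (neighbours E t \<inter> S))"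
  unfolding im[symmetric] cP[symmetric] using finP by (rule card_image_le)
 have "P \<subseteq> (\<Union>e\<in>edges_between E S T. {p. {fst p, snd p} = e})" unfolding im[symmetric] by auto
 moreover have c2: "finite {p. {fst p, snd p} = e} & card {p. {fst p, snd p} = e} \<le> 2" for e :: "'a set"
 proof (cases "\<exists>a b. e = {a, b}")
  case True
  then obtain a b where "e = {a, b}" by blast
  then have sub: "{p. {fst p, snd p} = e} \<subseteq> {(a, b), (b, a)}" by (auto simp: doubleton_eq_iff)
  have "card {(a, b), (b, a)} \<le> 2" using card_length[of "[(a, b), (b, a)]"] by simp
  then have "card {p. {fst p, snd p} = e} \<le> 2" using card_mono[OF _ sub] by simp
  then show ?thesis using finite_subset[OF sub] by simp
 next
  case False
  then have "{p. {fst p, snd p} = e} = {}" by auto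
  then show ?thesis by simp
 qed
 moreover have fE: "finite (edges_between E S T)" using fin by (auto simp: edges_between_def)
 ultimately have "card P \<le> card (\<Union>e\<in>edges_between E S T. {p. {fst p, snd p} = e})"
  by (intro card_mono) auto
 also have "\<dots> \<le> (\<Sum>e\<in>edges_between E S T. card {p. {fst p, snd p} = e})" by (rule card_UN_le[OF fE])
 also have "\<dots> \<le> (\<Sum>e\<in>edges_between E S T. 2)" using c2 by (intro sum_mono) blast
 finally show "(\<Sum>t\<in>T. card (neighbours E t \<inter> S)) \<le> 2 * card (edges_between E S T)" using cP by simp
qed

lemma simple_graph_card_le:
 assumes "simple_graph V E"
 shows "card E \<le> (card V)\<^sup>2"
proof -
 have fin: "finite V" using assms by (simp add: simple_graph_def)
 have "E \<subseteq> (\<lambda>(a, b). {a, b}) ` (V \<times> V)"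
 proof
  fix e assume e: "e \<in> E"
  then have "card e = 2" "e \<subseteq> V" using assms by (auto simp: simple_graph_def)
  then obtain a b where "e = {a, b}" by (auto simp: card_2_iff)
  then show "e \<in> (\<lambda>(a, b). {a, b}) ` (V \<times> V)" using \<open>e \<subseteq> V\<close> by auto
 qed
 then have "card E \<le> card ((\<lambda>(a, b). {a, b}) ` (V \<times> V))" using fin by (intro card_mono) auto
 also have "\<dots> \<le> card (V \<times> V)" using fin by (intro card_image_le) simp
 finally show ?thesis by (simp add: power2_eq_square card_cartesian_product)
qed

text \<open>One class of an even \<open>k\<close>-colouring of the edges. Here a union bound over
  all 4^n pairs of vertex sets is possible, since a deviation \<xi>n^2 among at most n^2 edges has
  weight exp(-\<xi>^2 n^2/4). The threshold \<open>n0\<close> is uniform in k up to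
  \<open>K0\<close>, as k will depend on a parameter that n must not be compared with.\<close>

lemma sparse_expander_subgraph:
 fixes \<xi> :: real and K0 :: nat
 assumes xi: "0 < \<xi>" "\<xi> \<le> 1"
 shows "\<exists>n0::nat. \<forall>(V :: 'a set) E k \<nu> \<tau>. simple_graph V E & n0 \<le> card V & 0 < k & k \<le> K0 &
  robust_expander \<nu> \<tau> V E & 8 * real k * \<xi> \<le> \<nu>\<^sup>2 -->
  (\<exists>\<Gamma>\<subseteq>E. (\<forall>v\<in>V. \<bar>real (card (neighbours \<Gamma> v)) - real (card (neighbours E v)) / real k\<bar> \<le> \<xi> * real (card V)) &
   (\<forall>S\<subseteq>V. \<tau> * real (card V) \<le> real (card S) & real (card S) \<le> (1 - \<tau>) * real (card V) -->
     real (card S) + \<nu> / 2 * real (card V) \<le>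
     real (card {v\<in>V. \<nu> / (8 * real k) * real (card V) \<le> real (card (neighbours \<Gamma> v \<inter> S))})))"
proof -
 have "\<forall>\<^sub>F n in sequentially. (4 * real K0) * real n ^ 0 * exp (- 1 * real n) < 1"
  by (rule eventually_power_mult_exp_less) simp
 moreover have "\<forall>\<^sub>F n in sequentially. (4 * real K0) * real n ^ 1 * exp (- (\<xi>\<^sup>2 / 4) * real n) < 1"
  by (rule eventually_power_mult_exp_less) (use xi in simp)
 moreover have "\<forall>\<^sub>F n in sequentially. 16 / \<xi>\<^sup>2 \<le> real n"
  using filterlim_real_sequentially by (simp add: filterlim_at_top)
 ultimately have "\<forall>\<^sub>F n in sequentially. (4 * real K0) * exp (- real n) < 1 &
   (4 * real K0) * real n * exp (- (\<xi>\<^sup>2 / 4) * real n) < 1 & 16 / \<xi>\<^sup>2 \<le> real n"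
  by eventually_elim simp
 then obtain n0 where n0: "\<And>n. n \<ge> n0 ==> (4 * real K0) * exp (- real n) < 1 &
   (4 * real K0) * real n * exp (- (\<xi>\<^sup>2 / 4) * real n) < 1 & 16 / \<xi>\<^sup>2 \<le> real n"
  unfolding eventually_sequentially by blast
 show ?thesis
 proof (intro exI[of _ n0] allI impI, elim conjE)
  fix V :: "'a set" and E k \<nu> \<tau>
  assume g: "simple_graph V E" and nV: "n0 \<le> card V" and k: "0 < k" "k \<le> K0"
   and rob: "robust_expander \<nu> \<tau> V E" and kxi: "8 * real k * \<xi> \<le> \<nu>\<^sup>2"
  define n where "n = real (card V)"
  have fin: "finite V" "finite E" using g simple_graph_finite by (auto simp: simple_graph_def)
  have nx: "16 \<le> \<xi>\<^sup>2 * n" using n0[OF nV] xi by (simp add: n_def field_simps)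
  have n1: "1 \<le> n"
  proof (rule ccontr)
   assume "\<not> 1 \<le> n"
   then have "\<xi>\<^sup>2 * n \<le> 1 * 1" using xi by (intro mult_mono) (auto simp: power_le_one n_def)
   then show False using nx by simp
  qed
  \<comment> \<open>Left summands: the edges between two vertex sets, for the expansion. Right
    summands: the edges at a vertex, for the degrees.\<close>
  define I where "I = (Inl ` (Pow V \<times> Pow V) \<union> Inr ` V :: ('a set \<times> 'a set + 'a) set)"
  define A where "A = case_sum (\<lambda>(S, T). edges_between E S T) (\<lambda>v. {e\<in>E. v \<in> e})"
  define D where "D = case_sum (\<lambda>_ :: 'a set \<times> 'a set. \<xi> * n\<^sup>2) (\<lambda>_ :: 'a. \<xi> * n)"
  define M where "M = case_sum (\<lambda>_ :: 'a set \<times> 'a set. n\<^sup>2) (\<lambda>_ :: 'a. n)"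
  have "\<exists>c. (\<forall>x. c x < k) &
   (\<forall>i\<in>I. \<forall>j<k. \<bar>real (card {x \<in> A i. c x = j}) - real (card (A i)) / real k\<bar> \<le> D i)"
  proof (rule equidistributed_colouring[OF fin(2) _ k(1), where M = M])
   show "finite I" using fin by (simp add: I_def)
   fix i assume i: "i \<in> I"
   show "A i \<subseteq> E" by (cases i) (auto simp: A_def edges_between_def split: prod.splits)
   show "0 < D i" using xi n1 by (cases i) (simp_all add: D_def)
   show "D i \<le> M i" using xi n1 by (cases i) (simp_all add: D_def M_def)
   show "real (card (A i)) \<le> M i"
   proof (cases i)
    case (Inl p)
    have "card (A i) \<le> card E" using fin(2) unfolding Inl A_def
     by (intro card_mono) (auto simp: edges_between_def split: prod.splits)
    also have "\<dots> \<le> (card V)\<^sup>2" by (rule simple_graph_card_le[OF g])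
    finally have "real (card (A i)) \<le> real ((card V)\<^sup>2)" by (simp only: of_nat_le_iff)
    then show ?thesis by (simp add: M_def Inl n_def)
   next
    case (Inr v)
    have "card (A i) = card (neighbours E v)" by (simp add: A_def Inr card_neighbours[OF g])
    also have "\<dots> \<le> card V" by (rule card_mono[OF fin(1) neighbours_subset[OF g]])
    finally show ?thesis by (simp add: M_def Inr n_def)
   qed
  next
   have "(\<Sum>i\<in>I. 2 * real k * exp (- ((D i)\<^sup>2 / (4 * M i)))) =
     (\<Sum>i\<in>Inl ` (Pow V \<times> Pow V). 2 * real k * exp (- ((D i)\<^sup>2 / (4 * M i)))) +
     (\<Sum>i\<in>Inr ` V. 2 * real k * exp (- ((D i)\<^sup>2 / (4 * M i))))"
    unfolding I_def using fin by (intro sum.union_disjoint) auto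
   also have "\<dots> = 4 ^ card V * (2 * real k * exp (- ((\<xi> * n\<^sup>2)\<^sup>2 / (4 * n\<^sup>2)))) +
     n * (2 * real k * exp (- ((\<xi> * n)\<^sup>2 / (4 * n))))"
    using fin by (simp add: sum.reindex D_def M_def card_Pow n_def power_mult_distrib[symmetric])
   also have "\<dots> < 1"
   proof -
    have e1: "(\<xi> * n\<^sup>2)\<^sup>2 / (4 * n\<^sup>2) = \<xi>\<^sup>2 * n * n / 4" "(\<xi> * n)\<^sup>2 / (4 * n) = \<xi>\<^sup>2 / 4 * n"
     using n1 by (simp_all add: power2_eq_square)
    \<comment> \<open>The 4^n tests are paid for by \<xi>^2 n being at least 16: then \<xi>^2 n^2/4
      is at least 4n, which exceeds 3n by n.\<close>
    have "(4::real) \<le> exp 3"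
     using exp_ge_add_one_self[of "3::real"] by simp
    then have "(4::real) ^ card V \<le> exp 3 ^ card V" by (intro power_mono) auto
    also have "\<dots> = exp (3 * n)" by (simp add: n_def mult.commute flip: exp_of_nat_mult)
    finally have "4 ^ card V * exp (- (\<xi>\<^sup>2 * n * n / 4)) \<le> exp (3 * n) * exp (- (\<xi>\<^sup>2 * n * n / 4))"
     by (intro mult_right_mono) auto
    also have "\<dots> = exp (3 * n - \<xi>\<^sup>2 * n * n / 4)" by (simp flip: exp_add)
    also have "\<dots> \<le> exp (- n)"
    proof -
     have "16 * n \<le> \<xi>\<^sup>2 * n * n" using nx n1 by (intro mult_right_mono) auto
     then show ?thesis by simp
    qed
    finally have "2 * real k * (4 ^ card V * exp (- (\<xi>\<^sup>2 * n * n / 4))) \<le> 2 * real K0 * exp (- n)"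
     using k by (intro mult_mono) auto
    also have "\<dots> < 1 / 2" using n0[OF nV] by (simp add: n_def)
    finally have p1: "4 ^ card V * (2 * real k * exp (- (\<xi>\<^sup>2 * n * n / 4))) < 1 / 2" by (simp add: mult_ac)
    have "n * (2 * real k * exp (- (\<xi>\<^sup>2 / 4 * n))) \<le> n * (2 * real K0 * exp (- (\<xi>\<^sup>2 / 4 * n)))"
     using k n1 by (intro mult_left_mono mult_right_mono) auto
    also have "\<dots> < 1 / 2" using n0[OF nV] by (simp add: n_def mult_ac)
    finally show ?thesis using p1 unfolding e1 by linarith
   qed
   finally show "(\<Sum>i\<in>I. 2 * real k * exp (- ((D i)\<^sup>2 / (4 * M i)))) < 1" .
  qed
  then obtain c where c0: "\<forall>i\<in>I. \<forall>j<k. \<bar>real (card {x \<in> A i. c x = j}) - real (card (A i)) / real k\<bar> \<le> D i"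
   by (elim exE conjE)
  note c = c0[rule_format, OF _ k(1)]
  define \<Gamma> where "\<Gamma> = {e\<in>E. c e = 0}"
  have \<Gamma>E: "\<Gamma> \<subseteq> E" by (auto simp: \<Gamma>_def)
  have g\<Gamma>: "simple_graph V \<Gamma>" using g \<Gamma>E by (auto simp: simple_graph_def)
  have deg: "\<bar>real (card (neighbours \<Gamma> v)) - real (card (neighbours E v)) / real k\<bar> \<le> \<xi> * n" if "v \<in> V" for v
  proof -
   have "Inr v \<in> I" using that by (simp add: I_def)
   from c[OF this] have "\<bar>real (card {x \<in> {e\<in>E. v \<in> e}. c x = 0}) - real (card {e\<in>E. v \<in> e}) / real k\<bar> \<le> \<xi> * n"
    by (simp add: A_def D_def)
   moreover have "{x \<in> {e\<in>E. v \<in> e}. c x = 0} = {e\<in>\<Gamma>. v \<in> e}" by (auto simp: \<Gamma>_def)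
   ultimately show ?thesis using card_neighbours[OF g] card_neighbours[OF g\<Gamma>] by simp
  qed
  have nu: "0 < \<nu>" using rob by (simp add: robust_expander_def)
  have exp: "real (card S) + \<nu> / 2 * n \<le> real (card {v\<in>V. \<nu> / (8 * real k) * n \<le> real (card (neighbours \<Gamma> v \<inter> S))})"
   if S: "S \<subseteq> V" "\<tau> * n \<le> real (card S)" "real (card S) \<le> (1 - \<tau>) * n" for S
  proof -
   define B where "B = {v\<in>V. \<nu> * n \<le> real (card (neighbours E v \<inter> S))}"
   define G where "G = {v\<in>V. \<nu> / (8 * real k) * n \<le> real (card (neighbours \<Gamma> v \<inter> S))}"
   have cB: "real (card S) + \<nu> * n \<le> real (card B)"
    using rob S unfolding robust_expander_def B_def n_def by blast
   \<comment> \<open>The vertices that lose their robust adjacency to \<open>S\<close>. If there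
     were more than \<nu>n/2 of them, they would span many edges to \<open>S\<close> in
     \<open>E\<close> but fewer than a k-th share of these in \<open>\<Gamma>\<close>, against the
     even split of \<open>edges_between E S T\<close>.\<close>
   define T where "T = B - G"
   have TV: "T \<subseteq> V" by (auto simp: T_def B_def)
   have "real (card T) \<le> \<nu> / 2 * n"
   proof (rule ccontr)
    assume "\<not> ?thesis"
    then have Tbig: "\<nu> / 2 * n < real (card T)" by simp
    have "Inl (S, T) \<in> I" using S TV by (simp add: I_def)
    from c[OF this] have dev: "\<bar>real (card {x \<in> edges_between E S T. c x = 0}) - real (card (edges_between E S T)) / real k\<bar> \<le> \<xi> * n\<^sup>2"
     by (simp add: A_def D_def)
    have "{x \<in> edges_between E S T. c x = 0} = edges_between \<Gamma> S T" by (auto simp: \<Gamma>_def edges_between_def)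
    then have dev': "real (card (edges_between E S T)) / real k - real (card (edges_between \<Gamma> S T)) \<le> \<xi> * n\<^sup>2"
     using dev by simp
    have "real (card T) * (\<nu> * n) = (\<Sum>t\<in>T. \<nu> * n)" by simp
    also have "\<dots> \<le> (\<Sum>t\<in>T. real (card (neighbours E t \<inter> S)))" by (intro sum_mono) (auto simp: T_def B_def)
    also have "\<dots> \<le> 2 * real (card (edges_between E S T))"
     using of_nat_mono[OF card_edges_between(1)[OF g TV, of S], where 'a = real] by simp
    finally have lo: "real (card T) * (\<nu> * n) \<le> 2 * real (card (edges_between E S T))" .
    have "real (card (edges_between \<Gamma> S T)) \<le> (\<Sum>t\<in>T. real (card (neighbours \<Gamma> t \<inter> S)))"
     using of_nat_mono[OF card_edges_between(2)[OF g\<Gamma> TV, of S], where 'a = real] by simp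
    also have "\<dots> \<le> (\<Sum>t\<in>T. \<nu> / (8 * real k) * n)" by (intro sum_mono) (auto simp: T_def B_def G_def)
    also have "\<dots> = real (card T) * (\<nu> * n) / (8 * real k)" by simp
    finally have hi: "real (card (edges_between \<Gamma> S T)) \<le> real (card T) * (\<nu> * n) / (8 * real k)" .
    define y where "y = real (card T) * (\<nu> * n)"
    have "real (card (edges_between E S T)) / real k \<ge> (y / 2) / real k"
     using lo k unfolding y_def by (intro divide_right_mono) auto
    then have "y / 2 / real k - y / (8 * real k) \<le> \<xi> * n\<^sup>2" using dev' hi unfolding y_def by linarith
    then have "3 / 8 * y / real k \<le> \<xi> * n\<^sup>2" using k by (simp add: field_simps)
    then have "3 / 8 * y \<le> real k * \<xi> * n\<^sup>2" using k by (simp add: field_simps)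
    also have "\<dots> \<le> \<nu>\<^sup>2 / 8 * n\<^sup>2" using kxi by (intro mult_right_mono) auto
    finally have "3 * y \<le> \<nu>\<^sup>2 * n\<^sup>2" by simp
    moreover have "\<nu> / 2 * n * (\<nu> * n) < y" unfolding y_def using Tbig nu n1 by (intro mult_strict_right_mono) auto
    moreover have "\<nu> / 2 * n * (\<nu> * n) = \<nu>\<^sup>2 * n\<^sup>2 / 2" by (simp add: power2_eq_square)
    moreover have "0 < \<nu>\<^sup>2 * n\<^sup>2" using nu n1 by simp
    ultimately show False by linarith
   qed
   moreover have "card B \<le> card G + card T"
   proof -
    have "card B \<le> card (G \<union> T)" using fin by (intro card_mono) (auto simp: T_def G_def B_def)
    then show ?thesis using card_Un_le[of G T] by linarith
   qed
   ultimately show ?thesis using cB unfolding G_def[symmetric] by linarith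
  qed
  show "\<exists>\<Gamma>\<subseteq>E. (\<forall>v\<in>V. \<bar>real (card (neighbours \<Gamma> v)) - real (card (neighbours E v)) / real k\<bar> \<le> \<xi> * real (card V)) &
   (\<forall>S\<subseteq>V. \<tau> * real (card V) \<le> real (card S) & real (card S) \<le> (1 - \<tau>) * real (card V) -->
     real (card S) + \<nu> / 2 * real (card V) \<le>
     real (card {v\<in>V. \<nu> / (8 * real k) * real (card V) \<le> real (card (neighbours \<Gamma> v \<inter> S))}))"
   using \<Gamma>E deg exp unfolding n_def by (intro exI[of _ \<Gamma>]) blast
 qed
qed

section \<open>Linear forests from colour classes\<close>

lemma mod_shift:
 fixes a b d K :: nat
 assumes "a < K" "b < K" "0 < d" "d < K"
 shows "b = (a + d) mod K \<longleftrightarrow> a = (b + (K - d)) mod K" "(a + d) mod K \<noteq> a"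
proof -
 have 1: "(a + d) mod K = (if a + d < K then a + d else a + d - K)"
  using assms by (simp add: mod_if)
 have 2: "(b + (K - d)) mod K = (if b + (K - d) < K then b + (K - d) else b + (K - d) - K)"
  using assms by (simp add: mod_if)
 show "b = (a + d) mod K \<longleftrightarrow> a = (b + (K - d)) mod K" unfolding 1 2 using assms by (auto split: if_splits)
 show "(a + d) mod K \<noteq> a" unfolding 1 using assms by auto
qed

lemma mod_add_left_inj:
 fixes b x y K :: nat
 assumes "b < K" "x < K" "y < K" "(b + x) mod K = (b + y) mod K"
 shows "x = y"
proof -
 have "(b + z) mod K = (if b + z < K then b + z else b + z - K)" if "z < K" for z
  using that assms(1) by (simp add: mod_if)
 then show ?thesis using assms by (auto split: if_splits)
qed

text \<open>Multiplication by \<open>d\<close> is injective modulo a prime. Hence the parts p, p +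
  d, p + 2d, ... run through all parts in a single cycle, along which forest arcs advance.\<close>

lemma prime_arithmetic_progression_covers:
 fixes K d p b :: nat
 assumes "prime K" "0 < d" "d < K" "b < K"
 shows "\<exists>k. (p + k * d) mod K = b"
proof -
 have less: "(p + k * d) mod K \<noteq> (p + k' * d) mod K" if "k < k'" "k' < K" for k k'
 proof
  assume eq: "(p + k * d) mod K = (p + k' * d) mod K"
  have "p + k * d \<le> p + k' * d" using that by simp
  from mod_eq_dvd_iff_nat[OF this, of K] have "K dvd (p + k' * d) - (p + k * d)" using eq by simp
  then have "K dvd (k' - k) * d" by (simp add: diff_mult_distrib)
  then have "K dvd (k' - k) \<or> K dvd d" using prime_dvd_mult_iff[OF assms(1)] by blast
  moreover have "\<not> K dvd (k' - k)" "\<not> K dvd d"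
   using nat_dvd_not_less[of "k' - k" K] nat_dvd_not_less[of d K] that assms(2,3) by simp_all
  ultimately show False by blast
 qed
 have "inj_on (\<lambda>k. (p + k * d) mod K) {..<K}"
 proof (rule inj_onI)
  fix k k' assume "k \<in> {..<K}" "k' \<in> {..<K}" "(p + k * d) mod K = (p + k' * d) mod K"
  then show "k = k'" using less[of k k'] less[of k' k] by (metis lessThan_iff nat_neq_iff)
 qed
 then have "(\<lambda>k. (p + k * d) mod K) ` {..<K} = {..<K}"
  using assms by (intro endo_inj_surj) auto
 then have "b \<in> (\<lambda>k. (p + k * d) mod K) ` {..<K}" using assms(4) by simp
 then show ?thesis by blast
qed

lemma card_residue_class_le:
 fixes \<Delta> K b :: nat
 assumes "0 < K"
 shows "card {c0. c0 < \<Delta> & c0 mod K = b} \<le> \<Delta> div K + 1"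
proof -
 have "inj_on (\<lambda>c0. c0 div K) {c0. c0 < \<Delta> & c0 mod K = b}"
 proof (rule inj_onI)
  fix x y assume "x \<in> {c0. c0 < \<Delta> & c0 mod K = b}" "y \<in> {c0. c0 < \<Delta> & c0 mod K = b}" "x div K = y div K"
  then have "x div K * K + x mod K = y div K * K + y mod K" by simp
  then show "x = y" by (simp only: div_mult_mod_eq)
 qed
 moreover have "(\<lambda>c0. c0 div K) ` {c0. c0 < \<Delta> & c0 mod K = b} \<subseteq> {..\<Delta> div K}"
  by (auto intro: div_le_mono)
 ultimately have "card {c0. c0 < \<Delta> & c0 mod K = b} \<le> card {..\<Delta> div K}"
  using card_inj_on_le[OF _ _ finite_atMost] by blast
 then show ?thesis by simp
qed

lemma card_missing_colours:
 fixes f :: "'a => nat"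
 assumes "finite S" "inj_on f S" "f ` S \<subseteq> {..<\<Delta>}" "real \<Delta> - x \<le> real (card S)"
 shows "real (card {c0. c0 < \<Delta> & c0 \<notin> f ` S}) \<le> x"
proof -
 have "{c0. c0 < \<Delta> & c0 \<notin> f ` S} = {..<\<Delta>} - f ` S" by auto
 then have "card {c0. c0 < \<Delta> & c0 \<notin> f ` S} = \<Delta> - card S"
  using assms by (simp add: card_Diff_subset card_image)
 moreover have "card S \<le> \<Delta>" using assms card_mono[of "{..<\<Delta>}" "f ` S"] by (simp add: card_image)
 ultimately show ?thesis using assms(4) by simp
qed

text \<open>A forest is indexed by a difference \<open>d\<close> and a colour \<open>c0\<close>; its
  deleted part is \<open>c0 mod K\<close>, so the pair (q, p) determines \<open>d\<close> and the
  residue of \<open>c0\<close>, and at most \<Delta> div K + 1 forests share a pair. A vertex misses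
  at most \<rho>n colours for each difference. By Markov's inequality all but (\<rho>/\<omega>)n
  colours of a difference miss at most \<omega>n vertices, and only those are kept.\<close>

lemma forest_system:
 fixes V :: "'a set" and c :: "'a => nat" and \<rho> \<omega> :: real
 assumes g: "simple_graph V Gp" and K: "prime K" "2 < K" and c: "\<And>v. c v < K"
  and degU: "\<And>v j. v \<in> V ==> j < K ==> j \<noteq> c v ==> card (neighbours Gp v \<inter> {w\<in>V. c w = j}) \<le> \<Delta>"
  and degL: "\<And>v j. v \<in> V ==> j < K ==> j \<noteq> c v ==>
    real \<Delta> - \<rho> * real (card V) \<le> real (card (neighbours Gp v \<inter> {w\<in>V. c w = j}))"
  and om: "0 < \<omega>" and V1: "1 \<le> card V"
 shows "\<exists>(J :: (nat \<times> nat) set) arcs p q. finite J &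
  (\<forall>j\<in>J. arcs j \<subseteq> V \<times> V & (\<forall>u v. (u, v) \<in> arcs j --> {u, v} \<in> Gp) &
    single_valued (arcs j) & single_valued ((arcs j)\<inverse>) &
    (\<exists>pos :: 'a => nat. \<forall>u v. (u, v) \<in> arcs j --> pos u < pos v) &
    p j < K & q j < K & p j \<noteq> q j & (\<forall>u v. (u, v) \<in> arcs j --> c v \<noteq> p j & c u \<noteq> q j) &
    real (card {u\<in>V. c u \<noteq> q j & u \<notin> Domain (arcs j)}) \<le> \<omega> * real (card V) &
    real (card {v\<in>V. c v \<noteq> p j & v \<notin> Range (arcs j)}) \<le> \<omega> * real (card V)) &
  (\<forall>j\<in>J. \<forall>j'\<in>J. \<forall>u v u' v'. (u, v) \<in> arcs j --> (u', v') \<in> arcs j' --> {u, v} = {u', v'} --> j = j') &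
  (\<forall>v\<in>V. real (card {j\<in>J. c v \<noteq> q j & v \<notin> Domain (arcs j)}) \<le> real K * (\<rho> * real (card V)) &
      real (card {j\<in>J. c v \<noteq> p j & v \<notin> Range (arcs j)}) \<le> real K * (\<rho> * real (card V))) &
  (\<forall>a b. card {j\<in>J. q j = a & p j = b} \<le> \<Delta> div K + 1) &
  real ((K - 1) div 2) * (real \<Delta> - \<rho> / \<omega> * real (card V)) \<le> real (card J)"
proof -
 define n where "n = real (card V)"
 have fin: "finite V" using g by (simp add: simple_graph_def)
 \<comment> \<open>Only half of the nonzero differences are used: an edge between two parts has
   differences d and K - d in its two orientations, and exactly one of them is at most (K-1)/2. Thus
   every such edge is used in one direction.\<close>
 define D where "D = {d. 0 < d & d \<le> (K - 1) div 2}"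
 have D: "0 < d" "d < K" "2 * d < K" if "d \<in> D" for d using that K by (auto simp: D_def)
 have finD: "finite D" "card D = (K - 1) div 2"
 proof -
  have "D = {1..(K - 1) div 2}" by (auto simp: D_def)
  then show "finite D" "card D = (K - 1) div 2" by simp_all
 qed
 define B where "B d = {(u, v). u \<in> V & v \<in> V & {u, v} \<in> Gp & c v = (c u + d) mod K}" for d
 have out: "{v\<in>V. (u, v) \<in> B d} = neighbours Gp u \<inter> {w\<in>V. c w = (c u + d) mod K}" if "u \<in> V" for u d
  using that by (auto simp: B_def neighbours_def)
 have inn: "{u\<in>V. (u, v) \<in> B d} = neighbours Gp v \<inter> {w\<in>V. c w = (c v + (K - d)) mod K}" if "v \<in> V" "d \<in> D" for v d
  using that mod_shift(1)[OF c c D(1,2)[OF that(2)]] by (auto simp: B_def neighbours_def insert_commute)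
 have shift: "(c u + d) mod K < K" "(c u + d) mod K \<noteq> c u" "(c u + (K - d)) mod K < K" "(c u + (K - d)) mod K \<noteq> c u"
  if "d \<in> D" for u d
  using mod_shift(2)[of "c u" K "c u" d] mod_shift(2)[of "c u" K "c u" "K - d"] c[of u] D[OF that] K by simp_all
 have "\<exists>col. (\<forall>e\<in>B d. col e < \<Delta>) &
  (\<forall>u v v'. (u, v) \<in> B d & (u, v') \<in> B d & col (u, v) = col (u, v') --> v = v') &
  (\<forall>u u' v. (u, v) \<in> B d & (u', v) \<in> B d & col (u, v) = col (u', v) --> u = u')" if d: "d \<in> D" for d
 proof (rule digraph_edge_colouring[OF fin])
  show "B d \<subseteq> V \<times> V" by (auto simp: B_def)
  show "card {v\<in>V. (u, v) \<in> B d} \<le> \<Delta>" if "u \<in> V" for u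
   unfolding out[OF that] using shift[OF d] by (intro degU that) auto
  show "card {u\<in>V. (u, v) \<in> B d} \<le> \<Delta>" if "v \<in> V" for v
   unfolding inn[OF that d] using shift[OF d] by (intro degU that) auto
 qed
 then obtain col where col0: "\<forall>d\<in>D. (\<forall>e\<in>B d. col d e < \<Delta>) &
  (\<forall>u v v'. (u, v) \<in> B d & (u, v') \<in> B d & col d (u, v) = col d (u, v') --> v = v') &
  (\<forall>u u' v. (u, v) \<in> B d & (u', v) \<in> B d & col d (u, v) = col d (u', v) --> u = u')"
  by (metis (no_types, lifting))
 have colD: "col d (u, v) < \<Delta>" if "d \<in> D" "(u, v) \<in> B d" for d u v using col0 that by blast
 have colO: "v = v'" if "d \<in> D" "(u, v) \<in> B d" "(u, v') \<in> B d" "col d (u, v) = col d (u, v')" for d u v v'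
  using col0[rule_format, OF that(1)] that(2-4) by blast
 have colI: "u = u'" if "d \<in> D" "(u, v) \<in> B d" "(u', v) \<in> B d" "col d (u, v) = col d (u', v)" for d u u' v
  using col0[rule_format, OF that(1)] that(2-4) by blast
 define M where "M d c0 = {(u, v). (u, v) \<in> B d & col d (u, v) = c0}" for d c0
 have MV: "M d c0 \<subseteq> V \<times> V" for d c0 by (auto simp: M_def B_def)
 have finM: "finite (M d c0)" for d c0 using finite_subset[OF MV] fin by simp
 have missO: "real (card {c0. c0 < \<Delta> & u \<notin> Domain (M d c0)}) \<le> \<rho> * n" if u: "u \<in> V" and d: "d \<in> D" for u d
 proof -
  let ?S = "{v\<in>V. (u, v) \<in> B d}"
  have "{c0. c0 < \<Delta> & u \<notin> Domain (M d c0)} = {c0. c0 < \<Delta> & c0 \<notin> (\<lambda>v. col d (u, v)) ` ?S}"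
   by (auto simp: M_def B_def)
  moreover have "real (card {c0. c0 < \<Delta> & c0 \<notin> (\<lambda>v. col d (u, v)) ` ?S}) \<le> \<rho> * n"
  proof (rule card_missing_colours)
   show "finite ?S" using fin by simp
   show "inj_on (\<lambda>v. col d (u, v)) ?S" by (rule inj_onI) (use colO[OF d] in blast)
   show "(\<lambda>v. col d (u, v)) ` ?S \<subseteq> {..<\<Delta>}" using colD[OF d] by blast
   show "real \<Delta> - \<rho> * n \<le> real (card ?S)"
    unfolding out[OF u] n_def using shift[OF d] by (intro degL u) auto
  qed
  ultimately show ?thesis by simp
 qed
 have missI: "real (card {c0. c0 < \<Delta> & v \<notin> Range (M d c0)}) \<le> \<rho> * n" if v: "v \<in> V" and d: "d \<in> D" for v d
 proof -
  let ?S = "{u\<in>V. (u, v) \<in> B d}"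
  have "{c0. c0 < \<Delta> & v \<notin> Range (M d c0)} = {c0. c0 < \<Delta> & c0 \<notin> (\<lambda>u. col d (u, v)) ` ?S}"
   by (auto simp: M_def B_def)
  moreover have "real (card {c0. c0 < \<Delta> & c0 \<notin> (\<lambda>u. col d (u, v)) ` ?S}) \<le> \<rho> * n"
  proof (rule card_missing_colours)
   show "finite ?S" using fin by simp
   show "inj_on (\<lambda>u. col d (u, v)) ?S" by (rule inj_onI) (use colI[OF d] in blast)
   show "(\<lambda>u. col d (u, v)) ` ?S \<subseteq> {..<\<Delta>}" using colD[OF d] by blast
   show "real \<Delta> - \<rho> * n \<le> real (card ?S)"
    unfolding inn[OF v d] n_def using shift[OF d] by (intro degL v) auto
  qed
  ultimately show ?thesis by simp
 qed
 \<comment> \<open>Deleting the arcs into the part \<open>c0 mod K\<close> cuts the cycle of parts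
   at this place; the tails of the deleted arcs lie in the part \<open>q\<close>.\<close>
 define arcs where "arcs = (\<lambda>(d, c0). {(u, v). (u, v) \<in> M d c0 & c v \<noteq> c0 mod K})"
 define p where "p = (\<lambda>(d::nat, c0). c0 mod K)"
 define q where "q = (\<lambda>(d, c0). (c0 mod K + (K - d)) mod K)"
 define J where "J = (SIGMA d:D. {c0. c0 < \<Delta> & real (card {u\<in>V. u \<notin> Domain (M d c0)}) \<le> \<omega> * n})"
 have finJ: "finite J" unfolding J_def using finD by (intro finite_SigmaI) auto
 have qp: "c u = (c0 mod K + (K - d)) mod K \<longleftrightarrow> (c u + d) mod K = c0 mod K" if "d \<in> D" for u d c0
  using mod_shift(1)[OF c[of u], of "c0 mod K" d] D[OF that] K by auto
 have sv: "single_valued (M d c0)" "single_valued ((M d c0)\<inverse>)" if "d \<in> D" for d c0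
 proof -
  show "single_valued (M d c0)" by (rule single_valuedI) (use colO[OF that] in \<open>auto simp: M_def\<close>)
  show "single_valued ((M d c0)\<inverse>)" by (rule single_valuedI) (use colI[OF that] in \<open>auto simp: M_def\<close>)
 qed
 have cardDR: "card (Domain (M d c0)) = card (Range (M d c0))" if "d \<in> D" for d c0
 proof -
  have "inj_on fst (M d c0)" using sv(1)[OF that] by (auto simp: inj_on_def single_valued_def)
  moreover have "inj_on snd (M d c0)" using sv(2)[OF that] by (auto simp: inj_on_def single_valued_def)
  ultimately show ?thesis by (simp add: Domain_fst Range_snd card_image)
 qed
 have J1: "arcs j \<subseteq> V \<times> V & (\<forall>u v. (u, v) \<in> arcs j --> {u, v} \<in> Gp) &
    single_valued (arcs j) & single_valued ((arcs j)\<inverse>) &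
    (\<exists>pos :: 'a => nat. \<forall>u v. (u, v) \<in> arcs j --> pos u < pos v) &
    p j < K & q j < K & p j \<noteq> q j & (\<forall>u v. (u, v) \<in> arcs j --> c v \<noteq> p j & c u \<noteq> q j) &
    real (card {u\<in>V. c u \<noteq> q j & u \<notin> Domain (arcs j)}) \<le> \<omega> * real (card V) &
    real (card {v\<in>V. c v \<noteq> p j & v \<notin> Range (arcs j)}) \<le> \<omega> * real (card V)" if jJ: "j \<in> J" for j
 proof -
  obtain d c0 where j: "j = (d, c0)" and d: "d \<in> D" and c0: "real (card {u\<in>V. u \<notin> Domain (M d c0)}) \<le> \<omega> * n"
   using jJ by (auto simp: J_def)
  have aM: "arcs j \<subseteq> M d c0" by (auto simp: arcs_def j)
  have arc: "(u, v) \<in> arcs j \<longleftrightarrow> (u, v) \<in> M d c0 & c v \<noteq> c0 mod K" for u v by (simp add: arcs_def j)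
  have pj: "p j = c0 mod K" "q j = (c0 mod K + (K - d)) mod K" by (simp_all add: p_def q_def j)
  have cM: "c v = (c u + d) mod K" if "(u, v) \<in> M d c0" for u v using that by (auto simp: M_def B_def)
  have domeq: "{u\<in>V. c u \<noteq> q j & u \<notin> Domain (arcs j)} \<subseteq> {u\<in>V. u \<notin> Domain (M d c0)}"
  proof
   fix u assume u: "u \<in> {u\<in>V. c u \<noteq> q j & u \<notin> Domain (arcs j)}"
   have "u \<notin> Domain (M d c0)"
   proof
    assume "u \<in> Domain (M d c0)"
    then obtain v where v: "(u, v) \<in> M d c0" by blast
    have "c u \<noteq> q j" using u by simp
    then have "(c u + d) mod K \<noteq> c0 mod K" using qp[OF d, of u c0] pj(2) by simp
    then have "c v \<noteq> c0 mod K" using cM[OF v] by simp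
    then have "(u, v) \<in> arcs j" using arc[of u v] v by simp
    then show False using u by blast
   qed
   then show "u \<in> {u\<in>V. u \<notin> Domain (M d c0)}" using u by blast
  qed
  have raneq: "{v\<in>V. c v \<noteq> p j & v \<notin> Range (arcs j)} \<subseteq> {v\<in>V. v \<notin> Range (M d c0)}"
  proof
   fix v assume v: "v \<in> {v\<in>V. c v \<noteq> p j & v \<notin> Range (arcs j)}"
   have "(u, v) \<notin> M d c0" for u
   proof
    assume "(u, v) \<in> M d c0"
    then have "(u, v) \<in> arcs j" using arc[of u v] v pj(1) by simp
    then show False using v by blast
   qed
   then have "v \<notin> Range (M d c0)" by blast
   then show "v \<in> {v\<in>V. v \<notin> Range (M d c0)}" using v by simp
  qed
  have "card {v\<in>V. v \<notin> Range (M d c0)} = card {u\<in>V. u \<notin> Domain (M d c0)}"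
  proof -
   have "Domain (M d c0) \<subseteq> V" "Range (M d c0) \<subseteq> V" using MV by blast+
   moreover have "{v\<in>V. v \<notin> Range (M d c0)} = V - Range (M d c0)" "{u\<in>V. u \<notin> Domain (M d c0)} = V - Domain (M d c0)" by auto
   ultimately show ?thesis
    using cardDR[OF d] card_Diff_subset[OF finite_subset[OF _ fin], of "Domain (M d c0)"]
     card_Diff_subset[OF finite_subset[OF _ fin], of "Range (M d c0)"] by simp
  qed
  moreover have "card {u\<in>V. c u \<noteq> q j & u \<notin> Domain (arcs j)} \<le> card {u\<in>V. u \<notin> Domain (M d c0)}"
   using fin by (intro card_mono domeq) simp
  moreover have "card {v\<in>V. c v \<noteq> p j & v \<notin> Range (arcs j)} \<le> card {v\<in>V. v \<notin> Range (M d c0)}"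
   using fin by (intro card_mono raneq) simp
  ultimately have cards: "real (card {u\<in>V. c u \<noteq> q j & u \<notin> Domain (arcs j)}) \<le> \<omega> * n"
    "real (card {v\<in>V. c v \<noteq> p j & v \<notin> Range (arcs j)}) \<le> \<omega> * n" using c0 by linarith+
  \<comment> \<open>The position of the part of \<open>v\<close> in the progression starting at
    \<open>p\<close>. An arc advances it by one, because the only arcs from the last part back to
    the first are those into \<open>p\<close>, which were deleted.\<close>
  define pos where "pos v = (LEAST k. (p j + k * d) mod K = c v)" for v
  have posx: "(p j + pos v * d) mod K = c v" for v
   unfolding pos_def by (rule LeastI_ex) (rule prime_arithmetic_progression_covers[OF K(1) D(1,2)[OF d] c])
  have posl: "pos v \<le> k" if "(p j + k * d) mod K = c v" for v k
   unfolding pos_def using that by (rule Least_le)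
  have pos: "pos u < pos v" if uv: "(u, v) \<in> arcs j" for u v
  proof -
   have cv: "c v = (c u + d) mod K" "c v \<noteq> p j" using cM[of u v] uv arc[of u v] pj(1) by simp_all
   have "pos v \<noteq> 0"
   proof
    assume "pos v = 0"
    then show False using posx[of v] cv(2) by (simp add: pj)
   qed
   then obtain k where k: "pos v = Suc k" by (cases "pos v") auto
   have "((p j + k * d) mod K + d) mod K = c v" using posx[of v] unfolding k by (simp add: mod_simps add_ac)
   then have "(p j + k * d) mod K = (c v + (K - d)) mod K"
    using mod_shift(1)[of "(p j + k * d) mod K" K "c v" d] c D[OF d] K by simp
   also have "\<dots> = c u" using mod_shift(1)[OF c c D(1,2)[OF d], of v u] cv(1) by simp
   finally have "pos u \<le> k" by (rule posl)
   then show ?thesis using k by simp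
  qed
  have "\<forall>u v. (u, v) \<in> arcs j --> c v \<noteq> p j & c u \<noteq> q j"
  proof (intro allI impI)
   fix u v assume uv: "(u, v) \<in> arcs j"
   then have "c v = (c u + d) mod K" "c v \<noteq> c0 mod K" using cM[of u v] arc[of u v] by simp_all
   then show "c v \<noteq> p j & c u \<noteq> q j" using qp[OF d, of u c0] unfolding pj by simp
  qed
  moreover have "p j < K" "q j < K" "p j \<noteq> q j"
   using K mod_shift(2)[of "c0 mod K" K 0 "K - d"] D[OF d] unfolding pj by simp_all
  moreover have "single_valued (arcs j)" by (rule single_valued_subset[OF aM sv(1)[OF d]])
  moreover have "single_valued ((arcs j)\<inverse>)" by (rule single_valued_subset[OF _ sv(2)[OF d]]) (use aM in \<open>simp add: converse_mono\<close>)
  moreover have "arcs j \<subseteq> V \<times> V" using aM MV by (rule order_trans)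
  moreover have "\<forall>u v. (u, v) \<in> arcs j --> {u, v} \<in> Gp" using aM by (auto simp: M_def B_def)
  moreover have "\<exists>pos :: 'a => nat. \<forall>u v. (u, v) \<in> arcs j --> pos u < pos v" using pos by blast
  ultimately show ?thesis using cards unfolding n_def by (intro conjI) assumption+
 qed
 have J2: "j = j'" if j: "j \<in> J" "j' \<in> J" and e: "(u, v) \<in> arcs j" "(u', v') \<in> arcs j'" "{u, v} = {u', v'}" for j j' u v u' v'
 proof -
  obtain d c0 d' c0' where jj: "j = (d, c0)" "j' = (d', c0')" "d \<in> D" "d' \<in> D" using j by (auto simp: J_def)
  have m: "(u, v) \<in> B d" "col d (u, v) = c0" "(u', v') \<in> B d'" "col d' (u', v') = c0'"
   using e by (auto simp: arcs_def jj M_def)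
  have cc: "c v = (c u + d) mod K" "c v' = (c u' + d') mod K" using m by (auto simp: B_def)
  from e(3) consider "u = u'" "v = v'" | "u = v'" "v = u'" by (auto simp: doubleton_eq_iff)
  then show ?thesis
  proof cases
   case 1
   have "(c u + d) mod K = (c u + d') mod K" using cc 1 by simp
   then have "d = d'" by (rule mod_add_left_inj[of "c u" K d d', OF c D(2)[OF jj(3)] D(2)[OF jj(4)]])
   then show ?thesis using m 1 jj by simp
  next
   \<comment> \<open>Opposite orientations of one edge would force d + d' = K, but both differences
     are below K/2.\<close>
   case 2
   have "c u = (c v + (K - d)) mod K" using mod_shift(1)[OF c c D(1,2)[OF jj(3)]] cc(1) by blast
   moreover have "c u = (c v + d') mod K" using cc(2) 2 by simp
   ultimately have "(c v + (K - d)) mod K = (c v + d') mod K" by simp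
   moreover have "K - d < K" using D(1,2)[OF jj(3)] by linarith
   ultimately have "K - d = d'" using mod_add_left_inj[of "c v" K "K - d" d', OF c _ D(2)[OF jj(4)]] by blast
   then show ?thesis using D(3)[OF jj(3)] D(3)[OF jj(4)] by linarith
  qed
 qed
 have DK: "real (card D) \<le> real K" using finD by simp
 have J3: "real (card {j\<in>J. c v \<noteq> q j & v \<notin> Domain (arcs j)}) \<le> real K * (\<rho> * n)"
  "real (card {j\<in>J. c v \<noteq> p j & v \<notin> Range (arcs j)}) \<le> real K * (\<rho> * n)" if v: "v \<in> V" for v
 proof -
  have d0: "1 \<in> D" using K(2) by (simp add: D_def)
  have rho: "0 \<le> \<rho> * n" using missO[OF v d0] by linarith
  have sub1: "{j\<in>J. c v \<noteq> q j & v \<notin> Domain (arcs j)} \<subseteq> (SIGMA d:D. {c0. c0 < \<Delta> & v \<notin> Domain (M d c0)})"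
  proof
   fix j assume j: "j \<in> {j\<in>J. c v \<noteq> q j & v \<notin> Domain (arcs j)}"
   obtain d c0 where jj: "j = (d, c0)" "d \<in> D" "c0 < \<Delta>" using j by (auto simp: J_def)
   have "v \<notin> Domain (M d c0)"
   proof
    assume "v \<in> Domain (M d c0)"
    then obtain w where w: "(v, w) \<in> M d c0" by blast
    then have "c w = (c v + d) mod K" by (auto simp: M_def B_def)
    then have "c w \<noteq> c0 mod K" using qp[OF jj(2), of v c0] j by (auto simp: q_def jj)
    then have "(v, w) \<in> arcs j" using w by (simp add: arcs_def jj)
    then show False using j by blast
   qed
   then show "j \<in> (SIGMA d:D. {c0. c0 < \<Delta> & v \<notin> Domain (M d c0)})" using jj by simp
  qed
  have sub2: "{j\<in>J. c v \<noteq> p j & v \<notin> Range (arcs j)} \<subseteq> (SIGMA d:D. {c0. c0 < \<Delta> & v \<notin> Range (M d c0)})"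
  proof
   fix j assume j: "j \<in> {j\<in>J. c v \<noteq> p j & v \<notin> Range (arcs j)}"
   obtain d c0 where jj: "j = (d, c0)" "d \<in> D" "c0 < \<Delta>" using j by (auto simp: J_def)
   have "v \<notin> Range (M d c0)" using j by (auto simp: arcs_def jj p_def)
   then show "j \<in> (SIGMA d:D. {c0. c0 < \<Delta> & v \<notin> Range (M d c0)})" using jj by simp
  qed
  have bound: "real (card (SIGMA d:D. F d)) \<le> real K * (\<rho> * n)"
   if F: "\<And>d. d \<in> D ==> finite (F d) & real (card (F d)) \<le> \<rho> * n" for F :: "nat => nat set"
  proof -
   have "real (card (SIGMA d:D. F d)) = (\<Sum>d\<in>D. real (card (F d)))" using F finD by (simp add: card_SigmaI)
   also have "\<dots> \<le> (\<Sum>d\<in>D. \<rho> * n)" using F by (intro sum_mono) blast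
   also have "\<dots> = real (card D) * (\<rho> * n)" by simp
   also have "\<dots> \<le> real K * (\<rho> * n)" using DK rho by (intro mult_right_mono) auto
   finally show ?thesis .
  qed
  have finS: "finite (SIGMA d:D. {c0. c0 < \<Delta> & P d c0})" for P using finD by (intro finite_SigmaI) auto
  have "real (card {j\<in>J. c v \<noteq> q j & v \<notin> Domain (arcs j)}) \<le> real (card (SIGMA d:D. {c0. c0 < \<Delta> & v \<notin> Domain (M d c0)}))"
   using card_mono[OF finS sub1] by simp
  also have "\<dots> \<le> real K * (\<rho> * n)" by (rule bound) (use missO[OF v] in simp)
  finally show "real (card {j\<in>J. c v \<noteq> q j & v \<notin> Domain (arcs j)}) \<le> real K * (\<rho> * n)" .
  have "real (card {j\<in>J. c v \<noteq> p j & v \<notin> Range (arcs j)}) \<le> real (card (SIGMA d:D. {c0. c0 < \<Delta> & v \<notin> Range (M d c0)}))"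
   using card_mono[OF finS sub2] by simp
  also have "\<dots> \<le> real K * (\<rho> * n)" by (rule bound) (use missI[OF v] in simp)
  finally show "real (card {j\<in>J. c v \<noteq> p j & v \<notin> Range (arcs j)}) \<le> real K * (\<rho> * n)" .
 qed
 have J4: "card {j\<in>J. q j = a & p j = b} \<le> \<Delta> div K + 1" for a b
 proof (cases "{j\<in>J. q j = a & p j = b} = {}")
  case False
  then obtain d c0 where d: "d \<in> D" "(c0 mod K + (K - d)) mod K = a" "c0 mod K = b"
   by (auto simp: J_def p_def q_def)
  have bK: "b < K" using d(3) K by auto
  have "{j\<in>J. q j = a & p j = b} \<subseteq> {d} \<times> {c0. c0 < \<Delta> & c0 mod K = b}"
  proof
   fix j assume j: "j \<in> {j\<in>J. q j = a & p j = b}"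
   obtain d' c0' where jj: "j = (d', c0')" "d' \<in> D" "c0' < \<Delta>" using j by (auto simp: J_def)
   have "p j = c0' mod K" "q j = (c0' mod K + (K - d')) mod K" by (simp_all add: p_def q_def jj(1))
   moreover have "p j = b" "q j = a" using j by blast+
   ultimately have b': "c0' mod K = b" "(b + (K - d')) mod K = a" by simp_all
   have "(b + (K - d')) mod K = (b + (K - d)) mod K" using b' d by simp
   moreover have "K - d' < K" "K - d < K" using D(1,2)[OF jj(2)] D(1,2)[OF d(1)] by linarith+
   ultimately have "K - d' = K - d" using mod_add_left_inj[of b K "K - d'" "K - d", OF bK] by blast
   then have "d = d'" using D[OF d(1)] D[OF jj(2)] by simp
   then show "j \<in> {d} \<times> {c0. c0 < \<Delta> & c0 mod K = b}" using jj b' by simp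
  qed
  then have "card {j\<in>J. q j = a & p j = b} \<le> card ({d} \<times> {c0. c0 < \<Delta> & c0 mod K = b})"
   by (intro card_mono) auto
  also have "\<dots> = card {c0. c0 < \<Delta> & c0 mod K = b}" by (simp add: card_cartesian_product)
  also have "\<dots> \<le> \<Delta> div K + 1" using K by (intro card_residue_class_le) simp
  finally show ?thesis .
 next
  case True
  then show ?thesis by (simp only: card.empty le0)
 qed
 have n0: "0 < n" using V1 by (simp add: n_def)
 have J5: "real ((K - 1) div 2) * (real \<Delta> - \<rho> / \<omega> * n) \<le> real (card J)"
 proof -
  have good: "real \<Delta> - \<rho> / \<omega> * n \<le> real (card {c0. c0 < \<Delta> & real (card {u\<in>V. u \<notin> Domain (M d c0)}) \<le> \<omega> * n})"
   if d: "d \<in> D" for d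
  proof -
   \<comment> \<open>Summing the missing vertices over all colours equals summing the missing
     colours over all vertices, at most \<rho>n for each of the n vertices.\<close>
   let ?bad = "{c0\<in>{..<\<Delta>}. \<omega> * n < real (card {u\<in>V. u \<notin> Domain (M d c0)})}"
   have "\<omega> * n * real (card ?bad) \<le> (\<Sum>c0<\<Delta>. real (card {u\<in>V. u \<notin> Domain (M d c0)}))"
    by (rule card_gt_threshold_le) auto
   also have "\<dots> = (\<Sum>c0<\<Delta>. \<Sum>u\<in>V. of_bool (u \<notin> Domain (M d c0)))"
    using fin by (simp add: of_bool_def sum.If_cases Int_def)
   also have "\<dots> = (\<Sum>u\<in>V. \<Sum>c0<\<Delta>. of_bool (u \<notin> Domain (M d c0)))" by (rule sum.swap)
   also have "\<dots> = (\<Sum>u\<in>V. real (card {c0. c0 < \<Delta> & u \<notin> Domain (M d c0)}))"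
    by (simp add: of_bool_def sum.If_cases Int_def)
   also have "\<dots> \<le> (\<Sum>u\<in>V. \<rho> * n)" using missO[OF _ d] by (intro sum_mono)
   also have "\<dots> = \<rho> * n * n" by (simp add: n_def)
   finally have "n * (\<omega> * real (card ?bad)) \<le> n * (\<rho> * n)" by (simp add: mult_ac)
   then have "\<omega> * real (card ?bad) \<le> \<rho> * n" using n0 by simp
   then have bad: "real (card ?bad) \<le> \<rho> / \<omega> * n" using om by (simp add: field_simps)
   have "{c0. c0 < \<Delta> & real (card {u\<in>V. u \<notin> Domain (M d c0)}) \<le> \<omega> * n} = {..<\<Delta>} - ?bad" by auto
   then show ?thesis using card_Diff_ge[of ?bad "{..<\<Delta>}"] bad by simp
  qed
  have "real ((K - 1) div 2) * (real \<Delta> - \<rho> / \<omega> * n) = (\<Sum>d\<in>D. real \<Delta> - \<rho> / \<omega> * n)" using finD by simp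
  also have "\<dots> \<le> (\<Sum>d\<in>D. real (card {c0. c0 < \<Delta> & real (card {u\<in>V. u \<notin> Domain (M d c0)}) \<le> \<omega> * n}))"
   by (intro sum_mono good)
  also have "\<dots> = real (card J)" unfolding J_def using finD by (simp add: card_SigmaI)
  finally show ?thesis .
 qed
 show ?thesis
 proof (rule exI[of _ J], rule exI[of _ arcs], rule exI[of _ p], rule exI[of _ q], intro conjI)
  show "\<forall>j\<in>J. \<forall>j'\<in>J. \<forall>u v u' v'. (u, v) \<in> arcs j --> (u', v') \<in> arcs j' --> {u, v} = {u', v'} --> j = j'"
   by (intro ballI allI impI) (rule J2)
  show "\<forall>v\<in>V. real (card {j\<in>J. c v \<noteq> q j & v \<notin> Domain (arcs j)}) \<le> real K * (\<rho> * real (card V)) &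
      real (card {j\<in>J. c v \<noteq> p j & v \<notin> Range (arcs j)}) \<le> real K * (\<rho> * real (card V))"
   using J3 unfolding n_def by (intro ballI conjI)
  show "\<forall>a b. card {j\<in>J. q j = a & p j = b} \<le> \<Delta> div K + 1" by (intro allI J4)
  show "real ((K - 1) div 2) * (real \<Delta> - \<rho> / \<omega> * real (card V)) \<le> real (card J)" using J5 by (simp add: n_def)
 qed (intro finJ ballI J1)+
qed

section \<open>Assignment of forests to layouts\<close>

text \<open>Greedy choice against the potential summing 2^(number of hits) over the vertices. At
  least \<open>g\<close> forests are free at each step and a vertex is hit by at most
  \<open>B\<close> of them, so the average choice multiplies the potential by at most 1 + B/g. A
  bound on the sum bounds every single exponent.\<close>

lemma balanced_assignment:
 fixes hit :: "nat => 'j => 'v => bool" and g B :: real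
 assumes fin: "finite J" "finite V" and g: "0 < g" "0 \<le> B"
  and hit: "\<And>i w. i \<in> {1..l} ==> w \<in> V ==> real (card {j\<in>J. hit i j w}) \<le> B"
  and J: "real l + g \<le> real (card J)"
 shows "\<exists>\<phi>. inj_on \<phi> {1..l} & \<phi> ` {1..l} \<subseteq> J &
  (\<Sum>w\<in>V. 2 ^ card {i\<in>{1..l}. hit i (\<phi> i) w}) \<le> real (card V) * (1 + B / g) ^ l"
proof -
 have "m \<le> l ==> \<exists>\<phi>. inj_on \<phi> {1..m} & \<phi> ` {1..m} \<subseteq> J &
  (\<Sum>w\<in>V. 2 ^ card {i\<in>{1..m}. hit i (\<phi> i) w}) \<le> real (card V) * (1 + B / g) ^ m" for m
 proof (induction m)
  case 0
  then show ?case by simp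
 next
  case (Suc m)
  then obtain \<phi> where phi: "inj_on \<phi> {1..m}" "\<phi> ` {1..m} \<subseteq> J"
   and pot: "(\<Sum>w\<in>V. 2 ^ card {i\<in>{1..m}. hit i (\<phi> i) w}) \<le> real (card V) * (1 + B / g) ^ m" by auto
  define P where "P w = (2::real) ^ card {i\<in>{1..m}. hit i (\<phi> i) w}" for w
  define A where "A = J - \<phi> ` {1..m}"
  have finA: "finite A" using fin by (simp add: A_def)
  have "card (\<phi> ` {1..m}) = m" using phi(1) by (simp add: card_image)
  then have cA: "g \<le> real (card A)"
   using card_Diff_ge[of "\<phi> ` {1..m}" J] J Suc.prems unfolding A_def by simp
  have P0: "0 \<le> P w" for w by (simp add: P_def)
  have "(\<Sum>j\<in>A. \<Sum>w\<in>V. P w * (1 + of_bool (hit (Suc m) j w))) = (\<Sum>w\<in>V. \<Sum>j\<in>A. P w * (1 + of_bool (hit (Suc m) j w)))"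
   by (rule sum.swap)
  also have "\<dots> = (\<Sum>w\<in>V. P w * (real (card A) + real (card {j\<in>A. hit (Suc m) j w})))"
   using finA by (intro sum.cong refl) (simp add: sum_distrib_left[symmetric] sum.distrib of_bool_def sum.If_cases Int_def)
  also have "\<dots> \<le> (\<Sum>w\<in>V. P w * (real (card A) + B))"
  proof (intro sum_mono mult_left_mono add_left_mono P0)
   fix w assume w: "w \<in> V"
   have "card {j\<in>A. hit (Suc m) j w} \<le> card {j\<in>J. hit (Suc m) j w}"
    using fin by (intro card_mono) (auto simp: A_def)
   moreover have "Suc m \<in> {1..l}" using Suc.prems by simp
   from hit[OF this w] have "real (card {j\<in>J. hit (Suc m) j w}) \<le> B" .
   ultimately show "real (card {j\<in>A. hit (Suc m) j w}) \<le> B" by linarith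
  qed
  also have "\<dots> = (\<Sum>w\<in>V. P w) * (real (card A) + B)" by (simp only: sum_distrib_right)
  also have "\<dots> = real (card A) * ((1 + B / real (card A)) * (\<Sum>w\<in>V. P w))"
   using cA g by (simp add: field_simps)
  also have "\<dots> \<le> real (card A) * ((1 + B / g) * (\<Sum>w\<in>V. P w))"
   using cA g P0 by (intro mult_left_mono mult_right_mono add_left_mono sum_nonneg divide_left_mono) auto
  finally have avg: "(\<Sum>j\<in>A. \<Sum>w\<in>V. P w * (1 + of_bool (hit (Suc m) j w))) \<le> real (card A) * ((1 + B / g) * (\<Sum>w\<in>V. P w))" .
  have "A \<noteq> {}" using cA g by auto
  have "\<exists>j\<in>A. (\<Sum>w\<in>V. P w * (1 + of_bool (hit (Suc m) j w))) \<le> (1 + B / g) * (\<Sum>w\<in>V. P w)"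
  proof (rule ccontr)
   assume "\<not> ?thesis"
   then have "(\<Sum>j\<in>A. (1 + B / g) * (\<Sum>w\<in>V. P w)) < (\<Sum>j\<in>A. \<Sum>w\<in>V. P w * (1 + of_bool (hit (Suc m) j w)))"
    using finA \<open>A \<noteq> {}\<close> by (intro sum_strict_mono) auto
   then show False using avg by simp
  qed
  then obtain j where j: "j \<in> A" "(\<Sum>w\<in>V. P w * (1 + of_bool (hit (Suc m) j w))) \<le> (1 + B / g) * (\<Sum>w\<in>V. P w)" by blast
  define \<phi>' where "\<phi>' = \<phi>(Suc m := j)"
  have at: "{1..Suc m} = insert (Suc m) {1..m}" by auto
  have same: "\<phi>' i = \<phi> i" if "i \<in> {1..m}" for i using that by (simp add: \<phi>'_def)
  have cnt: "2 ^ card {i\<in>{1..Suc m}. hit i (\<phi>' i) w} = P w * (1 + of_bool (hit (Suc m) j w))" for w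
  proof -
   have "{i\<in>{1..Suc m}. hit i (\<phi>' i) w} = (if hit (Suc m) j w then insert (Suc m) else id) {i\<in>{1..m}. hit i (\<phi> i) w}"
    unfolding at using same by (auto simp: \<phi>'_def)
   then show ?thesis by (simp add: P_def)
  qed
  have "(\<Sum>w\<in>V. 2 ^ card {i\<in>{1..Suc m}. hit i (\<phi>' i) w}) \<le> (1 + B / g) * (\<Sum>w\<in>V. P w)"
   unfolding cnt using j(2) .
  also have "\<dots> \<le> (1 + B / g) * (real (card V) * (1 + B / g) ^ m)"
   using pot g unfolding P_def by (intro mult_left_mono) auto
  finally have "(\<Sum>w\<in>V. 2 ^ card {i\<in>{1..Suc m}. hit i (\<phi>' i) w}) \<le> real (card V) * (1 + B / g) ^ Suc m" by (simp add: mult_ac)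
  moreover have "inj_on \<phi>' {1..Suc m}"
  proof -
   have "inj_on \<phi>' {1..m}" using phi(1) by (subst inj_on_cong[OF same]) auto
   moreover have "\<phi>' ` ({1..m} - {Suc m}) = \<phi> ` {1..m}" using same by (intro image_cong) auto
   moreover have "\<phi>' (Suc m) \<notin> \<phi> ` {1..m}" using j(1) by (simp add: A_def \<phi>'_def)
   ultimately show ?thesis unfolding at inj_on_insert by simp
  qed
  moreover have "\<phi>' ` {1..Suc m} \<subseteq> J"
  proof -
   have "\<phi>' ` {1..m} = \<phi> ` {1..m}" using same by (intro image_cong) auto
   then show ?thesis unfolding at image_insert using phi(2) j(1) by (simp add: A_def \<phi>'_def)
  qed
  ultimately show ?case by blast
 qed
 from this[OF order_refl] show ?thesis .
qed

section \<open>From one forest to one configuration\<close>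

text \<open>A path that ends at a bad vertex is continued by a \<open>\<gamma>\<close>-arc to the
  head of another path. \<open>Req\<close> collects these arcs, always from the bad vertex that
  requests the repair to the vertex of \<open>P\<close> that receives it.\<close>

lemma attach_bad_lasts:
 assumes fin: "finite B" and pc: "path_cover r W \<Q>" and B: "B \<subseteq> last ` \<Q>" and P: "P \<subseteq> hd ` \<Q>" "finite P"
  and deg: "\<And>z. z \<in> B ==> m0 \<le> card {y\<in>P. (z, y) \<in> \<gamma>}" and m0: "card B < m0"
 shows "\<exists>\<Q>' Req. Req \<subseteq> \<gamma> \<inter> B \<times> P & single_valued Req & single_valued (Req\<inverse>) &
  path_cover (r \<union> Req) W \<Q>' & last ` \<Q>' = last ` \<Q> - B & hd ` \<Q>' = hd ` \<Q> - Range Req & card (Range Req) \<le> card B"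
 using fin B deg m0
proof (induction B rule: finite_induct)
 case empty
 show ?case using pc by (intro exI[of _ \<Q>] exI[of _ "{}"]) simp
next
 case (insert z B)
 have "\<exists>\<Q>' Req. Req \<subseteq> \<gamma> \<inter> B \<times> P & single_valued Req & single_valued (Req\<inverse>) &
  path_cover (r \<union> Req) W \<Q>' & last ` \<Q>' = last ` \<Q> - B & hd ` \<Q>' = hd ` \<Q> - Range Req & card (Range Req) \<le> card B"
 proof (rule insert.IH)
  show "B \<subseteq> last ` \<Q>" using insert.prems(1) by blast
  show "m0 \<le> card {y\<in>P. (z, y) \<in> \<gamma>}" if "z \<in> B" for z using that by (intro insert.prems(2)) simp
  show "card B < m0" using insert.prems(3) insert.hyps by simp
 qed
 then obtain \<Q>' where "\<exists>Req. Req \<subseteq> \<gamma> \<inter> B \<times> P & single_valued Req & single_valued (Req\<inverse>) &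
  path_cover (r \<union> Req) W \<Q>' & last ` \<Q>' = last ` \<Q> - B & hd ` \<Q>' = hd ` \<Q> - Range Req & card (Range Req) \<le> card B" ..
 then obtain Req where R0: "Req \<subseteq> \<gamma> \<inter> B \<times> P & single_valued Req & single_valued (Req\<inverse>) &
  path_cover (r \<union> Req) W \<Q>' & last ` \<Q>' = last ` \<Q> - B & hd ` \<Q>' = hd ` \<Q> - Range Req & card (Range Req) \<le> card B" ..
 note R = R0[THEN conjunct1] R0[THEN conjunct2, THEN conjunct1] R0[THEN conj_drop2, THEN conjunct1]
  and Q' = R0[THEN conj_drop2, THEN conjunct2, THEN conjunct1] R0[THEN conj_drop4, THEN conjunct1] R0[THEN conj_drop4, THEN conjunct2, THEN conjunct1]
  and cR = R0[THEN conj_drop4, THEN conj_drop2]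
 have "z \<in> last ` \<Q>'" using insert.prems(1) insert.hyps(2) unfolding Q'(2) by simp
 then obtain X where X: "X \<in> \<Q>'" "last X = z" by blast
 have RP: "Range Req \<subseteq> P" using R(1) by blast
 \<comment> \<open>Heads already used must be avoided, and also the head of the path ending in
   \<open>z\<close>, which would close a cycle.\<close>
 let ?D = "insert (hd X) (Range Req)"
 have finD: "finite ?D" using finite_subset[OF RP P(2)] by simp
 have "card ?D \<le> Suc (card B)" using card_insert_le_m1[of "Suc (card B)" "Range Req" "hd X"] cR by simp
 moreover have "Suc (card B) < m0" using insert.prems(3) insert.hyps by simp
 moreover have "m0 \<le> card {y\<in>P. (z, y) \<in> \<gamma>}" by (intro insert.prems(2)) simp
 ultimately have "card ?D < card {y\<in>P. (z, y) \<in> \<gamma>}" by linarith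
 then have "\<not> {y\<in>P. (z, y) \<in> \<gamma>} \<subseteq> ?D" using card_mono[OF finD] by (meson not_le)
 then obtain y where y: "y \<in> P" "(z, y) \<in> \<gamma>" "y \<noteq> hd X" "y \<notin> Range Req" by blast
 have "y \<in> hd ` \<Q>'" using y(1,4) P(1) unfolding Q'(3) by blast
 then obtain q2 where q2: "q2 \<in> \<Q>'" "hd q2 = y" by blast
 have Xq: "X \<noteq> q2" using q2(2) y(3) by blast
 note m = path_cover_merge[OF Q'(1) X(1) q2(1) Xq, of "r \<union> insert (z, y) Req"]
 have mm: "(last X, hd q2) \<in> r \<union> insert (z, y) Req" "r \<union> Req \<subseteq> r \<union> insert (z, y) Req"
  using X(2) q2(2) by (simp, blast)
 have zD: "z \<notin> Domain Req" using R(1) insert.hyps(2) by blast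
 show ?case
 proof (intro exI[of _ "insert (X @ q2) (\<Q>' - {X, q2})"] exI[of _ "insert (z, y) Req"] conjI)
  show "insert (z, y) Req \<subseteq> \<gamma> \<inter> insert z B \<times> P" using R(1) y(1,2) by blast
  show "single_valued (insert (z, y) Req)" using R(2) zD unfolding single_valued_def by blast
  show "single_valued ((insert (z, y) Req)\<inverse>)" using R(3) y(4) unfolding single_valued_def by blast
  show "path_cover (r \<union> insert (z, y) Req) W (insert (X @ q2) (\<Q>' - {X, q2}))"
   by (rule m(1)[OF mm])
  show "last ` insert (X @ q2) (\<Q>' - {X, q2}) = last ` \<Q> - insert z B"
  proof -
   have "last ` insert (X @ q2) (\<Q>' - {X, q2}) = last ` \<Q>' - {last X}"
    by (rule m(3)[OF mm])
   then show ?thesis unfolding Q'(2) X(2) by blast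
  qed
  show "hd ` insert (X @ q2) (\<Q>' - {X, q2}) = hd ` \<Q> - Range (insert (z, y) Req)"
  proof -
   have "hd ` insert (X @ q2) (\<Q>' - {X, q2}) = hd ` \<Q>' - {hd q2}"
    by (rule m(2)[OF mm])
   then show ?thesis unfolding Q'(3) q2(2) by auto
  qed
  have "Range (insert (z, y) Req) = insert y (Range Req)" by auto
  then show "card (Range (insert (z, y) Req)) \<le> card (insert z B)"
   using cR insert.hyps y(4) finite_subset[OF RP P(2)] by simp
 qed
qed

lemma path_cover_rev:
 assumes "path_cover r W \<Q>"
 shows "path_cover (r\<inverse>) W (rev ` \<Q>)" "hd ` rev ` \<Q> = last ` \<Q>" "last ` rev ` \<Q> = hd ` \<Q>"
proof -
 note D = path_coverD[OF assms]
 show "path_cover (r\<inverse>) W (rev ` \<Q>)"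
  unfolding path_cover_def
 proof (intro conjI ballI impI)
  fix q assume "q \<in> rev ` \<Q>"
  then obtain q0 where "q0 \<in> \<Q>" "q = rev q0" by blast
  then show "q \<noteq> []" "distinct q" "successively (\<lambda>x y. (x, y) \<in> r\<inverse>) q"
   using D(1-3)[of q0] by simp_all
 next
  fix q q' assume "q \<in> rev ` \<Q>" "q' \<in> rev ` \<Q>" "q \<noteq> q'"
  then obtain q0 q1 where "q0 \<in> \<Q>" "q = rev q0" "q1 \<in> \<Q>" "q' = rev q1" "q0 \<noteq> q1" by blast
  then show "set q \<inter> set q' = {}" using D(4)[of q0 q1] by simp
 next
  show "(\<Union>q\<in>rev ` \<Q>. set q) = W" using D(5) by simp
 qed
 show "hd ` rev ` \<Q> = last ` \<Q>" "last ` rev ` \<Q> = hd ` \<Q>"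
  unfolding image_image using D(1) by (auto intro!: image_cong simp: hd_rev last_rev)
qed

text \<open>The reversal of \<open>attach_bad_lasts\<close>. \<open>Req\<close> still points from
  the bad vertex to the receiver, so the paths themselves traverse its converse.\<close>

lemma attach_bad_hds:
 assumes fin: "finite B" and pc: "path_cover r W \<Q>" and B: "B \<subseteq> hd ` \<Q>" and P: "P \<subseteq> last ` \<Q>" "finite P"
  and deg: "\<And>z. z \<in> B ==> m0 \<le> card {y\<in>P. (z, y) \<in> \<gamma>}" and m0: "card B < m0"
 shows "\<exists>\<Q>' Req. Req \<subseteq> \<gamma> \<inter> B \<times> P & single_valued Req & single_valued (Req\<inverse>) &
  path_cover (r \<union> Req\<inverse>) W \<Q>' & hd ` \<Q>' = hd ` \<Q> - B & last ` \<Q>' = last ` \<Q> - Range Req & card (Range Req) \<le> card B"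
proof -
 note rv = path_cover_rev[OF pc]
 have "\<exists>\<Q>' Req. Req \<subseteq> \<gamma> \<inter> B \<times> P & single_valued Req & single_valued (Req\<inverse>) &
  path_cover (r\<inverse> \<union> Req) W \<Q>' & last ` \<Q>' = last ` rev ` \<Q> - B & hd ` \<Q>' = hd ` rev ` \<Q> - Range Req & card (Range Req) \<le> card B"
 proof (rule attach_bad_lasts[OF fin rv(1) _ _ P(2) deg m0])
  show "B \<subseteq> last ` rev ` \<Q>" "P \<subseteq> hd ` rev ` \<Q>" unfolding rv(2,3) by (rule B, rule P(1))
 qed
 then obtain \<Q>' where "\<exists>Req. Req \<subseteq> \<gamma> \<inter> B \<times> P & single_valued Req & single_valued (Req\<inverse>) &
  path_cover (r\<inverse> \<union> Req) W \<Q>' & last ` \<Q>' = last ` rev ` \<Q> - B & hd ` \<Q>' = hd ` rev ` \<Q> - Range Req & card (Range Req) \<le> card B" ..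
 then obtain Req where R0: "Req \<subseteq> \<gamma> \<inter> B \<times> P & single_valued Req & single_valued (Req\<inverse>) &
  path_cover (r\<inverse> \<union> Req) W \<Q>' & last ` \<Q>' = last ` rev ` \<Q> - B & hd ` \<Q>' = hd ` rev ` \<Q> - Range Req & card (Range Req) \<le> card B" ..
 note R = R0[THEN conjunct1]
  R0[THEN conjunct2, THEN conjunct1]
  R0[THEN conj_drop2, THEN conjunct1]
  R0[THEN conj_drop2, THEN conjunct2, THEN conjunct1]
  R0[THEN conj_drop4, THEN conjunct1]
  R0[THEN conj_drop4, THEN conjunct2, THEN conjunct1]
  R0[THEN conj_drop4, THEN conj_drop2]
 note rv' = path_cover_rev[OF R(4)]
 have "(r\<inverse> \<union> Req)\<inverse> = r \<union> Req\<inverse>" by auto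
 then have "path_cover (r \<union> Req\<inverse>) W (rev ` \<Q>')" using rv'(1) by simp
 moreover have "hd ` rev ` \<Q>' = hd ` \<Q> - B" "last ` rev ` \<Q>' = last ` \<Q> - Range Req"
  using rv'(2,3) R(5,6) rv(2,3) by simp_all
 ultimately show ?thesis using R(1-3,7) by (intro exI[of _ "rev ` \<Q>'"] exI[of _ Req]) simp
qed

lemma distinct_choice:
 assumes "finite I" "\<And>i. i \<in> I ==> finite (N i)" "\<And>i. i \<in> I ==> card I \<le> card (N i)"
 shows "\<exists>f. inj_on f I & (\<forall>i\<in>I. f i \<in> N i)"
proof (rule hall[OF assms(1,2)])
 fix J assume J: "J \<subseteq> I"
 show "card J \<le> card (\<Union>(N ` J))"
 proof (cases "J = {}")
  case False
  then obtain i where i: "i \<in> J" by blast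
  have fJ: "finite J" by (rule finite_subset[OF J assms(1)])
  have "finite (\<Union>(N ` J))" using fJ J assms(2) by (intro finite_UN_I) auto
  moreover have "N i \<subseteq> \<Union>(N ` J)" using i by blast
  ultimately have "card (N i) \<le> card (\<Union>(N ` J))" by (rule card_mono)
  moreover have "card J \<le> card I" by (rule card_mono[OF assms(1) J])
  moreover have "card I \<le> card (N i)" using i J by (intro assms(3)) blast
  ultimately show ?thesis by linarith
 qed simp
qed

text \<open>Paths become the vertices of a digraph with arcs from the last vertex of one to the head
  of another. Distinct paths have distinct ends, so arc counts are the same as between the
  underlying end sets.\<close>

lemma dense_expander_contracted:
 assumes ex: "dense_expander \<zeta> \<tau> N \<gamma> Ls Hs"
  and f: "inj_on l Q" "l ` Q \<subseteq> Ls" "inj_on h Q" "h ` Q \<subseteq> Hs"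
 shows "dense_expander \<zeta> \<tau> N {(x, y). (l x, h y) \<in> \<gamma>} Q Q"
 unfolding dense_expander_def
proof (intro allI impI, elim conjE)
 fix X Y assume X: "X \<subseteq> Q" "\<tau> * N \<le> real (card X)" and Y: "Y \<subseteq> Q" "\<tau> * N \<le> real (card Y)"
  and s: "(1 - \<zeta>) * N \<le> real (card X) + real (card Y)"
 have c: "card (l ` X) = card X" "card (h ` Y) = card Y"
  using inj_on_subset[OF f(1) X(1)] inj_on_subset[OF f(3) Y(1)] by (simp_all add: card_image)
 have "\<zeta> * N\<^sup>2 \<le> real (card (\<gamma> \<inter> l ` X \<times> h ` Y))"
 proof (rule dense_expanderD[OF ex])
  show "l ` X \<subseteq> Ls" "h ` Y \<subseteq> Hs" using f(2,4) X(1) Y(1) by blast+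
 qed (use c X Y s in simp_all)
 also have "card (\<gamma> \<inter> l ` X \<times> h ` Y) = card ({(x, y). (l x, h y) \<in> \<gamma>} \<inter> X \<times> Y)"
 proof (rule bij_betw_same_card[symmetric])
  show "bij_betw (map_prod l h) ({(x, y). (l x, h y) \<in> \<gamma>} \<inter> X \<times> Y) (\<gamma> \<inter> l ` X \<times> h ` Y)"
   unfolding bij_betw_def
  proof
   have "inj_on (map_prod l h) (X \<times> Y)"
    by (rule map_prod_inj_on[OF inj_on_subset[OF f(1) X(1)] inj_on_subset[OF f(3) Y(1)]])
   then show "inj_on (map_prod l h) ({(x, y). (l x, h y) \<in> \<gamma>} \<inter> X \<times> Y)" by (rule inj_on_subset) blast
   show "map_prod l h ` ({(x, y). (l x, h y) \<in> \<gamma>} \<inter> X \<times> Y) = \<gamma> \<inter> l ` X \<times> h ` Y" by force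
  qed
 qed
 finally show "\<zeta> * N\<^sup>2 \<le> real (card ({(x, y). (l x, h y) \<in> \<gamma>} \<inter> X \<times> Y))" .
qed

lemma arc_path_mono: "arc_path r p ==> r \<subseteq> r' ==> arc_path r' p"
 by (auto elim!: successively_mono)

text \<open>A path whose vertices are paths unfolds to a path of vertices; the zipped list consists
  of exactly the new joining arcs.\<close>

lemma arc_path_concat:
 assumes "ps \<noteq> []" "arc_path {(x, y). (last x, hd y) \<in> \<gamma>} ps"
  and "\<And>p. p \<in> set ps ==> p \<noteq> [] & arc_path r p"
 shows "arc_path (r \<union> set (zip (map last ps) (map hd (tl ps)))) (concat ps) & concat ps \<noteq> [] &
  hd (concat ps) = hd (hd ps) & last (concat ps) = last (last ps) &
  set (zip (map last ps) (map hd (tl ps))) \<subseteq> \<gamma>"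
 using assms
proof (induction ps rule: list_nonempty_induct)
 case (single p)
 have "p \<noteq> []" "arc_path r p" using single.prems(2)[of p] by simp_all
 then show ?case by simp
next
 case (cons p ps)
 let ?Z = "set (zip (map last ps) (map hd (tl ps)))"
 let ?Z' = "set (zip (map last (p # ps)) (map hd (tl (p # ps))))"
 obtain p' ps' where ps: "ps = p' # ps'" using cons.hyps by (cases ps) auto
 have 1: "(last p, hd p') \<in> \<gamma>" "arc_path {(x, y). (last x, hd y) \<in> \<gamma>} ps"
  using cons.prems(1) unfolding ps by simp_all
 have IH: "arc_path (r \<union> ?Z) (concat ps)" "concat ps \<noteq> []" "hd (concat ps) = hd (hd ps)"
  "last (concat ps) = last (last ps)" "?Z \<subseteq> \<gamma>"
 proof -
  have "p \<noteq> [] & arc_path r p" if "p \<in> set ps" for p using that by (intro cons.prems(2)) simp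
  from cons.IH[OF 1(2) this] show "arc_path (r \<union> ?Z) (concat ps)" "concat ps \<noteq> []" "hd (concat ps) = hd (hd ps)"
   "last (concat ps) = last (last ps)" "?Z \<subseteq> \<gamma>" by blast+
 qed
 have Z': "?Z' = insert (last p, hd p') ?Z" by (simp add: ps)
 have pp: "p \<noteq> []" "arc_path r p" using cons.prems(2)[of p] by simp_all
 have sub: "r \<union> ?Z \<subseteq> r \<union> ?Z'" unfolding Z' by blast
 have "arc_path (r \<union> ?Z') p" by (rule arc_path_mono[OF pp(2)]) blast
 moreover have "arc_path (r \<union> ?Z') (concat ps)" by (rule arc_path_mono[OF IH(1) sub])
 moreover have "(last p, hd (concat ps)) \<in> r \<union> ?Z'" using IH(3) Z' by (simp add: ps)
 ultimately have "arc_path (r \<union> ?Z') (concat (p # ps))" using pp IH(2) by (simp add: successively_append_iff)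
 moreover have "?Z' \<subseteq> \<gamma>" unfolding Z' using IH(5) 1(1) by simp
 moreover have "concat (p # ps) \<noteq> []" "hd (concat (p # ps)) = hd (hd (p # ps))"
  "last (concat (p # ps)) = last (last (p # ps))" using pp(1) IH(2,4) cons.hyps by simp_all
 ultimately show ?case by blast
qed

lemma single_valued_zip_tl:
 assumes "distinct ps"
 shows "single_valued (set (zip ps (tl ps)))" "single_valued ((set (zip ps (tl ps)))\<inverse>)"
proof -
 have *: "\<exists>i. Suc i < length ps & x = ps ! i & y = ps ! Suc i" if xy: "(x, y) \<in> set (zip ps (tl ps))" for x y
 proof -
  obtain i where i: "i < length ps" "i < length (tl ps)" "x = ps ! i" "y = tl ps ! i"
   using xy unfolding in_set_zip by auto
  then show ?thesis by (intro exI[of _ i]) (simp add: nth_tl)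
 qed
 show "single_valued (set (zip ps (tl ps)))"
 proof (rule single_valuedI)
  fix x y z assume a: "(x, y) \<in> set (zip ps (tl ps))" "(x, z) \<in> set (zip ps (tl ps))"
  obtain i where i: "Suc i < length ps" "x = ps ! i" "y = ps ! Suc i" using *[OF a(1)] by blast
  obtain j where j: "Suc j < length ps" "x = ps ! j" "z = ps ! Suc j" using *[OF a(2)] by blast
  have "i = j" using nth_eq_iff_index_eq[OF assms, of i j] i j by simp
  then show "y = z" using i j by simp
 qed
 show "single_valued ((set (zip ps (tl ps)))\<inverse>)"
 proof (rule single_valuedI)
  fix x y z assume "(x, y) \<in> (set (zip ps (tl ps)))\<inverse>" "(x, z) \<in> (set (zip ps (tl ps)))\<inverse>"
  then have a: "(y, x) \<in> set (zip ps (tl ps))" "(z, x) \<in> set (zip ps (tl ps))" by simp_all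
  obtain i where i: "Suc i < length ps" "y = ps ! i" "x = ps ! Suc i" using *[OF a(1)] by blast
  obtain j where j: "Suc j < length ps" "z = ps ! j" "x = ps ! Suc j" using *[OF a(2)] by blast
  have "Suc i = Suc j" using nth_eq_iff_index_eq[OF assms, of "Suc i" "Suc j"] i j by simp
  then show "y = z" using i j by simp
 qed
qed

lemma finite_copies: "finite (copies M)" and card_copies: "card (copies M) = size M"
proof -
 have *: "copies M = (SIGMA e:set_mset M. {..<count M e})" by (auto simp: copies_def count_inI)
 show "finite (copies M)" unfolding * by (intro finite_SigmaI) auto
 show "card (copies M) = size M" unfolding * by (simp add: card_SigmaI size_multiset_overloaded_eq)
qed

lemma copies_filter: "copies (filter_mset P M) = {x\<in>copies M. P (fst x)}"
 by (auto simp: copies_def split: if_splits)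

lemma copies_mono: "F \<subseteq># M ==> copies F \<subseteq> copies M"
 unfolding copies_def subseteq_mset_def by (auto intro: less_le_trans)

lemma path_edges_ends:
 assumes "distinct p" "e \<in># path_edges p"
 shows "\<exists>u v. u \<noteq> v & e = {u, v} & u \<in> set p & v \<in> set p"
 using assms
proof (induction p rule: path_edges.induct)
 case (1 u v p)
 show ?case
 proof (cases "e = {u, v}")
  case True
  then show ?thesis using 1(2) by (intro exI[of _ u] exI[of _ v]) auto
 next
  case False
  then have "\<exists>a b. a \<noteq> b & e = {a, b} & a \<in> set (v # p) & b \<in> set (v # p)" using 1 by auto
  then obtain a b where "a \<noteq> b" "e = {a, b}" "a \<in> set (v # p)" "b \<in> set (v # p)" by blast
  then show ?thesis by (intro exI[of _ a] exI[of _ b]) auto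
 qed
qed auto

lemma layout_edges_ends:
 assumes "layout L F" "e \<in># layout_edges L"
 shows "\<exists>u v. u \<noteq> v & e = {u, v} & u \<in> layout_verts L & v \<in> layout_verts L"
proof -
 obtain p where p: "p \<in># L" "e \<in># path_edges p" using assms(2) by (auto simp: layout_edges_def)
 have "distinct p" using assms(1) p(1) by (auto simp: layout_def)
 from path_edges_ends[OF this p(2)] obtain u v where "u \<noteq> v" "e = {u, v}" "u \<in> set p" "v \<in> set p" by blast
 then show ?thesis using p(1) unfolding layout_verts_def by blast
qed

definition graph_path :: "'a list => 'a mpath" where
 "graph_path vs = (vs, map (\<lambda>(u, v). GEdge {u, v}) (zip vs (tl vs)))"

lemma graph_path_nth:
 assumes "Suc i < length vs"
 shows "snd (graph_path vs) ! i = GEdge {vs ! i, vs ! Suc i}"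
 using assms by (simp add: graph_path_def nth_tl)

lemma length_graph_path: "length (snd (graph_path vs)) = length vs - 1"
 by (simp add: graph_path_def)

lemma is_mpath_graph_path: "distinct vs ==> vs \<noteq> [] ==> is_mpath (graph_path vs)"
 unfolding is_mpath_def using graph_path_nth[of _ vs] length_graph_path[of vs]
 by (auto simp: graph_path_def)

lemma distinct_graph_path:
 assumes "distinct vs"
 shows "distinct (snd (graph_path vs))"
 unfolding distinct_conv_nth length_graph_path
proof (intro allI impI)
 fix i j assume ij: "i < length vs - 1" "j < length vs - 1" "i \<noteq> j"
 then have "{vs ! i, vs ! Suc i} \<noteq> {vs ! j, vs ! Suc j}"
  using assms by (simp add: doubleton_eq_iff nth_eq_iff_index_eq)
 then show "snd (graph_path vs) ! i \<noteq> snd (graph_path vs) ! j"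
  using ij graph_path_nth[of i vs] graph_path_nth[of j vs] by simp
qed

lemma in_graph_path:
 assumes "GEdge e \<in> set (snd (graph_path vs))"
 shows "\<exists>i. Suc i < length vs & e = {vs ! i, vs ! Suc i}"
proof -
 obtain i where i: "i < length (snd (graph_path vs))" "snd (graph_path vs) ! i = GEdge e"
  using assms by (metis in_set_conv_nth)
 then have "Suc i < length vs" by (simp add: length_graph_path)
 then show ?thesis using i graph_path_nth[of i vs] by auto
qed

lemma graph_path_edge_cases:
 assumes e: "GEdge e \<in> set (snd (graph_path (u # c @ [v])))" and c: "c \<noteq> []" "arc_path r c"
 shows "e = {u, hd c} \<or> e = {last c, v} \<or> (\<exists>a b. (a, b) \<in> r & e = {a, b})"
  and "\<exists>w\<in>set c. w \<in> e" "e \<subseteq> {u, v} \<union> set c"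
proof -
 let ?vs = "u # c @ [v]"
 obtain i where i: "Suc i < length ?vs" "e = {?vs ! i, ?vs ! Suc i}" using in_graph_path[OF e] by blast
 have "i = 0 \<or> 0 < i & i < length c \<or> i = length c & 0 < i" using i(1) c(1) by auto
 then consider "i = 0" | "0 < i" "i < length c" | "i = length c" "0 < i" by blast
 then have "(e = {u, hd c} \<or> e = {last c, v} \<or> (\<exists>a b. (a, b) \<in> r & e = {a, b})) & (\<exists>w\<in>set c. w \<in> e) & e \<subseteq> {u, v} \<union> set c"
 proof cases
  case 1
  have "e = {u, hd c}" unfolding i(2) 1 using c(1) by (simp add: nth_append hd_conv_nth)
  then show ?thesis using hd_in_set[OF c(1)] by blast
 next
  case 2
  obtain j where j: "i = Suc j" using 2(1) by (cases i) simp_all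
  have e': "e = {c ! j, c ! Suc j}" unfolding i(2) j using 2 j by (simp add: nth_append)
  have "(c ! j, c ! Suc j) \<in> r" using c(2) 2 j by (simp add: successively_conv_nth)
  moreover have "c ! j \<in> set c" "c ! Suc j \<in> set c" using 2 j by simp_all
  ultimately show ?thesis unfolding e' by blast
 next
  case 3
  obtain j where j: "i = Suc j" using 3(2) by (cases i) simp_all
  have "e = {last c, v}" unfolding i(2) j using 3 j c(1) by (simp add: nth_append last_conv_nth)
  then show ?thesis using last_in_set[OF c(1)] by blast
 qed
 then show "e = {u, hd c} \<or> e = {last c, v} \<or> (\<exists>a b. (a, b) \<in> r & e = {a, b})"
  "\<exists>w\<in>set c. w \<in> e" "e \<subseteq> {u, v} \<union> set c" by blast+
qed

lemma sum_le_one_if_unique: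
 fixes f :: "'b => nat"
 assumes "finite C" "\<And>x. x \<in> C ==> f x \<le> 1" "\<And>x y. x \<in> C ==> y \<in> C ==> f x \<noteq> 0 ==> f y \<noteq> 0 ==> x = y"
 shows "(\<Sum>x\<in>C. f x) \<le> 1"
proof (cases "\<exists>x\<in>C. f x \<noteq> 0")
 case True
 then obtain x where x: "x \<in> C" "f x \<noteq> 0" by blast
 have "(\<Sum>y\<in>C. f y) = (\<Sum>y\<in>{x}. f y)"
 proof (rule sum.mono_neutral_right[OF assms(1)])
  show "\<forall>i\<in>C - {x}. f i = 0" using assms(3)[OF x(1) _ x(2)] by blast
 qed (use x(1) in simp)
 then show ?thesis using assms(2)[OF x(1)] by simp
qed simp

lemma count_sum_mset: "finite C ==> count (\<Sum>x\<in>C. M x) e = (\<Sum>x\<in>C. count (M x) e)"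
 by (induction C rule: finite_induct) simp_all

lemma fst_copies: "x \<in> copies M ==> fst x \<in># M"
 by (auto simp: copies_def intro!: count_inI)

text \<open>The edges of \<open>F\<close> represent themselves; every other copy \<open>x\<close> of
  a layout edge is realised through the interior \<open>cc x\<close>. Every graph edge used has an
  end in the interior of its path, and the interiors are disjoint, so no graph edge is used
  twice.\<close>

lemma configuration_of_paths:
 fixes eu ev :: "'a set \<times> nat => 'a" and cc :: "'a set \<times> nat => 'a list"
 assumes L: "layout L F" and C: "C = copies (layout_edges L) - copies F"
  and ends: "\<And>x. x \<in> C ==> eu x \<noteq> ev x & fst x = {eu x, ev x} & eu x \<in> layout_verts L & ev x \<in> layout_verts L"
  and cc: "\<And>x. x \<in> C ==> cc x \<noteq> [] & distinct (cc x)"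
  and ccd: "\<And>x y. x \<in> C ==> y \<in> C ==> x \<noteq> y ==> set (cc x) \<inter> set (cc y) = {}"
  and ccU: "(\<Union>x\<in>C. set (cc x)) = V - layout_verts L"
 shows "\<exists>H. spanning_configuration V L F H & (\<forall>e. count H (FEdge e) = count F e) & (\<forall>e. count H (GEdge e) \<le> 1) &
  (\<forall>e. GEdge e \<in># H --> (\<exists>x\<in>C. GEdge e \<in> set (snd (graph_path (eu x # cc x @ [ev x])))))"
proof -
 define vs where "vs x = eu x # cc x @ [ev x]" for x
 have FL: "F \<subseteq># layout_edges L" using L by (simp add: layout_def)
 have cFL: "copies F \<subseteq> copies (layout_edges L)" by (rule copies_mono[OF FL])
 have "\<exists>u v. u \<noteq> v & fst x = {u, v}" if "x \<in> copies F" for x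
 proof -
  have "x \<in> copies (layout_edges L)" using cFL that by blast
  then have "fst x \<in># layout_edges L" by (rule fst_copies)
  from layout_edges_ends[OF L this] show ?thesis by blast
 qed
 then have "\<forall>x\<in>copies F. \<exists>p. fst p \<noteq> snd p & fst x = {fst p, snd p}" by simp
 from bchoice[OF this] obtain fp where fp: "\<forall>x\<in>copies F. fst (fp x) \<noteq> snd (fp x) & fst x = {fst (fp x), snd (fp x)}" ..
 define fu fv where "fu x = fst (fp x)" and "fv x = snd (fp x)" for x
 have fuv: "fu x \<noteq> fv x & fst x = {fu x, fv x}" if "x \<in> copies F" for x
  using fp[rule_format, OF that] unfolding fu_def fv_def .
 define P where "P x = (if x \<in> copies F then ([fu x, fv x], [FEdge (fst x)]) else graph_path (vs x))" for x
 have PF: "P x = ([fu x, fv x], [FEdge (fst x)])" if "x \<in> copies F" for x using that by (simp add: P_def)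
 have PC: "P x = graph_path (vs x)" if "x \<in> C" for x using that C by (simp add: P_def)
 have split: "copies (layout_edges L) = C \<union> copies F" "C \<inter> copies F = {}" using cFL C by blast+
 have ccW: "set (cc x) \<inter> layout_verts L = {}" if "x \<in> C" for x using ccU that by blast
 have vsd: "distinct (vs x)" if x: "x \<in> C" for x
 proof -
  have "eu x \<notin> set (cc x)" "ev x \<notin> set (cc x)" using ends[OF x] ccW[OF x] by blast+
  then show ?thesis using cc[OF x] ends[OF x] by (simp add: vs_def)
 qed
 have endsC: "path_ends (P x) = fst x" "internal_verts (P x) = set (cc x)" "set (fst (P x)) = {eu x, ev x} \<union> set (cc x)"
  "is_mpath (P x)" if x: "x \<in> C" for x
 proof -
  have 1: "fst (P x) = vs x" by (simp add: PC[OF x] graph_path_def)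
  show 2: "path_ends (P x) = fst x" using ends[OF x] unfolding path_ends_def 1 by (simp add: vs_def)
  show 3: "set (fst (P x)) = {eu x, ev x} \<union> set (cc x)" unfolding 1 by (auto simp: vs_def)
  show "internal_verts (P x) = set (cc x)"
  proof -
   have "eu x \<notin> set (cc x)" "ev x \<notin> set (cc x)" "fst x = {eu x, ev x}" using ends[OF x] ccW[OF x] by blast+
   then show ?thesis unfolding internal_verts_def 2 3 by auto
  qed
  show "is_mpath (P x)" unfolding PC[OF x] by (rule is_mpath_graph_path[OF vsd[OF x]]) (simp add: vs_def)
 qed
 have endsF: "path_ends (P x) = fst x" "internal_verts (P x) = {}" "set (fst (P x)) = fst x" "is_mpath (P x)" if x: "x \<in> copies F" for x
 proof -
  have f: "fu x \<noteq> fv x" "fst x = {fu x, fv x}" using fuv[OF x] by simp_all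
  show 1: "path_ends (P x) = fst x" "set (fst (P x)) = fst x"
   unfolding PF[OF x] path_ends_def f(2) by simp_all
  show "internal_verts (P x) = {}" unfolding internal_verts_def 1 by simp
  show "is_mpath (P x)" unfolding PF[OF x] is_mpath_def using f by simp
 qed
 have FV: "fst x \<subseteq> layout_verts L" if "x \<in> copies F" for x
 proof -
  have "x \<in> copies (layout_edges L)" using cFL that by blast
  then have "fst x \<in># layout_edges L" by (rule fst_copies)
  from layout_edges_ends[OF L this] obtain u v where "fst x = {u, v}" "u \<in> layout_verts L" "v \<in> layout_verts L" by blast
  then show ?thesis by simp
 qed
 define H where "H = (\<Sum>x\<in>copies (layout_edges L). mset (snd (P x)))"
 have conf: "spanning_configuration V L F H"
  unfolding spanning_configuration_def
 proof (intro exI[of _ P] conjI ballI impI)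
  fix x assume "x \<in> copies (layout_edges L)"
  then have "x \<in> C \<or> x \<in> copies F" using split(1) by blast
  then have "is_mpath (P x) & path_ends (P x) = fst x"
  proof
   assume "x \<in> C" then show ?thesis using endsC(1,4)[of x] by simp
  next
   assume "x \<in> copies F" then show ?thesis using endsF(1,4)[of x] by simp
  qed
  then show "is_mpath (P x)" "path_ends (P x) = fst x" by simp_all
 next
  fix x assume "x \<in> copies F"
  then show "snd (P x) = [FEdge (fst x)]" by (simp add: PF)
 next
  fix x y assume x: "x \<in> copies (layout_edges L)" and y: "y \<in> copies (layout_edges L)" and xy: "x \<noteq> y"
  show "set (fst (P x)) \<inter> internal_verts (P y) = {}"
  proof (cases "y \<in> copies F")
   case True
   then show ?thesis using endsF(2) by simp
  next
   case False
   then have yC: "y \<in> C" using y split(1) by blast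
   show ?thesis
   proof (cases "x \<in> copies F")
    case True
    then show ?thesis unfolding endsF(3)[OF True] endsC(2)[OF yC] using FV[OF True] ccW[OF yC] by blast
   next
    case False
    then have xC: "x \<in> C" using x split(1) by blast
    have "eu x \<notin> set (cc y)" "ev x \<notin> set (cc y)" using ends[OF xC] ccW[OF yC] by blast+
    then show ?thesis unfolding endsC(3)[OF xC] endsC(2)[OF yC] using ccd[OF xC yC xy] by simp
   qed
  qed
 next
  have "(\<Union>x\<in>copies (layout_edges L). internal_verts (P x)) = (\<Union>x\<in>C. internal_verts (P x)) \<union> (\<Union>x\<in>copies F. internal_verts (P x))"
   unfolding split(1) by blast
  also have "\<dots> = (\<Union>x\<in>C. set (cc x))" using endsC(2) endsF(2) by simp
  finally show "(\<Union>x\<in>copies (layout_edges L). internal_verts (P x)) = V - layout_verts L" using ccU by simp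
 qed (rule H_def)
 have finC: "finite C" unfolding C by (intro finite_Diff finite_copies)
 have cntH: "count H e = (\<Sum>x\<in>C. count (mset (snd (graph_path (vs x)))) e) + (\<Sum>x\<in>copies F. count {#FEdge (fst x)#} e)" for e
 proof -
  have "count H e = (\<Sum>x\<in>C \<union> copies F. count (mset (snd (P x))) e)"
   unfolding H_def split(1) using finC finite_copies[of F] by (intro count_sum_mset) simp
  also have "\<dots> = (\<Sum>x\<in>C. count (mset (snd (P x))) e) + (\<Sum>x\<in>copies F. count (mset (snd (P x))) e)"
   using finC finite_copies[of F] split(2) by (intro sum.union_disjoint)
  also have "\<dots> = (\<Sum>x\<in>C. count (mset (snd (graph_path (vs x)))) e) + (\<Sum>x\<in>copies F. count {#FEdge (fst x)#} e)"
   using PC PF by simp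
  finally show ?thesis .
 qed
 have noF: "count (mset (snd (graph_path (vs x)))) (FEdge e) = 0" for x e
  by (auto simp: graph_path_def count_eq_zero_iff)
 have cF: "count H (FEdge e) = count F e" for e
 proof -
  have "count H (FEdge e) = (\<Sum>x\<in>copies F. if fst x = e then 1 else 0)"
   unfolding cntH noF sum.neutral_const add_0 by (intro sum.cong refl) auto
  also have "\<dots> = card {x\<in>copies F. fst x = e}" using finite_copies[of F] by (simp add: sum.If_cases Int_def)
  also have "{x\<in>copies F. fst x = e} = {e} \<times> {..<count F e}" by (auto simp: copies_def)
  finally show ?thesis by (simp add: card_cartesian_product)
 qed
 have cG0: "count H (GEdge e) = (\<Sum>x\<in>C. count (mset (snd (graph_path (vs x)))) (GEdge e))" for e
  unfolding cntH by simp
 have mem: "GEdge e \<in> set (snd (graph_path (vs x)))" if "count (mset (snd (graph_path (vs x)))) (GEdge e) \<noteq> 0" for x e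
  using that by (metis count_mset_0_iff)
 have cG: "count H (GEdge e) \<le> 1" for e
  unfolding cG0
 proof (rule sum_le_one_if_unique[OF finC])
  fix x assume x: "x \<in> C"
  show "count (mset (snd (graph_path (vs x)))) (GEdge e) \<le> 1"
   using distinct_graph_path[OF vsd[OF x]] by (simp add: distinct_count_atmost_1)
 next
  fix x y assume x: "x \<in> C" and y: "y \<in> C"
   and nx: "count (mset (snd (graph_path (vs x)))) (GEdge e) \<noteq> 0" and ny: "count (mset (snd (graph_path (vs y)))) (GEdge e) \<noteq> 0"
  \<comment> \<open>The universal relation serves here because only the location of the edge
    matters, not which relation it comes from.\<close>
  have t: "arc_path UNIV c" for c :: "'a list" by (induction c rule: induct_list012) auto
  have cne: "cc x \<noteq> []" "cc y \<noteq> []" using cc x y by blast+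
  obtain w where w: "w \<in> set (cc x)" "w \<in> e"
   using graph_path_edge_cases(2)[OF mem[OF nx, unfolded vs_def] cne(1) t] by blast
  have "e \<subseteq> {eu y, ev y} \<union> set (cc y)" by (rule graph_path_edge_cases(3)[OF mem[OF ny, unfolded vs_def] cne(2) t])
  then have "w \<in> {eu y, ev y} \<union> set (cc y)" using w(2) by blast
  moreover have "w \<notin> layout_verts L" using ccW[OF x] w(1) by blast
  ultimately have "w \<in> set (cc y)" using ends[OF y] by blast
  then show "x = y" using ccd[OF x y] w(1) by blast
 qed
 have memH: "\<exists>x\<in>C. GEdge e \<in> set (snd (graph_path (vs x)))" if "GEdge e \<in># H" for e
 proof -
  have "(\<Sum>x\<in>C. count (mset (snd (graph_path (vs x)))) (GEdge e)) \<noteq> 0" using that unfolding cG0[symmetric] by simp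
  then obtain x where "x \<in> C" "count (mset (snd (graph_path (vs x)))) (GEdge e) \<noteq> 0" by (meson sum.neutral)
  then show ?thesis using mem by blast
 qed
 show ?thesis using conf cF cG memH unfolding vs_def by blast
qed

text \<open>Deleting the layout vertices may cut forest paths, and the forest itself misses a few
  arcs. These are the non-layout vertices that would end a path outside the intended part
  \<open>Vq\<close>.\<close>

definition bad_lasts :: "'a set => 'a list multiset => ('a \<times> 'a) set => 'a set => 'a set" where
 "bad_lasts V L arcs Vq = {w \<in> V - layout_verts L. w \<notin> Vq & (\<forall>v\<in>V - layout_verts L. (w, v) \<notin> arcs)}"

definition bad_hds :: "'a set => 'a list multiset => ('a \<times> 'a) set => 'a set => 'a set" where
 "bad_hds V L arcs Vp = {w \<in> V - layout_verts L. w \<notin> Vp & (\<forall>v\<in>V - layout_verts L. (v, w) \<notin> arcs)}"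

definition adj :: "'a set set => ('a \<times> 'a) set" where
 "adj E = {(u, v). {u, v} \<in> E}"

text \<open>The input for one layout: \<open>\<Gamma>\<close> is what earlier layouts have left of
  the sparse subgraph, \<open>m\<close> the nominal part size, and \<open>Ov\<close> the congested
  vertices that must not receive repair edges. All exceptional sets are bounded by
  \<sigma>m.\<close>

definition step_data where
 "step_data \<zeta> \<sigma> m0 V \<Gamma> L F arcs Vp Vq Ov m \<tau> \<longleftrightarrow>
   simple_graph V \<Gamma> & layout L F & layout_verts L \<subseteq> V & arcs \<subseteq> V \<times> V & single_valued arcs & single_valued (arcs\<inverse>) &
   (\<exists>pos :: 'a => nat. \<forall>u v. (u, v) \<in> arcs --> pos u < pos v) & Vp \<subseteq> V & Vq \<subseteq> V & Vp \<inter> Vq = {} &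
   (\<forall>u v. (u, v) \<in> arcs --> v \<notin> Vp & u \<notin> Vq) & m0 \<le> m & \<zeta> \<le> \<tau> & dense_expander \<zeta> \<tau> m (adj \<Gamma>) Vq Vp &
   \<bar>real (card Vp) - m\<bar> \<le> \<zeta> / 32 * m & \<bar>real (card Vq) - m\<bar> \<le> \<zeta> / 32 * m &
   (\<forall>z\<in>V. 80 * \<tau> * m \<le> real (card (neighbours \<Gamma> z \<inter> Vp)) & 80 * \<tau> * m \<le> real (card (neighbours \<Gamma> z \<inter> Vq))) &
   real (card (bad_lasts V L arcs Vq)) \<le> \<sigma> * m & real (card (bad_hds V L arcs Vp)) \<le> \<sigma> * m &
   real (card (layout_verts L)) \<le> \<sigma> * m & real (size (layout_edges L)) \<le> \<sigma> * m & Ov \<subseteq> V & real (card Ov) \<le> \<sigma> * m"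

text \<open>The edges taken from \<open>\<Gamma>\<close> are split by how they are rationed. The
  linkage edges \<open>R1\<close> form a matching from \<open>Vq\<close> to \<open>Vp\<close>. The
  request edges \<open>Req\<close> are oriented so that a vertex sends no more than it asks for and
  receives at most one, none if it lies in \<open>Ov\<close>.\<close>

definition step_result where
 "step_result \<sigma> V \<Gamma> L F arcs Vp Vq Ov m H R1 Req \<longleftrightarrow>
   spanning_configuration V L F H & (\<forall>e. count H (FEdge e) = count F e) & (\<forall>e. count H (GEdge e) \<le> 1) &
   (\<forall>e. GEdge e \<in># H --> (\<exists>u v. e = {u, v} & ((u, v) \<in> arcs \<or> (u, v) \<in> R1 \<or> (u, v) \<in> Req))) &
   R1 \<subseteq> adj \<Gamma> \<inter> Vq \<times> Vp & single_valued R1 & single_valued (R1\<inverse>) &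
   Req \<subseteq> adj \<Gamma> \<inter> V \<times> (V - Ov) & single_valued (Req\<inverse>) &
   (\<forall>z. card {y. (z, y) \<in> Req} \<le> of_bool (z \<in> bad_lasts V L arcs Vq) + of_bool (z \<in> bad_hds V L arcs Vp) + layout_degree L z) &
   real (card (Range Req)) \<le> 4 * \<sigma> * m"

lemma card_fibre_inj:
 assumes "inj_on h Q"
 shows "card {x\<in>Q. P (h x)} = card {y\<in>h ` Q. P y}"
proof -
 have "{y\<in>h ` Q. P y} = h ` {x\<in>Q. P (h x)}" by blast
 moreover have "inj_on h {x\<in>Q. P (h x)}" by (rule inj_on_subset[OF assms]) blast
 ultimately show ?thesis by (simp add: card_image)
qed

text \<open>For a given copy of a layout edge, \<open>z\<close> is either the \<open>eu\<close> end
  or the \<open>ev\<close> end, never both, so the two fibres together inject into the copies of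
  edges at \<open>z\<close>.\<close>

lemma card_request_degree:
 fixes eu ev :: "'a set \<times> nat => 'a"
 assumes C: "C \<subseteq> copies (layout_edges L)" and e: "\<And>x. x \<in> C ==> eu x \<noteq> ev x & fst x = {eu x, ev x}"
 shows "card ((\<lambda>x. ha x) ` {x\<in>C. eu x = z} \<union> (\<lambda>x. lb x) ` {x\<in>C. ev x = z}) \<le> layout_degree L z"
proof -
 have finC: "finite C" by (rule finite_subset[OF C finite_copies])
 have "card (ha ` {x\<in>C. eu x = z} \<union> lb ` {x\<in>C. ev x = z}) \<le> card (ha ` {x\<in>C. eu x = z}) + card (lb ` {x\<in>C. ev x = z})"
  by (rule card_Un_le)
 also have "\<dots> \<le> card {x\<in>C. eu x = z} + card {x\<in>C. ev x = z}" using finC by (intro add_mono card_image_le) simp_all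
 also have "\<dots> = card ({x\<in>C. eu x = z} \<union> {x\<in>C. ev x = z})"
 proof (rule card_Un_disjoint[symmetric])
  have "\<not> (eu x = z & ev x = z)" if "x \<in> C" for x using e[OF that] by metis
  then show "{x\<in>C. eu x = z} \<inter> {x\<in>C. ev x = z} = {}" by auto
 qed (use finC in simp_all)
 also have "\<dots> \<le> card (copies {#d \<in># layout_edges L. z \<in> d#})"
 proof (rule card_mono[OF finite_copies])
  show "{x\<in>C. eu x = z} \<union> {x\<in>C. ev x = z} \<subseteq> copies {#d \<in># layout_edges L. z \<in> d#}"
  proof
   fix x assume x: "x \<in> {x\<in>C. eu x = z} \<union> {x\<in>C. ev x = z}"
   then have xC: "x \<in> C" by blast
   have "fst x = {eu x, ev x}" using e[OF xC] by simp
   then have "z \<in> fst x" using x by auto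
   then show "x \<in> copies {#d \<in># layout_edges L. z \<in> d#}" unfolding copies_filter using C xC by blast
  qed
 qed
 also have "\<dots> = layout_degree L z" by (simp add: card_copies layout_degree_def)
 finally show ?thesis .
qed

text \<open>The forest restricted to non-layout vertices is a path cover whose last vertices are
  those of \<open>Vq\<close> and the bad ones, and likewise for heads. Repairing both kinds leaves a
  cover with all heads in \<open>Vp\<close> and all last vertices in \<open>Vq\<close>; an end that
  receives a repair edge ceases to be an end.\<close>

lemma requests_resolved:
 fixes m :: real
 assumes sd: "step_data \<zeta> \<sigma> m0 V \<Gamma> L F arcs Vp Vq Ov m \<tau>" and z: "0 < \<zeta>" and s: "0 < \<sigma>" "\<sigma> \<le> \<zeta>" and m: "1 < \<zeta> * m"
 defines "W \<equiv> V - layout_verts L"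
 shows "\<exists>\<Q> Rq1 Rq2. path_cover (arcs \<union> Rq1 \<union> Rq2\<inverse>) W \<Q> &
  Rq1 \<subseteq> adj \<Gamma> \<inter> bad_lasts V L arcs Vq \<times> (Vp \<inter> W - Ov) & single_valued Rq1 & single_valued (Rq1\<inverse>) &
  Rq2 \<subseteq> adj \<Gamma> \<inter> bad_hds V L arcs Vp \<times> (Vq \<inter> W - Ov) & single_valued Rq2 & single_valued (Rq2\<inverse>) &
  hd ` \<Q> = Vp \<inter> W - Range Rq1 & last ` \<Q> = Vq \<inter> W - Range Rq2 &
  real (card (Range Rq1)) \<le> \<sigma> * m & real (card (Range Rq2)) \<le> \<sigma> * m"
proof -
 note c = sd[unfolded step_data_def]
 note g = c[THEN conjunct1]
  and lay = c[THEN conjunct2, THEN conjunct1]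
  and lvV = c[THEN conj_drop2, THEN conjunct1]
  and arcs_V = c[THEN conj_drop2, THEN conjunct2, THEN conjunct1]
  and arcs_sv = c[THEN conj_drop4, THEN conjunct1]
  and arcs_svc = c[THEN conj_drop4, THEN conjunct2, THEN conjunct1]
  and arcs_pos = c[THEN conj_drop4, THEN conj_drop2, THEN conjunct1]
  and VpV = c[THEN conj_drop4, THEN conj_drop2, THEN conjunct2, THEN conjunct1]
  and VqV = c[THEN conj_drop8, THEN conjunct1]
  and Vpq = c[THEN conj_drop8, THEN conjunct2, THEN conjunct1]
  and av = c[THEN conj_drop8, THEN conj_drop2, THEN conjunct1]
  and mm0 = c[THEN conj_drop8, THEN conj_drop2, THEN conjunct2, THEN conjunct1]
  and zt = c[THEN conj_drop8, THEN conj_drop4, THEN conjunct1]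
  and ex = c[THEN conj_drop8, THEN conj_drop4, THEN conjunct2, THEN conjunct1]
  and cVp = c[THEN conj_drop8, THEN conj_drop4, THEN conj_drop2, THEN conjunct1]
  and cVq = c[THEN conj_drop8, THEN conj_drop4, THEN conj_drop2, THEN conjunct2, THEN conjunct1]
  and deg = c[THEN conj_drop8, THEN conj_drop8, THEN conjunct1]
  and cBL = c[THEN conj_drop8, THEN conj_drop8, THEN conjunct2, THEN conjunct1]
  and cBH = c[THEN conj_drop8, THEN conj_drop8, THEN conj_drop2, THEN conjunct1]
  and cLV = c[THEN conj_drop8, THEN conj_drop8, THEN conj_drop2, THEN conjunct2, THEN conjunct1]
  and cLE = c[THEN conj_drop8, THEN conj_drop8, THEN conj_drop4, THEN conjunct1]
  and OvV = c[THEN conj_drop8, THEN conj_drop8, THEN conj_drop4, THEN conjunct2, THEN conjunct1]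
  and cO = c[THEN conj_drop8, THEN conj_drop8, THEN conj_drop4, THEN conj_drop2]
 obtain pos :: "'a => nat" where pos: "\<forall>u v. (u, v) \<in> arcs --> pos u < pos v" using arcs_pos ..
 have fin: "finite V" using g by (simp add: simple_graph_def)
 have finW: "finite W" using fin by (simp add: W_def)
 have mpos: "0 < m" using m z by (smt (verit) mult_nonneg_nonpos)
 have sm: "\<sigma> * m \<le> \<zeta> * m" "\<zeta> * m \<le> \<tau> * m" using s zt mpos by simp_all
 define aW where "aW = arcs \<inter> W \<times> W"
 define BL where "BL = bad_lasts V L arcs Vq"
 define BH where "BH = bad_hds V L arcs Vp"
 have BL: "W - Domain aW = (Vq \<inter> W) \<union> BL" "Vq \<inter> BL = {}"
 proof -
  have avq: "u \<notin> Vq" if "(u, v) \<in> arcs" for u v using av that by blast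
  show "W - Domain aW = (Vq \<inter> W) \<union> BL"
  proof (intro set_eqI iffI)
   fix w assume w: "w \<in> W - Domain aW"
   then have "(w, v) \<notin> arcs" if "v \<in> W" for v using that by (auto simp: aW_def)
   then show "w \<in> (Vq \<inter> W) \<union> BL" using w by (cases "w \<in> Vq") (simp_all add: BL_def bad_lasts_def W_def)
  next
   fix w assume w: "w \<in> (Vq \<inter> W) \<union> BL"
   have "w \<in> W" using w by (auto simp: BL_def bad_lasts_def W_def)
   moreover have "(w, v) \<notin> aW" for v
   proof
    assume v: "(w, v) \<in> aW"
    then have "w \<notin> Vq" using avq[of w v] by (simp add: aW_def)
    then have "w \<in> BL" using w by blast
    then show False using v by (auto simp: BL_def bad_lasts_def aW_def W_def)
   qed
   ultimately show "w \<in> W - Domain aW" by blast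
  qed
  show "Vq \<inter> BL = {}" by (auto simp: BL_def bad_lasts_def)
 qed
 have BH: "W - Range aW = (Vp \<inter> W) \<union> BH" "Vp \<inter> BH = {}"
 proof -
  have avp: "v \<notin> Vp" if "(u, v) \<in> arcs" for u v using av that by blast
  show "W - Range aW = (Vp \<inter> W) \<union> BH"
  proof (intro set_eqI iffI)
   fix w assume w: "w \<in> W - Range aW"
   then have "(v, w) \<notin> arcs" if "v \<in> W" for v using that by (auto simp: aW_def)
   then show "w \<in> (Vp \<inter> W) \<union> BH" using w by (cases "w \<in> Vp") (simp_all add: BH_def bad_hds_def W_def)
  next
   fix w assume w: "w \<in> (Vp \<inter> W) \<union> BH"
   have "w \<in> W" using w by (auto simp: BH_def bad_hds_def W_def)
   moreover have "(v, w) \<notin> aW" for v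
   proof
    assume v: "(v, w) \<in> aW"
    then have "w \<notin> Vp" using avp[of v w] by (simp add: aW_def)
    then have "w \<in> BH" using w by blast
    then show False using v by (auto simp: BH_def bad_hds_def aW_def W_def)
   qed
   ultimately show "w \<in> W - Range aW" by blast
  qed
  show "Vp \<inter> BH = {}" by (auto simp: BH_def bad_hds_def)
 qed
 have BV: "BL \<subseteq> V" "BH \<subseteq> V" by (auto simp: BL_def BH_def bad_lasts_def bad_hds_def)
 have finB: "finite BL" "finite BH" using finite_subset[OF BV(1) fin] finite_subset[OF BV(2) fin] .
 have "\<exists>\<Q>. path_cover aW W \<Q> & hd ` \<Q> = W - Range aW & last ` \<Q> = W - Domain aW"
 proof (rule path_cover_of_arcs[OF finW, where pos = pos])
  show "aW \<subseteq> W \<times> W" by (auto simp: aW_def)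
  show "pos x < pos y" if "(x, y) \<in> aW" for x y using pos that by (simp add: aW_def)
  show "single_valued aW" by (rule single_valued_subset[OF _ arcs_sv]) (simp add: aW_def)
  show "single_valued (aW\<inverse>)" by (rule single_valued_subset[OF _ arcs_svc]) (auto simp: aW_def)
 qed
 then obtain \<Q>0 where Q0: "path_cover aW W \<Q>0 & hd ` \<Q>0 = W - Range aW & last ` \<Q>0 = W - Domain aW" ..
 \<comment> \<open>Excluding layout and congested vertices costs at most 2\<sigma>m of the 80\<tau>m
   neighbours, which still leaves more receivers than there are bad vertices.\<close>
 have cand: "card B + 1 \<le> card {y\<in>S \<inter> W - Ov. (z, y) \<in> adj \<Gamma>}"
  if zV: "z \<in> V" and B: "real (card B) \<le> \<sigma> * m" and S: "S \<subseteq> V" and d: "80 * \<tau> * m \<le> real (card (neighbours \<Gamma> z \<inter> S))" for z B S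
 proof -
  have finD: "finite (layout_verts L \<union> Ov)" using finite_subset[OF lvV fin] finite_subset[OF OvV fin] by simp
  have "neighbours \<Gamma> z \<inter> S - (layout_verts L \<union> Ov) \<subseteq> {y\<in>S \<inter> W - Ov. (z, y) \<in> adj \<Gamma>}"
   using S by (auto simp: W_def adj_def neighbours_def)
  then have "card (neighbours \<Gamma> z \<inter> S - (layout_verts L \<union> Ov)) \<le> card {y\<in>S \<inter> W - Ov. (z, y) \<in> adj \<Gamma>}"
   using finW by (intro card_mono) auto
  moreover have "real (card (layout_verts L \<union> Ov)) \<le> 2 * (\<sigma> * m)"
   using card_Un_le[of "layout_verts L" Ov] cLV cO by linarith
  ultimately have "80 * \<tau> * m - 2 * (\<sigma> * m) \<le> real (card {y\<in>S \<inter> W - Ov. (z, y) \<in> adj \<Gamma>})"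
   using card_Diff_ge[OF finD, of "neighbours \<Gamma> z \<inter> S"] d by linarith
  moreover have "real (card B) + 1 \<le> 80 * \<tau> * m - 2 * (\<sigma> * m)" using B sm m by linarith
  ultimately show ?thesis by linarith
 qed
 have "\<exists>\<Q>' Req. Req \<subseteq> adj \<Gamma> \<inter> BL \<times> (Vp \<inter> W - Ov) & single_valued Req & single_valued (Req\<inverse>) &
  path_cover (aW \<union> Req) W \<Q>' & last ` \<Q>' = last ` \<Q>0 - BL & hd ` \<Q>' = hd ` \<Q>0 - Range Req & card (Range Req) \<le> card BL"
 proof (rule attach_bad_lasts[OF finB(1), where ?m0.0 = "card BL + 1"])
  show "path_cover aW W \<Q>0" using Q0 by simp
  show "BL \<subseteq> last ` \<Q>0" using Q0 BL(1) by simp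
  show "Vp \<inter> W - Ov \<subseteq> hd ` \<Q>0" using Q0 BH(1) by auto
  show "card BL + 1 \<le> card {y\<in>Vp \<inter> W - Ov. (z, y) \<in> adj \<Gamma>}" if "z \<in> BL" for z
  proof (rule cand)
   show zV: "z \<in> V" using that BV by blast
   show "80 * \<tau> * m \<le> real (card (neighbours \<Gamma> z \<inter> Vp))" using deg zV by blast
  qed (use cBL VpV in \<open>simp_all add: BL_def\<close>)
 qed (use finW in simp_all)
 then obtain \<Q>1 where "\<exists>Req. Req \<subseteq> adj \<Gamma> \<inter> BL \<times> (Vp \<inter> W - Ov) & single_valued Req & single_valued (Req\<inverse>) &
  path_cover (aW \<union> Req) W \<Q>1 & last ` \<Q>1 = last ` \<Q>0 - BL & hd ` \<Q>1 = hd ` \<Q>0 - Range Req & card (Range Req) \<le> card BL" ..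
 then obtain Rq1 where R1: "Rq1 \<subseteq> adj \<Gamma> \<inter> BL \<times> (Vp \<inter> W - Ov) & single_valued Rq1 & single_valued (Rq1\<inverse>) &
  path_cover (aW \<union> Rq1) W \<Q>1 & last ` \<Q>1 = last ` \<Q>0 - BL & hd ` \<Q>1 = hd ` \<Q>0 - Range Rq1 & card (Range Rq1) \<le> card BL" ..
 have last1: "last ` \<Q>1 = Vq \<inter> W"
 proof -
  have "last ` \<Q>1 = ((Vq \<inter> W) \<union> BL) - BL" using R1 Q0 BL(1) by simp
  then show ?thesis using BL(2) by blast
 qed
 have hd1: "hd ` \<Q>1 = ((Vp \<inter> W) \<union> BH) - Range Rq1" using R1 Q0 BH(1) by simp
 have RR1: "Range Rq1 \<subseteq> Vp" using R1 by blast
 have "\<exists>\<Q>' Req. Req \<subseteq> adj \<Gamma> \<inter> BH \<times> (Vq \<inter> W - Ov) & single_valued Req & single_valued (Req\<inverse>) &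
  path_cover (aW \<union> Rq1 \<union> Req\<inverse>) W \<Q>' & hd ` \<Q>' = hd ` \<Q>1 - BH & last ` \<Q>' = last ` \<Q>1 - Range Req & card (Range Req) \<le> card BH"
 proof (rule attach_bad_hds[OF finB(2), where ?m0.0 = "card BH + 1"])
  show "path_cover (aW \<union> Rq1) W \<Q>1" using R1 by simp
  show "BH \<subseteq> hd ` \<Q>1" unfolding hd1 using RR1 BH(2) by blast
  show "Vq \<inter> W - Ov \<subseteq> last ` \<Q>1" unfolding last1 by blast
  show "card BH + 1 \<le> card {y\<in>Vq \<inter> W - Ov. (z, y) \<in> adj \<Gamma>}" if "z \<in> BH" for z
  proof (rule cand)
   show zV: "z \<in> V" using that BV by blast
   show "80 * \<tau> * m \<le> real (card (neighbours \<Gamma> z \<inter> Vq))" using deg zV by blast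
  qed (use cBH VqV in \<open>simp_all add: BH_def\<close>)
 qed (use finW in simp_all)
 then obtain \<Q>2 where "\<exists>Req. Req \<subseteq> adj \<Gamma> \<inter> BH \<times> (Vq \<inter> W - Ov) & single_valued Req & single_valued (Req\<inverse>) &
  path_cover (aW \<union> Rq1 \<union> Req\<inverse>) W \<Q>2 & hd ` \<Q>2 = hd ` \<Q>1 - BH & last ` \<Q>2 = last ` \<Q>1 - Range Req & card (Range Req) \<le> card BH" ..
 then obtain Rq2 where R2: "Rq2 \<subseteq> adj \<Gamma> \<inter> BH \<times> (Vq \<inter> W - Ov) & single_valued Rq2 & single_valued (Rq2\<inverse>) &
  path_cover (aW \<union> Rq1 \<union> Rq2\<inverse>) W \<Q>2 & hd ` \<Q>2 = hd ` \<Q>1 - BH & last ` \<Q>2 = last ` \<Q>1 - Range Rq2 & card (Range Rq2) \<le> card BH" ..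
 have "aW \<union> Rq1 \<union> Rq2\<inverse> \<subseteq> arcs \<union> Rq1 \<union> Rq2\<inverse>" by (auto simp: aW_def)
 from path_cover_mono[OF _ this] have pc: "path_cover (arcs \<union> Rq1 \<union> Rq2\<inverse>) W \<Q>2" using R2 by simp
 have hd2: "hd ` \<Q>2 = Vp \<inter> W - Range Rq1"
 proof -
  have "hd ` \<Q>2 = ((Vp \<inter> W) \<union> BH) - Range Rq1 - BH" using R2 hd1 by simp
  then show ?thesis using BH(2) by blast
 qed
 have last2: "last ` \<Q>2 = Vq \<inter> W - Range Rq2" using R2 last1 by simp
 have c1: "real (card (Range Rq1)) \<le> \<sigma> * m"
 proof -
  have "card (Range Rq1) \<le> card BL" using R1 by simp
  then show ?thesis using cBL unfolding BL_def by linarith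
 qed
 have c2: "real (card (Range Rq2)) \<le> \<sigma> * m"
 proof -
  have "card (Range Rq2) \<le> card BH" using R2 by simp
  then show ?thesis using cBH unfolding BH_def by linarith
 qed
 show ?thesis
  by (rule exI[of _ \<Q>2], rule exI[of _ Rq1], rule exI[of _ Rq2])
    (use pc R1 R2 hd2 last2 c1 c2 in \<open>simp add: BL_def BH_def\<close>)
qed

text \<open>For every layout edge outside \<open>F\<close> a first path \<open>a x\<close> and a
  final path \<open>b x\<close> of the cover are attached to its two ends. A spanning linkage from
  all \<open>a x\<close> to all \<open>b x\<close> in the contracted digraph then uses every path of
  the cover, so the unfolded paths use every non-layout vertex.\<close>

lemma configuration_step:
 fixes \<zeta> :: real
 assumes z: "0 < \<zeta>" "\<zeta> \<le> 1"
 shows "\<exists>\<sigma>>0. \<exists>m0::real. \<forall>(V :: 'a set) \<Gamma> L F arcs Vp Vq Ov m \<tau>. step_data \<zeta> \<sigma> m0 V \<Gamma> L F arcs Vp Vq Ov m \<tau> -->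
  (\<exists>H R1 Req. step_result \<sigma> V \<Gamma> L F arcs Vp Vq Ov m H R1 Req)"
proof -
 have z2: "0 < \<zeta> / 2" "\<zeta> / 2 \<le> 1" using z by auto
 from spanning_linkage[OF z2, where 'q = "'a list" and 'c = "'a set \<times> nat"] obtain \<sigma>' where
  s0: "0 < \<sigma>' & (\<exists>N0::nat. \<forall>(Q :: 'a list set) r \<tau> (C :: ('a set \<times> nat) set) a b.
  finite Q & N0 \<le> card Q & \<zeta> / 2 \<le> \<tau> & dense_expander (\<zeta> / 2) \<tau> (real (card Q)) r Q Q &
  (\<forall>x\<in>Q. 32 * \<tau> * real (card Q) \<le> real (card {y\<in>Q. (x, y) \<in> r}) &
      32 * \<tau> * real (card Q) \<le> real (card {y\<in>Q. (y, x) \<in> r})) &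
  finite C & C \<noteq> {} & real (card C) \<le> \<sigma>' * real (card Q) &
  inj_on a C & inj_on b C & a ` C \<subseteq> Q & b ` C \<subseteq> Q & a ` C \<inter> b ` C = {} -->
  (\<exists>W. (\<forall>x\<in>C. path_on r (a x) (b x) (W x)) & (\<forall>x\<in>C. \<forall>y\<in>C. x \<noteq> y --> W x \<inter> W y = {}) &
    (\<Union>x\<in>C. W x) = Q))" ..
 note \<sigma>' = s0[THEN conjunct1]
 from s0[THEN conjunct2] obtain N0 :: nat where link: "\<forall>(Q :: 'a list set) r \<tau> (C :: ('a set \<times> nat) set) a b.
  finite Q & N0 \<le> card Q & \<zeta> / 2 \<le> \<tau> & dense_expander (\<zeta> / 2) \<tau> (real (card Q)) r Q Q &
  (\<forall>x\<in>Q. 32 * \<tau> * real (card Q) \<le> real (card {y\<in>Q. (x, y) \<in> r}) &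
      32 * \<tau> * real (card Q) \<le> real (card {y\<in>Q. (y, x) \<in> r})) &
  finite C & C \<noteq> {} & real (card C) \<le> \<sigma>' * real (card Q) &
  inj_on a C & inj_on b C & a ` C \<subseteq> Q & b ` C \<subseteq> Q & a ` C \<inter> b ` C = {} -->
  (\<exists>W. (\<forall>x\<in>C. path_on r (a x) (b x) (W x)) & (\<forall>x\<in>C. \<forall>y\<in>C. x \<noteq> y --> W x \<inter> W y = {}) &
    (\<Union>x\<in>C. W x) = Q)" ..
 \<comment> \<open>The first bound makes the lost ends of paths negligible against \<zeta>m. The
   second gives |C| at most \<sigma>' times the number of cover paths, which is at least
   m/2.\<close>
 define \<sigma> where "\<sigma> = min (\<zeta> / 256) (\<sigma>' / 2)"
 have s: "0 < \<sigma>" "\<sigma> \<le> \<zeta> / 256" "\<sigma> \<le> \<sigma>' / 2" using z \<sigma>' by (auto simp: \<sigma>_def)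
 define m0 where "m0 = max (2 * real N0) (2 / \<zeta>)"
 show ?thesis
 proof (rule exI[of _ \<sigma>], rule conjI[OF s(1)], rule exI[of _ m0], intro allI impI)
  fix V :: "'a set" and \<Gamma> L F arcs Vp Vq Ov m \<tau>
  assume sd: "step_data \<zeta> \<sigma> m0 V \<Gamma> L F arcs Vp Vq Ov m \<tau>"
  note c = sd[unfolded step_data_def]
  note g = c[THEN conjunct1]
   and lay = c[THEN conjunct2, THEN conjunct1]
   and lvV = c[THEN conj_drop2, THEN conjunct1]
   and arcs_V = c[THEN conj_drop2, THEN conjunct2, THEN conjunct1]
   and arcs_sv = c[THEN conj_drop4, THEN conjunct1]
   and arcs_svc = c[THEN conj_drop4, THEN conjunct2, THEN conjunct1]
   and arcs_pos = c[THEN conj_drop4, THEN conj_drop2, THEN conjunct1]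
   and VpV = c[THEN conj_drop4, THEN conj_drop2, THEN conjunct2, THEN conjunct1]
   and VqV = c[THEN conj_drop8, THEN conjunct1]
   and Vpq = c[THEN conj_drop8, THEN conjunct2, THEN conjunct1]
   and av = c[THEN conj_drop8, THEN conj_drop2, THEN conjunct1]
   and mm0 = c[THEN conj_drop8, THEN conj_drop2, THEN conjunct2, THEN conjunct1]
   and zt = c[THEN conj_drop8, THEN conj_drop4, THEN conjunct1]
   and ex = c[THEN conj_drop8, THEN conj_drop4, THEN conjunct2, THEN conjunct1]
   and cVp = c[THEN conj_drop8, THEN conj_drop4, THEN conj_drop2, THEN conjunct1]
   and cVq = c[THEN conj_drop8, THEN conj_drop4, THEN conj_drop2, THEN conjunct2, THEN conjunct1]
   and deg = c[THEN conj_drop8, THEN conj_drop8, THEN conjunct1]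
   and cBL = c[THEN conj_drop8, THEN conj_drop8, THEN conjunct2, THEN conjunct1]
   and cBH = c[THEN conj_drop8, THEN conj_drop8, THEN conj_drop2, THEN conjunct1]
   and cLV = c[THEN conj_drop8, THEN conj_drop8, THEN conj_drop2, THEN conjunct2, THEN conjunct1]
   and cLE = c[THEN conj_drop8, THEN conj_drop8, THEN conj_drop4, THEN conjunct1]
   and OvV = c[THEN conj_drop8, THEN conj_drop8, THEN conj_drop4, THEN conjunct2, THEN conjunct1]
   and cO = c[THEN conj_drop8, THEN conj_drop8, THEN conj_drop4, THEN conj_drop2]
  have m0: "2 * real N0 \<le> m" "2 / \<zeta> \<le> m" using mm0 by (simp_all add: m0_def)
  have zm2: "2 \<le> \<zeta> * m" using m0(2) z by (simp add: field_simps)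
  have mpos: "0 < m" using zm2 z by (smt (verit) mult_nonneg_nonpos)
  have sm: "\<sigma> * m \<le> \<zeta> / 256 * m" "\<zeta> * m \<le> \<tau> * m" "\<zeta> * m \<le> m" "0 < \<sigma> * m" "\<sigma> * m \<le> \<sigma>' / 2 * m"
   using s zt mpos z mult_right_mono[of \<zeta> 1 m] by (simp_all only: mult_right_mono less_imp_le mult_pos_pos) simp_all
  define W where "W = V - layout_verts L"
  have fin: "finite V" using g by (simp add: simple_graph_def)
  have finL: "finite (layout_verts L)" by (rule finite_subset[OF lvV fin])
  have sz: "\<sigma> \<le> \<zeta>" "1 < \<zeta> * m" using s z zm2 by linarith+
  from requests_resolved[OF sd z(1) s(1) sz, folded W_def] obtain \<Q> where
   "\<exists>Rq1 Rq2. path_cover (arcs \<union> Rq1 \<union> Rq2\<inverse>) W \<Q> &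
   Rq1 \<subseteq> adj \<Gamma> \<inter> bad_lasts V L arcs Vq \<times> (Vp \<inter> W - Ov) & single_valued Rq1 & single_valued (Rq1\<inverse>) &
   Rq2 \<subseteq> adj \<Gamma> \<inter> bad_hds V L arcs Vp \<times> (Vq \<inter> W - Ov) & single_valued Rq2 & single_valued (Rq2\<inverse>) &
   hd ` \<Q> = Vp \<inter> W - Range Rq1 & last ` \<Q> = Vq \<inter> W - Range Rq2 &
   real (card (Range Rq1)) \<le> \<sigma> * m & real (card (Range Rq2)) \<le> \<sigma> * m" ..
  then obtain Rq1 where
   "\<exists>Rq2. path_cover (arcs \<union> Rq1 \<union> Rq2\<inverse>) W \<Q> &
   Rq1 \<subseteq> adj \<Gamma> \<inter> bad_lasts V L arcs Vq \<times> (Vp \<inter> W - Ov) & single_valued Rq1 & single_valued (Rq1\<inverse>) &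
   Rq2 \<subseteq> adj \<Gamma> \<inter> bad_hds V L arcs Vp \<times> (Vq \<inter> W - Ov) & single_valued Rq2 & single_valued (Rq2\<inverse>) &
   hd ` \<Q> = Vp \<inter> W - Range Rq1 & last ` \<Q> = Vq \<inter> W - Range Rq2 &
   real (card (Range Rq1)) \<le> \<sigma> * m & real (card (Range Rq2)) \<le> \<sigma> * m" ..
  then obtain Rq2 where rq: "path_cover (arcs \<union> Rq1 \<union> Rq2\<inverse>) W \<Q> &
   Rq1 \<subseteq> adj \<Gamma> \<inter> bad_lasts V L arcs Vq \<times> (Vp \<inter> W - Ov) & single_valued Rq1 & single_valued (Rq1\<inverse>) &
   Rq2 \<subseteq> adj \<Gamma> \<inter> bad_hds V L arcs Vp \<times> (Vq \<inter> W - Ov) & single_valued Rq2 & single_valued (Rq2\<inverse>) &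
   hd ` \<Q> = Vp \<inter> W - Range Rq1 & last ` \<Q> = Vq \<inter> W - Range Rq2 &
   real (card (Range Rq1)) \<le> \<sigma> * m & real (card (Range Rq2)) \<le> \<sigma> * m" ..
  note Rq_pc = rq[THEN conjunct1]
   and Rq1 = rq[THEN conjunct2, THEN conjunct1]
   and sv1 = rq[THEN conj_drop2, THEN conjunct1]
   and sv1c = rq[THEN conj_drop2, THEN conjunct2, THEN conjunct1]
   and Rq2 = rq[THEN conj_drop4, THEN conjunct1]
   and sv2 = rq[THEN conj_drop4, THEN conjunct2, THEN conjunct1]
   and sv2c = rq[THEN conj_drop4, THEN conj_drop2, THEN conjunct1]
   and hdQ = rq[THEN conj_drop4, THEN conj_drop2, THEN conjunct2, THEN conjunct1]
   and lastQ = rq[THEN conj_drop8, THEN conjunct1]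
   and cR1 = rq[THEN conj_drop8, THEN conjunct2, THEN conjunct1]
   and cR2 = rq[THEN conj_drop8, THEN conj_drop2]
  define r2 where "r2 = arcs \<union> Rq1 \<union> Rq2\<inverse>"
  have pc: "path_cover r2 W \<Q>" using Rq_pc unfolding r2_def .
  have finW: "finite W" using fin by (simp add: W_def)
  have finQ: "finite \<Q>" by (rule path_cover_finite[OF pc finW])
  have ih: "inj_on hd \<Q>" and il: "inj_on last \<Q>" using path_cover_inj[OF pc] by simp_all
  have finR: "finite (Range Rq1)" "finite (Range Rq2)"
   using finite_subset[of "Range Rq1" V] finite_subset[of "Range Rq2" V] Rq1 Rq2 VpV VqV fin by blast+
  have hdV: "hd ` \<Q> \<subseteq> Vp" "last ` \<Q> \<subseteq> Vq" unfolding hdQ lastQ by blast+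
  define N where "N = real (card \<Q>)"
  have Nhd: "N = real (card (hd ` \<Q>))" unfolding N_def by (simp add: card_image[OF ih])
  have finD1: "finite (layout_verts L \<union> Range Rq1)" and finD2: "finite (layout_verts L \<union> Range Rq2)"
   using finL finR by simp_all
  have cD: "real (card (layout_verts L \<union> Range Rq1)) \<le> 2 * (\<sigma> * m)" "real (card (layout_verts L \<union> Range Rq2)) \<le> 2 * (\<sigma> * m)"
   using card_Un_le[of "layout_verts L" "Range Rq1"] card_Un_le[of "layout_verts L" "Range Rq2"] cLV cR1 cR2 by linarith+
  have hdsub: "S \<inter> Vp - (layout_verts L \<union> Range Rq1) = S \<inter> hd ` \<Q>" "S \<inter> Vq - (layout_verts L \<union> Range Rq2) = S \<inter> last ` \<Q>" for S
   unfolding hdQ lastQ W_def using VpV VqV by blast+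
  have Nm: "\<bar>N - m\<bar> \<le> \<zeta> / 16 * m"
  proof -
   have "card (hd ` \<Q>) \<le> card Vp" by (rule card_mono[OF finite_subset[OF VpV fin] hdV(1)])
   moreover have "real (card Vp) - 2 * (\<sigma> * m) \<le> real (card (hd ` \<Q>))"
    using card_Diff_ge[OF finD1, of "UNIV \<inter> Vp"] cD(1) unfolding hdsub by simp
   ultimately show ?thesis using cVp sm unfolding Nhd abs_le_iff by linarith
  qed
  \<comment> \<open>A path is represented as one vertex; an arc means that a
    \<open>\<Gamma>\<close>-edge can continue the first path by the second.\<close>
  define rQ where "rQ = {(x, y). (last x, hd y) \<in> adj \<Gamma>}"
  have exQ: "dense_expander \<zeta> \<tau> m rQ \<Q> \<Q>"
   unfolding rQ_def by (rule dense_expander_contracted[OF ex il hdV(2) ih hdV(1)])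
  have exN: "dense_expander (\<zeta> / 2) (2 * \<tau>) (real (card \<Q>)) rQ \<Q> \<Q>"
  proof (rule dense_expander_rescale[OF exQ z])
   show "\<bar>real (card \<Q>) - m\<bar> \<le> \<zeta> / 8 * m" using Nm sm z mpos unfolding N_def by linarith
  qed (use zt z mpos in auto)
  have dh: "80 * \<tau> * m - 2 * (\<sigma> * m) \<le> real (card (neighbours \<Gamma> v \<inter> hd ` \<Q>))" if "v \<in> V" for v
   using card_Diff_ge[OF finD1, of "neighbours \<Gamma> v \<inter> Vp"] cD(1) deg[rule_format, OF that] unfolding hdsub by linarith
  have dl: "80 * \<tau> * m - 2 * (\<sigma> * m) \<le> real (card (neighbours \<Gamma> v \<inter> last ` \<Q>))" if "v \<in> V" for v
   using card_Diff_ge[OF finD2, of "neighbours \<Gamma> v \<inter> Vq"] cD(2) deg[rule_format, OF that] unfolding hdsub by linarith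
  have eqh: "card {Q\<in>\<Q>. (v, hd Q) \<in> adj \<Gamma>} = card (neighbours \<Gamma> v \<inter> hd ` \<Q>)" for v
   unfolding card_fibre_inj[OF ih, of "\<lambda>y. (v, y) \<in> adj \<Gamma>"] by (rule arg_cong[where f = card]) (auto simp: adj_def neighbours_def)
  have eql: "card {Q\<in>\<Q>. (last Q, v) \<in> adj \<Gamma>} = card (neighbours \<Gamma> v \<inter> last ` \<Q>)" for v
   unfolding card_fibre_inj[OF il, of "\<lambda>y. (y, v) \<in> adj \<Gamma>"]
   by (rule arg_cong[where f = card]) (auto simp: adj_def neighbours_def insert_commute)
  \<comment> \<open>The linkage is applied with 2\<tau> in place of \<tau> and hence needs degrees
    64\<tau>N. As N is at most 17/16 m, this is at most 68\<tau>m, within the 80\<tau>m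
    provided.\<close>
  have N64: "64 * \<tau> * N \<le> 80 * \<tau> * m - 2 * (\<sigma> * m)"
  proof -
   have "N \<le> 17 / 16 * m" using Nm sm(3) unfolding abs_le_iff by linarith
   then have "64 * \<tau> * N \<le> 64 * \<tau> * (17 / 16 * m)" using zt z by (intro mult_left_mono) auto
   also have "\<dots> = 68 * (\<tau> * m)" by simp
   finally show ?thesis using sm by linarith
  qed
  have QV: "hd Q \<in> V" "last Q \<in> V" if "Q \<in> \<Q>" for Q using hdV VpV VqV that by blast+
  define C where "C = copies (layout_edges L) - copies F"
  have finC: "finite C" unfolding C_def by (intro finite_Diff finite_copies)
  have "card C \<le> card (copies (layout_edges L))" unfolding C_def by (rule card_mono[OF finite_copies]) blast
  then have cC: "real (card C) \<le> \<sigma> * m" using cLE by (simp add: card_copies)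
  have FL: "F \<subseteq># layout_edges L" "layout_edges L - F \<noteq> {#}" using lay by (simp_all add: layout_def)
  \<comment> \<open>Here the layout condition that not all edges are prescribed enters: some path
    must be free to pick up the remaining vertices.\<close>
  have Cne: "C \<noteq> {}"
  proof -
   obtain e where "e \<in># layout_edges L - F" using FL(2) by blast
   then have "count F e < count (layout_edges L) e" by (simp add: in_diff_count)
   then have "(e, count F e) \<in> C" by (simp add: C_def copies_def)
   then show ?thesis by blast
  qed
  have "\<forall>x\<in>C. \<exists>p. fst p \<noteq> snd p & fst x = {fst p, snd p} & fst p \<in> layout_verts L & snd p \<in> layout_verts L"
  proof
   fix x assume "x \<in> C"
   then have "fst x \<in># layout_edges L" by (intro fst_copies) (simp add: C_def)
   from layout_edges_ends[OF lay this]
   show "\<exists>p. fst p \<noteq> snd p & fst x = {fst p, snd p} & fst p \<in> layout_verts L & snd p \<in> layout_verts L" by simp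
  qed
  from bchoice[OF this] obtain ep where ep: "\<forall>x\<in>C. fst (ep x) \<noteq> snd (ep x) & fst x = {fst (ep x), snd (ep x)} &
   fst (ep x) \<in> layout_verts L & snd (ep x) \<in> layout_verts L" ..
  define eu ev where "eu x = fst (ep x)" and "ev x = snd (ep x)" for x
  have ends: "eu x \<noteq> ev x & fst x = {eu x, ev x} & eu x \<in> layout_verts L & ev x \<in> layout_verts L" if "x \<in> C" for x
   using ep[rule_format, OF that] unfolding eu_def ev_def .
  \<comment> \<open>Both choices for all layout edges are made at once, \<open>Inl\<close> for first
    and \<open>Inr\<close> for final paths, so that one injective choice makes all these paths
    distinct.\<close>
  define Cand where "Cand = case_sum (\<lambda>x. {Q\<in>\<Q>. (eu x, hd Q) \<in> adj \<Gamma>} - {Q\<in>\<Q>. hd Q \<in> Ov})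
    (\<lambda>x. {Q\<in>\<Q>. (last Q, ev x) \<in> adj \<Gamma>} - {Q\<in>\<Q>. last Q \<in> Ov})"
  define I where "I = (Inl ` C \<union> Inr ` C :: ('a set \<times> nat + 'a set \<times> nat) set)"
  have finO: "finite Ov" by (rule finite_subset[OF OvV fin])
  have cOv: "real (card {Q\<in>\<Q>. hd Q \<in> Ov}) \<le> \<sigma> * m" "real (card {Q\<in>\<Q>. last Q \<in> Ov}) \<le> \<sigma> * m"
  proof -
   have "card {y\<in>hd ` \<Q>. y \<in> Ov} \<le> card Ov" "card {y\<in>last ` \<Q>. y \<in> Ov} \<le> card Ov" using finO by (intro card_mono; blast)+
   then show "real (card {Q\<in>\<Q>. hd Q \<in> Ov}) \<le> \<sigma> * m" "real (card {Q\<in>\<Q>. last Q \<in> Ov}) \<le> \<sigma> * m"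
    unfolding card_fibre_inj[OF ih, of "\<lambda>y. y \<in> Ov"] card_fibre_inj[OF il, of "\<lambda>y. y \<in> Ov"] using cO by linarith+
  qed
  have cI: "real (card I) \<le> 2 * (\<sigma> * m)"
  proof -
   have "card I \<le> card C + card C" unfolding I_def by (intro order_trans[OF card_Un_le] add_mono card_image_le finC)
   then show ?thesis using cC by linarith
  qed
  have "\<exists>f. inj_on f I & (\<forall>i\<in>I. f i \<in> Cand i)"
  proof (rule distinct_choice)
   show "finite I" using finC by (simp add: I_def)
   show "finite (Cand i)" for i using finQ by (cases i) (simp_all add: Cand_def)
   fix i assume "i \<in> I"
   then consider x where "i = Inl x" "x \<in> C" | x where "i = Inr x" "x \<in> C" unfolding I_def by blast
   then show "card I \<le> card (Cand i)"
   proof cases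
    case 1
    have "eu x \<in> V" using ends[OF 1(2)] lvV by blast
    from dh[OF this] have "80 * \<tau> * m - 2 * (\<sigma> * m) \<le> real (card {Q\<in>\<Q>. (eu x, hd Q) \<in> adj \<Gamma>})" unfolding eqh .
    moreover have "real (card {Q\<in>\<Q>. (eu x, hd Q) \<in> adj \<Gamma>}) - real (card {Q\<in>\<Q>. hd Q \<in> Ov}) \<le> real (card (Cand i))"
     unfolding 1(1) Cand_def sum.case by (rule card_Diff_ge) (use finQ in simp)
    ultimately show ?thesis using cI cOv(1) sm by linarith
   next
    case 2
    have "ev x \<in> V" using ends[OF 2(2)] lvV by blast
    from dl[OF this] have "80 * \<tau> * m - 2 * (\<sigma> * m) \<le> real (card {Q\<in>\<Q>. (last Q, ev x) \<in> adj \<Gamma>})" unfolding eql .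
    moreover have "real (card {Q\<in>\<Q>. (last Q, ev x) \<in> adj \<Gamma>}) - real (card {Q\<in>\<Q>. last Q \<in> Ov}) \<le> real (card (Cand i))"
     unfolding 2(1) Cand_def sum.case by (rule card_Diff_ge) (use finQ in simp)
    ultimately show ?thesis using cI cOv(2) sm by linarith
   qed
  qed
  then obtain f where f: "inj_on f I & (\<forall>i\<in>I. f i \<in> Cand i)" ..
  define a where "a x = f (Inl x)" for x
  define b where "b x = f (Inr x)" for x
  have inI: "Inl x \<in> I" "Inr x \<in> I" if "x \<in> C" for x using that by (simp_all add: I_def)
  have aC: "a x \<in> \<Q>" "(eu x, hd (a x)) \<in> adj \<Gamma>" "hd (a x) \<notin> Ov" if x: "x \<in> C" for x
  proof -
   have "a x \<in> Cand (Inl x)" unfolding a_def using f inI(1)[OF x] by blast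
   then show "a x \<in> \<Q>" "(eu x, hd (a x)) \<in> adj \<Gamma>" "hd (a x) \<notin> Ov" by (simp_all add: Cand_def)
  qed
  have bC: "b x \<in> \<Q>" "(last (b x), ev x) \<in> adj \<Gamma>" "last (b x) \<notin> Ov" if x: "x \<in> C" for x
  proof -
   have "b x \<in> Cand (Inr x)" unfolding b_def using f inI(2)[OF x] by blast
   then show "b x \<in> \<Q>" "(last (b x), ev x) \<in> adj \<Gamma>" "last (b x) \<notin> Ov" by (simp_all add: Cand_def)
  qed
  have fe: "i = j" if "i \<in> I" "j \<in> I" "f i = f j" for i j using f that by (meson inj_onD)
  have inja: "inj_on a C" and injb: "inj_on b C" and ab: "a ` C \<inter> b ` C = {}"
  proof -
   show "inj_on a C" unfolding a_def by (rule inj_onI) (use fe inI in blast)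
   show "inj_on b C" unfolding b_def by (rule inj_onI) (use fe inI in blast)
   have "f (Inl x) \<noteq> f (Inr y)" if "x \<in> C" "y \<in> C" for x y using fe[OF inI(1)[OF that(1)] inI(2)[OF that(2)]] by auto
   then show "a ` C \<inter> b ` C = {}" unfolding a_def b_def by blast
  qed
  have "\<exists>Wl. (\<forall>x\<in>C. path_on rQ (a x) (b x) (Wl x)) & (\<forall>x\<in>C. \<forall>y\<in>C. x \<noteq> y --> Wl x \<inter> Wl y = {}) & (\<Union>x\<in>C. Wl x) = \<Q>"
  proof (rule link[rule_format, where \<tau> = "2 * \<tau>"], intro conjI ballI)
   have mN: "m \<le> 2 * N" using Nm sm(3) unfolding abs_le_iff by linarith
   then show "N0 \<le> card \<Q>" using m0(1) unfolding N_def by linarith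
   have "\<sigma>' / 2 * m \<le> \<sigma>' * N" using mult_left_mono[OF mN, of "\<sigma>' / 2"] \<sigma>' by simp
   then show "real (card C) \<le> \<sigma>' * real (card \<Q>)" using cC sm(5) unfolding N_def by linarith
   show "\<zeta> / 2 \<le> 2 * \<tau>" using zt z by linarith
   fix Q assume Q: "Q \<in> \<Q>"
   show "32 * (2 * \<tau>) * real (card \<Q>) \<le> real (card {y\<in>\<Q>. (Q, y) \<in> rQ})"
    using dh[OF QV(2)[OF Q]] eqh[of "last Q"] N64 unfolding N_def rQ_def by simp
   show "32 * (2 * \<tau>) * real (card \<Q>) \<le> real (card {y\<in>\<Q>. (y, Q) \<in> rQ})"
    using dl[OF QV(1)[OF Q]] eql[of "hd Q"] N64 unfolding N_def rQ_def by simp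
  qed (use finQ exN finC Cne inja injb ab aC(1) bC(1) in \<open>auto\<close>)
  then obtain Wl where Wl: "(\<forall>x\<in>C. path_on rQ (a x) (b x) (Wl x)) & (\<forall>x\<in>C. \<forall>y\<in>C. x \<noteq> y --> Wl x \<inter> Wl y = {}) & (\<Union>x\<in>C. Wl x) = \<Q>" ..
  have "\<forall>x\<in>C. \<exists>p. p \<noteq> [] & hd p = a x & last p = b x & distinct p & set p = Wl x & arc_path rQ p"
   using Wl unfolding path_on_def by blast
  from bchoice[OF this] obtain ps where ps: "\<forall>x\<in>C. ps x \<noteq> [] & hd (ps x) = a x & last (ps x) = b x & distinct (ps x) & set (ps x) = Wl x & arc_path rQ (ps x)" ..
  have psQ: "set (ps x) \<subseteq> \<Q>" if "x \<in> C" for x using ps[rule_format, OF that] Wl that by blast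
  have psd: "set (ps x) \<inter> set (ps y) = {}" if "x \<in> C" "y \<in> C" "x \<noteq> y" for x y
  proof -
   have "Wl x \<inter> Wl y = {}" using Wl that by blast
   then show ?thesis using ps[rule_format, OF that(1)] ps[rule_format, OF that(2)] by simp
  qed
  define cc where "cc x = concat (ps x)" for x
  define Zx where "Zx x = set (zip (map last (ps x)) (map hd (tl (ps x))))" for x
  have cat: "arc_path (r2 \<union> Zx x) (cc x) & cc x \<noteq> [] & hd (cc x) = hd (a x) & last (cc x) = last (b x) & Zx x \<subseteq> adj \<Gamma>"
   if x: "x \<in> C" for x
  proof -
   have p: "ps x \<noteq> []" "hd (ps x) = a x" "last (ps x) = b x" "arc_path {(x, y). (last x, hd y) \<in> adj \<Gamma>} (ps x)"
    using ps[rule_format, OF x] unfolding rQ_def by simp_all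
   have "q \<noteq> [] & arc_path r2 q" if "q \<in> set (ps x)" for q
    using path_coverD(1,3)[OF pc] psQ[OF x] that by blast
   from arc_path_concat[OF p(1,4) this] show ?thesis unfolding cc_def Zx_def p(2,3) .
  qed
  have setcc: "set (cc x) = (\<Union>q\<in>set (ps x). set q)" for x by (simp add: cc_def)
  have dcc: "distinct (cc x)" if x: "x \<in> C" for x
  proof -
   have d: "distinct (ps x)" using ps[rule_format, OF x] by simp
   show ?thesis unfolding cc_def
   proof (rule distinct_concat[OF d])
    show "distinct q" if "q \<in> set (ps x)" for q using path_coverD(2)[OF pc] psQ[OF x] that by blast
    show "set q \<inter> set q' = {}" if "q \<in> set (ps x)" "q' \<in> set (ps x)" "q \<noteq> q'" for q q'
     using path_coverD(4)[OF pc, of q q'] psQ[OF x] that by blast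
   qed
  qed
  have ccd: "set (cc x) \<inter> set (cc y) = {}" if xy: "x \<in> C" "y \<in> C" "x \<noteq> y" for x y
  proof -
   have "set q \<inter> set q' = {}" if "q \<in> set (ps x)" "q' \<in> set (ps y)" for q q'
   proof -
    have "q \<noteq> q'" using psd[OF xy] that by blast
    then show ?thesis using path_coverD(4)[OF pc, of q q'] psQ[OF xy(1)] psQ[OF xy(2)] that by blast
   qed
   then show ?thesis unfolding setcc by blast
  qed
  have ccU: "(\<Union>x\<in>C. set (cc x)) = V - layout_verts L"
  proof -
   have "(\<Union>x\<in>C. set (ps x)) = (\<Union>x\<in>C. Wl x)" by (rule SUP_cong[OF refl]) (use ps in simp)
   then have "(\<Union>x\<in>C. set (ps x)) = \<Q>" using Wl by simp
   moreover have "(\<Union>x\<in>C. set (cc x)) = (\<Union>q\<in>(\<Union>x\<in>C. set (ps x)). set q)" unfolding setcc by blast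
   ultimately show ?thesis using path_coverD(5)[OF pc] unfolding W_def by simp
  qed
  have "\<exists>H. spanning_configuration V L F H & (\<forall>e. count H (FEdge e) = count F e) & (\<forall>e. count H (GEdge e) \<le> 1) &
   (\<forall>e. GEdge e \<in># H --> (\<exists>x\<in>C. GEdge e \<in> set (snd (graph_path (eu x # cc x @ [ev x])))))"
   by (rule configuration_of_paths[OF lay C_def ends _ ccd ccU]) (use cat dcc in simp_all)
  then obtain H where H: "spanning_configuration V L F H & (\<forall>e. count H (FEdge e) = count F e) & (\<forall>e. count H (GEdge e) \<le> 1) &
   (\<forall>e. GEdge e \<in># H --> (\<exists>x\<in>C. GEdge e \<in> set (snd (graph_path (eu x # cc x @ [ev x])))))" ..
  \<comment> \<open>\<open>ZZ\<close> relates consecutive paths of the cover in the linkage. Its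
    image under last vertex and head is the set of linkage edges, and it remains a matching since
    both end maps are injective on the cover.\<close>
  define ZZ where "ZZ = (\<Union>x\<in>C. set (zip (ps x) (tl (ps x))))"
  define R1 where "R1 = map_prod last hd ` ZZ"
  have ZxR: "Zx x = map_prod last hd ` set (zip (ps x) (tl (ps x)))" for x
   unfolding Zx_def by (simp add: zip_map_map map_prod_def)
  have R1Z: "R1 = (\<Union>x\<in>C. Zx x)" unfolding R1_def ZZ_def ZxR by blast
  have zipin: "Q \<in> set (ps x) & Q' \<in> set (ps x)" if "(Q, Q') \<in> set (zip (ps x) (tl (ps x)))" for Q Q' x
   using set_zip_leftD[OF that] set_zip_rightD[OF that] by (cases "ps x") auto
  have ZZin: "\<exists>x\<in>C. (Q, Q') \<in> set (zip (ps x) (tl (ps x)))" if "(Q, Q') \<in> ZZ" for Q Q' using that unfolding ZZ_def by blast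
  have same: "x = y" if "x \<in> C" "y \<in> C" "Q \<in> set (ps x)" "Q \<in> set (ps y)" for x y Q using psd[OF that(1,2)] that(3,4) by blast
  have dps: "distinct (ps x)" if "x \<in> C" for x using ps[rule_format, OF that] by simp
  have ZZQ: "Q \<in> \<Q>" "Q' \<in> \<Q>" if QQ: "(Q, Q') \<in> ZZ" for Q Q'
  proof -
   obtain x where x: "x \<in> C" "(Q, Q') \<in> set (zip (ps x) (tl (ps x)))" using ZZin[OF QQ] by blast
   then show "Q \<in> \<Q>" "Q' \<in> \<Q>" using zipin[OF x(2)] psQ[OF x(1)] by blast+
  qed
  have svZ: "Q' = Q''" if q: "(Q, Q') \<in> ZZ" "(Q, Q'') \<in> ZZ" for Q Q' Q''
  proof -
   obtain x where x: "x \<in> C" "(Q, Q') \<in> set (zip (ps x) (tl (ps x)))" using ZZin[OF q(1)] by blast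
   obtain y where y: "y \<in> C" "(Q, Q'') \<in> set (zip (ps y) (tl (ps y)))" using ZZin[OF q(2)] by blast
   have "x = y" by (rule same[of x y Q]) (use x y zipin[OF x(2)] zipin[OF y(2)] in simp_all)
   then show ?thesis using single_valuedD[OF single_valued_zip_tl(1)[OF dps[OF x(1)]] x(2)] y(2) by simp
  qed
  have svZc: "Q' = Q''" if q: "(Q', Q) \<in> ZZ" "(Q'', Q) \<in> ZZ" for Q Q' Q''
  proof -
   obtain x where x: "x \<in> C" "(Q', Q) \<in> set (zip (ps x) (tl (ps x)))" using ZZin[OF q(1)] by blast
   obtain y where y: "y \<in> C" "(Q'', Q) \<in> set (zip (ps y) (tl (ps y)))" using ZZin[OF q(2)] by blast
   have "x = y" by (rule same[of x y Q]) (use x y zipin[OF x(2)] zipin[OF y(2)] in simp_all)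
   then show ?thesis using single_valuedD[OF single_valued_zip_tl(2)[OF dps[OF x(1)]], of Q Q' Q''] x(2) y(2) by simp
  qed
  have R1in: "\<exists>Q Q'. (Q, Q') \<in> ZZ & u = last Q & v = hd Q'" if "(u, v) \<in> R1" for u v using that unfolding R1_def by auto
  have svR1: "single_valued R1" "single_valued (R1\<inverse>)"
  proof -
   show "single_valued R1"
   proof (rule single_valuedI)
    fix u v w assume uv: "(u, v) \<in> R1" "(u, w) \<in> R1"
    obtain Q Q' where 1: "(Q, Q') \<in> ZZ" "u = last Q" "v = hd Q'" using R1in[OF uv(1)] by blast
    obtain P P' where 2: "(P, P') \<in> ZZ" "u = last P" "w = hd P'" using R1in[OF uv(2)] by blast
    have "Q = P" by (rule inj_onD[OF il]) (use 1 2 ZZQ in simp_all)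
    then have "Q' = P'" using svZ[of Q Q' P'] 1 2 by simp
    then show "v = w" using 1 2 by simp
   qed
   show "single_valued (R1\<inverse>)"
   proof (rule single_valuedI)
    fix u v w assume "(u, v) \<in> R1\<inverse>" "(u, w) \<in> R1\<inverse>"
    then have uv: "(v, u) \<in> R1" "(w, u) \<in> R1" by simp_all
    obtain Q Q' where 1: "(Q, Q') \<in> ZZ" "v = last Q" "u = hd Q'" using R1in[OF uv(1)] by blast
    obtain P P' where 2: "(P, P') \<in> ZZ" "w = last P" "u = hd P'" using R1in[OF uv(2)] by blast
    have "Q' = P'" by (rule inj_onD[OF ih]) (use 1 2 ZZQ in simp_all)
    then have "Q = P" using svZc[of Q Q' P] 1 2 by simp
    then show "v = w" using 1 2 by simp
   qed
  qed
  have R1sub: "R1 \<subseteq> adj \<Gamma> \<inter> Vq \<times> Vp"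
  proof (rule subrelI)
   fix u v assume uv: "(u, v) \<in> R1"
   obtain Q Q' where 1: "(Q, Q') \<in> ZZ" "u = last Q" "v = hd Q'" using R1in[OF uv] by blast
   have "u \<in> Vq" "v \<in> Vp" using ZZQ[OF 1(1)] 1(2,3) hdV by blast+
   moreover have "(u, v) \<in> adj \<Gamma>" using uv cat unfolding R1Z by blast
   ultimately show "(u, v) \<in> adj \<Gamma> \<inter> Vq \<times> Vp" by simp
  qed
  define RA where "RA = (\<lambda>x. (eu x, hd (a x))) ` C"
  define RB where "RB = (\<lambda>x. (ev x, last (b x))) ` C"
  define Req where "Req = Rq1 \<union> Rq2 \<union> RA \<union> RB"
  have adjsym: "(u, v) \<in> adj \<Gamma> \<longleftrightarrow> (v, u) \<in> adj \<Gamma>" for u v by (simp add: adj_def insert_commute)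
  have edge: "\<exists>u v. e = {u, v} & ((u, v) \<in> arcs \<or> (u, v) \<in> R1 \<or> (u, v) \<in> Req)" if e: "GEdge e \<in># H" for e
  proof -
   obtain x where x: "x \<in> C" "GEdge e \<in> set (snd (graph_path (eu x # cc x @ [ev x])))" using H e by blast
   have cx: "arc_path (r2 \<union> Zx x) (cc x)" "cc x \<noteq> []" "hd (cc x) = hd (a x)" "last (cc x) = last (b x)" using cat[OF x(1)] by simp_all
   consider "e = {eu x, hd (a x)}" | "e = {last (b x), ev x}" | u v where "(u, v) \<in> r2 \<union> Zx x" "e = {u, v}"
    using graph_path_edge_cases(1)[OF x(2) cx(2,1)] unfolding cx(3,4) by blast
   then show ?thesis
   proof cases
    case 1
    have "(eu x, hd (a x)) \<in> Req" using x(1) by (simp add: Req_def RA_def)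
    then show ?thesis using 1 by blast
   next
    case 2
    have "(ev x, last (b x)) \<in> Req" using x(1) by (simp add: Req_def RB_def)
    moreover have "e = {ev x, last (b x)}" using 2 by (simp add: insert_commute)
    ultimately show ?thesis by blast
   next
    case 3
    note eq = 3(2)
    from 3(1) consider "(u, v) \<in> arcs" | "(u, v) \<in> Rq1" | "(v, u) \<in> Rq2" | "(u, v) \<in> R1"
     unfolding r2_def R1Z using x(1) by blast
    then show ?thesis
    proof cases
     case 1
     then show ?thesis by (intro exI[of _ u] exI[of _ v]) (simp add: eq)
    next
     case 2
     then show ?thesis by (intro exI[of _ u] exI[of _ v]) (simp add: eq Req_def)
    next
     case 3
     then show ?thesis by (intro exI[of _ v] exI[of _ u]) (simp add: eq Req_def insert_commute)
    next
     case 4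
     then show ?thesis by (intro exI[of _ u] exI[of _ v]) (simp add: eq)
    qed
   qed
  qed
  have VW: "Vp \<inter> W \<subseteq> V" "Vq \<inter> W \<subseteq> V" using VpV VqV by blast+
  have Reqsub: "Req \<subseteq> adj \<Gamma> \<inter> V \<times> (V - Ov)"
  proof -
   have "Rq1 \<subseteq> adj \<Gamma> \<inter> V \<times> (V - Ov)" using Rq1 VW unfolding bad_lasts_def by blast
   moreover have "Rq2 \<subseteq> adj \<Gamma> \<inter> V \<times> (V - Ov)" using Rq2 VW unfolding bad_hds_def by blast
   moreover have "(eu x, hd (a x)) \<in> adj \<Gamma> \<inter> V \<times> (V - Ov)" if "x \<in> C" for x
    using aC[OF that] QV(1)[OF aC(1)[OF that]] ends[OF that] lvV by blast
   moreover have "(ev x, last (b x)) \<in> adj \<Gamma> \<inter> V \<times> (V - Ov)" if "x \<in> C" for x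
    using bC[OF that] QV(2)[OF bC(1)[OF that]] ends[OF that] lvV adjsym[of "last (b x)" "ev x"] by blast
   ultimately show ?thesis unfolding Req_def RA_def RB_def by blast
  qed
  have RAr: "Range RA \<subseteq> hd ` \<Q>" and RBr: "Range RB \<subseteq> last ` \<Q>" unfolding RA_def RB_def using aC(1) bC(1) by blast+
  have svRA: "single_valued (RA\<inverse>)"
  proof (rule single_valuedI)
   fix y u v assume "(y, u) \<in> RA\<inverse>" "(y, v) \<in> RA\<inverse>"
   then obtain x x' where x: "x \<in> C" "u = eu x" "y = hd (a x)" "x' \<in> C" "v = eu x'" "y = hd (a x')" unfolding RA_def by auto
   have "a x = a x'" by (rule inj_onD[OF ih]) (use x aC(1) in simp_all)
   then have "x = x'" using inj_onD[OF inja] x by blast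
   then show "u = v" using x by simp
  qed
  have svRB: "single_valued (RB\<inverse>)"
  proof (rule single_valuedI)
   fix y u v assume "(y, u) \<in> RB\<inverse>" "(y, v) \<in> RB\<inverse>"
   then obtain x x' where x: "x \<in> C" "u = ev x" "y = last (b x)" "x' \<in> C" "v = ev x'" "y = last (b x')" unfolding RB_def by auto
   have "b x = b x'" by (rule inj_onD[OF il]) (use x bC(1) in simp_all)
   then have "x = x'" using inj_onD[OF injb] x by blast
   then show "u = v" using x by simp
  qed
  \<comment> \<open>The four kinds of requests are received by disjoint sets: heads lost to
    \<open>Rq1\<close>, last vertices lost to \<open>Rq2\<close>, remaining heads, and remaining
    last vertices.\<close>
  have svReq: "single_valued (Req\<inverse>)"
  proof -
   have R: "Range Rq1 \<subseteq> Vp - hd ` \<Q>" "Range Rq2 \<subseteq> Vq - last ` \<Q>" "Range RA \<subseteq> hd ` \<Q>" "Range RB \<subseteq> last ` \<Q>"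
    using Rq1 Rq2 RAr RBr unfolding hdQ lastQ by blast+
   have un: "single_valued ((A \<union> B)\<inverse>)" if "single_valued (A\<inverse>)" "single_valued (B\<inverse>)" "Range A \<inter> Range B = {}" for A B :: "('a \<times> 'a) set"
    using that unfolding single_valued_def by blast
   have "single_valued ((Rq1 \<union> Rq2)\<inverse>)" by (rule un[OF sv1c sv2c]) (use R Vpq in blast)
   then have "single_valued ((Rq1 \<union> Rq2 \<union> RA)\<inverse>)" by (rule un[OF _ svRA]) (use R Vpq hdV in blast)
   then show ?thesis unfolding Req_def by (rule un[OF _ svRB]) (use R Vpq hdV in blast)
  qed
  have rdeg: "card {y. (v, y) \<in> Req} \<le> of_bool (v \<in> bad_lasts V L arcs Vq) + of_bool (v \<in> bad_hds V L arcs Vp) + layout_degree L v" for v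
  proof -
   have one: "card {y. (v, y) \<in> R} \<le> of_bool (v \<in> B)" if "single_valued R" "R \<subseteq> B \<times> UNIV" for R :: "('a \<times> 'a) set" and B
   proof (cases "\<exists>y. (v, y) \<in> R")
    case True
    then obtain y where y: "(v, y) \<in> R" by blast
    then have "{y. (v, y) \<in> R} = {y}" using that(1) by (auto simp: single_valued_def)
    then show ?thesis using y that(2) by auto
   qed simp
   have "{y. (v, y) \<in> Req} = {y. (v, y) \<in> Rq1} \<union> {y. (v, y) \<in> Rq2} \<union>
     ((\<lambda>x. hd (a x)) ` {x\<in>C. eu x = v} \<union> (\<lambda>x. last (b x)) ` {x\<in>C. ev x = v})"
    unfolding Req_def RA_def RB_def by auto
   then have "card {y. (v, y) \<in> Req} \<le> card {y. (v, y) \<in> Rq1} + card {y. (v, y) \<in> Rq2} +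
     card ((\<lambda>x. hd (a x)) ` {x\<in>C. eu x = v} \<union> (\<lambda>x. last (b x)) ` {x\<in>C. ev x = v})"
    by (simp only:) (intro order_trans[OF card_Un_le] add_right_mono card_Un_le)
   also have "\<dots> \<le> of_bool (v \<in> bad_lasts V L arcs Vq) + of_bool (v \<in> bad_hds V L arcs Vp) + layout_degree L v"
   proof (intro add_mono)
    show "card {y. (v, y) \<in> Rq1} \<le> of_bool (v \<in> bad_lasts V L arcs Vq)" by (rule one[OF sv1]) (use Rq1 in blast)
    show "card {y. (v, y) \<in> Rq2} \<le> of_bool (v \<in> bad_hds V L arcs Vp)" by (rule one[OF sv2]) (use Rq2 in blast)
    show "card ((\<lambda>x. hd (a x)) ` {x\<in>C. eu x = v} \<union> (\<lambda>x. last (b x)) ` {x\<in>C. ev x = v}) \<le> layout_degree L v"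
     by (rule card_request_degree) (use ends in \<open>auto simp: C_def\<close>)
   qed
   finally show ?thesis .
  qed
  have rcard: "real (card (Range Req)) \<le> 4 * \<sigma> * m"
  proof -
   have "Range Req = Range Rq1 \<union> Range Rq2 \<union> (\<lambda>x. hd (a x)) ` C \<union> (\<lambda>x. last (b x)) ` C"
    unfolding Req_def RA_def RB_def by auto
   then have "card (Range Req) \<le> card (Range Rq1) + card (Range Rq2) + card ((\<lambda>x. hd (a x)) ` C) + card ((\<lambda>x. last (b x)) ` C)"
    by (simp only:) (intro order_trans[OF card_Un_le] add_right_mono order_refl)
   also have "\<dots> \<le> card (Range Rq1) + card (Range Rq2) + card C + card C" by (intro add_mono card_image_le finC order_refl)
   finally show ?thesis using cR1 cR2 cC by linarith
  qed
  show "\<exists>H R1 Req. step_result \<sigma> V \<Gamma> L F arcs Vp Vq Ov m H R1 Req"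
   unfolding step_result_def
   by (rule exI[of _ H], rule exI[of _ R1], rule exI[of _ Req])
     (intro conjI R1sub svR1 Reqsub svReq allI rdeg rcard impI edge H[THEN conjunct1]
      H[THEN conjunct2, THEN conjunct1, rule_format] H[THEN conj_drop2, THEN conjunct1, rule_format])
 qed
qed

section \<open>Treating all layouts one after the other\<close>

lemma card_UN_le_card:
 assumes "finite I" "\<And>i. i \<in> I ==> card (A i) \<le> Suc 0"
 shows "card (\<Union>i\<in>I. A i) \<le> card I"
proof -
 have "card (\<Union>i\<in>I. A i) \<le> (\<Sum>i\<in>I. card (A i))" by (rule card_UN_le[OF assms(1)])
 also have "\<dots> \<le> (\<Sum>i\<in>I. Suc 0)" by (rule sum_mono) (rule assms(2))
 finally show ?thesis by simp
qed

lemma card_image_single_valued_le_1: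
 assumes "single_valued R"
 shows "card {y. (x, y) \<in> R} \<le> Suc 0"
proof (cases "\<exists>y. (x, y) \<in> R")
 case True
 then obtain y where y: "(x, y) \<in> R" by blast
 have "{y. (x, y) \<in> R} \<subseteq> {y}" using single_valuedD[OF assms y] by blast
 then show ?thesis using card_mono[of "{y}"] by simp
qed simp

text \<open>\<open>D\<close> bounds the forests per pair of parts, \<open>\<delta>\<close> the
  requests sent by a vertex over all layouts, \<open>\<theta>\<close> is the number of received
  requests at which a vertex counts as congested, and \<open>t\<close> is the resulting bound on
  used edges between a vertex and a part. Degrees carry the surplus \<open>t\<close> and expansion
  the doubled constant 2\<zeta>, so that what is left over still meets the demands of one
  step.\<close>

locale iteration =
 fixes V :: "'a set" and \<Gamma> :: "'a set set" and L :: "nat => 'a list multiset" and F :: "nat => 'a set multiset"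
  and l :: nat and arcs :: "nat => ('a \<times> 'a) set" and p q :: "nat => nat" and c :: "'a => nat" and K D :: nat
  and \<zeta> \<sigma> m0 m \<tau> t \<theta> \<delta> :: real
 assumes g: "simple_graph V \<Gamma>"
  and lay: "\<And>i. i \<in> {1..l} ==> layout (L i) (F i)" "\<And>i. i \<in> {1..l} ==> layout_verts (L i) \<subseteq> V"
  and arcs: "\<And>i. i \<in> {1..l} ==> arcs i \<subseteq> V \<times> V & single_valued (arcs i) & single_valued ((arcs i)\<inverse>) &
    (\<exists>pos :: 'a => nat. \<forall>u v. (u, v) \<in> arcs i --> pos u < pos v)"
  and pq: "\<And>i. i \<in> {1..l} ==> p i < K & q i < K & p i \<noteq> q i"
  and avoid: "\<And>i u v. i \<in> {1..l} ==> (u, v) \<in> arcs i ==> c v \<noteq> p i & c u \<noteq> q i"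
  and mult: "\<And>a b. card {i\<in>{1..l}. q i = a & p i = b} \<le> D"
  and dense: "\<And>a b. a < K ==> b < K ==> dense_expander (2 * \<zeta>) \<tau> m (adj \<Gamma>) {w\<in>V. c w = a} {w\<in>V. c w = b}"
  and parts: "\<And>a. a < K ==> \<bar>real (card {w\<in>V. c w = a}) - m\<bar> \<le> \<zeta> / 32 * m"
  and degs: "\<And>z a. z \<in> V ==> a < K ==> 80 * \<tau> * m + t \<le> real (card (neighbours \<Gamma> z \<inter> {w\<in>V. c w = a}))"
  and m0: "m0 \<le> m" and zt: "\<zeta> \<le> \<tau>" and z: "0 < \<zeta>" "\<zeta> \<le> 1" and m: "0 < m" and th: "0 < \<theta>"
  and bad: "\<And>i. i \<in> {1..l} ==> real (card (bad_lasts V (L i) (arcs i) {w\<in>V. c w = q i})) \<le> \<sigma> * m &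
    real (card (bad_hds V (L i) (arcs i) {w\<in>V. c w = p i})) \<le> \<sigma> * m &
    real (card (layout_verts (L i))) \<le> \<sigma> * m & real (size (layout_edges (L i))) \<le> \<sigma> * m"
  and requests: "\<And>z. z \<in> V ==> real (\<Sum>i\<in>{1..l}. of_bool (z \<in> bad_lasts V (L i) (arcs i) {w\<in>V. c w = q i}) +
    of_bool (z \<in> bad_hds V (L i) (arcs i) {w\<in>V. c w = p i}) + layout_degree (L i) z) \<le> \<delta>"
  and ov: "real (card V) * \<delta> \<le> \<sigma> * m * \<theta>"
  and tb: "2 * real D + \<theta> + 1 + \<delta> \<le> t" "2 * t \<le> \<zeta> * m"
  and step: "\<forall>(V :: 'a set) \<Gamma> L F arcs Vp Vq Ov m \<tau>. step_data \<zeta> \<sigma> m0 V \<Gamma> L F arcs Vp Vq Ov m \<tau> -->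
    (\<exists>H R1 Req. step_result \<sigma> V \<Gamma> L F arcs Vp Vq Ov m H R1 Req)"
begin

definition used :: "(nat => ('a \<times> 'a) set) => (nat => ('a \<times> 'a) set) => nat => 'a set set" where
 "used R1 Req i = {{u, v} | u v. \<exists>j\<in>{1..<i}. (u, v) \<in> R1 j \<or> (u, v) \<in> Req j}"

definition load :: "(nat => ('a \<times> 'a) set) => nat => 'a => nat set" where
 "load Req i v = {j\<in>{1..<i}. v \<in> Range (Req j)}"

definition congested :: "(nat => ('a \<times> 'a) set) => nat => 'a set" where
 "congested Req i = {v\<in>V. \<theta> \<le> real (card (load Req i v))}"

definition invariant where
 "invariant k H R1 Req \<longleftrightarrow> (\<forall>i\<in>{1..k}. step_result \<sigma> V (\<Gamma> - used R1 Req i) (L i) (F i) (arcs i)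
   {w\<in>V. c w = p i} {w\<in>V. c w = q i} (congested Req i) m (H i) (R1 i) (Req i))"

lemma finV: "finite V" using g by (simp add: simple_graph_def)

context
 fixes k H R1 Req
 assumes inv: "invariant k H R1 Req" and kl: "k \<le> l"
begin

lemma invD:
 assumes "j \<in> {1..k}"
 shows "R1 j \<subseteq> adj (\<Gamma> - used R1 Req j) \<inter> {w\<in>V. c w = q j} \<times> {w\<in>V. c w = p j}"
  and "single_valued (R1 j)" and "single_valued ((R1 j)\<inverse>)"
  and "Req j \<subseteq> adj (\<Gamma> - used R1 Req j) \<inter> V \<times> (V - congested Req j)" and "single_valued ((Req j)\<inverse>)"
  and "card {y. (z, y) \<in> Req j} \<le> of_bool (z \<in> bad_lasts V (L j) (arcs j) {w\<in>V. c w = q j}) +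
    of_bool (z \<in> bad_hds V (L j) (arcs j) {w\<in>V. c w = p j}) + layout_degree (L j) z"
 using inv[unfolded invariant_def, rule_format, OF assms] unfolding step_result_def by simp_all

lemma sum_requests: "z \<in> V ==> real (\<Sum>j\<in>{1..k}. card {y. (z, y) \<in> Req j}) \<le> \<delta>"
proof -
 assume z: "z \<in> V"
 have "(\<Sum>j\<in>{1..k}. card {y. (z, y) \<in> Req j}) \<le> (\<Sum>i\<in>{1..k}. of_bool (z \<in> bad_lasts V (L i) (arcs i) {w\<in>V. c w = q i}) +
    of_bool (z \<in> bad_hds V (L i) (arcs i) {w\<in>V. c w = p i}) + layout_degree (L i) z)"
  by (rule sum_mono) (rule invD(6))
 also have "\<dots> \<le> (\<Sum>i\<in>{1..l}. of_bool (z \<in> bad_lasts V (L i) (arcs i) {w\<in>V. c w = q i}) +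
    of_bool (z \<in> bad_hds V (L i) (arcs i) {w\<in>V. c w = p i}) + layout_degree (L i) z)"
  by (rule sum_mono2) (use kl in auto)
 finally show ?thesis using requests[OF z] by linarith
qed

text \<open>At the last index where \<open>v\<close> received a request it was not congested, so its
  load before that index was below \<open>\<theta>\<close>.\<close>

lemma card_load: "real (card (load Req (Suc k) v)) \<le> \<theta> + 1"
proof (cases "load Req (Suc k) v = {}")
 case True
 then show ?thesis using th by simp
next
 case False
 let ?S = "load Req (Suc k) v"
 have fin: "finite ?S" by (simp add: load_def)
 define j where "j = Max ?S"
 have j: "j \<in> ?S" unfolding j_def by (rule Max_in[OF fin False])
 then have jk: "j \<in> {1..k}" and vj: "v \<in> Range (Req j)" by (auto simp: load_def)
 from vj obtain u where "(u, v) \<in> Req j" by blast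
 then have v: "v \<in> V" "v \<notin> congested Req j" using invD(4)[OF jk] by blast+
 have sub: "?S \<subseteq> insert j (load Req j v)"
 proof
  fix i assume i: "i \<in> ?S"
  then have "i \<le> j" unfolding j_def using fin by (rule Max_ge[rotated])
  then show "i \<in> insert j (load Req j v)" using i by (auto simp: load_def)
 qed
 have "card ?S \<le> card (insert j (load Req j v))" by (rule card_mono[OF _ sub]) (simp add: load_def)
 also have "\<dots> \<le> Suc (card (load Req j v))" by (simp add: card_insert_if load_def)
 finally show ?thesis using v by (simp add: congested_def)
qed

text \<open>Double counting: every congested vertex has received at least \<open>\<theta>\<close>
  requests, while all vertices together send at most \<open>card V * \<delta>\<close>.\<close>

lemma card_congested: "real (card (congested Req (Suc k))) \<le> \<sigma> * m"
proof -
 let ?O = "congested Req (Suc k)"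
 have fO: "finite ?O" using finV by (simp add: congested_def)
 have rV: "Req j \<subseteq> V \<times> V" if "j \<in> {1..k}" for j using invD(4)[OF that] by blast
 have "real (card ?O) * \<theta> = (\<Sum>v\<in>?O. \<theta>)" by simp
 also have "\<dots> \<le> (\<Sum>v\<in>?O. real (card (load Req (Suc k) v)))" by (rule sum_mono) (simp add: congested_def)
 also have "\<dots> \<le> (\<Sum>v\<in>V. real (card (load Req (Suc k) v)))" by (rule sum_mono2[OF finV]) (auto simp: congested_def)
 also have "\<dots> = real (\<Sum>v\<in>V. \<Sum>j\<in>{1..k}. of_bool (v \<in> Range (Req j)))"
 proof -
  have "card (load Req (Suc k) v) = (\<Sum>j\<in>{1..k}. of_bool (v \<in> Range (Req j)))" for v
   unfolding load_def by (simp add: of_bool_def sum.If_cases Int_def atLeastLessThanSuc_atLeastAtMost)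
  then show ?thesis by simp
 qed
 also have "\<dots> = real (\<Sum>j\<in>{1..k}. \<Sum>v\<in>V. of_bool (v \<in> Range (Req j)))" by (subst sum.swap) simp
 also have "\<dots> \<le> real (\<Sum>j\<in>{1..k}. \<Sum>z\<in>V. card {y. (z, y) \<in> Req j})"
 proof (rule of_nat_mono, rule sum_mono)
  fix j assume j: "j \<in> {1..k}"
  have "(\<Sum>v\<in>V. of_bool (v \<in> Range (Req j))) = card (V \<inter> Range (Req j))" using finV
   by (simp add: of_bool_def sum.If_cases Int_def)
  also have "\<dots> \<le> card (\<Union>z\<in>V. {y. (z, y) \<in> Req j})"
  proof (rule card_mono)
   show "finite (\<Union>z\<in>V. {y. (z, y) \<in> Req j})" by (rule finite_subset[OF _ finV]) (use rV[OF j] in blast)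
   show "V \<inter> Range (Req j) \<subseteq> (\<Union>z\<in>V. {y. (z, y) \<in> Req j})" using rV[OF j] by blast
  qed
  also have "\<dots> \<le> (\<Sum>z\<in>V. card {y. (z, y) \<in> Req j})" by (rule card_UN_le[OF finV])
  finally show "(\<Sum>v\<in>V. of_bool (v \<in> Range (Req j))) \<le> (\<Sum>z\<in>V. card {y. (z, y) \<in> Req j})" .
 qed
 also have "\<dots> = (\<Sum>z\<in>V. real (\<Sum>j\<in>{1..k}. card {y. (z, y) \<in> Req j}))" by (subst sum.swap) simp
 also have "\<dots> \<le> (\<Sum>z\<in>V. \<delta>)" by (rule sum_mono) (rule sum_requests)
 also have "\<dots> \<le> \<sigma> * m * \<theta>" using ov by simp
 finally show ?thesis using th by (simp only: mult_le_cancel_right_pos)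
qed

text \<open>The used edges between \<open>v\<close> and part \<open>b\<close> are of four kinds:
  linkage edges leaving or entering \<open>v\<close>, at most one for each layout whose pair of
  parts is that of \<open>v\<close> and \<open>b\<close> in the respective order, hence at most
  \<open>D\<close> each; requests sent, at most \<open>\<delta>\<close>; requests received, at most
  \<open>\<theta> + 1\<close>.\<close>

lemma card_used:
 assumes v: "v \<in> V"
 shows "real (card {w\<in>V. c w = b & {v, w} \<in> used R1 Req (Suc k)}) \<le> t"
proof -
 let ?U = "{w\<in>V. c w = b & {v, w} \<in> used R1 Req (Suc k)}"
 define I1 where "I1 = {j\<in>{1..k}. q j = c v & p j = b}"
 define I2 where "I2 = {j\<in>{1..k}. q j = b & p j = c v}"
 define A1 where "A1 = (\<Union>j\<in>I1. {w. (v, w) \<in> R1 j})"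
 define A2 where "A2 = (\<Union>j\<in>I2. {w. (v, w) \<in> (R1 j)\<inverse>})"
 define A3 where "A3 = (\<Union>j\<in>{1..k}. {w. (v, w) \<in> Req j})"
 define A4 where "A4 = (\<Union>j\<in>load Req (Suc k) v. {w. (v, w) \<in> (Req j)\<inverse>})"
 have R1in: "x \<in> V & y \<in> V & c x = q j & c y = p j" if "j \<in> {1..k}" "(x, y) \<in> R1 j" for x y j
  using invD(1)[OF that(1)] that(2) by blast
 have Rqin: "x \<in> V & y \<in> V" if "j \<in> {1..k}" "(x, y) \<in> Req j" for x y j
  using invD(4)[OF that(1)] that(2) by blast
 have subV: "A1 \<union> A2 \<union> A3 \<union> A4 \<subseteq> V"
  unfolding A1_def A2_def A3_def A4_def I1_def I2_def load_def using R1in Rqin by (auto simp: less_Suc_eq_le)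
 have sub: "?U \<subseteq> A1 \<union> A2 \<union> A3 \<union> A4"
 proof
  fix w assume "w \<in> ?U"
  then have w: "c w = b" "{v, w} \<in> used R1 Req (Suc k)" by simp_all
  from w(2) obtain x y j where xy: "{v, w} = {x, y}" and j': "j \<in> {1..<Suc k}" and R: "(x, y) \<in> R1 j \<or> (x, y) \<in> Req j"
   unfolding used_def by blast
  from j' have j: "j \<in> {1..k}" by simp
  from xy consider (a) "x = v" "y = w" | (b) "x = w" "y = v" by (auto simp: doubleton_eq_iff)
  then show "w \<in> A1 \<union> A2 \<union> A3 \<union> A4"
  proof cases
   case a
   show ?thesis
   proof (cases "(x, y) \<in> R1 j")
    case True
    have "j \<in> I1" using R1in[OF j True] a w(1) j by (simp add: I1_def)
    then show ?thesis using True a by (auto simp: A1_def)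
   next
    case False
    then show ?thesis using R a j by (auto simp: A3_def)
   qed
  next
   case b
   show ?thesis
   proof (cases "(x, y) \<in> R1 j")
    case True
    have "j \<in> I2" using R1in[OF j True] b w(1) j by (simp add: I2_def)
    then show ?thesis using True b by (auto simp: A2_def)
   next
    case False
    then have wv: "(w, v) \<in> Req j" using R b by simp
    then have "j \<in> load Req (Suc k) v" using j by (auto simp: load_def)
    then show ?thesis using wv by (auto simp: A4_def)
   qed
  qed
 qed
 have c1: "card A1 \<le> D"
 proof -
  have "card A1 \<le> card I1" unfolding A1_def
  proof (rule card_UN_le_card)
   show "finite I1" by (simp add: I1_def)
   show "card {w. (v, w) \<in> R1 j} \<le> Suc 0" if "j \<in> I1" for j
    by (rule card_image_single_valued_le_1) (use that in \<open>auto simp: I1_def intro!: invD(2)\<close>)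
  qed
  also have "\<dots> \<le> card {i\<in>{1..l}. q i = c v & p i = b}" by (rule card_mono) (use kl in \<open>auto simp: I1_def\<close>)
  finally show ?thesis using mult[of "c v" b] by linarith
 qed
 have c2: "card A2 \<le> D"
 proof -
  have "card A2 \<le> card I2" unfolding A2_def
   by (rule card_UN_le_card) (auto simp add: I2_def simp del: converse_iff intro!: card_image_single_valued_le_1 invD(3))
  also have "\<dots> \<le> card {i\<in>{1..l}. q i = b & p i = c v}" by (rule card_mono) (use kl in \<open>auto simp: I2_def\<close>)
  finally show ?thesis using mult[of b "c v"] by linarith
 qed
 have c3: "real (card A3) \<le> \<delta>"
 proof -
  have "card A3 \<le> (\<Sum>j\<in>{1..k}. card {y. (v, y) \<in> Req j})" unfolding A3_def by (rule card_UN_le) simp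
  then show ?thesis using sum_requests[OF v] by linarith
 qed
 have c4: "real (card A4) \<le> \<theta> + 1"
 proof -
  have "card A4 \<le> card (load Req (Suc k) v)" unfolding A4_def
   by (rule card_UN_le_card) (auto simp add: load_def simp del: converse_iff intro!: card_image_single_valued_le_1 invD(5))
  then show ?thesis using card_load[of v] by linarith
 qed
 have "card ?U \<le> card (A1 \<union> A2 \<union> A3 \<union> A4)" by (rule card_mono[OF finite_subset[OF subV finV] sub])
 also have "\<dots> \<le> card A1 + card A2 + card A3 + card A4" by (intro order_trans[OF card_Un_le] add_right_mono order_refl)
 finally show ?thesis using c1 c2 c3 c4 tb(1) by linarith
qed

text \<open>The used edges cost each vertex at most \<open>t\<close> neighbours in any part, and
  cost any pair X, Y at most 2mt, which is at most \<zeta>m^2; the reserves in the locale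
  assumptions cover both losses.\<close>

lemma step_data_next:
 assumes i: "i = Suc k" "i \<in> {1..l}"
 shows "step_data \<zeta> \<sigma> m0 V (\<Gamma> - used R1 Req i) (L i) (F i) (arcs i) {w\<in>V. c w = p i} {w\<in>V. c w = q i} (congested Req i) m \<tau>"
proof -
 let ?U = "used R1 Req i"
 have cu: "real (card {w\<in>V. c w = b & {v, w} \<in> ?U}) \<le> t" if "v \<in> V" for v b unfolding i(1) by (rule card_used[OF that])
 have pqi: "p i < K" "q i < K" "p i \<noteq> q i" using pq[OF i(2)] by simp_all
 have g': "simple_graph V (\<Gamma> - ?U)" using g by (simp add: simple_graph_def)
 have deg': "80 * \<tau> * m \<le> real (card (neighbours (\<Gamma> - ?U) z \<inter> {w\<in>V. c w = a}))" if z: "z \<in> V" and a: "a < K" for z a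
 proof -
  have eq: "neighbours (\<Gamma> - ?U) z \<inter> {w\<in>V. c w = a} = (neighbours \<Gamma> z \<inter> {w\<in>V. c w = a}) - {w\<in>V. c w = a & {z, w} \<in> ?U}"
   by (auto simp: neighbours_def)
  have "real (card (neighbours \<Gamma> z \<inter> {w\<in>V. c w = a})) - real (card {w\<in>V. c w = a & {z, w} \<in> ?U})
    \<le> real (card (neighbours (\<Gamma> - ?U) z \<inter> {w\<in>V. c w = a}))"
   unfolding eq by (rule card_Diff_ge) (use finV in simp)
  then show ?thesis using degs[OF z a] cu[OF z, of a] by linarith
 qed
 have dense': "dense_expander \<zeta> \<tau> m (adj (\<Gamma> - ?U)) {w\<in>V. c w = q i} {w\<in>V. c w = p i}"
  unfolding dense_expander_def
 proof (intro allI impI)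
  fix X Y assume X: "X \<subseteq> {w\<in>V. c w = q i}" and Y: "Y \<subseteq> {w\<in>V. c w = p i}"
   and h: "\<tau> * m \<le> real (card X) & \<tau> * m \<le> real (card Y) & (1 - \<zeta>) * m \<le> real (card X) + real (card Y)"
  have fin: "finite X" "finite Y" using X Y finV by (auto intro: finite_subset)
  have "(1 - 2 * \<zeta>) * m \<le> (1 - \<zeta>) * m" using z m by (intro mult_right_mono) auto
  then have ge: "2 * \<zeta> * m\<^sup>2 \<le> real (card (adj \<Gamma> \<inter> X \<times> Y))"
   by (intro dense_expanderD[OF dense[OF pqi(2,1)] X Y]) (use h in linarith)+
  define B where "B = {(x, y). {x, y} \<in> ?U} \<inter> X \<times> Y"
  have "real (card B) = (\<Sum>x\<in>X. real (card {y\<in>Y. (x, y) \<in> {(x, y). {x, y} \<in> ?U}}))"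
   unfolding B_def by (simp add: card_rel_Times_eq_sum_left[OF fin])
  also have "\<dots> \<le> (\<Sum>x\<in>X. t)"
  proof (rule sum_mono)
   fix x assume "x \<in> X"
   then have xV: "x \<in> V" using X by blast
   have "card {y\<in>Y. (x, y) \<in> {(x, y). {x, y} \<in> ?U}} \<le> card {w\<in>V. c w = p i & {x, w} \<in> ?U}"
    by (rule card_mono) (use Y finV in auto)
   then show "real (card {y\<in>Y. (x, y) \<in> {(x, y). {x, y} \<in> ?U}}) \<le> t" using cu[OF xV, of "p i"] by linarith
  qed
  also have "\<dots> = real (card X) * t" by simp
  also have "\<dots> \<le> (2 * m) * t"
  proof (rule mult_right_mono)
   have "card X \<le> card {w\<in>V. c w = q i}" by (rule card_mono[OF _ X]) (use finV in simp)
   moreover have "\<zeta> / 32 * m \<le> 1 * m" by (rule mult_right_mono) (use z m in auto)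
   ultimately show "real (card X) \<le> 2 * m" using parts[OF pqi(2)] by linarith
   \<comment> \<open>For nonempty \<open>V\<close> this follows from \<open>card_used\<close>; an
     empty \<open>V\<close> would contradict the part sizes, which are close to m > 0.\<close>
   show "0 \<le> t"
   proof (cases "V = {}")
    case True
    have "m \<le> \<zeta> / 32 * m" using parts[OF pqi(2)] m True by simp
    moreover have "\<zeta> / 32 * m \<le> 1 / 32 * m" by (rule mult_right_mono) (use z m in auto)
    ultimately show ?thesis using m by linarith
   next
    case False
    then obtain v where "v \<in> V" by blast
    then show ?thesis using cu[of v 0] by (meson of_nat_0_le_iff order_trans)
   qed
  qed
  also have "\<dots> = m * (2 * t)" by simp
  also have "\<dots> \<le> m * (\<zeta> * m)" by (rule mult_left_mono) (use tb(2) m in auto)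
  also have "\<dots> = \<zeta> * m\<^sup>2" by (simp add: power2_eq_square)
  finally have Bb: "real (card B) \<le> \<zeta> * m\<^sup>2" .
  have eq: "adj (\<Gamma> - ?U) \<inter> X \<times> Y = (adj \<Gamma> \<inter> X \<times> Y) - B" by (auto simp: adj_def B_def)
  have "real (card (adj \<Gamma> \<inter> X \<times> Y)) - real (card B) \<le> real (card (adj (\<Gamma> - ?U) \<inter> X \<times> Y))"
   unfolding eq by (rule card_Diff_ge) (use fin in \<open>simp add: B_def\<close>)
  then show "\<zeta> * m\<^sup>2 \<le> real (card (adj (\<Gamma> - ?U) \<inter> X \<times> Y))" using ge Bb by linarith
 qed
 have av: "v \<notin> {w\<in>V. c w = p i} & u \<notin> {w\<in>V. c w = q i}" if "(u, v) \<in> arcs i" for u v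
  using avoid[OF i(2) that] by simp
 have co: "real (card (congested Req i)) \<le> \<sigma> * m" unfolding i(1) by (rule card_congested)
 note ar = arcs[OF i(2)]
 note b = bad[OF i(2)]
 show ?thesis
  unfolding step_data_def
  by (intro conjI g' lay[OF i(2)] m0 zt dense' parts pqi allI impI ballI co deg' b[THEN conjunct1] b[THEN conjunct2, THEN conjunct1]
    b[THEN conj_drop2, THEN conjunct1] b[THEN conj_drop2, THEN conjunct2] ar[THEN conjunct1]
    ar[THEN conjunct2, THEN conjunct1] ar[THEN conj_drop2, THEN conjunct1] ar[THEN conj_drop2, THEN conjunct2]
    av[THEN conjunct1] av[THEN conjunct2]) (use pqi in \<open>auto simp: congested_def\<close>)
qed

end

text \<open>Index \<open>i\<close> looks only at earlier entries, so extending the sequences by one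
  step does not disturb the invariant for the steps already made.\<close>

lemma used_cong:
 assumes "\<And>j. j < i ==> R1 j = R1' j" "\<And>j. j < i ==> Req j = Req' j"
 shows "used R1 Req i = used R1' Req' i" "congested Req i = congested Req' i"
proof -
 have "(\<exists>j\<in>{1..<i}. (u, v) \<in> R1 j \<or> (u, v) \<in> Req j) \<longleftrightarrow> (\<exists>j\<in>{1..<i}. (u, v) \<in> R1' j \<or> (u, v) \<in> Req' j)" for u v
  by (rule bex_cong[OF refl]) (simp add: assms)
 then show "used R1 Req i = used R1' Req' i" unfolding used_def by simp
 have "load Req i v = load Req' i v" for v unfolding load_def by (rule Collect_cong) (auto simp: assms)
 then show "congested Req i = congested Req' i" unfolding congested_def by simp
qed

lemma invariant_exists: "k \<le> l ==> \<exists>H R1 Req. invariant k H R1 Req"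
proof (induction k)
 case 0
 show ?case by (simp add: invariant_def)
next
 case (Suc k)
 then obtain H R1 Req where inv: "invariant k H R1 Req" by auto
 have kl: "k \<le> l" and i: "Suc k \<in> {1..l}" using Suc.prems by simp_all
 let ?i = "Suc k"
 from step[rule_format, OF step_data_next[OF inv kl refl i]]
 obtain h r s where res: "step_result \<sigma> V (\<Gamma> - used R1 Req ?i) (L ?i) (F ?i) (arcs ?i) {w\<in>V. c w = p ?i} {w\<in>V. c w = q ?i}
   (congested Req ?i) m h r s" by blast
 define H' R1' Req' where "H' = H(?i := h)" and "R1' = R1(?i := r)" and "Req' = Req(?i := s)"
 have "invariant ?i H' R1' Req'"
  unfolding invariant_def
 proof
  fix j assume j: "j \<in> {1..?i}"
  have U: "used R1' Req' j = used R1 Req j" "congested Req' j = congested Req j"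
   by (rule used_cong, use j in \<open>simp_all add: R1'_def Req'_def\<close>)+
  show "step_result \<sigma> V (\<Gamma> - used R1' Req' j) (L j) (F j) (arcs j) {w\<in>V. c w = p j} {w\<in>V. c w = q j}
    (congested Req' j) m (H' j) (R1' j) (Req' j)"
  proof (cases "j = ?i")
   case True
   show ?thesis unfolding U unfolding True H'_def R1'_def Req'_def fun_upd_same by (rule res)
  next
   case False
   then have "j \<in> {1..k}" using j by simp
   from inv[unfolded invariant_def, rule_format, OF this] show ?thesis unfolding U using False by (simp add: H'_def R1'_def Req'_def)
  qed
 qed
 then show ?case by blast
qed

lemma configurations:
 "\<exists>H R. (\<forall>i\<in>{1..l}. spanning_configuration V (L i) (F i) (H i) & (\<forall>e. count (H i) (FEdge e) = count (F i) e) &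
   (\<forall>e. count (H i) (GEdge e) \<le> 1) & (\<forall>e. GEdge e \<in># H i --> e \<in> (\<lambda>(u, v). {u, v}) ` arcs i \<or> e \<in> R i) & R i \<subseteq> \<Gamma>) &
  (\<forall>i\<in>{1..l}. \<forall>j\<in>{1..l}. i \<noteq> j --> R i \<inter> R j = {}) &
  (\<forall>v\<in>V. \<forall>b. real (card {w\<in>V. c w = b & {v, w} \<in> (\<Union>i\<in>{1..l}. R i)}) \<le> t)"
proof -
 obtain H R1 Req where inv: "invariant l H R1 Req" using invariant_exists[OF order_refl] by blast
 define R where "R i = {{u, v} | u v. (u, v) \<in> R1 i \<or> (u, v) \<in> Req i}" for i
 have usedR: "used R1 Req i = (\<Union>j\<in>{1..<i}. R j)" for i unfolding used_def R_def by blast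
 have Rsub: "R i \<subseteq> \<Gamma> - used R1 Req i" if "i \<in> {1..l}" for i
  using invD(1,4)[OF inv order_refl that] unfolding R_def adj_def by blast
 have lt: "R i \<inter> R j = {}" if "i \<in> {1..l}" "j \<in> {1..l}" "i < j" for i j
 proof -
  have "R i \<subseteq> used R1 Req j" unfolding usedR using that by auto
  then show ?thesis using Rsub[OF that(2)] by blast
 qed
 have disj: "R i \<inter> R j = {}" if ij: "i \<in> {1..l}" "j \<in> {1..l}" "i \<noteq> j" for i j
 proof (cases "i < j")
  case True
  then show ?thesis using lt ij by blast
 next
  case False
  then have "j < i" using ij by simp
  then show ?thesis using lt[OF ij(2,1)] by blast
 qed
 have U: "(\<Union>i\<in>{1..l}. R i) = used R1 Req (Suc l)" unfolding usedR atLeastLessThanSuc_atLeastAtMost ..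
 have main: "spanning_configuration V (L i) (F i) (H i) & (\<forall>e. count (H i) (FEdge e) = count (F i) e) &
   (\<forall>e. count (H i) (GEdge e) \<le> 1) & (\<forall>e. GEdge e \<in># H i --> e \<in> (\<lambda>(u, v). {u, v}) ` arcs i \<or> e \<in> R i) & R i \<subseteq> \<Gamma>"
  if i: "i \<in> {1..l}" for i
 proof -
  note r = inv[unfolded invariant_def, rule_format, OF i, unfolded step_result_def]
  have e: "e \<in> (\<lambda>(u, v). {u, v}) ` arcs i \<or> e \<in> R i" if e: "GEdge e \<in># H i" for e
  proof -
   from r[THEN conj_drop2, THEN conjunct2, THEN conjunct1, rule_format, OF e]
   obtain u v where uv: "e = {u, v}" "(u, v) \<in> arcs i \<or> (u, v) \<in> R1 i \<or> (u, v) \<in> Req i" by blast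
   show ?thesis
   proof (cases "(u, v) \<in> arcs i")
    case True
    then show ?thesis using uv(1) by (intro disjI1 image_eqI[of _ _ "(u, v)"]) auto
   next
    case False
    then have "(u, v) \<in> R1 i \<or> (u, v) \<in> Req i" using uv(2) by simp
    then show ?thesis using uv(1) unfolding R_def by blast
   qed
  qed
  show ?thesis using r[THEN conjunct1] r[THEN conjunct2, THEN conjunct1] r[THEN conj_drop2, THEN conjunct1] e Rsub[OF i] by blast
 qed
 show ?thesis
  by (rule exI[of _ H], rule exI[of _ R]) (unfold U, intro conjI ballI allI impI main disj card_used[OF inv order_refl])
qed

end

section \<open>Choice of the hierarchy and assembly\<close>

text \<open>The thresholds \<open>e\<close> are given for integer levels and need not be monotone.
  The minimum over all levels up to \<lceil>1/y\<rceil> is non-decreasing in y and still below the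
  threshold of its own level.\<close>

lemma hierarchy_function_below:
 fixes e :: "nat => real"
 assumes e: "\<And>j. 0 < e j"
 shows "\<exists>f. hierarchy_function f & (\<forall>y\<in>{0<..1}. f y \<le> y\<^sup>2 / 10^4 & f y \<le> e (nat \<lceil>1 / y\<rceil>))"
proof -
 define M where "M N = Min (e ` {..N::nat})" for N
 have M0: "0 < M N" for N unfolding M_def using e by (subst Min_gr_iff) auto
 have Me: "M N \<le> e N" for N unfolding M_def by (rule Min_le) auto
 have Mm: "M N' \<le> M N" if "N \<le> N'" for N N' unfolding M_def by (rule Min_antimono) (use that in auto)
 define f where "f y = min (y\<^sup>2 / 10^4) (M (nat \<lceil>1 / y\<rceil>))" for y :: real
 have "hierarchy_function f"
  unfolding hierarchy_function_def
 proof (intro conjI)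
  show "f \<in> {0<..1} \<rightarrow> {0<..1}"
  proof
   fix y :: real assume y: "y \<in> {0<..1}"
   have "y\<^sup>2 \<le> 1" using y by (simp add: power_le_one)
   then have "f y \<le> 1" unfolding f_def by (intro min.coboundedI1) simp
   moreover have "0 < f y" using y M0 by (simp add: f_def)
   ultimately show "f y \<in> {0<..1}" by simp
  qed
  show "mono_on {0<..1} f"
  proof (rule mono_onI)
   fix y y' :: real assume y: "y \<in> {0<..1}" "y' \<in> {0<..1}" "y \<le> y'"
   have "y\<^sup>2 \<le> y'\<^sup>2" using y by (intro power_mono) auto
   moreover have "1 / y' \<le> 1 / y" using y by (intro divide_left_mono) auto
   then have "nat \<lceil>1 / y'\<rceil> \<le> nat \<lceil>1 / y\<rceil>" by (intro nat_mono ceiling_mono)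
   then have "M (nat \<lceil>1 / y\<rceil>) \<le> M (nat \<lceil>1 / y'\<rceil>)" by (rule Mm)
   ultimately show "f y \<le> f y'" unfolding f_def by (intro min.mono) (simp_all add: divide_right_mono)
  qed
 qed
 moreover have "f y \<le> y\<^sup>2 / 10^4 & f y \<le> e (nat \<lceil>1 / y\<rceil>)" for y
  unfolding f_def by (intro conjI min.cobounded1 min.coboundedI2 Me)
 ultimately show ?thesis by blast
qed

lemma count_image_mset_inj: "inj f ==> count (image_mset f M) (f x) = count M x"
 by (induction M) (auto dest: injD)

text \<open>Tagged edges are compared one kind at a time: the multiplicities of \<open>FEdge\<close>
  add up exactly, while a \<open>GEdge\<close> belongs to at most one \<open>S i\<close> and hence
  occurs at most once in the sum.\<close>

lemma sum_edge_disjoint_subset_mset: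
 fixes H :: "'i => 'a medge multiset"
 assumes fin: "finite I" "finite E"
  and F: "\<And>i e. i \<in> I ==> count (H i) (FEdge e) = count (F i) e"
  and G: "\<And>i e. i \<in> I ==> count (H i) (GEdge e) \<le> 1"
  and S: "\<And>i e. i \<in> I ==> GEdge e \<in># H i ==> e \<in> S i" "\<And>i. i \<in> I ==> S i \<subseteq> E"
  and disj: "\<And>i j. i \<in> I ==> j \<in> I ==> i \<noteq> j ==> S i \<inter> S j = {}"
 shows "(\<Sum>i\<in>I. H i) \<subseteq># add_edges E (\<Sum>i\<in>I. F i)"
proof (rule mset_subset_eqI)
 fix x :: "'a medge"
 have inj: "inj (GEdge :: 'a set => _)" "inj (FEdge :: 'a set => _)" by (auto intro: injI)
 show "count (\<Sum>i\<in>I. H i) x \<le> count (add_edges E (\<Sum>i\<in>I. F i)) x"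
 proof (cases x)
  case (FEdge e)
  have "count (add_edges E (\<Sum>i\<in>I. F i)) (FEdge e) = count (image_mset GEdge (mset_set E)) (FEdge e) + (\<Sum>i\<in>I. count (F i) e)"
   unfolding add_edges_def by (simp add: count_image_mset_inj[OF inj(2)] count_sum)
  moreover have "count (\<Sum>i\<in>I. H i) (FEdge e) = (\<Sum>i\<in>I. count (F i) e)" by (simp add: count_sum F)
  ultimately show ?thesis unfolding FEdge by simp
 next
  case (GEdge e)
  have c: "count (\<Sum>i\<in>I. H i) (GEdge e) = (\<Sum>i\<in>I. count (H i) (GEdge e))" by (simp add: count_sum)
  have a: "count (add_edges E (\<Sum>i\<in>I. F i)) (GEdge e) \<ge> count (mset_set E) e"
   unfolding add_edges_def by (simp add: count_image_mset_inj[OF inj(1)])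
  show ?thesis
  proof (cases "\<exists>i\<in>I. GEdge e \<in># H i")
   case True
   then obtain i where i: "i \<in> I" "GEdge e \<in># H i" by blast
   have ei: "e \<in> S i" by (rule S(1)[OF i])
   have "count (H j) (GEdge e) = 0" if j: "j \<in> I - {i}" for j
   proof (rule ccontr)
    assume "count (H j) (GEdge e) \<noteq> 0"
    then have "GEdge e \<in># H j" by (simp add: count_eq_zero_iff)
    then have "e \<in> S j" using S(1) j by blast
    then show False using ei disj[of i j] i(1) j by blast
   qed
   then have "(\<Sum>i\<in>I. count (H i) (GEdge e)) = count (H i) (GEdge e)" using i(1) fin(1) by (subst sum.remove[of _ i]) simp_all
   moreover have "count (mset_set E) e = 1" using S(2)[OF i(1)] ei fin(2) by (subst count_mset_set(1)) auto
   ultimately show ?thesis using G[OF i(1), of e] a c unfolding GEdge by linarith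
  next
   case False
   then have "(\<Sum>i\<in>I. count (H i) (GEdge e)) = 0" by (intro sum.neutral) (auto simp: count_eq_zero_iff)
   then show ?thesis unfolding GEdge c by simp
  qed
 qed
qed

text \<open>A vertex robustly adjacent to \<open>S\<close> in \<open>\<Gamma>\<close> loses at most
  (\<beta> - \<mu>)n neighbours to \<open>U\<close>, so at least \<mu>n survive. The size range for
  4\<tau> lies inside the one for \<tau>.\<close>

lemma robust_expander_residual:
 assumes fin: "finite V" and E': "\<And>e. e \<in> E' ==> e \<subseteq> V"
  and rob: "\<And>S. S \<subseteq> V ==> \<tau> * real (card V) \<le> real (card S) ==> real (card S) \<le> (1 - \<tau>) * real (card V) ==>
   real (card S) + \<kappa> * real (card V) \<le> real (card {v\<in>V. \<beta> * real (card V) \<le> real (card (neighbours \<Gamma> v \<inter> S))})"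
  and U: "\<And>v. v \<in> V ==> real (card {w\<in>V. {v, w} \<in> U}) \<le> (\<beta> - \<mu>) * real (card V)" and sub: "\<Gamma> - U \<subseteq> E'"
  and par: "0 < \<mu>" "\<mu> \<le> \<kappa>" "\<mu> \<le> 4 * \<tau>" "4 * \<tau> < 1"
 shows "robust_expander \<mu> (4 * \<tau>) V E'"
 unfolding robust_expander_def
proof (intro conjI par allI impI)
 fix S assume SV: "S \<subseteq> V" and S: "4 * \<tau> * real (card V) \<le> real (card S) & real (card S) \<le> (1 - 4 * \<tau>) * real (card V)"
 have t: "0 \<le> \<tau>" using par by linarith
 have "\<tau> * real (card V) \<le> 4 * \<tau> * real (card V)" "(1 - 4 * \<tau>) * real (card V) \<le> (1 - \<tau>) * real (card V)"
  using t by (intro mult_right_mono; simp)+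
 then have r: "real (card S) + \<kappa> * real (card V) \<le> real (card {v\<in>V. \<beta> * real (card V) \<le> real (card (neighbours \<Gamma> v \<inter> S))})"
  by (intro rob[OF SV]) (use S in linarith)+
 have "card {v\<in>V. \<beta> * real (card V) \<le> real (card (neighbours \<Gamma> v \<inter> S))} \<le> card {v\<in>V. \<mu> * real (card V) \<le> real (card (neighbours E' v \<inter> S))}"
 proof (rule card_mono)
  show "finite {v\<in>V. \<mu> * real (card V) \<le> real (card (neighbours E' v \<inter> S))}" using fin by simp
  show "{v\<in>V. \<beta> * real (card V) \<le> real (card (neighbours \<Gamma> v \<inter> S))} \<subseteq> {v\<in>V. \<mu> * real (card V) \<le> real (card (neighbours E' v \<inter> S))}"
  proof
   fix v assume "v \<in> {v\<in>V. \<beta> * real (card V) \<le> real (card (neighbours \<Gamma> v \<inter> S))}"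
   then have v: "v \<in> V" "\<beta> * real (card V) \<le> real (card (neighbours \<Gamma> v \<inter> S))" by simp_all
   have "neighbours \<Gamma> v \<inter> S - {w\<in>V. {v, w} \<in> U} \<subseteq> neighbours E' v \<inter> S" using sub SV by (auto simp: neighbours_def)
   then have "card (neighbours \<Gamma> v \<inter> S - {w\<in>V. {v, w} \<in> U}) \<le> card (neighbours E' v \<inter> S)"
    by (rule card_mono[rotated]) (use finite_subset[OF SV fin] in simp)
   moreover have "real (card (neighbours \<Gamma> v \<inter> S)) - real (card {w\<in>V. {v, w} \<in> U}) \<le> real (card (neighbours \<Gamma> v \<inter> S - {w\<in>V. {v, w} \<in> U}))"
    by (rule card_Diff_ge) (use fin in simp)
   moreover have "(\<beta> - \<mu>) * real (card V) = \<beta> * real (card V) - \<mu> * real (card V)" by (simp add: left_diff_distrib)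
   ultimately have "\<mu> * real (card V) \<le> real (card (neighbours E' v \<inter> S))" using v(2) U[OF v(1)] by linarith
   then show "v \<in> {v\<in>V. \<mu> * real (card V) \<le> real (card (neighbours E' v \<inter> S))}" using v(1) by simp
  qed
 qed
 moreover have "\<mu> * real (card V) \<le> \<kappa> * real (card V)" using par by (intro mult_right_mono) auto
 ultimately show "real (card S) + \<mu> * real (card V) \<le> real (card {v\<in>V. \<mu> * real (card V) \<le> real (card (neighbours E' v \<inter> S))})"
  using r by linarith
qed

lemma layout_degree_sum: "finite I ==> layout_degree (\<Sum>i\<in>I. L i) v = (\<Sum>i\<in>I. layout_degree (L i) v)"
 by (induction I rule: finite_induct) (simp_all add: layout_degree_def layout_edges_def)

lemma bad_lasts_cases:
 assumes "z \<in> bad_lasts V L arcs {w\<in>V. c w = q}" "arcs \<subseteq> V \<times> V"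
 shows "c z \<noteq> q & z \<notin> Domain arcs \<or> (\<exists>u\<in>layout_verts L. (z, u) \<in> arcs)"
 using assms unfolding bad_lasts_def by blast

lemma bad_hds_cases:
 assumes "z \<in> bad_hds V L arcs {w\<in>V. c w = p}" "arcs \<subseteq> V \<times> V"
 shows "c z \<noteq> p & z \<notin> Range arcs \<or> (\<exists>u\<in>layout_verts L. (u, z) \<in> arcs)"
 using assms unfolding bad_hds_def by blast

text \<open>A vertex is bad because the forest lacks an arc there or because its arc joins it to a
  layout vertex; matching-like arcs allow at most one vertex of the latter kind for each layout
  vertex.\<close>

lemma card_bad_le:
 assumes fin: "finite V" and sub: "layout_verts L \<subseteq> V" and a: "arcs \<subseteq> V \<times> V"
  and sv: "single_valued arcs" "single_valued (arcs\<inverse>)"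
 shows "card (bad_lasts V L arcs {w\<in>V. c w = q}) \<le> card {u\<in>V. c u \<noteq> q & u \<notin> Domain arcs} + card (layout_verts L)"
  and "card (bad_hds V L arcs {w\<in>V. c w = p}) \<le> card {u\<in>V. c u \<noteq> p & u \<notin> Range arcs} + card (layout_verts L)"
proof -
 have fL: "finite (layout_verts L)" by (rule finite_subset[OF sub fin])
 have V: "bad_lasts V L arcs {w\<in>V. c w = q} \<subseteq> V" "bad_hds V L arcs {w\<in>V. c w = p} \<subseteq> V" by (auto simp: bad_lasts_def bad_hds_def)
 let ?A = "\<Union>u\<in>layout_verts L. {z. (u, z) \<in> arcs\<inverse>}" and ?B = "\<Union>u\<in>layout_verts L. {z. (u, z) \<in> arcs}"
 have A: "card ?A \<le> card (layout_verts L)" by (rule card_UN_le_card[OF fL]) (rule card_image_single_valued_le_1[OF sv(2)])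
 have B: "card ?B \<le> card (layout_verts L)" by (rule card_UN_le_card[OF fL]) (rule card_image_single_valued_le_1[OF sv(1)])
 have AB: "finite ?A" "finite ?B" by (rule finite_subset[OF _ fin], use a in blast)+
 have s1: "bad_lasts V L arcs {w\<in>V. c w = q} \<subseteq> {u\<in>V. c u \<noteq> q & u \<notin> Domain arcs} \<union> ?A"
 proof
  fix z assume z: "z \<in> bad_lasts V L arcs {w\<in>V. c w = q}"
  show "z \<in> {u\<in>V. c u \<noteq> q & u \<notin> Domain arcs} \<union> ?A" using bad_lasts_cases[OF z a] V(1) z by blast
 qed
 have s2: "bad_hds V L arcs {w\<in>V. c w = p} \<subseteq> {u\<in>V. c u \<noteq> p & u \<notin> Range arcs} \<union> ?B"
 proof
  fix z assume z: "z \<in> bad_hds V L arcs {w\<in>V. c w = p}"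
  show "z \<in> {u\<in>V. c u \<noteq> p & u \<notin> Range arcs} \<union> ?B" using bad_hds_cases[OF z a] V(2) z by blast
 qed
 show "card (bad_lasts V L arcs {w\<in>V. c w = q}) \<le> card {u\<in>V. c u \<noteq> q & u \<notin> Domain arcs} + card (layout_verts L)"
  by (rule order_trans[OF card_mono[OF _ s1]], use fin AB in simp, rule order_trans[OF card_Un_le], use A in linarith)
 show "card (bad_hds V L arcs {w\<in>V. c w = p}) \<le> card {u\<in>V. c u \<noteq> p & u \<notin> Range arcs} + card (layout_verts L)"
  by (rule order_trans[OF card_mono[OF _ s2]], use fin AB in simp, rule order_trans[OF card_Un_le], use B in linarith)
qed

text \<open>The bad vertices that the forests themselves cause are already bounded per vertex by
  \<open>forest_system\<close>. Those caused by the layouts depend on the assignment, and the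
  balanced one bounds them by \<open>Y\<close>.\<close>

lemma forest_assignment:
 fixes V :: "'a set" and c :: "'a => nat" and \<rho> \<omega> B g Y :: real and L :: "nat => 'a list multiset"
 assumes G: "simple_graph V Gp" and K: "prime K" "2 < K" and c: "\<And>v. c v < K"
  and degU: "\<And>v j. v \<in> V ==> j < K ==> j \<noteq> c v ==> card (neighbours Gp v \<inter> {w\<in>V. c w = j}) \<le> \<Delta>"
  and degL: "\<And>v j. v \<in> V ==> j < K ==> j \<noteq> c v ==>
    real \<Delta> - \<rho> * real (card V) \<le> real (card (neighbours Gp v \<inter> {w\<in>V. c w = j}))"
  and om: "0 < \<omega>" and V1: "1 \<le> card V"
  and L: "\<And>i. i \<in> {1..l} ==> layout_verts (L i) \<subseteq> V" "\<And>i. i \<in> {1..l} ==> real (card (layout_verts (L i))) \<le> B"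
  and g: "0 < g" "0 \<le> B" and many: "real l + g \<le> real ((K - 1) div 2) * (real \<Delta> - \<rho> / \<omega> * real (card V))"
  and Y: "real (card V) * (1 + B / g) ^ l \<le> 2 powr Y"
 shows "\<exists>arcs p q.
  (\<forall>i\<in>{1..l}. arcs i \<subseteq> V \<times> V & single_valued (arcs i) & single_valued ((arcs i)\<inverse>) &
    (\<exists>pos :: 'a => nat. \<forall>u v. (u, v) \<in> arcs i --> pos u < pos v)) &
  (\<forall>i\<in>{1..l}. p i < K & q i < K & p i \<noteq> q i) &
  (\<forall>i\<in>{1..l}. \<forall>u v. (u, v) \<in> arcs i --> {u, v} \<in> Gp & c v \<noteq> p i & c u \<noteq> q i) &
  (\<forall>i\<in>{1..l}. real (card (bad_lasts V (L i) (arcs i) {w\<in>V. c w = q i})) \<le> \<omega> * real (card V) + B &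
        real (card (bad_hds V (L i) (arcs i) {w\<in>V. c w = p i})) \<le> \<omega> * real (card V) + B) &
  (\<forall>i\<in>{1..l}. \<forall>j\<in>{1..l}. i \<noteq> j --> (\<lambda>(u, v). {u, v}) ` arcs i \<inter> (\<lambda>(u, v). {u, v}) ` arcs j = {}) &
  (\<forall>a b. card {i\<in>{1..l}. q i = a & p i = b} \<le> \<Delta> div K + 1) &
  (\<forall>z\<in>V. real (\<Sum>i\<in>{1..l}. of_bool (z \<in> bad_lasts V (L i) (arcs i) {w\<in>V. c w = q i}) +
    of_bool (z \<in> bad_hds V (L i) (arcs i) {w\<in>V. c w = p i})) \<le> 2 * (real K * (\<rho> * real (card V)) + Y))"
proof -
 have finV: "finite V" using G by (simp add: simple_graph_def)
 let ?n = "real (card V)"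
 obtain J :: "(nat \<times> nat) set" and arcs p q where fs: "finite J &
  (\<forall>j\<in>J. arcs j \<subseteq> V \<times> V & (\<forall>u v. (u, v) \<in> arcs j --> {u, v} \<in> Gp) &
    single_valued (arcs j) & single_valued ((arcs j)\<inverse>) &
    (\<exists>pos :: 'a => nat. \<forall>u v. (u, v) \<in> arcs j --> pos u < pos v) &
    p j < K & q j < K & p j \<noteq> q j & (\<forall>u v. (u, v) \<in> arcs j --> c v \<noteq> p j & c u \<noteq> q j) &
    real (card {u\<in>V. c u \<noteq> q j & u \<notin> Domain (arcs j)}) \<le> \<omega> * ?n &
    real (card {v\<in>V. c v \<noteq> p j & v \<notin> Range (arcs j)}) \<le> \<omega> * ?n) &
  (\<forall>j\<in>J. \<forall>j'\<in>J. \<forall>u v u' v'. (u, v) \<in> arcs j --> (u', v') \<in> arcs j' --> {u, v} = {u', v'} --> j = j') &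
  (\<forall>v\<in>V. real (card {j\<in>J. c v \<noteq> q j & v \<notin> Domain (arcs j)}) \<le> real K * (\<rho> * ?n) &
      real (card {j\<in>J. c v \<noteq> p j & v \<notin> Range (arcs j)}) \<le> real K * (\<rho> * ?n)) &
  (\<forall>a b. card {j\<in>J. q j = a & p j = b} \<le> \<Delta> div K + 1) &
  real ((K - 1) div 2) * (real \<Delta> - \<rho> / \<omega> * ?n) \<le> real (card J)"
  by (rule exE[OF forest_system[OF G K c degU degL om V1]], assumption+, elim exE, erule that)
 note finJ = fs[THEN conjunct1] and fJ = fs[THEN conjunct2, THEN conjunct1, rule_format]
  and fdis = fs[THEN conj_drop2, THEN conjunct1, rule_format]
  and fmiss = fs[THEN conj_drop2, THEN conjunct2, THEN conjunct1, rule_format]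
  and fmult = fs[THEN conj_drop4, THEN conjunct1, rule_format]
  and fcard = fs[THEN conj_drop4, THEN conjunct2]
 \<comment> \<open>Forest j joins \<open>w\<close> to a vertex of layout i. For fixed i and w, each
   layout vertex accounts for at most one j, because the forests are edge-disjoint; so at most
   \<open>B\<close> forests hit.\<close>
 define hit where "hit i j w \<longleftrightarrow> (\<exists>u\<in>layout_verts (L i). (w, u) \<in> arcs j \<or> (u, w) \<in> arcs j)" for i j w
 have hitB: "real (card {j\<in>J. hit i j w}) \<le> B" if i: "i \<in> {1..l}" for i w
 proof -
  have fL: "finite (layout_verts (L i))" by (rule finite_subset[OF L(1)[OF i] finV])
  have eq: "{j\<in>J. hit i j w} = (\<Union>u\<in>layout_verts (L i). {j\<in>J. (w, u) \<in> arcs j \<or> (u, w) \<in> arcs j})"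
   unfolding hit_def by blast
  have "card {j\<in>J. hit i j w} \<le> card (layout_verts (L i))" unfolding eq
  proof (rule card_UN_le_card[OF fL])
   fix u
   have fin: "finite {j\<in>J. (w, u) \<in> arcs j \<or> (u, w) \<in> arcs j}" using finJ by simp
   have "j = j'" if j: "j \<in> J" "(w, u) \<in> arcs j \<or> (u, w) \<in> arcs j" and j': "j' \<in> J" "(w, u) \<in> arcs j' \<or> (u, w) \<in> arcs j'" for j j'
   proof -
    obtain x y where xy: "(x, y) \<in> arcs j" "{x, y} = {w, u}" using j(2) by (metis insert_commute)
    obtain x' y' where xy': "(x', y') \<in> arcs j'" "{x', y'} = {w, u}" using j'(2) by (metis insert_commute)
    show ?thesis by (rule fdis[OF j(1) j'(1) xy(1) xy'(1)]) (simp only: xy(2) xy'(2))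
   qed
   then show "card {j\<in>J. (w, u) \<in> arcs j \<or> (u, w) \<in> arcs j} \<le> Suc 0" unfolding card_le_Suc0_iff_eq[OF fin] by simp
  qed
  then show ?thesis using L(2)[OF i] by linarith
 qed
 obtain \<phi> where
  "inj_on \<phi> {1..l} & \<phi> ` {1..l} \<subseteq> J & (\<Sum>w\<in>V. 2 ^ card {i\<in>{1..l}. hit i (\<phi> i) w}) \<le> ?n * (1 + B / g) ^ l"
  by (rule exE[OF balanced_assignment[OF finJ finV g hitB order_trans[OF many fcard]]], assumption, erule that)
 then have inj: "inj_on \<phi> {1..l}" and img: "\<phi> ` {1..l} \<subseteq> J"
  and bal: "(\<Sum>w\<in>V. 2 ^ card {i\<in>{1..l}. hit i (\<phi> i) w}) \<le> ?n * (1 + B / g) ^ l" by simp_all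
 have ph: "\<phi> i \<in> J" if "i \<in> {1..l}" for i using img that by blast
 \<comment> \<open>Each summand 2^hits is at most the potential, so the number of hits is at most
   its binary logarithm.\<close>
 have hits: "real (card {i\<in>{1..l}. hit i (\<phi> i) w}) \<le> Y" if w: "w \<in> V" for w
 proof -
  have "2 ^ card {i\<in>{1..l}. hit i (\<phi> i) w} \<le> (\<Sum>w\<in>V. 2 ^ card {i\<in>{1..l}. hit i (\<phi> i) w} :: real)"
   by (rule member_le_sum[OF w _ finV]) simp
  then have "2 ^ card {i\<in>{1..l}. hit i (\<phi> i) w} \<le> 2 powr Y" using bal Y by linarith
  then have "2 powr real (card {i\<in>{1..l}. hit i (\<phi> i) w}) \<le> 2 powr Y" by (simp add: powr_realpow)
  then show ?thesis by simp
 qed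
 have count: "card {i\<in>{1..l}. P (\<phi> i)} \<le> card {j\<in>J. P j}" for P
  by (rule card_inj_on_le[OF inj_on_subset[OF inj]]) (use ph finJ in auto)
 have sumc: "(\<Sum>i\<in>{1..l}. of_bool (P i)) = card {i\<in>{1..l}. P i}" for P
  by (simp add: of_bool_def sum.If_cases Int_def)
 have lasts: "real (card {i\<in>{1..l}. z \<in> bad_lasts V (L i) (arcs (\<phi> i)) {w\<in>V. c w = q (\<phi> i)}}) \<le> real K * (\<rho> * ?n) + Y" if z: "z \<in> V" for z
 proof -
  have "{i\<in>{1..l}. z \<in> bad_lasts V (L i) (arcs (\<phi> i)) {w\<in>V. c w = q (\<phi> i)}} \<subseteq>
    {i\<in>{1..l}. c z \<noteq> q (\<phi> i) & z \<notin> Domain (arcs (\<phi> i))} \<union> {i\<in>{1..l}. hit i (\<phi> i) z}"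
  proof
   fix i assume "i \<in> {i\<in>{1..l}. z \<in> bad_lasts V (L i) (arcs (\<phi> i)) {w\<in>V. c w = q (\<phi> i)}}"
   then have i: "i \<in> {1..l}" and b: "z \<in> bad_lasts V (L i) (arcs (\<phi> i)) {w\<in>V. c w = q (\<phi> i)}" by blast+
   from bad_lasts_cases[OF b fJ[OF ph[OF i], THEN conjunct1]]
   show "i \<in> {i\<in>{1..l}. c z \<noteq> q (\<phi> i) & z \<notin> Domain (arcs (\<phi> i))} \<union> {i\<in>{1..l}. hit i (\<phi> i) z}"
    using i unfolding hit_def by blast
  qed
  then have "card {i\<in>{1..l}. z \<in> bad_lasts V (L i) (arcs (\<phi> i)) {w\<in>V. c w = q (\<phi> i)}} \<le>
    card ({i\<in>{1..l}. c z \<noteq> q (\<phi> i) & z \<notin> Domain (arcs (\<phi> i))} \<union> {i\<in>{1..l}. hit i (\<phi> i) z})" by (rule card_mono[rotated]) simp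
  also have "\<dots> \<le> card {i\<in>{1..l}. c z \<noteq> q (\<phi> i) & z \<notin> Domain (arcs (\<phi> i))} + card {i\<in>{1..l}. hit i (\<phi> i) z}" by (rule card_Un_le)
  finally show ?thesis using count[of "\<lambda>j. c z \<noteq> q j & z \<notin> Domain (arcs j)"] fmiss[OF z, THEN conjunct1] hits[OF z] by linarith
 qed
 have hds: "real (card {i\<in>{1..l}. z \<in> bad_hds V (L i) (arcs (\<phi> i)) {w\<in>V. c w = p (\<phi> i)}}) \<le> real K * (\<rho> * ?n) + Y" if z: "z \<in> V" for z
 proof -
  have "{i\<in>{1..l}. z \<in> bad_hds V (L i) (arcs (\<phi> i)) {w\<in>V. c w = p (\<phi> i)}} \<subseteq>
    {i\<in>{1..l}. c z \<noteq> p (\<phi> i) & z \<notin> Range (arcs (\<phi> i))} \<union> {i\<in>{1..l}. hit i (\<phi> i) z}"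
  proof
   fix i assume "i \<in> {i\<in>{1..l}. z \<in> bad_hds V (L i) (arcs (\<phi> i)) {w\<in>V. c w = p (\<phi> i)}}"
   then have i: "i \<in> {1..l}" and b: "z \<in> bad_hds V (L i) (arcs (\<phi> i)) {w\<in>V. c w = p (\<phi> i)}" by blast+
   from bad_hds_cases[OF b fJ[OF ph[OF i], THEN conjunct1]]
   show "i \<in> {i\<in>{1..l}. c z \<noteq> p (\<phi> i) & z \<notin> Range (arcs (\<phi> i))} \<union> {i\<in>{1..l}. hit i (\<phi> i) z}"
    using i unfolding hit_def by blast
  qed
  then have "card {i\<in>{1..l}. z \<in> bad_hds V (L i) (arcs (\<phi> i)) {w\<in>V. c w = p (\<phi> i)}} \<le>
    card ({i\<in>{1..l}. c z \<noteq> p (\<phi> i) & z \<notin> Range (arcs (\<phi> i))} \<union> {i\<in>{1..l}. hit i (\<phi> i) z})" by (rule card_mono[rotated]) simp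
  also have "\<dots> \<le> card {i\<in>{1..l}. c z \<noteq> p (\<phi> i) & z \<notin> Range (arcs (\<phi> i))} + card {i\<in>{1..l}. hit i (\<phi> i) z}" by (rule card_Un_le)
  finally show ?thesis using count[of "\<lambda>j. c z \<noteq> p j & z \<notin> Range (arcs j)"] fmiss[OF z, THEN conjunct2] hits[OF z] by linarith
 qed
 show ?thesis
 proof (rule exI[of _ "\<lambda>i. arcs (\<phi> i)"], rule exI[of _ "\<lambda>i. p (\<phi> i)"], rule exI[of _ "\<lambda>i. q (\<phi> i)"], intro conjI ballI allI)
  fix i assume i: "i \<in> {1..l}"
  note f = fJ[OF ph[OF i]]
  show "arcs (\<phi> i) \<subseteq> V \<times> V" "single_valued (arcs (\<phi> i))" "single_valued ((arcs (\<phi> i))\<inverse>)"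
   "\<exists>pos :: 'a => nat. \<forall>u v. (u, v) \<in> arcs (\<phi> i) --> pos u < pos v" "p (\<phi> i) < K" "q (\<phi> i) < K" "p (\<phi> i) \<noteq> q (\<phi> i)"
   using f by - (elim conjE, assumption)+
  show "(u, v) \<in> arcs (\<phi> i) --> {u, v} \<in> Gp & c v \<noteq> p (\<phi> i) & c u \<noteq> q (\<phi> i)" for u v using f by blast
  have b: "card (bad_lasts V (L i) (arcs (\<phi> i)) {w\<in>V. c w = q (\<phi> i)}) \<le> card {u\<in>V. c u \<noteq> q (\<phi> i) & u \<notin> Domain (arcs (\<phi> i))} + card (layout_verts (L i))"
    "card (bad_hds V (L i) (arcs (\<phi> i)) {w\<in>V. c w = p (\<phi> i)}) \<le> card {u\<in>V. c u \<noteq> p (\<phi> i) & u \<notin> Range (arcs (\<phi> i))} + card (layout_verts (L i))"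
   by (rule card_bad_le[OF finV L(1)[OF i]]; insert f, elim conjE, assumption)+
  have o: "real (card {u\<in>V. c u \<noteq> q (\<phi> i) & u \<notin> Domain (arcs (\<phi> i))}) \<le> \<omega> * ?n"
   "real (card {u\<in>V. c u \<noteq> p (\<phi> i) & u \<notin> Range (arcs (\<phi> i))}) \<le> \<omega> * ?n" using f by - (elim conjE, assumption)+
  show "real (card (bad_lasts V (L i) (arcs (\<phi> i)) {w\<in>V. c w = q (\<phi> i)})) \<le> \<omega> * ?n + B" using b(1) o(1) L(2)[OF i] by linarith
  show "real (card (bad_hds V (L i) (arcs (\<phi> i)) {w\<in>V. c w = p (\<phi> i)})) \<le> \<omega> * ?n + B" using b(2) o(2) L(2)[OF i] by linarith
  fix j assume j: "j \<in> {1..l}"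
  show "i \<noteq> j --> (\<lambda>(u, v). {u, v}) ` arcs (\<phi> i) \<inter> (\<lambda>(u, v). {u, v}) ` arcs (\<phi> j) = {}"
  proof (intro impI equals0I)
   fix e assume ij: "i \<noteq> j" and "e \<in> (\<lambda>(u, v). {u, v}) ` arcs (\<phi> i) \<inter> (\<lambda>(u, v). {u, v}) ` arcs (\<phi> j)"
   then obtain u v u' v' where uv: "(u, v) \<in> arcs (\<phi> i)" "(u', v') \<in> arcs (\<phi> j)" "{u, v} = {u', v'}" by auto
   have "\<phi> i = \<phi> j" by (rule fdis[OF ph[OF i] ph[OF j] uv])
   then show False using inj_onD[OF inj _ i j] ij by simp
  qed
 next
  fix a b show "card {i\<in>{1..l}. q (\<phi> i) = a & p (\<phi> i) = b} \<le> \<Delta> div K + 1"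
   by (rule order_trans[OF count[of "\<lambda>j. q j = a & p j = b"] fmult])
 next
  fix z assume z: "z \<in> V"
  show "real (\<Sum>i\<in>{1..l}. of_bool (z \<in> bad_lasts V (L i) (arcs (\<phi> i)) {w\<in>V. c w = q (\<phi> i)}) +
    of_bool (z \<in> bad_hds V (L i) (arcs (\<phi> i)) {w\<in>V. c w = p (\<phi> i)})) \<le> 2 * (real K * (\<rho> * ?n) + Y)"
   unfolding sum.distrib sumc mult_2 of_nat_add by (rule add_mono[OF lasts[OF z] hds[OF z]])
 qed
qed

lemma half_le_ln_2: "1 / 2 \<le> ln (2::real)"
proof -
 have "(exp (1 / 2 :: real))\<^sup>2 = exp 1" by (simp add: power2_eq_square flip: exp_add)
 also have "\<dots> \<le> 2\<^sup>2" using exp_le by simp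
 finally have "exp (1 / 2 :: real) \<le> 2" by (rule power2_le_imp_le) simp
 then show ?thesis by (subst ln_ge_iff) simp_all
qed

text \<open>The threshold \<open>e\<close> for \<epsilon> and 1/n is computed from \<open>x\<close>
  alone, a lower bound for \<nu>'. All larger parameters are then at least \<open>x\<close>, so
  constants formed with \<open>x\<close> are valid for them uniformly.\<close>

lemma decomposition_of_small_parameters:
 fixes x :: real
 assumes x: "0 < x" "x \<le> 1"
 shows "\<exists>e>0. \<forall>(V :: 'a set) E n l \<epsilon>s \<epsilon> \<nu>' \<nu> \<tau> \<gamma> \<alpha> \<eta>s (L :: nat => 'a list multiset) F.
  x \<le> \<nu>' & \<nu>' \<le> \<nu>\<^sup>2 / 10^4 & \<nu> \<le> \<tau>\<^sup>2 / 10^4 & \<tau> \<le> \<gamma>\<^sup>2 / 10^4 & \<gamma> \<le> \<alpha>\<^sup>2 / 10^4 & \<gamma> \<le> \<eta>s\<^sup>2 / 10^4 &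
  0 < \<nu> & 0 < \<tau> & 0 < \<gamma> & 0 < \<alpha> & 0 < \<eta>s & \<alpha> \<le> 1 / 10^4 & \<eta>s \<le> 1 / 10^4 & \<epsilon>s \<le> \<epsilon> & 0 < \<epsilon> & \<epsilon> \<le> e &
  0 < 1 / real n & 1 / real n \<le> e & real l \<le> 1 / 2 * (\<alpha> - \<eta>s) * real n &
  simple_graph V E & card V = n & almost_regular \<alpha> \<epsilon>s V E & robust_expander \<nu> \<tau> V E &
  (\<forall>i\<in>{1..l}. layout (L i) (F i) & layout_verts (L i) \<subseteq> V) &
  (\<forall>i\<in>{1..l}. real (card (layout_verts (L i))) \<le> \<epsilon> ^ 2 * real n & real (size (layout_edges (L i))) \<le> \<epsilon> ^ 4 * real n) &
  (\<forall>v\<in>V. real (layout_degree (\<Sum>i\<in>{1..l}. L i) v) \<le> \<epsilon> ^ 3 * real n) -->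
  (\<exists>H :: nat => 'a medge multiset.
    (\<Sum>i\<in>{1..l}. H i) \<subseteq># add_edges E (\<Sum>i\<in>{1..l}. F i) &
    (\<forall>i\<in>{1..l}. spanning_configuration V (L i) (F i) (H i)) &
    robust_expander (\<nu>' / 2) (4 * \<tau>) V (E - {e. \<exists>i\<in>{1..l}. GEdge e \<in># H i}))"
proof -
 \<comment> \<open>Expansion of \<Gamma> requires \<zeta>0 at most \<nu>^2/(32k) with k at most
   2/\<gamma>. As \<nu> and \<gamma> are at least \<open>x\<close>, a multiple of x^3
   suffices.\<close>
 define \<zeta>0 where "\<zeta>0 = x ^ 3 / 64"
 have x3: "x ^ 3 \<le> x\<^sup>2" "x ^ 3 \<le> x" "x\<^sup>2 \<le> x" "0 < x ^ 3" "0 < x\<^sup>2"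
  using power_decreasing[of 2 3 x] power_decreasing[of 1 3 x] power_decreasing[of 1 2 x] x by simp_all
 have z0: "0 < \<zeta>0" "\<zeta>0 \<le> 1" "\<zeta>0 \<le> x / 64" using x3 x unfolding \<zeta>0_def by linarith+
 define \<zeta> where "\<zeta> = \<zeta>0 ^ 4 / 1024"
 have "\<zeta>0 ^ 4 \<le> \<zeta>0" "0 < \<zeta>0 ^ 4" using power_decreasing[of 1 4 \<zeta>0] z0 by simp_all
 then have z: "0 < \<zeta>" "\<zeta> \<le> 1" "\<zeta> \<le> x" using z0 x unfolding \<zeta>_def by linarith+
 from configuration_step[OF z(1,2), where 'a = 'a] obtain \<sigma> where s0: "0 < \<sigma> & (\<exists>m0::real. \<forall>(V :: 'a set) \<Gamma> L F arcs Vp Vq Ov m \<tau>.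
   step_data \<zeta> \<sigma> m0 V \<Gamma> L F arcs Vp Vq Ov m \<tau> --> (\<exists>H R1 Req. step_result \<sigma> V \<Gamma> L F arcs Vp Vq Ov m H R1 Req))" ..
 from s0[THEN conjunct2] obtain m0 :: real where step: "\<forall>(V :: 'a set) \<Gamma> L F arcs Vp Vq Ov m \<tau>.
   step_data \<zeta> \<sigma> m0 V \<Gamma> L F arcs Vp Vq Ov m \<tau> --> (\<exists>H R1 Req. step_result \<sigma> V \<Gamma> L F arcs Vp Vq Ov m H R1 Req)" ..
 define s where "s = min \<sigma> 1"
 have s: "0 < s" "s \<le> 1" "s \<le> \<sigma>" using s0[THEN conjunct1] by (auto simp: s_def)
 \<comment> \<open>10/\<zeta> makes the used edges negligible for expansion, as 10\<theta> is at
   most \<zeta>M for \<theta> = M/K. 160/x^2 makes them small against the degrees in \<Gamma> and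
   makes M small against \<eta>*n.\<close>
 obtain K where K: "prime K" "nat \<lceil>10 / \<zeta> + 160 / x\<^sup>2\<rceil> + 2 < K" using bigger_prime by blast
 define kr where "kr = real K"
 have K2: "2 < K" using K(2) by linarith
 have "10 / \<zeta> + 160 / x\<^sup>2 \<le> kr" using real_nat_ceiling_ge[of "10 / \<zeta> + 160 / x\<^sup>2"] K(2) unfolding kr_def by linarith
 moreover have "0 < 10 / \<zeta>" "0 < 160 / x\<^sup>2" using z x by simp_all
 ultimately have "10 / \<zeta> \<le> kr" "160 / x\<^sup>2 \<le> kr" by linarith+
 then have k10: "10 \<le> \<zeta> * kr" and k160: "160 \<le> x\<^sup>2 * kr" using z x3 by (simp_all add: pos_divide_le_eq mult.commute)
 have kr: "2 < kr" using K2 by (simp add: kr_def)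
 have kp: "kr \<le> kr ^ 3" "kr\<^sup>2 \<le> kr ^ 3" "0 < kr ^ 3" "0 < kr\<^sup>2" "0 < kr ^ 4" using power_increasing[of 1 3 kr] power_increasing[of 2 3 kr] kr by simp_all
 \<comment> \<open>u*n will be the bound on requests per vertex. The cube of \<open>K\<close>
   balances the condition on congestion exactly: n*(u*n) = s * (n/K) * (n/K^2).\<close>
 define u where "u = s / kr ^ 3"
 have u: "0 < u" "u \<le> s / kr" "u \<le> 1 / kr\<^sup>2"
 proof -
  show "0 < u" using s kp by (simp add: u_def)
  show "u \<le> s / kr" unfolding u_def by (rule divide_left_mono) (use s kp kr in auto)
  have "s / kr ^ 3 \<le> 1 / kr ^ 3" using s kp by (intro divide_right_mono) auto
  also have "\<dots> \<le> 1 / kr\<^sup>2" by (rule divide_left_mono) (use kp in auto)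
  finally show "u \<le> 1 / kr\<^sup>2" by (simp add: u_def)
 qed
 \<comment> \<open>Bad colours are those missing more than \<omega>n = sM/2 vertices, half of the
   tolerance of a single step.\<close>
 define \<omega> where "\<omega> = s / (2 * kr)"
 have om: "0 < \<omega>" using s kr by (simp add: \<omega>_def)
 \<comment> \<open>The first bound limits the requests that irregular degrees cause over all
   differences, through K\<rho> at most u/8; the second limits the fraction \<rho>/\<omega> of
   rejected colours by x/(4K).\<close>
 define \<rho> where "\<rho> = min (s / (8 * kr ^ 4)) (\<omega> * x / (4 * kr))"
 have r0: "0 < \<rho>" using s kr kp om x by (simp add: \<rho>_def)
 have r1: "kr * \<rho> \<le> u / 8"
 proof -
  have "kr * \<rho> \<le> kr * (s / (8 * kr ^ 4))" by (rule mult_left_mono) (use kr in \<open>auto simp: \<rho>_def\<close>)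
  also have "\<dots> = u / 8" unfolding u_def using kr by (simp add: field_simps power4_eq_xxxx power3_eq_cube)
  finally show ?thesis .
 qed
 have r2: "\<rho> / \<omega> \<le> x / (4 * kr)"
 proof -
  have "\<rho> \<le> x / (4 * kr) * \<omega>" by (simp add: \<rho>_def mult.commute)
  then show ?thesis using om by (simp add: pos_divide_le_eq)
 qed
 define \<xi> where "\<xi> = min (\<rho> / 8) (min (x ^ 3 / 16) (min (\<zeta> / (32 * kr)) (x\<^sup>2 / (16 * kr))))"
 have xi: "0 < \<xi>" "\<xi> \<le> \<rho> / 8" "\<xi> \<le> x ^ 3 / 16" "\<xi> \<le> \<zeta> / (32 * kr)" "\<xi> \<le> x\<^sup>2 / (16 * kr)"
  using r0 x z kr by (simp_all add: \<xi>_def min_le_iff_disj)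
 have xi1: "\<xi> \<le> 1" using xi(3) x3 x by linarith
 define a where "a = u / 32"
 have a: "0 < a" using u by (simp add: a_def)
 from eventually_power_mult_exp_less[OF a, of 1 1, unfolded eventually_sequentially] obtain n1 where
  n1: "\<forall>n\<ge>n1. 1 * real n ^ 1 * exp (- a * real n) < 1" ..
 \<comment> \<open>An upper bound for k in terms of \<open>x\<close>, since k is at most
   2/\<gamma>.\<close>
 define K0 where "K0 = nat \<lceil>2 / x\<rceil>"
 from sparse_expander_subgraph[OF xi(1) xi1, of K0, where 'a = 'a] obtain n2 :: nat where
  n2: "\<forall>(V :: 'a set) E k \<nu> \<tau>. simple_graph V E & n2 \<le> card V & 0 < k & k \<le> K0 &
  robust_expander \<nu> \<tau> V E & 8 * real k * \<xi> \<le> \<nu>\<^sup>2 -->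
  (\<exists>\<Gamma>\<subseteq>E. (\<forall>v\<in>V. \<bar>real (card (neighbours \<Gamma> v)) - real (card (neighbours E v)) / real k\<bar> \<le> \<xi> * real (card V)) &
   (\<forall>S\<subseteq>V. \<tau> * real (card V) \<le> real (card S) & real (card S) \<le> (1 - \<tau>) * real (card V) -->
     real (card S) + \<nu> / 2 * real (card V) \<le>
     real (card {v\<in>V. \<nu> / (8 * real k) * real (card V) \<le> real (card (neighbours \<Gamma> v \<inter> S))})))" ..
 have K0p: "0 < K" using K2 by simp
 from partition_expander[OF z0(1,2) xi(1) K0p, where 'a = 'a] obtain n3 :: nat where
  n3: "\<forall>(V :: 'a set) r \<tau> \<F>. finite V & n3 \<le> card V & \<zeta>0 \<le> \<tau> &
  dense_expander \<zeta>0 \<tau> (real (card V)) r V V & \<F> \<subseteq> Pow V & card \<F> \<le> 3 * card V -->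
  (\<exists>c. (\<forall>x. c x < K) &
    (\<forall>S\<in>\<F>. \<forall>j<K. \<bar>real (card {x\<in>S. c x = j}) - real (card S) / real K\<bar> \<le> \<xi> * real (card V)) &
    (\<forall>a<K. \<forall>b<K. dense_expander (\<zeta>0 ^ 4 / 512) (2 * \<tau>) (real (card V) / real K) r
     {x\<in>V. c x = a} {x\<in>V. c x = b}))" ..
 define N0 where "N0 = real n1 + real n2 + real n3 + 1 / x + 3 * kr\<^sup>2 + 4 * kr / x + kr * \<bar>m0\<bar> + 1"
 have Np: "0 < 1 / x" "0 < 3 * kr\<^sup>2" "0 < 4 * kr / x" "0 \<le> kr * \<bar>m0\<bar>" using x kr by simp_all
 have N0: "0 < N0" using Np unfolding N0_def by linarith
 define e where "e = min (\<rho> / 8) (min (x * s / (256 * kr ^ 3)) (min (x / 4) (1 / N0)))"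
 have e: "0 < e" "e \<le> \<rho> / 8" "e \<le> x * s / (256 * kr ^ 3)" "e \<le> x / 4" "e \<le> 1 / N0"
  using r0 x s kp N0 by (simp_all add: e_def min_le_iff_disj)
 show ?thesis
 proof (rule exI[of _ e], rule conjI[OF e(1)], intro allI impI, elim conjE)
  fix V :: "'a set" and E n l \<epsilon>s \<epsilon> \<nu>' \<nu> \<tau> \<gamma> \<alpha> \<eta>s and L :: "nat => 'a list multiset" and F
  assume h1: "x \<le> \<nu>'" "\<nu>' \<le> \<nu>\<^sup>2 / 10^4" "\<nu> \<le> \<tau>\<^sup>2 / 10^4" "\<tau> \<le> \<gamma>\<^sup>2 / 10^4" "\<gamma> \<le> \<alpha>\<^sup>2 / 10^4" "\<gamma> \<le> \<eta>s\<^sup>2 / 10^4"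
  assume h2: "0 < \<nu>" "0 < \<tau>" "0 < \<gamma>" "0 < \<alpha>" "0 < \<eta>s" "\<alpha> \<le> 1 / 10^4" "\<eta>s \<le> 1 / 10^4" "\<epsilon>s \<le> \<epsilon>" "0 < \<epsilon>" "\<epsilon> \<le> e"
  assume h3: "0 < 1 / real n" "1 / real n \<le> e" "real l \<le> 1 / 2 * (\<alpha> - \<eta>s) * real n" and g: "simple_graph V E" and cV: "card V = n"
   and areg: "almost_regular \<alpha> \<epsilon>s V E" and rexp: "robust_expander \<nu> \<tau> V E"
   and hl: "\<forall>i\<in>{1..l}. layout (L i) (F i) & layout_verts (L i) \<subseteq> V"
   and hc: "\<forall>i\<in>{1..l}. real (card (layout_verts (L i))) \<le> \<epsilon> ^ 2 * real n & real (size (layout_edges (L i))) \<le> \<epsilon> ^ 4 * real n"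
   and hd: "\<forall>v\<in>V. real (layout_degree (\<Sum>i\<in>{1..l}. L i) v) \<le> \<epsilon> ^ 3 * real n"
  have sq: "y \<le> b / 10^4" if "y \<le> b\<^sup>2 / 10^4" "0 < b" "b \<le> 1" for y b :: real
   using power_decreasing[of 1 2 b] that by simp
  have al1: "\<alpha> \<le> 1" "\<eta>s \<le> 1" using h2 by simp_all
  have ga: "\<gamma> \<le> \<alpha> / 10^4" by (rule sq[OF h1(5) h2(4) al1(1)])
  have ge: "\<gamma> \<le> \<eta>s / 10^4" by (rule sq[OF h1(6) h2(5) al1(2)])
  have ga1: "\<gamma> \<le> 1" using ga al1 h2 by simp
  have ta: "\<tau> \<le> \<gamma> / 10^4" by (rule sq[OF h1(4) h2(3) ga1])
  have ta1: "\<tau> \<le> 1" using ta ga1 h2 by simp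
  have nu: "\<nu> \<le> \<tau> / 10^4" by (rule sq[OF h1(3) h2(2) ta1])
  have nu1: "\<nu> \<le> 1" using nu ta1 h2 by simp
  have nu': "\<nu>' \<le> \<nu> / 10^4" by (rule sq[OF h1(2) h2(1) nu1])
  have xs: "x \<le> \<nu>" "x \<le> \<tau>" "x \<le> \<gamma>" "x \<le> \<alpha>" "x \<le> \<eta>s" "\<nu> \<le> \<gamma>" "\<gamma> \<le> \<alpha>" using ga ge ta nu nu' h1(1) h2(1-5) x(1) by simp_all
  define w where "w = \<alpha> * \<gamma>"
  have xw: "x\<^sup>2 \<le> w" unfolding w_def power2_eq_square by (rule mult_mono) (use xs x in auto)
  have xn: "x\<^sup>2 \<le> \<nu> * \<gamma>" unfolding power2_eq_square by (rule mult_mono) (use xs x in auto)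
  have xn2: "x\<^sup>2 \<le> \<nu>\<^sup>2" by (rule power_mono) (use xs x in auto)
  \<comment> \<open>The step needs degrees 80 * (4\<tau>) M into each part; the degrees in \<Gamma>
    are of order wM with w = \<alpha>\<gamma>, which is much larger than \<tau>.\<close>
  have tw: "320 * \<tau> \<le> w / 8"
  proof -
   have "\<gamma>\<^sup>2 \<le> w" unfolding w_def power2_eq_square by (rule mult_right_mono) (use xs h2 in auto)
   then show ?thesis using h1(4) h2(2) by simp
  qed
  define nn where "nn = real n"
  have nn: "0 < nn" using h3(1) by (simp add: nn_def)
  have cVn: "real (card V) = nn" by (simp add: nn_def cV)
  have nN: "N0 \<le> nn"
  proof -
   have "1 / nn \<le> 1 / N0" using h3(2) e(5) unfolding nn_def by linarith
   then show ?thesis using nn N0 by (simp add: divide_simps)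
  qed
  have big: "n1 \<le> n" "n2 \<le> n" "n3 \<le> n" "1 / x \<le> nn" "3 * kr\<^sup>2 \<le> nn" "4 * kr / x \<le> nn" "kr * \<bar>m0\<bar> \<le> nn" "1 \<le> n"
  proof -
   note N = nN[unfolded N0_def]
   have "real n1 \<le> nn" "real n2 \<le> nn" "real n3 \<le> nn" "1 \<le> nn" using N Np by linarith+
   then show "n1 \<le> n" "n2 \<le> n" "n3 \<le> n" "1 \<le> n" by (simp_all add: nn_def)
   show "1 / x \<le> nn" "3 * kr\<^sup>2 \<le> nn" "4 * kr / x \<le> nn" "kr * \<bar>m0\<bar> \<le> nn" using N Np by linarith+
  qed
  have ep1: "\<epsilon> \<le> \<rho> / 8" "\<epsilon> \<le> x / 4" "\<epsilon> \<le> 1" using h2 e x by linarith+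
  have epu: "\<epsilon> \<le> x * u / 256" using h2(10) e(3) by (simp add: u_def)
  have "x * u \<le> 1 * u" using x u by (intro mult_right_mono) auto
  then have epu': "\<epsilon> \<le> u / 256" using epu by linarith
  have epp: "\<epsilon>\<^sup>2 \<le> \<epsilon>" "\<epsilon> ^ 3 \<le> \<epsilon>" "\<epsilon> ^ 4 \<le> \<epsilon>" using power_decreasing[of 1 2 \<epsilon>] power_decreasing[of 1 3 \<epsilon>] power_decreasing[of 1 4 \<epsilon>] h2 ep1 by simp_all
  have fV: "finite V" using g by (simp add: simple_graph_def)
  \<comment> \<open>\<Gamma> receives a share 1/k between \<gamma>/2 and \<gamma> of each degree:
    small against \<eta>*, so that enough edges remain for the forests, and large against
    \<tau>.\<close>
  define k where "k = nat \<lceil>1 / \<gamma>\<rceil>"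
  define kq where "kq = real k"
  have kq1: "1 / \<gamma> \<le> kq" unfolding kq_def k_def by (rule real_nat_ceiling_ge)
  have one: "1 \<le> 1 / \<gamma>" using h2(3) ga1 by simp
  have kq2: "kq \<le> 2 / \<gamma>"
  proof -
   have "kq = of_int \<lceil>1 / \<gamma>\<rceil>" unfolding kq_def k_def using one by (simp add: of_nat_nat)
   also have "\<dots> \<le> 1 / \<gamma> + 1" by (rule of_int_ceiling_le_add_one)
   finally show ?thesis using one by simp
  qed
  have kqp: "0 < kq" using kq1 one by linarith
  have kp0: "0 < k" using kqp by (simp add: kq_def)
  define ik where "ik = 1 / kq"
  have ik: "\<gamma> / 2 \<le> ik" "ik \<le> \<gamma>" "0 < ik" "ik \<le> 1"
  proof -
   show "\<gamma> / 2 \<le> ik" using kq2 kqp h2(3) by (simp add: ik_def field_simps)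
   show "ik \<le> \<gamma>" using kq1 kqp h2(3) by (simp add: ik_def field_simps)
   then show "ik \<le> 1" using ga1 by linarith
   show "0 < ik" using kqp by (simp add: ik_def)
  qed
  have kqx: "kq * x ^ 3 \<le> 2 * x\<^sup>2"
  proof -
   have "kq * x \<le> kq * \<gamma>" using xs kqp by (intro mult_left_mono) auto
   also have "\<dots> \<le> 2" using kq2 h2(3) by (simp add: pos_le_divide_eq)
   finally have "kq * x * x\<^sup>2 \<le> 2 * x\<^sup>2" by (rule mult_right_mono) simp
   then show ?thesis by (simp add: power2_eq_square power3_eq_cube mult.assoc)
  qed
  have kK0: "k \<le> K0"
  proof -
   have "2 / \<gamma> \<le> 2 / x" using xs x h2 by (intro divide_left_mono) auto
   then have "real k \<le> real K0" using kq2 real_nat_ceiling_ge[of "2 / x"] unfolding kq_def K0_def by linarith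
   then show ?thesis by simp
  qed
  have kxi: "8 * real k * \<xi> \<le> \<nu>\<^sup>2"
  proof -
   have "kq * \<xi> \<le> kq * (x ^ 3 / 16)" using xi kqp by (intro mult_left_mono) auto
   then show ?thesis using kqx xn2 unfolding kq_def by simp
  qed
  have "\<exists>\<Gamma>\<subseteq>E. (\<forall>v\<in>V. \<bar>real (card (neighbours \<Gamma> v)) - real (card (neighbours E v)) / real k\<bar> \<le> \<xi> * real (card V)) &
   (\<forall>S\<subseteq>V. \<tau> * real (card V) \<le> real (card S) & real (card S) \<le> (1 - \<tau>) * real (card V) -->
     real (card S) + \<nu> / 2 * real (card V) \<le>
     real (card {v\<in>V. \<nu> / (8 * real k) * real (card V) \<le> real (card (neighbours \<Gamma> v \<inter> S))}))"
   by (rule n2[rule_format]) (intro conjI g kp0 kK0 rexp kxi, simp add: cV big)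
  then obtain \<Gamma> where \<Gamma>: "\<Gamma> \<subseteq> E & (\<forall>v\<in>V. \<bar>real (card (neighbours \<Gamma> v)) - real (card (neighbours E v)) / real k\<bar> \<le> \<xi> * real (card V)) &
   (\<forall>S\<subseteq>V. \<tau> * real (card V) \<le> real (card S) & real (card S) \<le> (1 - \<tau>) * real (card V) -->
     real (card S) + \<nu> / 2 * real (card V) \<le>
     real (card {v\<in>V. \<nu> / (8 * real k) * real (card V) \<le> real (card (neighbours \<Gamma> v \<inter> S))}))" ..
  note GE = \<Gamma>[THEN conjunct1] and Gdeg = \<Gamma>[THEN conjunct2, THEN conjunct1, rule_format]
  define \<beta> where "\<beta> = \<nu> / (8 * real k)"
  have Grob: "real (card S) + \<nu> / 2 * real (card V) \<le> real (card {v\<in>V. \<beta> * real (card V) \<le> real (card (neighbours \<Gamma> v \<inter> S))})"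
   if "S \<subseteq> V" "\<tau> * real (card V) \<le> real (card S)" "real (card S) \<le> (1 - \<tau>) * real (card V)" for S
   using \<Gamma>[THEN conj_drop2, rule_format, OF that(1) conjI[OF that(2,3)]] by (simp only: \<beta>_def)
  have be: "\<beta> = \<nu> * ik / 8" by (simp add: \<beta>_def ik_def kq_def)
  have gG: "simple_graph V \<Gamma>" and gE: "simple_graph V (E - \<Gamma>)" using g GE by (auto simp: simple_graph_def)
  have dense0: "dense_expander \<zeta>0 (2 * \<tau>) (real (card V)) (adj \<Gamma>) V V"
  proof (rule dense_expander_of_robust[where \<kappa> = "\<nu> / 2" and \<beta> = \<beta>, OF fV])
   fix S assume S: "S \<subseteq> V" "\<tau> * real (card V) \<le> real (card S)" "real (card S) \<le> (1 - \<tau>) * real (card V)"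
   have "{u\<in>S. (u, v) \<in> adj \<Gamma>} = neighbours \<Gamma> v \<inter> S" for v by (auto simp: adj_def neighbours_def insert_commute)
   then show "real (card S) + \<nu> / 2 * real (card V) \<le> real (card {v\<in>V. \<beta> * real (card V) \<le> real (card {u\<in>S. (u, v) \<in> adj \<Gamma>})})"
    using Grob[OF S] by simp
  next
   show "0 < \<tau>" "0 < \<nu> / 2" "0 \<le> \<zeta>0" using h2 z0 by simp_all
   show "\<tau> \<le> 1 / 4" using ta ga1 by simp
   show "0 < \<beta>" unfolding be using h2 ik by simp
   show "\<zeta>0 \<le> \<nu> / 2 / 2" using z0 xs x by linarith
   have "1 / x * x \<le> nn * \<tau>" using big xs x nn by (intro mult_mono) auto
   then show "1 \<le> \<tau> * real (card V)" using x unfolding cVn by (simp add: mult.commute)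
   have "\<zeta>0 * (32 * kq) \<le> \<nu>\<^sup>2" using kqx xn2 by (simp add: \<zeta>0_def mult.commute)
   then have "\<zeta>0 \<le> \<nu>\<^sup>2 / (32 * kq)" using kqp by (simp add: pos_le_divide_eq)
   then show "\<zeta>0 \<le> \<beta> * (\<nu> / 2) / 2" by (simp add: \<beta>_def kq_def power2_eq_square)
  qed
  define \<F> where "\<F> = neighbours (E - \<Gamma>) ` V \<union> neighbours \<Gamma> ` V \<union> {V}"
  have "card \<F> \<le> card V + card V + 1"
   unfolding \<F>_def by (intro order_trans[OF card_Un_le] add_mono card_image_le fV) simp
  then have cF: "card \<F> \<le> 3 * card V" using big(8) cV by linarith
  have FV: "\<F> \<subseteq> Pow V" unfolding \<F>_def using neighbours_subset[OF gG] neighbours_subset[OF gE] by blast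
  have zt: "\<zeta>0 \<le> 2 * \<tau>" using z0(3) xs(2) x by linarith
  have "\<exists>c. (\<forall>x. c x < K) &
    (\<forall>S\<in>\<F>. \<forall>j<K. \<bar>real (card {x\<in>S. c x = j}) - real (card S) / real K\<bar> \<le> \<xi> * real (card V)) &
    (\<forall>a<K. \<forall>b<K. dense_expander (\<zeta>0 ^ 4 / 512) (2 * (2 * \<tau>)) (real (card V) / real K) (adj \<Gamma>)
     {x\<in>V. c x = a} {x\<in>V. c x = b})"
   by (rule n3[rule_format]) (intro conjI fV zt dense0 FV cF, simp add: cV big)
  then obtain c where c: "(\<forall>x. c x < K) &
    (\<forall>S\<in>\<F>. \<forall>j<K. \<bar>real (card {x\<in>S. c x = j}) - real (card S) / real K\<bar> \<le> \<xi> * real (card V)) &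
    (\<forall>a<K. \<forall>b<K. dense_expander (\<zeta>0 ^ 4 / 512) (2 * (2 * \<tau>)) (real (card V) / real K) (adj \<Gamma>)
     {x\<in>V. c x = a} {x\<in>V. c x = b})" ..
  note cK = c[THEN conjunct1, rule_format] and cF = c[THEN conjunct2, THEN conjunct1, rule_format]
   and cD = c[THEN conj_drop2, rule_format]
  define M where "M = nn / kr"
  have M: "0 < M" "kr * M = nn" using nn kr by (simp_all add: M_def)
  have split: "\<bar>real (card (neighbours G' v \<inter> {w\<in>V. c w = j})) - real (card (neighbours G' v)) / kr\<bar> \<le> \<xi> * nn"
   if G': "simple_graph V G'" "neighbours G' v \<in> \<F>" "j < K" for G' v j
  proof -
   have "neighbours G' v \<inter> {w\<in>V. c w = j} = {x\<in>neighbours G' v. c x = j}" using neighbours_subset[OF G'(1), of v] by auto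
   then show ?thesis using cF[OF G'(2,3)] unfolding cVn kr_def by simp
  qed
  have dE: "\<bar>real (card (neighbours E v)) - \<alpha> * nn\<bar> \<le> \<epsilon> * nn" if v: "v \<in> V" for v
  proof -
   have "(\<alpha> - \<epsilon>s) * nn \<le> real (card (neighbours E v))" "real (card (neighbours E v)) \<le> (\<alpha> + \<epsilon>s) * nn"
    using areg v unfolding almost_regular_def cVn by blast+
   moreover have "\<epsilon>s * nn \<le> \<epsilon> * nn" using h2 nn by (intro mult_right_mono) auto
   ultimately show ?thesis by (simp add: distrib_right left_diff_distrib)
  qed
  have dG: "\<bar>real (card (neighbours \<Gamma> v)) - real (card (neighbours E v)) * ik\<bar> \<le> \<xi> * nn" if v: "v \<in> V" for v
   using Gdeg[OF v] unfolding cVn by (simp add: ik_def kq_def)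
  have dD: "real (card (neighbours (E - \<Gamma>) v)) = real (card (neighbours E v)) - real (card (neighbours \<Gamma> v))" for v
  proof -
   have "neighbours (E - \<Gamma>) v = neighbours E v - neighbours \<Gamma> v" by (auto simp: neighbours_def)
   moreover have sub: "neighbours \<Gamma> v \<subseteq> neighbours E v" using GE by (auto simp: neighbours_def)
   moreover have fin: "finite (neighbours E v)" by (rule finite_subset[OF neighbours_subset[OF g] fV])
   ultimately show ?thesis using card_Diff_subset[OF finite_subset[OF sub fin] sub] card_mono[OF fin sub] by (simp add: of_nat_diff)
  qed
  define \<mu> where "\<mu> = \<alpha> * (1 - ik) * M"
  define r0 where "r0 = (\<epsilon> + 2 * \<xi>) * nn"
  have r0r: "r0 \<le> 3 / 8 * (\<rho> * nn)" "0 \<le> r0"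
  proof -
   have "(\<epsilon> + 2 * \<xi>) * nn \<le> (3 / 8 * \<rho>) * nn" using ep1 xi nn by (intro mult_right_mono) linarith+
   then show "r0 \<le> 3 / 8 * (\<rho> * nn)" by (simp add: r0_def)
   show "0 \<le> r0" using h2 xi nn by (simp add: r0_def)
  qed
  have mu0: "0 \<le> \<mu>" using h2 ik M by (simp add: \<mu>_def)
  have near: "\<bar>real (card (neighbours (E - \<Gamma>) v \<inter> {w\<in>V. c w = j})) - \<mu>\<bar> \<le> r0" if v: "v \<in> V" and j: "j < K" for v j
  proof -
   let ?d = "real (card (neighbours E v))" and ?D = "real (card (neighbours (E - \<Gamma>) v))"
   have 1: "\<bar>real (card (neighbours (E - \<Gamma>) v \<inter> {w\<in>V. c w = j})) - ?D / kr\<bar> \<le> \<xi> * nn"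
    by (rule split[OF gE _ j]) (use v in \<open>simp add: \<F>_def\<close>)
   have "\<bar>(1 - ik) * (?d - \<alpha> * nn)\<bar> \<le> 1 * (\<epsilon> * nn)" unfolding abs_mult using ik dE[OF v] by (intro mult_mono) auto
   moreover have "(1 - ik) * (?d - \<alpha> * nn) = ?d - ?d * ik - \<alpha> * (1 - ik) * nn" by (simp add: algebra_simps)
   ultimately have 2: "\<bar>?D - \<alpha> * (1 - ik) * nn\<bar> \<le> (\<epsilon> + \<xi>) * nn" using dG[OF v] unfolding dD distrib_right by linarith
   have "?D / kr - \<mu> = (?D - \<alpha> * (1 - ik) * nn) / kr" by (simp add: \<mu>_def M_def diff_divide_distrib)
   then have "\<bar>?D / kr - \<mu>\<bar> = \<bar>?D - \<alpha> * (1 - ik) * nn\<bar> / kr" using kr by simp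
   also have "\<dots> \<le> \<bar>?D - \<alpha> * (1 - ik) * nn\<bar> / 1" using kr by (intro divide_left_mono) auto
   finally have "\<bar>?D / kr - \<mu>\<bar> \<le> (\<epsilon> + \<xi>) * nn" using 2 by simp
   moreover have "r0 = (\<epsilon> + \<xi>) * nn + \<xi> * nn" by (simp add: r0_def algebra_simps)
   ultimately show ?thesis using 1 by linarith
  qed
  \<comment> \<open>All degrees lie within \<open>r0\<close> of \<mu>, so they are at most this
    \<Delta> and fall short of it by at most 2*r0, less than \<rho>n.\<close>
  define \<Delta> where "\<Delta> = nat \<lfloor>\<mu> + r0\<rfloor>"
  have D1: "real \<Delta> \<le> \<mu> + r0" unfolding \<Delta>_def using mu0 r0r by (simp add: of_nat_nat)
  have D2: "\<mu> + r0 - 1 \<le> real \<Delta>"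
  proof -
   have "real \<Delta> = of_int \<lfloor>\<mu> + r0\<rfloor>" unfolding \<Delta>_def using mu0 r0r by (simp add: of_nat_nat)
   then show ?thesis using floor_correct[of "\<mu> + r0"] by linarith
  qed
  have degU: "card (neighbours (E - \<Gamma>) v \<inter> {w\<in>V. c w = j}) \<le> \<Delta>" if "v \<in> V" "j < K" for v j
   unfolding \<Delta>_def by (rule le_nat_floor) (use near[OF that] in linarith)
  have degL: "real \<Delta> - \<rho> * real (card V) \<le> real (card (neighbours (E - \<Gamma>) v \<inter> {w\<in>V. c w = j}))" if "v \<in> V" "j < K" for v j
  proof -
   have "0 \<le> \<rho> * nn" using \<open>0 < \<rho>\<close> nn by simp
   then show ?thesis unfolding cVn using near[OF that] D1 r0r by linarith
  qed
  have DM: "real \<Delta> \<le> M"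
  proof -
   have "\<alpha> * (1 - ik) \<le> (1 / 2) * 1" using h2 ik by (intro mult_mono) auto
   then have "\<mu> \<le> 1 / 2 * 1 * M" unfolding \<mu>_def using M by (intro mult_right_mono) auto
   moreover have "\<rho> * nn \<le> M / 8"
   proof -
    have "kr * \<rho> * M \<le> 1 / 8 * M"
    proof (rule mult_right_mono)
     have "1 / kr\<^sup>2 \<le> 1" using kr by simp
     then show "kr * \<rho> \<le> 1 / 8" using r1 u(3) by linarith
    qed (use M in simp)
    then show ?thesis unfolding M(2)[symmetric] by (simp add: mult_ac)
   qed
   ultimately show ?thesis using D1 r0r M by linarith
  qed
  \<comment> \<open>\<open>gg\<close> is the number of forests guaranteed to stay free during the
    assignment, and \<open>Y\<close> the number of hits allowed per vertex.\<close>
  define B where "B = \<epsilon>\<^sup>2 * nn"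
  define gg where "gg = \<eta>s * nn / 8"
  define Y where "Y = u * nn / 8"
  have gg: "0 < gg" "0 \<le> B" using h2 nn by (simp_all add: gg_def B_def)
  have many: "real l + gg \<le> real ((K - 1) div 2) * (real \<Delta> - \<rho> / \<omega> * real (card V))"
  proof -
   \<comment> \<open>The purely linear part of the estimate, with the products replaced by
     variables: h is \<eta>*n, d is \<alpha>n, Z the edges lost to \<Gamma> and inside parts, T the
     loss by rounding and rejected colours.\<close>
   have sum_up: "l' + h / 8 \<le> P" if "A \<le> P" "A = Q - T" "T \<le> T'" "T' = k' / 2 + b / 8" "Q = d / 2 - Z / 2" "Z \<le> f + M'"
    "f \<le> h'" "M' \<le> h'" "k' \<le> h / 4" "b \<le> h" "l' \<le> d / 2 - h / 2" "h' = h / 100" "0 < h"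
    for l' h P A Q T T' k' b d Z f M' h' :: real
   proof -
    have "T \<le> h / 4" using that(3,4,9,10) by linarith
    moreover have "Z \<le> h / 50" using that(6,7,8,12) by linarith
    ultimately show ?thesis using that(1,2,5,11,13) by linarith
   qed
   have aux: "\<alpha> * (ik * nn + M - ik * M) \<le> 1 * (ik * nn + M)"
   proof (rule mult_mono)
    show "ik * nn + M - ik * M \<le> ik * nn + M" using ik M by simp
    have "ik * M \<le> 1 * M" using ik M by (intro mult_right_mono) auto
    moreover have "0 \<le> ik * nn" using ik nn by simp
    ultimately show "0 \<le> ik * nn + M - ik * M" by linarith
   qed (use al1 in simp_all)
   have "odd K" by (rule prime_odd_nat[OF K(1) K2])
   then have q0: "real ((K - 1) div 2) = (kr - 1) / 2" by (auto elim!: oddE simp: kr_def)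
   have "\<rho> / \<omega> * nn \<le> x / (4 * kr) * nn" using r2 nn by (intro mult_right_mono) auto
   then have lo: "\<mu> - (1 + x * M / 4) \<le> real \<Delta> - \<rho> / \<omega> * nn" using D2 r0r by (simp add: M_def)
   have "(kr - 1) / 2 * (\<mu> - (1 + x * M / 4)) \<le> (kr - 1) / 2 * (real \<Delta> - \<rho> / \<omega> * nn)" by (rule mult_left_mono[OF lo]) (use kr in simp)
   moreover have "(kr - 1) / 2 * (\<mu> - (1 + x * M / 4)) = (kr - 1) / 2 * \<mu> - (kr - 1) / 2 * (1 + x * M / 4)" by (rule right_diff_distrib)
   moreover have "(kr - 1) / 2 * (1 + x * M / 4) \<le> kr / 2 * (1 + x * M / 4)" using x M by (intro mult_right_mono) auto
   moreover have "kr / 2 * (1 + x * M / 4) = kr / 2 + x * nn / 8" unfolding M(2)[symmetric] by (simp add: algebra_simps)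
   moreover have "(kr - 1) / 2 * \<mu> = \<alpha> * nn / 2 - \<alpha> * (ik * nn + M - ik * M) / 2"
    unfolding \<mu>_def M(2)[symmetric] by (simp add: algebra_simps diff_divide_distrib add_divide_distrib)
   moreover have "\<alpha> * (ik * nn + M - ik * M) \<le> ik * nn + M" using aux by (simp only: mult_1)
   moreover have "ik * nn \<le> \<eta>s / 100 * nn" using ik ge h2 nn by (intro mult_right_mono) auto
   moreover have "M \<le> \<eta>s / 100 * nn"
   proof -
    have "100 \<le> \<eta>s * kr"
    proof -
     have "x\<^sup>2 * kr \<le> \<eta>s * kr" using x3 xs kr by (intro mult_right_mono) linarith+
     then show ?thesis using k160 by linarith
    qed
    then have "100 * M \<le> \<eta>s * kr * M" by (rule mult_right_mono) (use M in simp)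
    then show ?thesis using M(2) by (simp add: mult.assoc)
   qed
   moreover have "kr \<le> \<eta>s * nn / 4"
   proof -
    have "4 * kr / x * x \<le> nn * \<eta>s" by (rule mult_mono[OF big(6) xs(5)]) (use nn x in auto)
    then show ?thesis using x by (simp add: mult.commute)
   qed
   moreover have "x * nn \<le> \<eta>s * nn" using xs nn by (intro mult_right_mono) auto
   moreover have "real l \<le> \<alpha> * nn / 2 - \<eta>s * nn / 2" using h3(3) unfolding nn_def[symmetric] by (simp add: algebra_simps)
   moreover have "\<eta>s / 100 * nn = \<eta>s * nn / 100" by simp
   moreover have "0 < \<eta>s * nn" using h2 nn by simp
   ultimately show ?thesis unfolding cVn q0 gg_def by (rule sum_up)
  qed
  \<comment> \<open>Both n and (1 + B/g)^l are at most exp(an), so the product is at most exp(2an) =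
    exp(Y/2); this is below 2^Y because ln 2 is at least 1/2.\<close>
  have Yb: "real (card V) * (1 + B / gg) ^ l \<le> 2 powr Y"
  proof -
   have "1 * real n ^ 1 * exp (- a * real n) < 1" by (rule n1[rule_format, OF big(1)])
   then have n_exp: "nn \<le> exp (a * nn)" by (simp add: nn_def exp_minus field_simps)
   have Bg: "B / gg = 8 * \<epsilon>\<^sup>2 / \<eta>s" unfolding B_def gg_def using nn by simp
   have Bg0: "0 \<le> B / gg" using gg by simp
   have "(1 + B / gg) ^ l \<le> exp (B / gg) ^ l" using Bg0 by (intro power_mono exp_ge_add_one_self) auto
   also have "\<dots> = exp (real l * (B / gg))" by (rule exp_of_nat_mult[symmetric])
   also have "\<dots> \<le> exp (nn * a)"
   proof -
    have "real l \<le> nn"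
    proof -
     have "1 / 2 * (\<alpha> - \<eta>s) * real n \<le> 1 * real n" using al1 h2 by (intro mult_right_mono) auto
     then show ?thesis using h3(3) unfolding nn_def by linarith
    qed
    moreover have "B / gg \<le> a"
    proof -
     have "8 * \<epsilon>\<^sup>2 \<le> x * a" using epp(1) epu by (simp add: a_def)
     also have "\<dots> \<le> \<eta>s * a" using xs a by (intro mult_right_mono) auto
     finally show ?thesis unfolding Bg using h2 by (simp add: pos_divide_le_eq mult.commute)
    qed
    ultimately have "real l * (B / gg) \<le> nn * a" using Bg0 nn by (intro mult_mono) auto
    then show ?thesis by simp
   qed
   finally have "nn * (1 + B / gg) ^ l \<le> exp (a * nn) * exp (nn * a)" using n_exp nn Bg0 by (intro mult_mono) auto
   also have "\<dots> = exp (Y * (1 / 2))" by (simp add: Y_def a_def mult.commute flip: exp_add)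
   also have "\<dots> \<le> exp (Y * ln 2)"
   proof -
    have "Y * (1 / 2) \<le> Y * ln 2" by (rule mult_left_mono[OF half_le_ln_2]) (use u nn in \<open>simp add: Y_def\<close>)
    then show ?thesis by simp
   qed
   also have "\<dots> = 2 powr Y" by (simp add: powr_def)
   finally show ?thesis unfolding cVn .
  qed
  have LV: "layout_verts (L i) \<subseteq> V" "real (card (layout_verts (L i))) \<le> B" "layout (L i) (F i)"
   "real (size (layout_edges (L i))) \<le> \<epsilon> ^ 4 * nn" if "i \<in> {1..l}" for i
   using bspec[OF hl that] bspec[OF hc that] unfolding B_def nn_def by simp_all
  have V1: "1 \<le> card V" using big cV by simp
  obtain arcs p q where fa: "(\<forall>i\<in>{1..l}. arcs i \<subseteq> V \<times> V & single_valued (arcs i) & single_valued ((arcs i)\<inverse>) &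
    (\<exists>pos :: 'a => nat. \<forall>u v. (u, v) \<in> arcs i --> pos u < pos v)) &
  (\<forall>i\<in>{1..l}. p i < K & q i < K & p i \<noteq> q i) &
  (\<forall>i\<in>{1..l}. \<forall>u v. (u, v) \<in> arcs i --> {u, v} \<in> E - \<Gamma> & c v \<noteq> p i & c u \<noteq> q i) &
  (\<forall>i\<in>{1..l}. real (card (bad_lasts V (L i) (arcs i) {w\<in>V. c w = q i})) \<le> \<omega> * real (card V) + B &
        real (card (bad_hds V (L i) (arcs i) {w\<in>V. c w = p i})) \<le> \<omega> * real (card V) + B) &
  (\<forall>i\<in>{1..l}. \<forall>j\<in>{1..l}. i \<noteq> j --> (\<lambda>(u, v). {u, v}) ` arcs i \<inter> (\<lambda>(u, v). {u, v}) ` arcs j = {}) &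
  (\<forall>a b. card {i\<in>{1..l}. q i = a & p i = b} \<le> \<Delta> div K + 1) &
  (\<forall>z\<in>V. real (\<Sum>i\<in>{1..l}. of_bool (z \<in> bad_lasts V (L i) (arcs i) {w\<in>V. c w = q i}) +
    of_bool (z \<in> bad_hds V (L i) (arcs i) {w\<in>V. c w = p i})) \<le> 2 * (real K * (\<rho> * real (card V)) + Y))"
   by (rule exE[OF forest_assignment[OF gE K(1) K2 cK degU degL om V1 LV(1,2) gg many Yb]], assumption+, elim exE, erule that)
  note fa1 = fa[THEN conjunct1, rule_format] and fa2 = fa[THEN conjunct2, THEN conjunct1, rule_format]
   and fa3 = fa[THEN conj_drop2, THEN conjunct1, rule_format]
   and fa4 = fa[THEN conj_drop2, THEN conjunct2, THEN conjunct1, rule_format]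
   and fa5 = fa[THEN conj_drop4, THEN conjunct1, rule_format]
   and fa6 = fa[THEN conj_drop4, THEN conjunct2, THEN conjunct1, rule_format]
   and fa7 = fa[THEN conj_drop4, THEN conj_drop2, rule_format]
  \<comment> \<open>n/K^2 is also an upper bound for \<Delta>/K, hence the natural unit for used
    edges between a vertex and a part.\<close>
  define \<theta> where "\<theta> = M / kr"
  have th: "0 < \<theta>" "3 \<le> \<theta>" "\<theta> = nn / kr\<^sup>2"
  proof -
   show "0 < \<theta>" using M kr by (simp add: \<theta>_def)
   show eq: "\<theta> = nn / kr\<^sup>2" by (simp add: \<theta>_def M_def power2_eq_square)
   show "3 \<le> \<theta>" unfolding eq using big(5) kp by (simp add: pos_le_divide_eq)
  qed
  have sM: "s * M \<le> \<sigma> * M" using s M by (intro mult_right_mono) auto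
  have unn: "u * nn \<le> s * M"
  proof -
   have "u * nn \<le> s / kr * nn" using u nn by (intro mult_right_mono) auto
   then show ?thesis by (simp add: M_def)
  qed
  have enn: "\<epsilon> * nn \<le> u * nn / 256" "\<epsilon>\<^sup>2 * nn \<le> \<epsilon> * nn" "\<epsilon> ^ 3 * nn \<le> \<epsilon> * nn" "\<epsilon> ^ 4 * nn \<le> \<epsilon> * nn"
   using mult_right_mono[OF epu', of nn] mult_right_mono[OF epp(1), of nn] mult_right_mono[OF epp(2), of nn] mult_right_mono[OF epp(3), of nn] nn by simp_all
  have unp: "0 < u * nn" using u nn by simp
  have omn: "\<omega> * real (card V) = s * M / 2" unfolding cVn by (simp add: \<omega>_def M_def)
  \<comment> \<open>The budget 5\<theta>: twice \<Delta> div K + 1 for the linkages, \<theta> + 1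
    for requests received and u*n, at most \<theta>, for requests sent give at most 4\<theta> + 3,
    and \<theta> is at least 3.\<close>
  interpret it: iteration V \<Gamma> L F l arcs p q c K "\<Delta> div K + 1" \<zeta> \<sigma> m0 M "4 * \<tau>" "5 * \<theta>" \<theta> "u * nn"
  proof
   show "simple_graph V \<Gamma>" by (rule gG)
   show "layout (L i) (F i)" "layout_verts (L i) \<subseteq> V" if "i \<in> {1..l}" for i by (rule LV[OF that])+
   show "arcs i \<subseteq> V \<times> V & single_valued (arcs i) & single_valued ((arcs i)\<inverse>) &
     (\<exists>pos :: 'a => nat. \<forall>u v. (u, v) \<in> arcs i --> pos u < pos v)" if "i \<in> {1..l}" for i by (rule fa1[OF that])
   show "p i < K & q i < K & p i \<noteq> q i" if "i \<in> {1..l}" for i by (rule fa2[OF that])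
   show "c v \<noteq> p i & c u \<noteq> q i" if "i \<in> {1..l}" "(u, v) \<in> arcs i" for i u v by (rule fa3[OF that, THEN conjunct2])
   show "card {i\<in>{1..l}. q i = a & p i = b} \<le> \<Delta> div K + 1" for a b by (rule fa6)
   have eqs: "2 * \<zeta> = \<zeta>0 ^ 4 / 512" "4 * \<tau> = 2 * (2 * \<tau>)" "M = real (card V) / real K" by (simp_all add: \<zeta>_def M_def cVn kr_def)
   show "dense_expander (2 * \<zeta>) (4 * \<tau>) M (adj \<Gamma>) {w\<in>V. c w = a} {w\<in>V. c w = b}" if "a < K" "b < K" for a b
    unfolding eqs by (rule cD[OF that])
   show "\<bar>real (card {w\<in>V. c w = a}) - M\<bar> \<le> \<zeta> / 32 * M" if "a < K" for a
   proof -
    have "\<bar>real (card {w\<in>V. c w = a}) - M\<bar> \<le> \<xi> * nn" using cF[of V a] that unfolding cVn M_def kr_def by (simp add: \<F>_def)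
    also have "\<dots> \<le> \<zeta> / (32 * kr) * nn" using xi nn by (intro mult_right_mono) auto
    also have "\<dots> = \<zeta> / 32 * M" by (simp add: M_def)
    finally show ?thesis .
   qed
   show "80 * (4 * \<tau>) * M + 5 * \<theta> \<le> real (card (neighbours \<Gamma> v \<inter> {w\<in>V. c w = j}))" if v: "v \<in> V" and j: "j < K" for v j
   proof -
    let ?d = "real (card (neighbours E v))" and ?D = "real (card (neighbours \<Gamma> v))"
    have 1: "\<bar>real (card (neighbours \<Gamma> v \<inter> {w\<in>V. c w = j})) - ?D / kr\<bar> \<le> \<xi> * nn"
     by (rule split[OF gG _ j]) (use v in \<open>simp add: \<F>_def\<close>)
    have "3 / 4 * \<alpha> * nn * (\<gamma> / 2) \<le> ?d * ik"
    proof (rule mult_mono)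
     have "\<epsilon> * nn \<le> \<alpha> / 4 * nn" using ep1 xs nn by (intro mult_right_mono) linarith+
     then show "3 / 4 * \<alpha> * nn \<le> ?d" using dE[OF v] by linarith
    qed (use ik h2 in simp_all)
    then have "3 / 8 * (w * nn) \<le> ?d * ik" by (simp add: w_def mult_ac)
    moreover have "\<xi> * nn \<le> w / 8 * nn" using xi(3) x3(1) xw xi(1) nn by (intro mult_right_mono) linarith+
    ultimately have "1 / 4 * (w * nn) \<le> ?D" using dG[OF v] by linarith
    then have "1 / 4 * (w * nn) / kr \<le> ?D / kr" by (rule divide_right_mono) (use kr in simp)
    then have 2: "1 / 4 * (w * M) \<le> ?D / kr" by (simp add: M_def)
    have "\<xi> * nn \<le> x\<^sup>2 / (16 * kr) * nn" using xi nn by (intro mult_right_mono) auto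
    then have 3: "\<xi> * nn \<le> x\<^sup>2 * M / 16" by (simp add: M_def)
    have 4: "x\<^sup>2 * M \<le> w * M" using xw M by (intro mult_right_mono) auto
    have 5: "320 * \<tau> * M \<le> w / 8 * M" using tw M by (intro mult_right_mono) auto
    have "160 * \<theta> \<le> x\<^sup>2 * kr * \<theta>" using k160 th by (intro mult_right_mono) auto
    then have 6: "160 * \<theta> \<le> x\<^sup>2 * M" using kr by (simp add: \<theta>_def)
    have "0 \<le> w * M" using 4 M by (smt (verit) mult_nonneg_nonneg zero_le_power2)
    then show ?thesis using 1 2 3 4 5 6 by linarith
   qed
   show "m0 \<le> M"
   proof -
    have "\<bar>m0\<bar> \<le> M" unfolding M_def using big(7) kr by (simp add: pos_le_divide_eq mult.commute)
    then show ?thesis by linarith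
   qed
   show "\<zeta> \<le> 4 * \<tau>" using z xs(2) x by linarith
   show "0 < \<zeta>" "\<zeta> \<le> 1" "0 < M" "0 < \<theta>" by (fact z M th)+
   show "real (card (bad_lasts V (L i) (arcs i) {w\<in>V. c w = q i})) \<le> \<sigma> * M &
     real (card (bad_hds V (L i) (arcs i) {w\<in>V. c w = p i})) \<le> \<sigma> * M &
     real (card (layout_verts (L i))) \<le> \<sigma> * M & real (size (layout_edges (L i))) \<le> \<sigma> * M" if i: "i \<in> {1..l}" for i
   proof -
    note b = fa4[OF i, unfolded omn]
    have BB: "B \<le> s * M / 2" using enn unn unp unfolding B_def by linarith
    have sp: "0 < s * M" using s M by simp
    show ?thesis using b[THEN conjunct1] b[THEN conjunct2] LV(2,4)[OF i] BB sM sp enn unn unp by (intro conjI) linarith+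
   qed
   show "real (\<Sum>i\<in>{1..l}. of_bool (v \<in> bad_lasts V (L i) (arcs i) {w\<in>V. c w = q i}) +
     of_bool (v \<in> bad_hds V (L i) (arcs i) {w\<in>V. c w = p i}) + layout_degree (L i) v) \<le> u * nn" if v: "v \<in> V" for v
   proof -
    have "real (\<Sum>i\<in>{1..l}. layout_degree (L i) v) \<le> \<epsilon> ^ 3 * nn"
     unfolding nn_def layout_degree_sum[OF finite_atLeastAtMost, symmetric] by (rule hd[rule_format, OF v])
    moreover have "real K * (\<rho> * nn) \<le> u * nn / 8" using mult_right_mono[OF r1, of nn] nn unfolding kr_def by (simp add: mult.assoc)
    ultimately show ?thesis using fa7[OF v, unfolded cVn Y_def distrib_left] enn unp unfolding sum.distrib[of _ "\<lambda>i. layout_degree (L i) v"] of_nat_add by linarith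
   qed
   show "real (card V) * (u * nn) \<le> \<sigma> * M * \<theta>"
   proof -
    have "real (card V) * (u * nn) = s * M * \<theta>" unfolding cVn u_def M_def \<theta>_def by (simp add: power3_eq_cube mult_ac)
    also have "\<dots> \<le> \<sigma> * M * \<theta>" by (rule mult_right_mono[OF sM less_imp_le[OF th(1)]])
    finally show ?thesis .
   qed
   show "2 * real (\<Delta> div K + 1) + \<theta> + 1 + u * nn \<le> 5 * \<theta>"
   proof -
    have "real (\<Delta> div K) \<le> real \<Delta> / real K" by (rule of_nat_div_le_of_nat)
    also have "\<dots> \<le> M / real K" using DM by (intro divide_right_mono) auto
    finally have "real (\<Delta> div K) \<le> \<theta>" by (simp add: \<theta>_def kr_def)
    moreover have "u * nn \<le> 1 / kr\<^sup>2 * nn" using u nn by (intro mult_right_mono) auto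
    then have "u * nn \<le> \<theta>" unfolding th(3) by simp
    ultimately show ?thesis using th(2) unfolding of_nat_add of_nat_1 distrib_left by linarith
   qed
   show "2 * (5 * \<theta>) \<le> \<zeta> * M"
   proof -
    have "10 * \<theta> \<le> \<zeta> * kr * \<theta>" using k10 th by (intro mult_right_mono) auto
    then show ?thesis using kr by (simp add: \<theta>_def)
   qed
   show "\<forall>(V :: 'a set) \<Gamma> L F arcs Vp Vq Ov m \<tau>. step_data \<zeta> \<sigma> m0 V \<Gamma> L F arcs Vp Vq Ov m \<tau> -->
    (\<exists>H R1 Req. step_result \<sigma> V \<Gamma> L F arcs Vp Vq Ov m H R1 Req)" by (rule step)
  qed
  obtain H R where HR: "(\<forall>i\<in>{1..l}. spanning_configuration V (L i) (F i) (H i) & (\<forall>e. count (H i) (FEdge e) = count (F i) e) &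
   (\<forall>e. count (H i) (GEdge e) \<le> 1) & (\<forall>e. GEdge e \<in># H i --> e \<in> (\<lambda>(u, v). {u, v}) ` arcs i \<or> e \<in> R i) & R i \<subseteq> \<Gamma>) &
  (\<forall>i\<in>{1..l}. \<forall>j\<in>{1..l}. i \<noteq> j --> R i \<inter> R j = {}) &
  (\<forall>v\<in>V. \<forall>b. real (card {w\<in>V. c w = b & {v, w} \<in> (\<Union>i\<in>{1..l}. R i)}) \<le> 5 * \<theta>)"
   by (rule exE[OF it.configurations], elim exE, erule that)
  note HR1 = HR[THEN conjunct1, rule_format] and HR2 = HR[THEN conjunct2, THEN conjunct1, rule_format]
   and HR3 = HR[THEN conj_drop2, rule_format]
  have arcsE: "(\<lambda>(u, v). {u, v}) ` arcs i \<subseteq> E - \<Gamma>" if "i \<in> {1..l}" for i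
  proof
   fix e assume "e \<in> (\<lambda>(u, v). {u, v}) ` arcs i"
   then obtain u v where uv: "e = {u, v}" "(u, v) \<in> arcs i" by auto
   show "e \<in> E - \<Gamma>" unfolding uv(1) by (rule fa3[OF that uv(2), THEN conjunct1])
  qed
  have RG: "R i \<subseteq> \<Gamma>" and HS: "\<And>e. GEdge e \<in># H i ==> e \<in> (\<lambda>(u, v). {u, v}) ` arcs i \<or> e \<in> R i" if "i \<in> {1..l}" for i
   by (rule HR1[OF that, THEN conj_drop4],
     rule HR1[OF that, THEN conj_drop2, THEN conjunct2, THEN conjunct1, rule_format])
  define S where "S i = (\<lambda>(u, v). {u, v}) ` arcs i \<union> R i" for i
  have sub: "(\<Sum>i\<in>{1..l}. H i) \<subseteq># add_edges E (\<Sum>i\<in>{1..l}. F i)"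
  proof (rule sum_edge_disjoint_subset_mset[where S = S])
   show "finite {1..l}" by simp
   show "finite E" by (rule simple_graph_finite[OF g])
   fix i assume i: "i \<in> {1..l}"
   show "count (H i) (FEdge e) = count (F i) e" "count (H i) (GEdge e) \<le> 1" for e
    by (rule HR1[OF i, THEN conjunct2, THEN conjunct1, rule_format], rule HR1[OF i, THEN conj_drop2, THEN conjunct1, rule_format])
   show "e \<in> S i" if "GEdge e \<in># H i" for e using HS[OF i that] by (simp add: S_def)
   show "S i \<subseteq> E" using arcsE[OF i] RG[OF i] GE unfolding S_def by blast
   fix j assume j: "j \<in> {1..l}" and ij: "i \<noteq> j"
   have dis: "(A \<union> P) \<inter> (B \<union> Q) = {}" if "A \<inter> B = {}" "P \<inter> Q = {}" "A \<subseteq> E - \<Gamma>" "B \<subseteq> E - \<Gamma>" "P \<subseteq> \<Gamma>" "Q \<subseteq> \<Gamma>" for A B P Q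
    using that by blast
   show "S i \<inter> S j = {}" unfolding S_def by (rule dis[OF fa5[OF i j ij] HR2[OF i j ij] arcsE[OF i] arcsE[OF j] RG[OF i] RG[OF j]])
  qed
  let ?U = "\<Union>i\<in>{1..l}. R i"
  \<comment> \<open>The bound 5\<theta> per part, summed over the K parts.\<close>
  have usedv: "real (card {w\<in>V. {v, w} \<in> ?U}) \<le> 5 * M" if v: "v \<in> V" for v
  proof -
   have "{w\<in>V. {v, w} \<in> ?U} = (\<Union>b\<in>{..<K}. {w\<in>V. c w = b & {v, w} \<in> ?U})"
   proof (intro equalityI subsetI)
    fix w assume "w \<in> {w\<in>V. {v, w} \<in> ?U}"
    then show "w \<in> (\<Union>b\<in>{..<K}. {w\<in>V. c w = b & {v, w} \<in> ?U})" using cK[of w] by (intro UN_I[of "c w"]) simp_all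
   qed blast
   then have "card {w\<in>V. {v, w} \<in> ?U} \<le> (\<Sum>b\<in>{..<K}. card {w\<in>V. c w = b & {v, w} \<in> ?U})" by (simp only:) (rule card_UN_le, simp)
   then have "real (card {w\<in>V. {v, w} \<in> ?U}) \<le> (\<Sum>b\<in>{..<K}. real (card {w\<in>V. c w = b & {v, w} \<in> ?U}))" by (simp only: of_nat_sum[symmetric] of_nat_le_iff)
   also have "\<dots> \<le> (\<Sum>b\<in>{..<K}. 5 * \<theta>)" by (rule sum_mono) (rule HR3[OF v])
   also have "\<dots> = 5 * M" using kr by (simp add: \<theta>_def kr_def)
   finally show ?thesis .
  qed
  have "robust_expander (\<nu>' / 2) (4 * \<tau>) V (E - {e. \<exists>i\<in>{1..l}. GEdge e \<in># H i})"
  proof (rule robust_expander_residual[where \<Gamma> = \<Gamma> and U = ?U and \<kappa> = "\<nu> / 2" and \<beta> = \<beta>, OF fV _ Grob])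
   show "e \<subseteq> V" if "e \<in> E - {e. \<exists>i\<in>{1..l}. GEdge e \<in># H i}" for e using g that by (auto simp: simple_graph_def)
   show "real (card {w\<in>V. {v, w} \<in> ?U}) \<le> (\<beta> - \<nu>' / 2) * real (card V)" if v: "v \<in> V" for v
   proof -
    \<comment> \<open>Robust adjacency in \<Gamma> has strength \<beta>, at least \<nu>\<gamma>/16,
      whereas \<nu>' is at most \<nu>\<gamma>/10^4; the difference of order x^2 n covers the 5M used
      edges since M = n/K.\<close>
    have "\<nu> * (\<gamma> / 2) \<le> \<nu> * ik" using ik h2 by (intro mult_left_mono) auto
    then have b1: "\<nu> * \<gamma> / 16 \<le> \<beta>" unfolding be by (simp add: mult_ac)
    have "\<nu> * \<nu> \<le> \<nu> * \<gamma>" using xs h2 by (intro mult_left_mono) auto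
    then have "\<nu>' \<le> \<nu> * \<gamma> / 10^4" using h1(2) by (simp add: power2_eq_square)
    moreover have "0 < \<nu> * \<gamma>" using h2 by simp
    ultimately have "x\<^sup>2 / 32 \<le> \<beta> - \<nu>' / 2" using b1 xn by simp
    then have "x\<^sup>2 / 32 * nn \<le> (\<beta> - \<nu>' / 2) * nn" using nn by (intro mult_right_mono) auto
    moreover have "160 * M \<le> x\<^sup>2 * kr * M" using k160 M by (intro mult_right_mono) auto
    then have "160 * M \<le> x\<^sup>2 * nn" unfolding M(2)[symmetric] by (simp add: mult.assoc)
    ultimately show ?thesis unfolding cVn using usedv[OF v] by linarith
   qed
   show "\<Gamma> - ?U \<subseteq> E - {e. \<exists>i\<in>{1..l}. GEdge e \<in># H i}"
   proof
    fix e assume e: "e \<in> \<Gamma> - ?U"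
    have "GEdge e \<notin># H i" if i: "i \<in> {1..l}" for i
    proof
     assume "GEdge e \<in># H i"
     from HS[OF i this] show False using e i arcsE[OF i] by blast
    qed
    then show "e \<in> E - {e. \<exists>i\<in>{1..l}. GEdge e \<in># H i}" using e GE by blast
   qed
   show "0 < \<nu>' / 2" "\<nu>' / 2 \<le> \<nu> / 2" "\<nu>' / 2 \<le> 4 * \<tau>" using h1(1) x nu' nu h2 by simp_all
   show "4 * \<tau> < 1" using ta ga1 by simp
  qed
  then show "\<exists>H :: nat => 'a medge multiset.
    (\<Sum>i\<in>{1..l}. H i) \<subseteq># add_edges E (\<Sum>i\<in>{1..l}. F i) &
    (\<forall>i\<in>{1..l}. spanning_configuration V (L i) (F i) (H i)) &
    robust_expander (\<nu>' / 2) (4 * \<tau>) V (E - {e. \<exists>i\<in>{1..l}. GEdge e \<in># H i})"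
   by (intro exI[of _ H] conjI ballI sub HR1[THEN conjunct1])
 qed
qed

theorem theorem2p13:
  "\<exists>f. hierarchy_function f \<and>
    (\<forall>(V :: 'a set) (E :: 'a set set) (n :: nat) (l :: nat)
      (\<epsilon>s :: real) (\<epsilon> :: real) (\<nu>' :: real) (\<nu> :: real) (\<tau> :: real) (\<gamma> :: real) (\<alpha> :: real) (\<eta>s :: real)
      (L :: nat \<Rightarrow> 'a list multiset) (F :: nat \<Rightarrow> 'a set multiset).
      0 < 1 / real n \<and> 0 < \<epsilon>s \<and> 0 < \<epsilon> \<and> 0 < \<nu>' \<and> 0 < \<nu> \<and> 0 < \<tau> \<and> 0 < \<gamma> \<and> 0 < \<alpha> \<and> 0 < \<eta>s \<and>
      1 / real n \<le> f \<epsilon>s \<and> \<epsilon>s \<le> \<epsilon> \<and> \<epsilon> \<le> f \<nu>' \<and> \<nu>' \<le> f \<nu> \<and> \<nu> \<le> f \<tau> \<and> \<tau> \<le> f \<gamma> \<and>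
      \<gamma> \<le> f \<alpha> \<and> \<gamma> \<le> f \<eta>s \<and> \<alpha> \<le> f 1 \<and> \<eta>s \<le> f 1 \<and>
      0 < l \<and> real l \<le> 1 / 2 * (\<alpha> - \<eta>s) * real n \<and>
      simple_graph V E \<and> card V = n \<and>
      almost_regular \<alpha> \<epsilon>s V E \<and> robust_expander \<nu> \<tau> V E \<and>
      (\<forall>i\<in>{1..l}. \<forall>e\<in>#F i. e \<subseteq> V \<and> card e = 2) \<and>
      (\<forall>i\<in>{1..l}. layout (L i) (F i) \<and> layout_verts (L i) \<subseteq> V) \<and>
      (\<forall>i\<in>{1..l}. real (card (layout_verts (L i))) \<le> \<epsilon> ^ 2 * real n \<and>
                  real (size (layout_edges (L i))) \<le> \<epsilon> ^ 4 * real n) \<and>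
      (\<forall>v\<in>V. real (layout_degree (\<Sum>i\<in>{1..l}. L i) v) \<le> \<epsilon> ^ 3 * real n \<and>
             real (card {i\<in>{1..l}. v \<in> layout_verts (L i)}) \<le> \<epsilon> ^ 2 * real n)
      \<longrightarrow>
      (\<exists>H :: nat \<Rightarrow> 'a medge multiset.
         (\<Sum>i\<in>{1..l}. H i) \<subseteq># add_edges E (\<Sum>i\<in>{1..l}. F i) \<and>
         (\<forall>i\<in>{1..l}. spanning_configuration V (L i) (F i) (H i)) \<and>
         robust_expander (\<nu>' / 2) (4 * \<tau>) V (E - {e. \<exists>i\<in>{1..l}. GEdge e \<in># H i})))"
proof -
 \<comment> \<open>Level j provides one threshold for all \<nu>' that are at least 1/(j+1);
   discretising turns the dependence on \<nu>' into a sequence.\<close>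
 have "\<forall>j::nat. \<exists>e>0. \<forall>(V :: 'a set) E n l \<epsilon>s \<epsilon> \<nu>' \<nu> \<tau> \<gamma> \<alpha> \<eta>s (L :: nat => 'a list multiset) F.
  1 / real (Suc j) \<le> \<nu>' & \<nu>' \<le> \<nu>\<^sup>2 / 10^4 & \<nu> \<le> \<tau>\<^sup>2 / 10^4 & \<tau> \<le> \<gamma>\<^sup>2 / 10^4 & \<gamma> \<le> \<alpha>\<^sup>2 / 10^4 & \<gamma> \<le> \<eta>s\<^sup>2 / 10^4 &
  0 < \<nu> & 0 < \<tau> & 0 < \<gamma> & 0 < \<alpha> & 0 < \<eta>s & \<alpha> \<le> 1 / 10^4 & \<eta>s \<le> 1 / 10^4 & \<epsilon>s \<le> \<epsilon> & 0 < \<epsilon> & \<epsilon> \<le> e &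
  0 < 1 / real n & 1 / real n \<le> e & real l \<le> 1 / 2 * (\<alpha> - \<eta>s) * real n &
  simple_graph V E & card V = n & almost_regular \<alpha> \<epsilon>s V E & robust_expander \<nu> \<tau> V E &
  (\<forall>i\<in>{1..l}. layout (L i) (F i) & layout_verts (L i) \<subseteq> V) &
  (\<forall>i\<in>{1..l}. real (card (layout_verts (L i))) \<le> \<epsilon> ^ 2 * real n & real (size (layout_edges (L i))) \<le> \<epsilon> ^ 4 * real n) &
  (\<forall>v\<in>V. real (layout_degree (\<Sum>i\<in>{1..l}. L i) v) \<le> \<epsilon> ^ 3 * real n) -->
  (\<exists>H :: nat => 'a medge multiset.
    (\<Sum>i\<in>{1..l}. H i) \<subseteq># add_edges E (\<Sum>i\<in>{1..l}. F i) &
    (\<forall>i\<in>{1..l}. spanning_configuration V (L i) (F i) (H i)) &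
    robust_expander (\<nu>' / 2) (4 * \<tau>) V (E - {e. \<exists>i\<in>{1..l}. GEdge e \<in># H i}))" (is "\<forall>j. \<exists>e. ?Q j e")
  by (rule allI, rule decomposition_of_small_parameters) simp_all
 from choice[OF this] obtain e where ej: "\<forall>j. ?Q j (e j)" ..
 note e0 = ej[rule_format, THEN conjunct1] and dec = ej[rule_format, THEN conjunct2, rule_format]
 obtain f where f: "hierarchy_function f" "\<forall>y\<in>{0<..1}. f y \<le> y\<^sup>2 / 10^4 & f y \<le> e (nat \<lceil>1 / y\<rceil>)"
  using hierarchy_function_below[of e] e0 by blast
 have f1: "f y \<le> y\<^sup>2 / 10^4" and f2: "f y \<le> e (nat \<lceil>1 / y\<rceil>)" and f3: "f y \<le> 1" if "0 < y" "y \<le> 1" for y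
  using f(2)[rule_format, of y] f(1) that by (auto simp: hierarchy_function_def Pi_iff)
 show ?thesis
 proof (rule exI[of _ f], rule conjI[OF f(1)], intro allI impI)
  fix V :: "'a set" and E n l \<epsilon>s \<epsilon> \<nu>' \<nu> \<tau> \<gamma> \<alpha> \<eta>s and L :: "nat => 'a list multiset" and F
  assume h: "0 < 1 / real n & 0 < \<epsilon>s & 0 < \<epsilon> & 0 < \<nu>' & 0 < \<nu> & 0 < \<tau> & 0 < \<gamma> & 0 < \<alpha> & 0 < \<eta>s &
   1 / real n \<le> f \<epsilon>s & \<epsilon>s \<le> \<epsilon> & \<epsilon> \<le> f \<nu>' & \<nu>' \<le> f \<nu> & \<nu> \<le> f \<tau> & \<tau> \<le> f \<gamma> &
   \<gamma> \<le> f \<alpha> & \<gamma> \<le> f \<eta>s & \<alpha> \<le> f 1 & \<eta>s \<le> f 1 &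
   0 < l & real l \<le> 1 / 2 * (\<alpha> - \<eta>s) * real n &
   simple_graph V E & card V = n &
   almost_regular \<alpha> \<epsilon>s V E & robust_expander \<nu> \<tau> V E &
   (\<forall>i\<in>{1..l}. \<forall>e\<in>#F i. e \<subseteq> V & card e = 2) &
   (\<forall>i\<in>{1..l}. layout (L i) (F i) & layout_verts (L i) \<subseteq> V) &
   (\<forall>i\<in>{1..l}. real (card (layout_verts (L i))) \<le> \<epsilon> ^ 2 * real n &
         real (size (layout_edges (L i))) \<le> \<epsilon> ^ 4 * real n) &
   (\<forall>v\<in>V. real (layout_degree (\<Sum>i\<in>{1..l}. L i) v) \<le> \<epsilon> ^ 3 * real n &
       real (card {i\<in>{1..l}. v \<in> layout_verts (L i)}) \<le> \<epsilon> ^ 2 * real n)"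
  have p: "0 < 1 / real n" "0 < \<epsilon>s" "0 < \<epsilon>" "0 < \<nu>'" "0 < \<nu>" "0 < \<tau>" "0 < \<gamma>" "0 < \<alpha>" "0 < \<eta>s" using h by - (elim conjE, assumption)+
  have c: "1 / real n \<le> f \<epsilon>s" "\<epsilon>s \<le> \<epsilon>" "\<epsilon> \<le> f \<nu>'" "\<nu>' \<le> f \<nu>" "\<nu> \<le> f \<tau>" "\<tau> \<le> f \<gamma>" "\<gamma> \<le> f \<alpha>" "\<gamma> \<le> f \<eta>s" "\<alpha> \<le> f 1" "\<eta>s \<le> f 1"
   using h by - (elim conjE, assumption)+
  have r: "real l \<le> 1 / 2 * (\<alpha> - \<eta>s) * real n" "simple_graph V E" "card V = n" "almost_regular \<alpha> \<epsilon>s V E" "robust_expander \<nu> \<tau> V E"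
   "\<forall>i\<in>{1..l}. layout (L i) (F i) & layout_verts (L i) \<subseteq> V"
   "\<forall>i\<in>{1..l}. real (card (layout_verts (L i))) \<le> \<epsilon> ^ 2 * real n & real (size (layout_edges (L i))) \<le> \<epsilon> ^ 4 * real n"
   using h by - (elim conjE, assumption)+
  have d0: "\<forall>v\<in>V. real (layout_degree (\<Sum>i\<in>{1..l}. L i) v) \<le> \<epsilon> ^ 3 * real n & real (card {i\<in>{1..l}. v \<in> layout_verts (L i)}) \<le> \<epsilon> ^ 2 * real n"
   using h by - (elim conjE, assumption)
  have d: "\<forall>v\<in>V. real (layout_degree (\<Sum>i\<in>{1..l}. L i) v) \<le> \<epsilon> ^ 3 * real n" by (rule ballI) (rule d0[rule_format, THEN conjunct1])
  have one: "f 1 \<le> 1 / 10^4" using f1[of 1] by simp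
  have al: "\<alpha> \<le> 1 / 10^4" "\<eta>s \<le> 1 / 10^4" using c(9,10) one by linarith+
  have al1: "\<alpha> \<le> 1" "\<eta>s \<le> 1" using al by simp_all
  have ga1: "\<gamma> \<le> 1" using c(7) f3[OF p(8) al1(1)] by linarith
  have ta1: "\<tau> \<le> 1" using c(6) f3[OF p(7) ga1] by linarith
  have nu1: "\<nu> \<le> 1" using c(5) f3[OF p(6) ta1] by linarith
  have nu1': "\<nu>' \<le> 1" using c(4) f3[OF p(5) nu1] by linarith
  have sq: "\<nu>' \<le> \<nu>\<^sup>2 / 10^4" "\<nu> \<le> \<tau>\<^sup>2 / 10^4" "\<tau> \<le> \<gamma>\<^sup>2 / 10^4" "\<gamma> \<le> \<alpha>\<^sup>2 / 10^4" "\<gamma> \<le> \<eta>s\<^sup>2 / 10^4"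
   by - (rule order_trans[OF c(4) f1[OF p(5) nu1]], rule order_trans[OF c(5) f1[OF p(6) ta1]], rule order_trans[OF c(6) f1[OF p(7) ga1]],
     rule order_trans[OF c(7) f1[OF p(8) al1(1)]], rule order_trans[OF c(8) f1[OF p(9) al1(2)]])
  have "\<nu>'\<^sup>2 \<le> \<nu>'" using power_decreasing[of 1 2 \<nu>'] p(4) nu1' by simp
  then have "\<nu>'\<^sup>2 / 10^4 \<le> \<nu>'" using p(4) by simp
  then have "\<epsilon> \<le> \<nu>'" using c(3) f1[OF p(4) nu1'] p(4) by linarith
  then have es: "\<epsilon>s \<le> \<nu>'" using c(2) by linarith
  \<comment> \<open>The level that the hierarchy function uses at \<nu>'; the bound 1/(j+1) holds
    with room to spare.\<close>
  define j where "j = nat \<lceil>1 / \<nu>'\<rceil>"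
  have e1: "\<epsilon> \<le> e j" unfolding j_def by (rule order_trans[OF c(3) f2[OF p(4) nu1']])
  \<comment> \<open>The hypothesis bounds 1/n by \<open>f\<close> at \<epsilon>* only; as
    \<epsilon>* is at most \<nu>', monotonicity turns this into the threshold belonging to
    \<nu>'.\<close>
  have "f \<epsilon>s \<le> f \<nu>'"
   by (rule mono_onD[of "{0<..1}" f]) (use f(1) es p nu1' in \<open>auto simp: hierarchy_function_def\<close>)
  then have e2: "1 / real n \<le> e j" using c(1) f2[OF p(4) nu1'] unfolding j_def by linarith
  have x: "1 / real (Suc j) \<le> \<nu>'"
  proof -
   have "1 / \<nu>' \<le> real (Suc j)" using real_nat_ceiling_ge[of "1 / \<nu>'"] unfolding j_def by simp
   then show ?thesis using p(4) by (simp add: field_simps)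
  qed
  show "(\<exists>H :: nat => 'a medge multiset.
    (\<Sum>i\<in>{1..l}. H i) \<subseteq># add_edges E (\<Sum>i\<in>{1..l}. F i) &
    (\<forall>i\<in>{1..l}. spanning_configuration V (L i) (F i) (H i)) &
    robust_expander (\<nu>' / 2) (4 * \<tau>) V (E - {e. \<exists>i\<in>{1..l}. GEdge e \<in># H i}))"
   by (rule dec[where j = j and n = n and \<nu> = \<nu> and \<gamma> = \<gamma> and \<alpha> = \<alpha> and \<eta>s = \<eta>s and \<epsilon> = \<epsilon> and \<epsilon>s = \<epsilon>s]) (intro conjI x sq p al c(2) e1 e2 r d)
 qed
qed

end
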